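(* Assume that $H$ is self-adjoint with its natural domain and that assumptions (A1), (A2) (see context) hold. Let $\mu$ be the spectral measure of $H$ at $P_0\Upsilon_0$. Then there is a point measure $\nu$ supported on $\liminf_n A^1_{0,n}=\bigcup_{m\ge 0}\bigcap_{n\ge m}A^1_{0,n}$ and generated by compactly supported eigenfunctions of $H$ such that $$ d\mu(\lambda)=d\nu(\lambda)+\lim_{n\to\infty}\frac1\pi\left\|\left(\mathbf 1+(\delta^\lambda_{0,n})^2\right)^{-1/2}\gamma^\lambda_{0,n}\right\|^2d\lambda = d\nu(\lambda)+\lim_{n\to\infty}\frac1\pi\left(\min_{\mathbf u\in\mathbf D^\lambda_n}\|\mathbf u\|^2\right)^{-1}d\lambda $$ $$ = d\nu(\lambda)+\lim_{n\to\infty}\frac1\pi\max_{T^\lambda_i\in\mathbb T^\lambda_i,\ i=0,\ldots,n}\left\|T^\lambda_nT^\lambda_{n-1}\cdots T^\lambda_1T^\lambda_0\begin{pmatrix}1\\0\end{pmatrix}\right\|^{-2}d\lambda $$ $$ = d\nu(\lambda)+\lim_{n\to\infty}\frac1\pi\max_{T^\lambda_i\in\mathbf T^\lambda_i,\ i=0,\ldots,n}\left\|T^\lambda_nT^\lambda_{n-1}\cdots T^\lambda_1T^\lambda_0\begin{pmatrix}1\\0\end{pmatrix}\right\|^{-2}d\lambda , $$ where $d\lambda$ is Lebesgue measure on $\mathbb R$, for each $n$ the densities are defined for all but finitely many $\lambda\in\mathbb R$, and the limits are in the weak topology of finite Radon measures (i.e. $\mu_n\to\mu$ iff $\int f\,d\mu_n\to\int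 f\,d\mu$ for all bounded continuous $f$).
   Context: Setting. $\mathbb G$ is a countable set partitioned into finite nonempty shells, $\mathbb G=\bigsqcup_{n=0}^\infty S_n$, $s_n=\#S_n$. $H$ is a (possibly unbounded) symmetric operator on $\ell^2(\mathbb G)$ with locally finite hopping: it is given by a Hermitian matrix $\langle\delta_x,H\delta_y\rangle$ ($x,y\in\mathbb G$) with finitely many nonzero entries in each row, hence acts on all of $\mathbb C^{\mathbb G}$; moreover $\langle\delta_x,H\delta_y\rangle=0$ if $x\in S_j,\ y\in S_k$, $|j-k|\ge2$. The graph on $\mathbb G$ joining $x\ne y$ whenever $\langle\delta_x,H\delta_y\rangle\neq0$ is connected. Identify $\ell^2(S_n)=\mathbb C^{s_n}$ and write $\psi=\bigoplus_n\psi_n$ with $\psi_n\in\mathbb C^{s_n}$. $V_n$ is the (Hermitian) $s_n\times s_n$ diagonal block of $H$ on $S_n$; for $n\ge1$, $W_n$ is the $s_n\times s_{n-1}$ block of $H$ from $\ell^2(S_{n-1})$ to $\ell^2(S_n)$ and $r_n=\operatorname{rank}W_n$. Fix factorizations $W_n=-\Upsilon_n\Phi_{n-1}^*$ with $\Upsilon_n\in\mathbb C^{s_n\times r_n}$, $\Phi_{n-1}\in\mathbb C^{s_{n-1}\times r_n}$ of full rank; set $r_0=1$ and fix a nonzero vector $\Upsilon_0\in\mathbb C^{s_0}$. Thus $(H\psi)_n=-\Phi_n\Upsilon_{n+1}^*\psi_{n+1}-\Upsilon_n\Phi_{n-1}^*\psi_{n-1}+V_n\psi_n$ (with $\Phi_{-1}^*\psi_{-1}=0$).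 $P_0:\ell^2(S_0)\hookrightarrow\ell^2(\mathbb G)$ is the canonical embedding. Boundary resolvent data. For $m\le n$ let $\mathbb G_{m,n}=\bigsqcup_{j=m}^nS_j$ and let $H_{m,n}$ be the compression of $H$ to $\ell^2(\mathbb G_{m,n})$. Let $\hat\Upsilon_m$, $\hat\Phi_n$ be $\Upsilon_m,\Phi_n$ with columns regarded (extended by zero) as vectors in $\ell^2(\mathbb G_{m,n})$. Set $$R^z_{m,n}=\begin{pmatrix}\hat\Upsilon_m^*\\ \hat\Phi_n^*\end{pmatrix}(H_{m,n}-z)^{-1}\begin{pmatrix}\hat\Upsilon_m&\hat\Phi_n\end{pmatrix}=\begin{pmatrix}\alpha^z_{m,n}&\beta^z_{m,n}\\ \gamma^z_{m,n}&\delta^z_{m,n}\end{pmatrix},$$ blocks of sizes $r_m\times r_m$, $r_m\times r_{n+1}$, $r_{n+1}\times r_m$, $r_{n+1}\times r_{n+1}$. This is a rational function of $z$, extended analytically across removable singularities; $A^1_{m,n}\subset\mathbb R$ is the (finite) set of points where it is not defined even after analytic extension. A single index $n$ means the pair $n,n$ (e.g. $\beta^z_n=\beta^z_{n,n}$). Assumptions. (A1): $r_{n+1}\ge r_n$ for all $n$. (A2): for all $n\ge0$ and almost all $\lambda\in\mathbb R$, the $r_n\times r_{n+1}$ matrix $\beta^\lambda_n$ has full rank $r_n$. Transfer matrices. $A_{m,n}=A^1_{m,n}\cup\{z\in\mathbb C:\operatorname{rank}\beta^z_{m,n}<r_m\}$. For $z\notin A_{m,n}$: $\mathbb B^z_{m,n}=\{B\in\mathbb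 C^{r_{n+1}\times r_m}:\beta^z_{m,n}B=\mathbf 1_{r_m}\}$, $\mathfrak B^z_{m,n}=\{b\in\mathbb C^{r_{n+1}\times r_m}:\beta^z_{m,n}b=\alpha^z_{m,n}\}$, $$\mathbb T^z_{m,n}=\left\{\begin{pmatrix}B&-b\\ \delta^z_{m,n}B&\gamma^z_{m,n}-\delta^z_{m,n}b\end{pmatrix}:B\in\mathbb B^z_{m,n},\,b\in\mathfrak B^z_{m,n}\right\},$$ $\mathbf T^z_{m,n}\subset\mathbb T^z_{m,n}$ is the subset with $b=B\alpha^z_{m,n}$; $\mathbb T^z_n=\mathbb T^z_{n,n}$, $\mathbf T^z_n=\mathbf T^z_{n,n}$; and $\mathbf D^z_n=\left\{\begin{pmatrix}B\\ \delta^z_{0,n}B\end{pmatrix}:B\in\mathbb B^z_{0,n}\right\}\subset\mathbb C^{2r_{n+1}}$. Self-adjointness. $H$ is self-adjoint with its natural domain if the restriction $H_{min}$ of $H$ to finitely supported vectors is essentially self-adjoint; then $H$ denotes $H_{min}^*$, with domain $\{\psi\in\ell^2(\mathbb G):H\psi\in\ell^2(\mathbb G)\}$. The spectral measure $\mu$ is defined by $\int f\,d\mu=\langle P_0\Upsilon_0,f(H)P_0\Upsilon_0\rangle$. "$\nu$ is generated by compactly supported eigenfunctions" means: $\nu(\{\lambda_0\})=\|\mathbb P_{\lambda_0}P_0\Upsilon_0\|^2$ for each $\lambda_0\in\mathbb{R}$, where $\mathbb P_{\lambda_0}$ is the orthogonal projection of $\ell^2(\mathbb G)$ onto the closure of the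 space of finitely supported $\psi$ with $H\psi=\lambda_0\psi$. *)

theory Defs
  imports
    "HOL-Complex_Analysis.Complex_Analysis"
    "Jordan_Normal_Form.DL_Rank"
    "Jordan_Normal_Form.Schur_Decomposition"
    "Jordan_Normal_Form.Gauss_Jordan_Elimination"
begin

unbundle no vec_syntax

definition l2 :: "('a \<Rightarrow> complex) set" where
  "l2 = {\<psi>. (\<lambda>x. (cmod (\<psi> x))\<^sup>2) summable_on UNIV}"

definition l2_inner :: "('a \<Rightarrow> complex) \<Rightarrow> ('a \<Rightarrow> complex) \<Rightarrow> complex" where
  "l2_inner \<phi> \<psi> = (\<Sum>\<^sub>\<infinity>x. cnj (\<phi> x) * \<psi> x)"

definition l2_norm :: "('a \<Rightarrow> complex) \<Rightarrow> real" where
  "l2_norm \<psi> = sqrt (\<Sum>\<^sub>\<infinity>x. (cmod (\<psi> x))\<^sup>2)"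

definition l2_dist :: "('a \<Rightarrow> complex) \<Rightarrow> ('a \<Rightarrow> complex) \<Rightarrow> real" where
  "l2_dist \<phi> \<psi> = l2_norm (\<lambda>x. \<phi> x - \<psi> x)"

definition l2_closure :: "('a \<Rightarrow> complex) set \<Rightarrow> ('a \<Rightarrow> complex) set" where
  "l2_closure F = {\<psi> \<in> l2. \<forall>\<epsilon>>0. \<exists>\<phi>\<in>F. l2_dist \<psi> \<phi> < \<epsilon>}"

text \<open>Well defined when \<open>K\<close> is a closed subspace.\<close>
definition l2_proj :: "('a \<Rightarrow> complex) set \<Rightarrow> ('a \<Rightarrow> complex) \<Rightarrow> ('a \<Rightarrow> complex)" where
  "l2_proj K \<psi> = (THE \<phi>. \<phi> \<in> K \<and> (\<forall>\<chi>\<in>K. l2_inner \<chi> (\<lambda>x. \<psi> x - \<phi> x) = 0))"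

text \<open>An unbounded operator is represented by its graph.\<close>
type_synonym 'a l2_op = "(('a \<Rightarrow> complex) \<times> ('a \<Rightarrow> complex)) set"

definition op_closure :: "'a l2_op \<Rightarrow> 'a l2_op" where
  "op_closure T = {(\<phi>, \<chi>). \<phi> \<in> l2 \<and> \<chi> \<in> l2 \<and>
     (\<forall>\<epsilon>>0. \<exists>(\<phi>', \<chi>')\<in>T. l2_dist \<phi> \<phi>' < \<epsilon> \<and> l2_dist \<chi> \<chi>' < \<epsilon>)}"

definition op_adjoint :: "'a l2_op \<Rightarrow> 'a l2_op" where
  "op_adjoint T = {(\<phi>, \<chi>). \<phi> \<in> l2 \<and> \<chi> \<in> l2 \<and>
     (\<forall>(\<psi>, \<eta>)\<in>T. l2_inner \<phi> \<eta> = l2_inner \<chi> \<psi>)}"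

definition self_adjoint :: "'a l2_op \<Rightarrow> bool" where
  "self_adjoint T \<longleftrightarrow> op_adjoint T = T"

definition essentially_self_adjoint :: "'a l2_op \<Rightarrow> bool" where
  "essentially_self_adjoint T \<longleftrightarrow> self_adjoint (op_closure T)"

text \<open>Projection-valued measures on the Borel sets of the real line; the values of
  \<open>E B\<close> outside \<open>l2\<close> are irrelevant.\<close>
definition proj_valued_measure ::
    "(real set \<Rightarrow> ('a \<Rightarrow> complex) \<Rightarrow> ('a \<Rightarrow> complex)) \<Rightarrow> bool" where
  "proj_valued_measure E \<longleftrightarrow>
     (\<forall>B\<in>sets borel.
        (\<forall>\<psi>\<in>l2. E B \<psi> \<in> l2 \<and> E B (E B \<psi>) = E B \<psi>) \<and>
        (\<forall>\<phi>\<in>l2. \<forall>\<psi>\<in>l2. \<forall>c.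
           E B (\<lambda>x. \<phi> x + c * \<psi> x) = (\<lambda>x. E B \<phi> x + c * E B \<psi> x)) \<and>
        (\<forall>\<phi>\<in>l2. \<forall>\<psi>\<in>l2. l2_inner \<phi> (E B \<psi>) = l2_inner (E B \<phi>) \<psi>)) \<and>
     (\<forall>\<psi>\<in>l2. E UNIV \<psi> = \<psi>) \<and>
     (\<forall>A :: nat \<Rightarrow> real set. range A \<subseteq> sets borel \<longrightarrow> disjoint_family A \<longrightarrow>
        (\<forall>\<psi>\<in>l2. (\<lambda>n. l2_dist (E (\<Union>i. A i) \<psi>) (\<lambda>x. \<Sum>i<n. E (A i) \<psi> x)) \<longlonglongrightarrow> 0))"

definition diag_measure ::
    "(real set \<Rightarrow> ('a \<Rightarrow> complex) \<Rightarrow> ('a \<Rightarrow> complex)) \<Rightarrow> ('a \<Rightarrow> complex) \<Rightarrow> real measure" where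
  "diag_measure E \<psi> = measure_of UNIV (sets borel) (\<lambda>B. ennreal (Re (l2_inner \<psi> (E B \<psi>))))"

text \<open>\<open>E\<close> is the spectral resolution of \<open>T\<close>, that is \<open>T = \<integral> t dE(t)\<close> including equality of
  domains.  By polarization the quadratic form determines \<open>T\<close> on its domain.\<close>
definition spectral_resolution ::
    "'a l2_op \<Rightarrow> (real set \<Rightarrow> ('a \<Rightarrow> complex) \<Rightarrow> ('a \<Rightarrow> complex)) \<Rightarrow> bool" where
  "spectral_resolution T E \<longleftrightarrow>
     proj_valued_measure E \<and>
     Domain T = {\<psi> \<in> l2. integrable (diag_measure E \<psi>) (\<lambda>t. t\<^sup>2)} \<and>
     (\<forall>(\<psi>, \<eta>)\<in>T. l2_inner \<psi> \<eta> = complex_of_real (\<integral>t. t \<partial>diag_measure E \<psi>))"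

text \<open>With \<open>f(T) = \<integral> f dE\<close> one has \<open>\<langle>v, f(T) v\<rangle> = \<integral> f d\<langle>v, E v\<rangle>\<close>, so the measure
  representing \<open>f \<mapsto> \<langle>v, f(T) v\<rangle>\<close> is \<open>B \<mapsto> \<langle>v, E B v\<rangle>\<close>.\<close>
definition is_spectral_measure :: "'a l2_op \<Rightarrow> ('a \<Rightarrow> complex) \<Rightarrow> real measure \<Rightarrow> bool" where
  "is_spectral_measure T v \<mu> \<longleftrightarrow>
     (\<exists>E. spectral_resolution T E \<and> \<mu> = diag_measure E v)"

definition cvec_norm :: "complex vec \<Rightarrow> real" where
  "cvec_norm v = sqrt (\<Sum>i<dim_vec v. (cmod (v $ i))\<^sup>2)"

definition is_pos_inv_sqrt :: "complex mat \<Rightarrow> complex mat \<Rightarrow> bool" where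
  "is_pos_inv_sqrt A X \<longleftrightarrow>
     X \<in> carrier_mat (dim_row A) (dim_row A) \<and> mat_adjoint X = X \<and>
     (\<forall>v\<in>carrier_vec (dim_row A). v \<noteq> 0\<^sub>v (dim_row A) \<longrightarrow> Re ((X *\<^sub>v v) \<bullet>c v) > 0) \<and>
     X * X * A = 1\<^sub>m (dim_row A)"

text \<open>Well defined when \<open>A\<close> is positive definite; for such \<open>A\<close> this is \<open>A\<^bsup>-1/2\<^esup>\<close>.\<close>
definition pos_inv_sqrt :: "complex mat \<Rightarrow> complex mat" where
  "pos_inv_sqrt A = (THE X. is_pos_inv_sqrt A X)"

text \<open>The graph is the whole type \<open>'a\<close>.  The list \<open>shell M n\<close> enumerates the \<open>n\<close>-th shell
  without repetition, which fixes the identification of the functions on that shell with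
  column vectors.  \<open>hop M x y\<close> is the matrix element \<open>\<langle>\<delta>\<^sub>x, H \<delta>\<^sub>y\<rangle>\<close>.\<close>
record 'a shell_model =
  shell :: "nat \<Rightarrow> 'a list"
  hop :: "'a \<Rightarrow> 'a \<Rightarrow> complex"
  Ups :: "nat \<Rightarrow> complex mat"
  Phi :: "nat \<Rightarrow> complex mat"

definition shell_size :: "'a shell_model \<Rightarrow> nat \<Rightarrow> nat" where
  "shell_size M n = length (shell M n)"

definition shell_partition :: "'a shell_model \<Rightarrow> bool" where
  "shell_partition M \<longleftrightarrow>
     (\<forall>n. shell M n \<noteq> [] \<and> distinct (shell M n)) \<and>
     disjoint_family (\<lambda>n. set (shell M n)) \<and> (\<Union>n. set (shell M n)) = UNIV"

definition shell_hopping :: "'a shell_model \<Rightarrow> bool" where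
  "shell_hopping M \<longleftrightarrow>
     (\<forall>x y. hop M y x = cnj (hop M x y)) \<and>
     (\<forall>x. finite {y. hop M x y \<noteq> 0}) \<and>
     (\<forall>j k. \<forall>x\<in>set (shell M j). \<forall>y\<in>set (shell M k).
        j + 2 \<le> k \<or> k + 2 \<le> j \<longrightarrow> hop M x y = 0) \<and>
     (\<forall>x y. (x, y) \<in> {(u, v). u \<noteq> v \<and> hop M u v \<noteq> 0}\<^sup>*)"

definition ham :: "'a shell_model \<Rightarrow> ('a \<Rightarrow> complex) \<Rightarrow> ('a \<Rightarrow> complex)" where
  "ham M \<psi> x = (\<Sum>y | hop M x y \<noteq> 0. hop M x y * \<psi> y)"

definition ham_min :: "'a shell_model \<Rightarrow> 'a l2_op" where
  "ham_min M = {(\<psi>, ham M \<psi>) | \<psi>. finite {x. \<psi> x \<noteq> 0}}"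

text \<open>The block from shell \<open>n - 1\<close> to shell \<open>n\<close>; used for positive \<open>n\<close> only.\<close>
definition hop_block :: "'a shell_model \<Rightarrow> nat \<Rightarrow> complex mat" where
  "hop_block M n = mat (shell_size M n) (shell_size M (n - 1))
     (\<lambda>(i, j). hop M (shell M n ! i) (shell M (n - 1) ! j))"

definition hop_rank :: "'a shell_model \<Rightarrow> nat \<Rightarrow> nat" where
  "hop_rank M n = (if n = 0 then 1 else vec_space.rank (shell_size M n) (hop_block M n))"

definition hop_factorization :: "'a shell_model \<Rightarrow> bool" where
  "hop_factorization M \<longleftrightarrow>
     (\<forall>n. Ups M n \<in> carrier_mat (shell_size M n) (hop_rank M n)) \<and>
     (\<forall>n. Phi M n \<in> carrier_mat (shell_size M n) (hop_rank M (Suc n))) \<and>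
     Ups M 0 \<noteq> 0\<^sub>m (shell_size M 0) 1 \<and>
     (\<forall>n\<ge>1. vec_space.rank (shell_size M n) (Ups M n) = hop_rank M n) \<and>
     (\<forall>n. vec_space.rank (shell_size M n) (Phi M n) = hop_rank M (Suc n)) \<and>
     (\<forall>n\<ge>1. hop_block M n = - (Ups M n * mat_adjoint (Phi M (n - 1))))"

definition embed0 :: "'a shell_model \<Rightarrow> complex vec \<Rightarrow> ('a \<Rightarrow> complex)" where
  "embed0 M v x = (\<Sum>i<shell_size M 0. if shell M 0 ! i = x then v $ i else 0)"

definition root_vector :: "'a shell_model \<Rightarrow> ('a \<Rightarrow> complex)" where
  "root_vector M = embed0 M (col (Ups M 0) 0)"

definition sites :: "'a shell_model \<Rightarrow> nat \<Rightarrow> nat \<Rightarrow> 'a list" where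
  "sites M m n = concat (map (shell M) [m..<Suc n])"

definition ham_mat :: "'a shell_model \<Rightarrow> nat \<Rightarrow> nat \<Rightarrow> complex mat" where
  "ham_mat M m n = mat (length (sites M m n)) (length (sites M m n))
     (\<lambda>(i, j). hop M (sites M m n ! i) (sites M m n ! j))"

definition Ups_hat :: "'a shell_model \<Rightarrow> nat \<Rightarrow> nat \<Rightarrow> complex mat" where
  "Ups_hat M m n =
     Ups M m @\<^sub>r 0\<^sub>m (length (sites M m n) - shell_size M m) (hop_rank M m)"

definition Phi_hat :: "'a shell_model \<Rightarrow> nat \<Rightarrow> nat \<Rightarrow> complex mat" where
  "Phi_hat M m n =
     0\<^sub>m (length (sites M m n) - shell_size M n) (hop_rank M (Suc n)) @\<^sub>r Phi M n"

text \<open>Meaningful only when \<open>z\<close> is not an eigenvalue of \<open>ham_mat M m n\<close>.\<close>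
definition bdry_resolvent_raw :: "'a shell_model \<Rightarrow> nat \<Rightarrow> nat \<Rightarrow> complex \<Rightarrow> complex mat" where
  "bdry_resolvent_raw M m n z =
     (let G = the (mat_inverse (ham_mat M m n - z \<cdot>\<^sub>m 1\<^sub>m (length (sites M m n))));
          U = Ups_hat M m n; P = Phi_hat M m n
      in four_block_mat (mat_adjoint U * G * U) (mat_adjoint U * G * P)
                        (mat_adjoint P * G * U) (mat_adjoint P * G * P))"

definition bdry_resolvent :: "'a shell_model \<Rightarrow> nat \<Rightarrow> nat \<Rightarrow> complex \<Rightarrow> complex mat" where
  "bdry_resolvent M m n z =
     (let d = hop_rank M m + hop_rank M (Suc n)
      in mat d d (\<lambda>(i, j). remove_sings (\<lambda>w. bdry_resolvent_raw M m n w $$ (i, j)) z))"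

definition extends_analytically :: "(complex \<Rightarrow> complex) \<Rightarrow> complex \<Rightarrow> bool" where
  "extends_analytically f z \<longleftrightarrow> (\<exists>g. g analytic_on {z} \<and> (\<forall>\<^sub>F w in at z. g w = f w))"

definition singular_set1 :: "'a shell_model \<Rightarrow> nat \<Rightarrow> nat \<Rightarrow> complex set" where
  "singular_set1 M m n =
     {z. \<exists>i < hop_rank M m + hop_rank M (Suc n). \<exists>j < hop_rank M m + hop_rank M (Suc n).
           \<not> extends_analytically (\<lambda>w. bdry_resolvent_raw M m n w $$ (i, j)) z}"

definition alpha :: "'a shell_model \<Rightarrow> nat \<Rightarrow> nat \<Rightarrow> complex \<Rightarrow> complex mat" where
  "alpha M m n z = mat (hop_rank M m) (hop_rank M m)
     (\<lambda>(i, j). bdry_resolvent M m n z $$ (i, j))"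

definition beta :: "'a shell_model \<Rightarrow> nat \<Rightarrow> nat \<Rightarrow> complex \<Rightarrow> complex mat" where
  "beta M m n z = mat (hop_rank M m) (hop_rank M (Suc n))
     (\<lambda>(i, j). bdry_resolvent M m n z $$ (i, hop_rank M m + j))"

definition gamma :: "'a shell_model \<Rightarrow> nat \<Rightarrow> nat \<Rightarrow> complex \<Rightarrow> complex mat" where
  "gamma M m n z = mat (hop_rank M (Suc n)) (hop_rank M m)
     (\<lambda>(i, j). bdry_resolvent M m n z $$ (hop_rank M m + i, j))"

definition delta :: "'a shell_model \<Rightarrow> nat \<Rightarrow> nat \<Rightarrow> complex \<Rightarrow> complex mat" where
  "delta M m n z = mat (hop_rank M (Suc n)) (hop_rank M (Suc n))
     (\<lambda>(i, j). bdry_resolvent M m n z $$ (hop_rank M m + i, hop_rank M m + j))"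

definition singular_set :: "'a shell_model \<Rightarrow> nat \<Rightarrow> nat \<Rightarrow> complex set" where
  "singular_set M m n = singular_set1 M m n \<union>
     {z. vec_space.rank (hop_rank M m) (beta M m n z) < hop_rank M m}"

definition right_inverses :: "'a shell_model \<Rightarrow> nat \<Rightarrow> nat \<Rightarrow> complex \<Rightarrow> complex mat set" where
  "right_inverses M m n z = {B \<in> carrier_mat (hop_rank M (Suc n)) (hop_rank M m).
     beta M m n z * B = 1\<^sub>m (hop_rank M m)}"

definition alpha_lifts :: "'a shell_model \<Rightarrow> nat \<Rightarrow> nat \<Rightarrow> complex \<Rightarrow> complex mat set" where
  "alpha_lifts M m n z = {b \<in> carrier_mat (hop_rank M (Suc n)) (hop_rank M m).
     beta M m n z * b = alpha M m n z}"

definition transfer_mat ::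
    "'a shell_model \<Rightarrow> nat \<Rightarrow> nat \<Rightarrow> complex \<Rightarrow> complex mat \<Rightarrow> complex mat \<Rightarrow> complex mat" where
  "transfer_mat M m n z B b =
     four_block_mat B (- b) (delta M m n z * B) (gamma M m n z - delta M m n z * b)"

definition transfer_set :: "'a shell_model \<Rightarrow> nat \<Rightarrow> nat \<Rightarrow> complex \<Rightarrow> complex mat set" where
  "transfer_set M m n z = {transfer_mat M m n z B b | B b.
     B \<in> right_inverses M m n z \<and> b \<in> alpha_lifts M m n z}"

definition restricted_transfer_set ::
    "'a shell_model \<Rightarrow> nat \<Rightarrow> nat \<Rightarrow> complex \<Rightarrow> complex mat set" where
  "restricted_transfer_set M m n z = {transfer_mat M m n z B b | B b.
     B \<in> right_inverses M m n z \<and> b \<in> alpha_lifts M m n z \<and> b = B * alpha M m n z}"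

text \<open>Since \<open>hop_rank M 0 = 1\<close>, the matrices in \<open>right_inverses M 0 n z\<close> have one column.\<close>
definition direct_set :: "'a shell_model \<Rightarrow> nat \<Rightarrow> complex \<Rightarrow> complex vec set" where
  "direct_set M n z =
     {col B 0 @\<^sub>v col (delta M 0 n z * B) 0 | B. B \<in> right_inverses M 0 n z}"

primrec chain :: "(nat \<Rightarrow> complex mat) \<Rightarrow> nat \<Rightarrow> complex vec \<Rightarrow> complex vec" where
  "chain T 0 v = T 0 *\<^sub>v v"
| "chain T (Suc n) v = T (Suc n) *\<^sub>v chain T n v"

definition chain_set :: "(nat \<Rightarrow> complex mat set) \<Rightarrow> nat \<Rightarrow> complex vec set" where
  "chain_set TT n = {chain T n (vec_of_list [1, 0]) | T. \<forall>i\<le>n. T i \<in> TT i}"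

text \<open>Each density comes with a predicate collecting the conditions under which its formula
  is meaningful at the given point, in particular that the minimum or maximum is attained.\<close>

definition has_least :: "real set \<Rightarrow> bool" where
  "has_least X \<longleftrightarrow> (\<exists>x\<in>X. \<forall>y\<in>X. x \<le> y)"

definition has_greatest :: "real set \<Rightarrow> bool" where
  "has_greatest X \<longleftrightarrow> (\<exists>x\<in>X. \<forall>y\<in>X. y \<le> x)"

definition one_plus_delta_sq :: "'a shell_model \<Rightarrow> nat \<Rightarrow> real \<Rightarrow> complex mat" where
  "one_plus_delta_sq M n t = 1\<^sub>m (hop_rank M (Suc n)) +
     delta M 0 n (of_real t) * delta M 0 n (of_real t)"

definition resolvent_density :: "'a shell_model \<Rightarrow> nat \<Rightarrow> real \<Rightarrow> real" where
  "resolvent_density M n t = 1 / pi *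
     (cvec_norm (col (pos_inv_sqrt (one_plus_delta_sq M n t) * gamma M 0 n (of_real t)) 0))\<^sup>2"

definition resolvent_density_defined :: "'a shell_model \<Rightarrow> nat \<Rightarrow> real \<Rightarrow> bool" where
  "resolvent_density_defined M n t \<longleftrightarrow>
     of_real t \<notin> singular_set1 M 0 n \<and> (\<exists>!X. is_pos_inv_sqrt (one_plus_delta_sq M n t) X)"

definition direct_density :: "'a shell_model \<Rightarrow> nat \<Rightarrow> real \<Rightarrow> real" where
  "direct_density M n t = 1 / pi *
     inverse (LEAST y. y \<in> {(cvec_norm u)\<^sup>2 | u. u \<in> direct_set M n (of_real t)})"

definition direct_density_defined :: "'a shell_model \<Rightarrow> nat \<Rightarrow> real \<Rightarrow> bool" where
  "direct_density_defined M n t \<longleftrightarrow>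
     of_real t \<notin> singular_set M 0 n \<and>
     (\<forall>u\<in>direct_set M n (of_real t). cvec_norm u \<noteq> 0) \<and>
     has_least {(cvec_norm u)\<^sup>2 | u. u \<in> direct_set M n (of_real t)}"

text \<open>The argument \<open>TT\<close> is one of the two families of sets of transfer matrices.\<close>
definition chain_density ::
    "(nat \<Rightarrow> nat \<Rightarrow> complex \<Rightarrow> complex mat set) \<Rightarrow> nat \<Rightarrow> real \<Rightarrow> real" where
  "chain_density TT n t = 1 / pi *
     (GREATEST y. y \<in> {inverse ((cvec_norm u)\<^sup>2) | u.
                        u \<in> chain_set (\<lambda>i. TT i i (of_real t)) n})"

definition chain_density_defined ::
    "'a shell_model \<Rightarrow> (nat \<Rightarrow> nat \<Rightarrow> complex \<Rightarrow> complex mat set) \<Rightarrow> nat \<Rightarrow> real \<Rightarrow> bool" where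
  "chain_density_defined M TT n t \<longleftrightarrow>
     (\<forall>i\<le>n. of_real t \<notin> singular_set M i i) \<and>
     (\<forall>u\<in>chain_set (\<lambda>i. TT i i (of_real t)) n. cvec_norm u \<noteq> 0) \<and>
     has_greatest {inverse ((cvec_norm u)\<^sup>2) | u.
                     u \<in> chain_set (\<lambda>i. TT i i (of_real t)) n}"

definition finite_borel_measure :: "real measure \<Rightarrow> bool" where
  "finite_borel_measure \<mu> \<longleftrightarrow> sets \<mu> = sets borel \<and> finite_measure \<mu>"

definition weak_limit :: "(nat \<Rightarrow> real measure) \<Rightarrow> real measure \<Rightarrow> bool" where
  "weak_limit \<mu>s \<mu> \<longleftrightarrow>
     (\<forall>n. finite_borel_measure (\<mu>s n)) \<and> finite_borel_measure \<mu> \<and>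
     (\<forall>f :: real \<Rightarrow> real. continuous_on UNIV f \<and> bounded (range f) \<longrightarrow>
        (\<lambda>n. \<integral>t. f t \<partial>\<mu>s n) \<longlonglongrightarrow> (\<integral>t. f t \<partial>\<mu>))"

text \<open>\<open>g n\<close> is a density, given by a formula that makes sense where \<open>D n\<close> holds.\<close>
definition weak_limit_of_densities ::
    "(nat \<Rightarrow> real \<Rightarrow> bool) \<Rightarrow> (nat \<Rightarrow> real \<Rightarrow> real) \<Rightarrow> real measure \<Rightarrow> bool" where
  "weak_limit_of_densities D g \<mu> \<longleftrightarrow>
     (\<forall>n. finite {t. \<not> D n t}) \<and>
     (\<forall>n. g n \<in> borel_measurable borel) \<and>
     weak_limit (\<lambda>n. density lborel (\<lambda>t. ennreal (g n t))) \<mu>"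

definition point_measure_on :: "real measure \<Rightarrow> real set \<Rightarrow> bool" where
  "point_measure_on \<nu> L \<longleftrightarrow> finite_borel_measure \<nu> \<and>
     (\<exists>C. countable C \<and> (AE t in \<nu>. t \<in> C)) \<and> (AE t in \<nu>. t \<in> L)"

definition compact_eigenspace :: "'a shell_model \<Rightarrow> real \<Rightarrow> ('a \<Rightarrow> complex) set" where
  "compact_eigenspace M t =
     {\<psi>. finite {x. \<psi> x \<noteq> 0} \<and> ham M \<psi> = (\<lambda>x. of_real t * \<psi> x)}"

definition generated_by_compact_eigenfunctions :: "'a shell_model \<Rightarrow> real measure \<Rightarrow> bool" where
  "generated_by_compact_eigenfunctions M \<nu> \<longleftrightarrow>
     (\<forall>t. measure \<nu> {t} =
        (l2_norm (l2_proj (l2_closure (compact_eigenspace M t)) (root_vector M)))\<^sup>2)"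

end

theory Submission
  imports Defs
begin

text \<open>Perturb the finite matrix \<open>H\<^sub>0\<^sub>,\<^sub>n\<close> to the dissipative matrix \<open>A\<^sub>n = H\<^sub>0\<^sub>,\<^sub>n - i \<Phi>\<^sub>n \<Phi>\<^sub>n\<^sup>*\<close> and let
  \<open>F\<^sub>n(z) = \<langle>u, (A\<^sub>n - z)\<^bsup>-1\<^esup> u\<rangle>\<close> for the root vector \<open>u\<close>.  The vector \<open>x = \<Phi>\<^sub>n\<^sup>* (A\<^sub>n - t)\<^bsup>-1\<^esup> u\<close> solves
  \<open>x = \<gamma> + i \<delta> x\<close>, whence \<open>Im F\<^sub>n(t) = \<parallel>x\<parallel>\<^sup>2 = \<parallel>(1 + \<delta>\<^sup>2)\<^bsup>-1/2\<^esup> \<gamma>\<parallel>\<^sup>2\<close> on the real line.  The function \<open>F\<^sub>n\<close> is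
  rational and holomorphic in the upper half plane; its real poles are simple, and the residue at
  \<open>t\<close> is the squared norm of the projection of \<open>u\<close> onto the eigenvectors of \<open>H\<^sub>0\<^sub>,\<^sub>n\<close> annihilated by \<open>\<Phi>\<^sub>n\<^sup>*\<close>,
  which are the eigenfunctions of \<open>H\<close> supported in the first shells.  So \<open>Im F\<^sub>n\<close> is the Poisson
  integral of the density and of a point part.  As \<open>A\<^sub>n\<close> acts like \<open>H\<close> on functions supported in the
  shells before the \<open>n\<close>-th, essential self-adjointness yields \<open>F\<^sub>n(z) \<longlongrightarrow> \<langle>u, (H - z)\<^bsup>-1\<^esup> u\<rangle>\<close>, hence weak
  convergence of both parts together to \<open>\<mu>\<close>, while the point parts increase to \<open>\<nu>\<close>.

  The other densities agree with this one pointwise.  By gluing solutions shell by shell, the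
  products of transfer matrices applied to \<open>(1, 0)\<close> are exactly the vectors \<open>(c, \<delta> c)\<close> with \<open>\<beta> c = 1\<close>,
  and \<open>\<parallel>c\<parallel>\<^sup>2 + \<parallel>\<delta> c\<parallel>\<^sup>2\<close> is minimal for \<open>c\<close> proportional to \<open>(1 + \<delta>\<^sup>2)\<^bsup>-1\<^esup> \<gamma>\<close>.\<close>

section \<open>Square-summable functions\<close>

text \<open>The spectral measure of \<open>ham_mat M 0 n\<close> consists of point masses.
  Absorption at the outer boundary smears all of it except the part on eigenvectors that do not feel
  the boundary; strength one is what produces 1 + \<delta>^2. \<open>spectral_resolution\<close>
  speaks of quadratic forms and domains only, so the resolvent of H is replaced by explicit vectors,
  Riemann sums of 1 / (t - z) over spectral cells, that solve the resolvent equation up to a small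
  error. Approximated by finitely supported functions, they can be compared with all large volumes
  at once. Two obstacles remain for the measures. Poisson transforms control compactly supported
  test functions; for bounded ones the approximants must not carry more mass than \<mu>, which is
  read off at infinity on the imaginary axis. And convergence of a sum of two parts says nothing
  about either part. The point parts are therefore written as densities between 0 and 1 with respect
  to \<mu>, which needs eigenvector weights to be at most the atoms of \<mu>, and dominated
  convergence isolates them.\<close>

lemma l2_add_scaled:
  assumes "\<phi> \<in> l2" "\<psi> \<in> l2"
  shows "(\<lambda>x. \<phi> x + c * \<psi> x) \<in> l2"
proof -
  have "(\<lambda>x. 2 * (cmod (\<phi> x))\<^sup>2 + (2 * (cmod c)\<^sup>2) * (cmod (\<psi> x))\<^sup>2) summable_on UNIV"
    using assms unfolding l2_def by (intro summable_on_add summable_on_cmult_right) auto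
  moreover have "((cmod (\<phi> x + c * \<psi> x))\<^sup>2)
      \<le> 2 * (cmod (\<phi> x))\<^sup>2 + (2 * (cmod c)\<^sup>2) * (cmod (\<psi> x))\<^sup>2" for x
  proof -
    have "(cmod (\<phi> x + c * \<psi> x))\<^sup>2 \<le> (cmod (\<phi> x) + cmod c * cmod (\<psi> x))\<^sup>2"
      using norm_triangle_ineq[of "\<phi> x" "c * \<psi> x"] by (intro power_mono) (auto simp: norm_mult)
    also have "\<dots> \<le> 2 * (cmod (\<phi> x))\<^sup>2 + 2 * (cmod c * cmod (\<psi> x))\<^sup>2"
      using sum_squares_bound[of "cmod (\<phi> x)" "cmod c * cmod (\<psi> x)"]
      by (simp add: power2_sum)
    finally show ?thesis by (simp add: power_mult_distrib)
  qed
  ultimately show ?thesis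
    unfolding l2_def mem_Collect_eq by (rule summable_on_comparison_test) auto
qed

lemma l2_zero: "(\<lambda>x. 0) \<in> l2"
  by (simp add: l2_def)

lemma l2_scale: "\<psi> \<in> l2 \<Longrightarrow> (\<lambda>x. c * \<psi> x) \<in> l2"
  using l2_add_scaled[OF l2_zero, of \<psi> c] by simp

lemma l2_add: "\<phi> \<in> l2 \<Longrightarrow> \<psi> \<in> l2 \<Longrightarrow> (\<lambda>x. \<phi> x + \<psi> x) \<in> l2"
  using l2_add_scaled[of \<phi> \<psi> 1] by simp

lemma l2_diff: "\<phi> \<in> l2 \<Longrightarrow> \<psi> \<in> l2 \<Longrightarrow> (\<lambda>x. \<phi> x - \<psi> x) \<in> l2"
  using l2_add_scaled[of \<phi> \<psi> "-1"] by simp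

lemma l2_sum: "(\<And>i. i \<in> I \<Longrightarrow> f i \<in> l2) \<Longrightarrow> (\<lambda>x. \<Sum>i\<in>I. f i x) \<in> l2"
  by (induction I rule: infinite_finite_induct) (auto simp: l2_zero l2_add)

lemma l2_finite_support: "finite {x. \<psi> x \<noteq> 0} \<Longrightarrow> \<psi> \<in> l2"
  unfolding l2_def mem_Collect_eq
  by (rule summable_on_cong_neutral[THEN iffD1, of UNIV "{x. \<psi> x \<noteq> 0}"]) auto

lemma l2_inner_summable:
  assumes "\<phi> \<in> l2" "\<psi> \<in> l2"
  shows "(\<lambda>x. cnj (\<phi> x) * \<psi> x) summable_on UNIV"
proof -
  have "(\<lambda>x. (cmod (\<phi> x))\<^sup>2 + (cmod (\<psi> x))\<^sup>2) summable_on UNIV"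
    using assms unfolding l2_def by (intro summable_on_add) auto
  moreover have "(cmod (cnj (\<phi> x) * \<psi> x)) \<le> (cmod (\<phi> x))\<^sup>2 + (cmod (\<psi> x))\<^sup>2" for x
    using sum_squares_bound[of "cmod (\<phi> x)" "cmod (\<psi> x)"]
    by (auto simp: norm_mult intro: order.trans[of _ "2 * cmod (\<phi> x) * cmod (\<psi> x)"])
  ultimately have "(\<lambda>x. cmod (cnj (\<phi> x) * \<psi> x)) summable_on UNIV"
    by (rule summable_on_comparison_test) auto
  thus ?thesis by (rule abs_summable_summable)
qed

lemma l2_inner_add_right:
  assumes "\<phi> \<in> l2" "\<psi> \<in> l2" "\<chi> \<in> l2"
  shows "l2_inner \<chi> (\<lambda>x. \<phi> x + c * \<psi> x) = l2_inner \<chi> \<phi> + c * l2_inner \<chi> \<psi>"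
proof -
  have "l2_inner \<chi> (\<lambda>x. \<phi> x + c * \<psi> x)
      = (\<Sum>\<^sub>\<infinity>x. cnj (\<chi> x) * \<phi> x + c * (cnj (\<chi> x) * \<psi> x))"
    unfolding l2_inner_def by (rule infsum_cong) (simp add: algebra_simps)
  also have "\<dots> = l2_inner \<chi> \<phi> + (\<Sum>\<^sub>\<infinity>x. c * (cnj (\<chi> x) * \<psi> x))"
    unfolding l2_inner_def
    by (intro infsum_add summable_on_cmult_right l2_inner_summable assms)
  also have "(\<Sum>\<^sub>\<infinity>x. c * (cnj (\<chi> x) * \<psi> x)) = c * l2_inner \<chi> \<psi>"
    unfolding l2_inner_def by (rule infsum_cmult_right')
  finally show ?thesis .
qed

lemma l2_inner_commute: "l2_inner \<psi> \<phi> = cnj (l2_inner \<phi> \<psi>)"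
  unfolding l2_inner_def infsum_cnj[symmetric] by (rule infsum_cong) simp

lemma l2_inner_add_left:
  assumes "\<phi> \<in> l2" "\<psi> \<in> l2" "\<chi> \<in> l2"
  shows "l2_inner (\<lambda>x. \<phi> x + c * \<psi> x) \<chi> = l2_inner \<phi> \<chi> + cnj c * l2_inner \<psi> \<chi>"
  by (subst (1 2 3) l2_inner_commute) (simp add: l2_inner_add_right assms)

lemma l2_inner_zero [simp]: "l2_inner \<chi> (\<lambda>x. 0) = 0" "l2_inner (\<lambda>x. 0) \<chi> = 0"
  by (simp_all add: l2_inner_def)

lemma l2_inner_scale_right: "l2_inner \<chi> (\<lambda>x. c * \<psi> x) = c * l2_inner \<chi> \<psi>"
  unfolding l2_inner_def infsum_cmult_right'[symmetric] by (rule infsum_cong) simp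

lemma l2_inner_scale_left: "l2_inner (\<lambda>x. c * \<psi> x) \<chi> = cnj c * l2_inner \<psi> \<chi>"
  by (subst (1 2) l2_inner_commute) (simp add: l2_inner_scale_right)

lemma l2_inner_plus_right:
  "\<phi> \<in> l2 \<Longrightarrow> \<psi> \<in> l2 \<Longrightarrow> \<chi> \<in> l2 \<Longrightarrow>
    l2_inner \<chi> (\<lambda>x. \<phi> x + \<psi> x) = l2_inner \<chi> \<phi> + l2_inner \<chi> \<psi>"
  using l2_inner_add_right[of \<phi> \<psi> \<chi> 1] by simp

lemma l2_inner_plus_left:
  "\<phi> \<in> l2 \<Longrightarrow> \<psi> \<in> l2 \<Longrightarrow> \<chi> \<in> l2 \<Longrightarrow>
    l2_inner (\<lambda>x. \<phi> x + \<psi> x) \<chi> = l2_inner \<phi> \<chi> + l2_inner \<psi> \<chi>"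
  using l2_inner_add_left[of \<phi> \<psi> \<chi> 1] by simp

lemma l2_inner_diff_right:
  "\<phi> \<in> l2 \<Longrightarrow> \<psi> \<in> l2 \<Longrightarrow> \<chi> \<in> l2 \<Longrightarrow>
    l2_inner \<chi> (\<lambda>x. \<phi> x - \<psi> x) = l2_inner \<chi> \<phi> - l2_inner \<chi> \<psi>"
  using l2_inner_add_right[of \<phi> \<psi> \<chi> "-1"] by simp

lemma l2_inner_diff_left:
  "\<phi> \<in> l2 \<Longrightarrow> \<psi> \<in> l2 \<Longrightarrow> \<chi> \<in> l2 \<Longrightarrow>
    l2_inner (\<lambda>x. \<phi> x - \<psi> x) \<chi> = l2_inner \<phi> \<chi> - l2_inner \<psi> \<chi>"
  using l2_inner_add_left[of \<phi> \<psi> \<chi> "-1"] by simp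

lemma l2_inner_sum_right:
  "finite I \<Longrightarrow> (\<And>i. i \<in> I \<Longrightarrow> f i \<in> l2) \<Longrightarrow> \<chi> \<in> l2 \<Longrightarrow>
    l2_inner \<chi> (\<lambda>x. \<Sum>i\<in>I. f i x) = (\<Sum>i\<in>I. l2_inner \<chi> (f i))"
  by (induction I rule: finite_induct) (auto simp: l2_inner_plus_right l2_sum)

lemma l2_inner_self: "l2_inner \<psi> \<psi> = complex_of_real ((l2_norm \<psi>)\<^sup>2)"
proof -
  have "l2_inner \<psi> \<psi> = (\<Sum>\<^sub>\<infinity>x. complex_of_real ((cmod (\<psi> x))\<^sup>2))"
    unfolding l2_inner_def
    by (rule infsum_cong) (metis complex_norm_square mult.commute)
  also have "\<dots> = complex_of_real (\<Sum>\<^sub>\<infinity>x. (cmod (\<psi> x))\<^sup>2)"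
    by (rule infsum_bounded_linear_strong[OF _ bounded_linear_of_real])
      (metis Re_complex_of_real summable_on_Re summable_on_cong summable_on_of_real)
  also have "(\<Sum>\<^sub>\<infinity>x. (cmod (\<psi> x))\<^sup>2) = (l2_norm \<psi>)\<^sup>2"
    unfolding l2_norm_def by (simp add: infsum_nonneg)
  finally show ?thesis .
qed

lemma l2_norm_nonneg [simp]: "l2_norm \<psi> \<ge> 0"
  unfolding l2_norm_def by (simp add: infsum_nonneg)

lemma l2_norm_sq_Re: "(l2_norm \<psi>)\<^sup>2 = Re (l2_inner \<psi> \<psi>)"
  by (simp add: l2_inner_self)

lemma l2_norm_scale: "l2_norm (\<lambda>x. c * \<psi> x) = cmod c * l2_norm \<psi>"
proof -
  have "complex_of_real ((l2_norm (\<lambda>x. c * \<psi> x))\<^sup>2) = c * cnj c * complex_of_real ((l2_norm \<psi>)\<^sup>2)"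
    unfolding l2_inner_self[symmetric] by (simp add: l2_inner_scale_left l2_inner_scale_right)
  also have "\<dots> = complex_of_real ((cmod c * l2_norm \<psi>)\<^sup>2)"
    unfolding power_mult_distrib of_real_mult complex_norm_square by simp
  finally have "(l2_norm (\<lambda>x. c * \<psi> x))\<^sup>2 = (cmod c * l2_norm \<psi>)\<^sup>2"
    unfolding of_real_eq_iff .
  thus ?thesis by (rule power2_eq_imp_eq) auto
qed

lemma l2_norm_add_sq:
  assumes "\<phi> \<in> l2" "\<psi> \<in> l2"
  shows "(l2_norm (\<lambda>x. \<phi> x + \<psi> x))\<^sup>2
    = (l2_norm \<phi>)\<^sup>2 + 2 * Re (l2_inner \<phi> \<psi>) + (l2_norm \<psi>)\<^sup>2"
proof -
  have "Re (l2_inner \<psi> \<phi>) = Re (l2_inner \<phi> \<psi>)"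
    by (subst l2_inner_commute) simp
  thus ?thesis
    unfolding l2_norm_sq_Re using assms
    by (simp add: l2_inner_plus_left l2_inner_plus_right l2_add)
qed

lemma l2_Cauchy_Schwarz:
  assumes "\<phi> \<in> l2" "\<psi> \<in> l2"
  shows "cmod (l2_inner \<phi> \<psi>) \<le> l2_norm \<phi> * l2_norm \<psi>"
proof (cases "l2_norm \<psi> = 0")
  case False
  define s where "s = (l2_norm \<psi>)\<^sup>2"
  have s: "s > 0" using False by (simp add: s_def)
  \<comment> \<open>The coefficient that minimizes the norm of \<phi> + c \<psi>, so that this
    vector is orthogonal to \<psi>.\<close>
  define c where "c = - (l2_inner \<psi> \<phi> / s)"
  have ip: "l2_inner \<phi> \<psi> = cnj (l2_inner \<psi> \<phi>)" by (rule l2_inner_commute)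
  have "0 \<le> (l2_norm (\<lambda>x. \<phi> x + c * \<psi> x))\<^sup>2" by simp
  also have "\<dots> = (l2_norm \<phi>)\<^sup>2 + 2 * Re (c * l2_inner \<phi> \<psi>) + (cmod c)\<^sup>2 * s"
    using assms by (subst l2_norm_add_sq)
      (auto simp: l2_scale l2_inner_scale_right l2_norm_scale power_mult_distrib s_def)
  also have "c * l2_inner \<phi> \<psi> = - complex_of_real ((cmod (l2_inner \<phi> \<psi>))\<^sup>2 / s)"
    unfolding c_def ip by (simp add: complex_norm_square mult.commute del: of_real_power)
  also have "(cmod c)\<^sup>2 * s = (cmod (l2_inner \<phi> \<psi>))\<^sup>2 / s"
    using s by (simp add: c_def ip norm_divide power_divide power2_eq_square)
  finally have "(cmod (l2_inner \<phi> \<psi>))\<^sup>2 / s \<le> (l2_norm \<phi>)\<^sup>2" by simp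
  hence "(cmod (l2_inner \<phi> \<psi>))\<^sup>2 \<le> (l2_norm \<phi> * l2_norm \<psi>)\<^sup>2"
    using s by (simp add: divide_le_eq s_def power_mult_distrib)
  thus ?thesis by (rule power2_le_imp_le) simp
next
  case True
  have "(\<Sum>\<^sub>\<infinity>x. (cmod (\<psi> x))\<^sup>2) = 0"
    using True by (simp add: l2_norm_def)
  hence "\<psi> x = 0" for x
    using assms(2) nonneg_infsum_le_0D[of "\<lambda>x. (cmod (\<psi> x))\<^sup>2" UNIV x] by (auto simp: l2_def)
  hence "\<psi> = (\<lambda>x. 0)" by auto
  thus ?thesis by simp
qed

lemma l2_norm_triangle:
  assumes "\<phi> \<in> l2" "\<psi> \<in> l2"
  shows "l2_norm (\<lambda>x. \<phi> x + \<psi> x) \<le> l2_norm \<phi> + l2_norm \<psi>"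
proof (rule power2_le_imp_le)
  have "Re (l2_inner \<phi> \<psi>) \<le> l2_norm \<phi> * l2_norm \<psi>"
    using complex_Re_le_cmod l2_Cauchy_Schwarz[OF assms] order.trans by blast
  thus "(l2_norm (\<lambda>x. \<phi> x + \<psi> x))\<^sup>2 \<le> (l2_norm \<phi> + l2_norm \<psi>)\<^sup>2"
    by (simp add: l2_norm_add_sq assms power2_sum)
qed simp

lemma l2_dist_commute: "l2_dist \<phi> \<psi> = l2_dist \<psi> \<phi>"
  unfolding l2_dist_def l2_norm_def by (simp add: norm_minus_commute)

lemma l2_dist_nonneg [simp]: "l2_dist \<phi> \<psi> \<ge> 0"
  by (simp add: l2_dist_def)

lemma l2_dist_triangle:
  assumes "\<phi> \<in> l2" "\<psi> \<in> l2" "\<chi> \<in> l2"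
  shows "l2_dist \<phi> \<chi> \<le> l2_dist \<phi> \<psi> + l2_dist \<psi> \<chi>"
  using l2_norm_triangle[of "\<lambda>x. \<phi> x - \<psi> x" "\<lambda>x. \<psi> x - \<chi> x"] assms
  by (simp add: l2_dist_def l2_diff)

lemma l2_norm_diff_le:
  assumes "\<phi> \<in> l2" "\<psi> \<in> l2"
  shows "\<bar>l2_norm \<phi> - l2_norm \<psi>\<bar> \<le> l2_dist \<phi> \<psi>"
proof -
  have "l2_norm \<phi> \<le> l2_dist \<phi> \<psi> + l2_norm \<psi>" "l2_norm \<psi> \<le> l2_dist \<psi> \<phi> + l2_norm \<phi>"
    using l2_dist_triangle[of \<phi> \<psi> "\<lambda>x. 0"] l2_dist_triangle[of \<psi> \<phi> "\<lambda>x. 0"] assms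
    by (auto simp: l2_dist_def l2_zero)
  thus ?thesis by (simp add: l2_dist_commute)
qed

lemma l2_inner_dist_le:
  assumes "\<phi> \<in> l2" "\<psi> \<in> l2" "\<chi> \<in> l2"
  shows "cmod (l2_inner \<chi> \<phi> - l2_inner \<chi> \<psi>) \<le> l2_norm \<chi> * l2_dist \<phi> \<psi>"
  using l2_Cauchy_Schwarz[of \<chi> "\<lambda>x. \<phi> x - \<psi> x"] assms
  by (simp add: l2_diff l2_inner_diff_right l2_dist_def)

lemma l2_inner_tendsto:
  assumes "(\<lambda>n. l2_dist \<phi> (f n)) \<longlonglongrightarrow> 0" "\<And>n. f n \<in> l2" "\<phi> \<in> l2" "\<chi> \<in> l2"
  shows "(\<lambda>n. l2_inner \<chi> (f n)) \<longlonglongrightarrow> l2_inner \<chi> \<phi>"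
proof (rule LIM_zero_cancel, rule Lim_null_comparison)
  show "\<forall>\<^sub>F n in sequentially. norm (l2_inner \<chi> (f n) - l2_inner \<chi> \<phi>) \<le> l2_norm \<chi> * l2_dist \<phi> (f n)"
    using l2_inner_dist_le[OF assms(2,3,4)] by (simp add: l2_dist_commute)
  show "(\<lambda>n. l2_norm \<chi> * l2_dist \<phi> (f n)) \<longlonglongrightarrow> 0"
    using tendsto_mult_right_zero[OF assms(1)] by simp
qed

lemma sum_cmod_le_l2_norm:
  assumes "\<psi> \<in> l2" "finite F"
  shows "(\<Sum>x\<in>F. (cmod (\<psi> x))\<^sup>2) \<le> (l2_norm \<psi>)\<^sup>2"
proof -
  have "(\<Sum>x\<in>F. (cmod (\<psi> x))\<^sup>2) \<le> (\<Sum>\<^sub>\<infinity>x. (cmod (\<psi> x))\<^sup>2)"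
    using assms by (intro finite_sum_le_infsum) (auto simp: l2_def)
  thus ?thesis unfolding l2_norm_def by (simp add: infsum_nonneg)
qed

lemma cmod_le_l2_norm:
  assumes "\<psi> \<in> l2"
  shows "cmod (\<psi> x) \<le> l2_norm \<psi>"
  using sum_cmod_le_l2_norm[OF assms, of "{x}"] by (simp add: power2_le_iff_abs_le)

lemma l2_norm_eq_0:
  assumes "\<psi> \<in> l2" "l2_norm \<psi> = 0"
  shows "\<psi> = (\<lambda>x. 0)"
  using cmod_le_l2_norm[OF assms(1)] assms(2) by (auto intro!: ext)

lemma l2_norm_leI:
  assumes "\<And>F. finite F \<Longrightarrow> (\<Sum>x\<in>F. (cmod (\<psi> x))\<^sup>2) \<le> C\<^sup>2" "C \<ge> 0"
  shows "\<psi> \<in> l2" "l2_norm \<psi> \<le> C"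
proof -
  show "\<psi> \<in> l2"
    unfolding l2_def mem_Collect_eq
    by (rule nonneg_bdd_above_summable_on) (auto intro!: bdd_aboveI[where M = "C\<^sup>2"] assms)
  hence "(\<Sum>\<^sub>\<infinity>x. (cmod (\<psi> x))\<^sup>2) \<le> C\<^sup>2"
    by (intro infsum_le_finite_sums assms) (auto simp: l2_def)
  thus "l2_norm \<psi> \<le> C"
    unfolding l2_norm_def using assms(2) by (simp add: real_le_lsqrt)
qed

text \<open>A Cauchy sequence converges at every point because point evaluation is bounded by the
  norm. Bounds on distances pass to the pointwise limit through finite partial sums, which also
  yields square summability of the limit.\<close>

lemma l2_complete:
  assumes f: "\<And>n. f n \<in> l2"
    and Cauchy: "\<And>e. e > 0 \<Longrightarrow> \<exists>N. \<forall>m\<ge>N. \<forall>n\<ge>N. l2_dist (f m) (f n) < e"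
  obtains g where "g \<in> l2" "(\<lambda>n. l2_dist (f n) g) \<longlonglongrightarrow> 0" "\<And>x. (\<lambda>n. f n x) \<longlonglongrightarrow> g x"
proof -
  have "Cauchy (\<lambda>n. f n x)" for x
  proof (rule CauchyI)
    fix e :: real assume "e > 0"
    then obtain N where N: "\<forall>m\<ge>N. \<forall>n\<ge>N. l2_dist (f m) (f n) < e" using Cauchy by blast
    have "cmod (f m x - f n x) \<le> l2_dist (f m) (f n)" for m n
      unfolding l2_dist_def using cmod_le_l2_norm[OF l2_diff[OF f f]] by simp
    thus "\<exists>M. \<forall>m\<ge>M. \<forall>n\<ge>M. norm (f m x - f n x) < e"
      using N le_less_trans by blast
  qed
  hence "\<forall>x. \<exists>l. (\<lambda>n. f n x) \<longlonglongrightarrow> l"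
    using Cauchy_convergent convergent_def by blast
  then obtain g where g: "\<And>x. (\<lambda>n. f n x) \<longlonglongrightarrow> g x" by metis
  have close: "\<exists>N. \<forall>n\<ge>N. (\<lambda>x. f n x - g x) \<in> l2 \<and> l2_dist (f n) g \<le> e" if e: "e > 0" for e
  proof -
    obtain N where N: "\<And>m n. m \<ge> N \<Longrightarrow> n \<ge> N \<Longrightarrow> l2_dist (f m) (f n) < e" using Cauchy e by blast
    have "(\<lambda>x. f n x - g x) \<in> l2 \<and> l2_dist (f n) g \<le> e" if n: "n \<ge> N" for n
    proof -
      have "(\<Sum>x\<in>F. (cmod (f n x - g x))\<^sup>2) \<le> e\<^sup>2" if F: "finite F" for F
      proof (rule LIMSEQ_le_const2)
        show "(\<lambda>m. \<Sum>x\<in>F. (cmod (f n x - f m x))\<^sup>2) \<longlonglongrightarrow> (\<Sum>x\<in>F. (cmod (f n x - g x))\<^sup>2)"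
          by (intro tendsto_intros g)
        have "(\<Sum>x\<in>F. (cmod (f n x - f m x))\<^sup>2) \<le> e\<^sup>2" if "m \<ge> N" for m
        proof -
          have "(\<Sum>x\<in>F. (cmod (f n x - f m x))\<^sup>2) \<le> (l2_dist (f n) (f m))\<^sup>2"
            unfolding l2_dist_def by (rule sum_cmod_le_l2_norm[OF l2_diff[OF f f] F])
          also have "\<dots> \<le> e\<^sup>2" using N[OF n that] by (intro power_mono) auto
          finally show ?thesis .
        qed
        thus "\<exists>M. \<forall>m\<ge>M. (\<Sum>x\<in>F. (cmod (f n x - f m x))\<^sup>2) \<le> e\<^sup>2" by blast
      qed
      thus ?thesis
        using l2_norm_leI[of "\<lambda>x. f n x - g x" e] e unfolding l2_dist_def by auto
    qed
    thus ?thesis by blast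
  qed
  obtain n where "(\<lambda>x. f n x - g x) \<in> l2" using close[of 1] by auto
  from l2_diff[OF f[of n] this] have gl2: "g \<in> l2" by simp
  have "(\<lambda>n. l2_dist (f n) g) \<longlonglongrightarrow> 0"
  proof (rule LIMSEQ_I)
    fix r :: real assume "r > 0"
    then obtain N where "\<forall>n\<ge>N. l2_dist (f n) g \<le> r / 2" using close[of "r/2"] by auto
    thus "\<exists>no. \<forall>n\<ge>no. norm (l2_dist (f n) g - 0) < r"
      using \<open>r > 0\<close> by (intro exI[of _ N]) (auto intro: le_less_trans)
  qed
  thus ?thesis using that gl2 g by blast
qed

lemma l2_closureI:
  assumes "\<psi> \<in> l2" "\<And>n. f n \<in> F" "(\<lambda>n. l2_dist (f n) \<psi>) \<longlonglongrightarrow> 0"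
  shows "\<psi> \<in> l2_closure F"
  unfolding l2_closure_def
proof (safe intro!: assms)
  fix \<epsilon> :: real assume "\<epsilon> > 0"
  then obtain n where "l2_dist (f n) \<psi> < \<epsilon>"
    using LIMSEQ_D[OF assms(3)] by fastforce
  thus "\<exists>\<phi>\<in>F. l2_dist \<psi> \<phi> < \<epsilon>"
    using assms(2)[of n] by (auto simp: l2_dist_commute)
qed

lemma orthogonal_l2_closure:
  assumes "F \<subseteq> l2" "\<eta> \<in> l2" "\<And>\<chi>. \<chi> \<in> F \<Longrightarrow> l2_inner \<chi> \<eta> = 0" "\<chi> \<in> l2_closure F"
  shows "l2_inner \<chi> \<eta> = 0"
proof -
  have \<chi>: "\<chi> \<in> l2" using assms(4) by (simp add: l2_closure_def)
  have "cmod (l2_inner \<eta> \<chi>) \<le> 0 + e" if "e > 0" for e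
  proof -
    have "e / (l2_norm \<eta> + 1) > 0" using that by (intro divide_pos_pos) (auto simp: add_nonneg_pos)
    then obtain \<phi> where \<phi>: "\<phi> \<in> F" "l2_dist \<chi> \<phi> < e / (l2_norm \<eta> + 1)"
      using assms(4) unfolding l2_closure_def by blast
    have "l2_inner \<eta> \<phi> = 0"
      using assms(3)[OF \<phi>(1)] l2_inner_commute[of \<eta> \<phi>] by simp
    hence "cmod (l2_inner \<eta> \<chi>) \<le> l2_norm \<eta> * l2_dist \<chi> \<phi>"
      using l2_inner_dist_le[OF \<chi> _ assms(2), of \<phi>] \<phi>(1) assms(1) by auto
    also have "\<dots> \<le> (l2_norm \<eta> + 1) * (e / (l2_norm \<eta> + 1))"
      using \<phi>(2) by (intro mult_mono) (auto simp: add_nonneg_pos)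
    also have "\<dots> = e" by (simp add: add_nonneg_eq_0_iff)
    finally show ?thesis by simp
  qed
  hence "cmod (l2_inner \<eta> \<chi>) \<le> 0" by (rule field_le_epsilon)
  thus ?thesis using l2_inner_commute[of \<chi> \<eta>] by simp
qed

text \<open>\<open>l2_proj\<close> is a definite description, so a candidate may be used only after
  uniqueness is shown: the difference of two candidates lies in K and is orthogonal to
  itself.\<close>

lemma l2_proj_eqI:
  assumes "\<phi> \<in> K" "K \<subseteq> l2" "\<psi> \<in> l2" "\<And>\<chi>. \<chi> \<in> K \<Longrightarrow> l2_inner \<chi> (\<lambda>x. \<psi> x - \<phi> x) = 0"
    and sub: "\<And>\<chi> \<chi>'. \<chi> \<in> K \<Longrightarrow> \<chi>' \<in> K \<Longrightarrow> (\<lambda>x. \<chi> x - \<chi>' x) \<in> K"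
  shows "l2_proj K \<psi> = \<phi>"
  unfolding l2_proj_def
proof (rule the_equality)
  fix \<phi>' assume \<phi>': "\<phi>' \<in> K \<and> (\<forall>\<chi>\<in>K. l2_inner \<chi> (\<lambda>x. \<psi> x - \<phi>' x) = 0)"
  define d where "d = (\<lambda>x. \<phi> x - \<phi>' x)"
  have d: "d \<in> K" "d \<in> l2" using sub[OF assms(1), of \<phi>'] \<phi>' assms(2) by (auto simp: d_def)
  have "l2_inner d d = l2_inner d (\<lambda>x. (\<psi> x - \<phi>' x) - (\<psi> x - \<phi> x))" by (simp add: d_def)
  also have "\<dots> = l2_inner d (\<lambda>x. \<psi> x - \<phi>' x) - l2_inner d (\<lambda>x. \<psi> x - \<phi> x)"
    using assms \<phi>' d by (intro l2_inner_diff_right l2_diff) auto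
  also have "\<dots> = 0" using assms(4)[OF d(1)] \<phi>' d(1) by simp
  finally have "d = (\<lambda>x. 0)"
    using l2_norm_eq_0[OF d(2)] by (simp add: l2_inner_self)
  thus "\<phi>' = \<phi>" by (auto simp: d_def fun_eq_iff)
qed (use assms in auto)

lemma l2_closure_diff:
  assumes "F \<subseteq> l2" "\<And>\<chi> \<chi>'. \<chi> \<in> F \<Longrightarrow> \<chi>' \<in> F \<Longrightarrow> (\<lambda>x. \<chi> x - \<chi>' x) \<in> F"
    and "\<phi> \<in> l2_closure F" "\<psi> \<in> l2_closure F"
  shows "(\<lambda>x. \<phi> x - \<psi> x) \<in> l2_closure F"
  unfolding l2_closure_def
proof (safe)
  have l2: "\<phi> \<in> l2" "\<psi> \<in> l2" using assms by (auto simp: l2_closure_def)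
  thus "(\<lambda>x. \<phi> x - \<psi> x) \<in> l2" by (rule l2_diff)
  fix e :: real assume "e > 0"
  hence "e / 2 > 0" by simp
  then obtain \<phi>' \<psi>' where *: "\<phi>' \<in> F" "l2_dist \<phi> \<phi>' < e/2" "\<psi>' \<in> F" "l2_dist \<psi> \<psi>' < e/2"
    using assms(3,4) unfolding l2_closure_def by blast
  have l2': "\<phi>' \<in> l2" "\<psi>' \<in> l2" using * assms(1) by auto
  have "l2_dist (\<lambda>x. \<phi> x - \<psi> x) (\<lambda>x. \<phi>' x - \<psi>' x)
      = l2_norm (\<lambda>x. (\<phi> x - \<phi>' x) + (\<psi>' x - \<psi> x))"
    by (simp add: l2_dist_def algebra_simps)
  also have "\<dots> \<le> l2_dist \<phi> \<phi>' + l2_dist \<psi>' \<psi>"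
    unfolding l2_dist_def using l2 l2' by (intro l2_norm_triangle l2_diff) auto
  also have "\<dots> < e" using * by (simp add: l2_dist_commute)
  finally show "\<exists>\<phi>'\<in>F. l2_dist (\<lambda>x. \<phi> x - \<psi> x) \<phi>' < e"
    using assms(2)[OF *(1,3)] by auto
qed

section \<open>Projection-valued measures\<close>

locale pvm =
  fixes E :: "real set \<Rightarrow> ('a \<Rightarrow> complex) \<Rightarrow> ('a \<Rightarrow> complex)"
  assumes pvm: "proj_valued_measure E"
begin

lemma E_l2: "B \<in> sets borel \<Longrightarrow> \<psi> \<in> l2 \<Longrightarrow> E B \<psi> \<in> l2"
  and E_idem: "B \<in> sets borel \<Longrightarrow> \<psi> \<in> l2 \<Longrightarrow> E B (E B \<psi>) = E B \<psi>"
  and E_lin: "B \<in> sets borel \<Longrightarrow> \<phi> \<in> l2 \<Longrightarrow> \<psi> \<in> l2 \<Longrightarrow>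
      E B (\<lambda>x. \<phi> x + c * \<psi> x) = (\<lambda>x. E B \<phi> x + c * E B \<psi> x)"
  and E_sym: "B \<in> sets borel \<Longrightarrow> \<phi> \<in> l2 \<Longrightarrow> \<psi> \<in> l2 \<Longrightarrow>
      l2_inner \<phi> (E B \<psi>) = l2_inner (E B \<phi>) \<psi>"
  and E_UNIV: "\<psi> \<in> l2 \<Longrightarrow> E UNIV \<psi> = \<psi>"
  and E_sigma: "range A \<subseteq> sets borel \<Longrightarrow> disjoint_family A \<Longrightarrow> \<psi> \<in> l2 \<Longrightarrow>
      (\<lambda>n. l2_dist (E (\<Union>i. A i) \<psi>) (\<lambda>x. \<Sum>i<n. E (A i) \<psi> x)) \<longlonglongrightarrow> 0"
  using pvm unfolding proj_valued_measure_def by blast+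

lemma E_zero: "B \<in> sets borel \<Longrightarrow> E B (\<lambda>x. 0) = (\<lambda>x. 0)"
  using E_lin[OF _ l2_zero l2_zero, of B 1] by (simp add: fun_eq_iff)

lemma E_scale: "B \<in> sets borel \<Longrightarrow> \<psi> \<in> l2 \<Longrightarrow> E B (\<lambda>x. c * \<psi> x) = (\<lambda>x. c * E B \<psi> x)"
  using E_lin[OF _ l2_zero, of B \<psi> c] by (simp add: E_zero)

lemma E_add: "B \<in> sets borel \<Longrightarrow> \<phi> \<in> l2 \<Longrightarrow> \<psi> \<in> l2 \<Longrightarrow>
    E B (\<lambda>x. \<phi> x + \<psi> x) = (\<lambda>x. E B \<phi> x + E B \<psi> x)"
  using E_lin[of B \<phi> \<psi> 1] by simp

lemma E_sum:
  assumes "B \<in> sets borel" "finite I" "\<And>i. i \<in> I \<Longrightarrow> f i \<in> l2"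
  shows "E B (\<lambda>x. \<Sum>i\<in>I. f i x) = (\<lambda>x. \<Sum>i\<in>I. E B (f i) x)"
  using assms(2,1,3)
proof (induction I rule: finite_induct)
  case (insert i I)
  have "(\<lambda>x. \<Sum>i\<in>I. f i x) \<in> l2" using insert by (intro l2_sum) auto
  thus ?case using insert E_add[of B "f i" "\<lambda>x. \<Sum>i\<in>I. f i x"] by simp
qed (simp add: E_zero)

lemma inner_E: "B \<in> sets borel \<Longrightarrow> \<psi> \<in> l2 \<Longrightarrow>
    l2_inner \<psi> (E B \<psi>) = complex_of_real ((l2_norm (E B \<psi>))\<^sup>2)"
  unfolding l2_inner_self[symmetric] using E_sym[of B \<psi> "E B \<psi>"] by (simp add: E_idem E_l2)

text \<open>Countable additivity for the constant family of empty sets says that n copies of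
  \<open>E {} \<psi>\<close> converge to one copy. The distance is (n - 1) times the norm, which can
  tend to 0 only if the norm is 0.\<close>

lemma E_empty:
  assumes "\<psi> \<in> l2"
  shows "E {} \<psi> = (\<lambda>x. 0)"
proof -
  have v: "E {} \<psi> \<in> l2" using assms by (intro E_l2) auto
  have lim: "(\<lambda>n. l2_dist (E {} \<psi>) (\<lambda>x. \<Sum>i<n. E {} \<psi> x)) \<longlonglongrightarrow> 0"
    using E_sigma[of "\<lambda>_. {}" \<psi>] assms by (simp add: disjoint_family_on_def)
  have "l2_norm (E {} \<psi>) \<le> 0"
  proof (rule LIMSEQ_le_const[OF lim])
    have "l2_norm (E {} \<psi>) \<le> l2_dist (E {} \<psi>) (\<lambda>x. \<Sum>i<n. E {} \<psi> x)" if "n \<ge> 2" for n :: nat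
    proof -
      have "l2_dist (E {} \<psi>) (\<lambda>x. \<Sum>i<n. E {} \<psi> x) = l2_norm (\<lambda>x. (1 - of_nat n) * E {} \<psi> x)"
        by (simp add: l2_dist_def algebra_simps)
      also have "\<dots> = cmod (1 - of_nat n) * l2_norm (E {} \<psi>)" by (rule l2_norm_scale)
      also have "cmod (1 - of_nat n) = cmod (of_real (1 - real n))" by simp
      also have "\<dots> = real n - 1" using that by (subst norm_of_real) simp
      finally show ?thesis using that mult_right_mono[of 1 "real n - 1" "l2_norm (E {} \<psi>)"] by simp
    qed
    thus "\<exists>N::nat. \<forall>n\<ge>N. l2_norm (E {} \<psi>) \<le> l2_dist (E {} \<psi>) (\<lambda>x. \<Sum>i<n. E {} \<psi> x)"
      by blast
  qed
  thus ?thesis using l2_norm_eq_0[OF v] l2_norm_nonneg[of "E {} \<psi>"] by (simp add: order_antisym)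
qed

lemma E_Un:
  assumes "A \<in> sets borel" "B \<in> sets borel" "A \<inter> B = {}" "\<psi> \<in> l2"
  shows "E (A \<union> B) \<psi> = (\<lambda>x. E A \<psi> x + E B \<psi> x)"
proof -
  define F where "F i = (if i = 0 then A else if i = Suc 0 then B else {})" for i :: nat
  have F: "range F \<subseteq> sets borel" "disjoint_family F" "(\<Union>i. F i) = A \<union> B"
    using assms unfolding F_def disjoint_family_on_def by (auto split: if_splits)
  have l2: "E (A \<union> B) \<psi> \<in> l2" "E A \<psi> \<in> l2" "E B \<psi> \<in> l2" using assms by (auto intro!: E_l2)
  define d where "d = l2_dist (E (A \<union> B) \<psi>) (\<lambda>x. E A \<psi> x + E B \<psi> x)"
  have "(\<Sum>i<n. E (F i) \<psi> x) = E A \<psi> x + E B \<psi> x" if "n \<ge> 2" for n x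
  proof -
    have "(\<Sum>i<n. E (F i) \<psi> x) = (\<Sum>i<2. E (F i) \<psi> x)"
      using that assms(4) by (intro sum.mono_neutral_right) (auto simp: F_def E_empty)
    thus ?thesis by (simp add: F_def numeral_2_eq_2)
  qed
  hence "\<forall>\<^sub>F n in sequentially. l2_dist (E (\<Union>i. F i) \<psi>) (\<lambda>x. \<Sum>i<n. E (F i) \<psi> x) = d"
    unfolding F(3) d_def eventually_sequentially by (intro exI[of _ 2]) auto
  with E_sigma[OF F(1,2) assms(4)] have "(\<lambda>n. d) \<longlonglongrightarrow> (0::real)"
    using tendsto_cong by fastforce
  hence "d = 0" using LIMSEQ_const_iff by blast
  hence "(\<lambda>x. E (A \<union> B) \<psi> x - (E A \<psi> x + E B \<psi> x)) = (\<lambda>x. 0)"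
    using l2 unfolding d_def l2_dist_def by (intro l2_norm_eq_0 l2_diff l2_add) auto
  thus ?thesis by (auto simp: fun_eq_iff)
qed

lemma E_UN_finite:
  assumes "finite I" "\<And>i. i \<in> I \<Longrightarrow> A i \<in> sets borel" "disjoint_family_on A I" "\<psi> \<in> l2"
  shows "E (\<Union>i\<in>I. A i) \<psi> = (\<lambda>x. \<Sum>i\<in>I. E (A i) \<psi> x)"
  using assms
proof (induction I rule: finite_induct)
  case (insert i I)
  have "E (A i \<union> (\<Union>i\<in>I. A i)) \<psi> = (\<lambda>x. E (A i) \<psi> x + E (\<Union>i\<in>I. A i) \<psi> x)"
    using insert by (intro E_Un) (auto simp: disjoint_family_on_def)
  moreover have "disjoint_family_on A I"
    using insert.prems(2) by (auto simp: disjoint_family_on_def)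
  ultimately show ?case using insert by simp
qed (simp add: E_empty)

text \<open>Pairing the norm convergence with \<psi> turns projections into squared norms; this is
  the countable additivity that makes \<open>diag_measure\<close> a measure.\<close>

lemma sums_norm_E:
  assumes "range A \<subseteq> sets borel" "disjoint_family A" "\<psi> \<in> l2"
  shows "(\<lambda>n. (l2_norm (E (A n) \<psi>))\<^sup>2) sums (l2_norm (E (\<Union>i. A i) \<psi>))\<^sup>2"
proof -
  have B: "A n \<in> sets borel" "(\<Union>i. A i) \<in> sets borel" for n using assms(1) by auto
  have "(\<lambda>n. l2_inner \<psi> (\<lambda>x. \<Sum>i<n. E (A i) \<psi> x)) \<longlonglongrightarrow> l2_inner \<psi> (E (\<Union>i. A i) \<psi>)"
    using assms B by (intro l2_inner_tendsto E_sigma l2_sum E_l2) auto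
  moreover have "l2_inner \<psi> (\<lambda>x. \<Sum>i<n. E (A i) \<psi> x) =
      complex_of_real (\<Sum>i<n. (l2_norm (E (A i) \<psi>))\<^sup>2)" for n
    using assms B by (subst l2_inner_sum_right) (auto intro: E_l2 simp: inner_E)
  ultimately have "(\<lambda>n. complex_of_real (\<Sum>i<n. (l2_norm (E (A i) \<psi>))\<^sup>2)) \<longlonglongrightarrow>
      complex_of_real ((l2_norm (E (\<Union>i. A i) \<psi>))\<^sup>2)"
    using inner_E[OF B(2) assms(3)] by simp
  thus ?thesis unfolding sums_def tendsto_of_real_iff .
qed

lemma space_diag_measure [simp]: "space (diag_measure E \<psi>) = UNIV"
  and sets_diag_measure [simp, measurable_cong]: "sets (diag_measure E \<psi>) = sets borel"
  unfolding diag_measure_def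
  by (auto simp: sets.sigma_sets_eq[of borel, simplified])

lemma emeasure_diag:
  assumes "\<psi> \<in> l2" "B \<in> sets borel"
  shows "emeasure (diag_measure E \<psi>) B = ennreal ((l2_norm (E B \<psi>))\<^sup>2)"
proof -
  have "emeasure (diag_measure E \<psi>) B = ennreal (Re (l2_inner \<psi> (E B \<psi>)))"
  proof (rule emeasure_measure_of[OF diag_measure_def])
    show "positive (sets (diag_measure E \<psi>)) (\<lambda>B. ennreal (Re (l2_inner \<psi> (E B \<psi>))))"
      using assms by (auto simp: positive_def E_empty)
    show "countably_additive (sets (diag_measure E \<psi>)) (\<lambda>B. ennreal (Re (l2_inner \<psi> (E B \<psi>))))"
    proof (rule countably_additiveI)
      fix A :: "nat \<Rightarrow> real set"
      assume A: "range A \<subseteq> sets (diag_measure E \<psi>)" "disjoint_family A"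
        "(\<Union>i. A i) \<in> sets (diag_measure E \<psi>)"
      hence B: "A n \<in> sets borel" "(\<Union>i. A i) \<in> sets borel" for n by auto
      show "(\<Sum>i. ennreal (Re (l2_inner \<psi> (E (A i) \<psi>)))) = ennreal (Re (l2_inner \<psi> (E (\<Union> (range A)) \<psi>)))"
        using sums_norm_E[of A \<psi>] A assms(1) B
        by (intro suminf_ennreal_eq) (simp_all add: inner_E del: of_real_power)
    qed
  qed (use assms in auto)
  thus ?thesis using assms by (simp add: inner_E del: of_real_power)
qed

lemma finite_diag: "\<psi> \<in> l2 \<Longrightarrow> finite_measure (diag_measure E \<psi>)"
  by (rule finite_measureI) (simp add: emeasure_diag)

lemma measure_diag:
  "\<psi> \<in> l2 \<Longrightarrow> B \<in> sets borel \<Longrightarrow> measure (diag_measure E \<psi>) B = (l2_norm (E B \<psi>))\<^sup>2"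
  by (simp add: measure_def emeasure_diag)

text \<open>Orthogonality of the ranges has to be derived from additivity. For \<phi> =
  \<open>E A \<psi>\<close> the measure \<open>diag_measure E \<phi>\<close> has its whole mass, the
  squared norm of \<phi>, already on A, so nothing is left for B.\<close>

lemma E_disjoint:
  assumes A: "A \<in> sets borel" and B: "B \<in> sets borel" and "A \<inter> B = {}" and \<psi>: "\<psi> \<in> l2"
  shows "E B (E A \<psi>) = (\<lambda>x. 0)"
proof -
  define \<phi> where "\<phi> = E A \<psi>"
  have \<phi>: "\<phi> \<in> l2" "E A \<phi> = \<phi>" unfolding \<phi>_def using A \<psi> by (auto simp: E_l2 E_idem)
  interpret finite_measure "diag_measure E \<phi>" by (rule finite_diag[OF \<phi>(1)])
  have "measure (diag_measure E \<phi>) A + measure (diag_measure E \<phi>) B = measure (diag_measure E \<phi>) (A \<union> B)"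
    using assms by (intro finite_measure_Union[symmetric]) auto
  also have "\<dots> \<le> measure (diag_measure E \<phi>) UNIV"
    by (intro finite_measure_mono) auto
  finally have "(l2_norm (E B \<phi>))\<^sup>2 \<le> 0"
    using A B \<phi> by (simp add: measure_diag E_UNIV)
  thus ?thesis using l2_norm_eq_0[OF E_l2[OF B \<phi>(1)]] by (simp add: \<phi>_def)
qed

lemma norm_minus_E:
  assumes "A \<in> sets borel" "\<psi> \<in> l2"
  shows "(l2_norm (\<lambda>x. \<psi> x - E A \<psi> x))\<^sup>2 = (l2_norm \<psi>)\<^sup>2 - (l2_norm (E A \<psi>))\<^sup>2"
proof -
  have "Re (l2_inner (\<lambda>x. \<psi> x - E A \<psi> x) (\<lambda>x. \<psi> x - E A \<psi> x))
      = Re (l2_inner \<psi> \<psi>) - Re (l2_inner \<psi> (E A \<psi>)) - Re (l2_inner (E A \<psi>) \<psi>) + Re (l2_inner (E A \<psi>) (E A \<psi>))"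
    using assms by (simp add: l2_inner_diff_left l2_inner_diff_right l2_diff E_l2)
  moreover have "l2_inner (E A \<psi>) \<psi> = l2_inner \<psi> (E A \<psi>)"
    using E_sym assms by simp
  ultimately show ?thesis
    unfolding l2_inner_self inner_E[OF assms] by simp
qed

lemma E_mono:
  assumes A: "A \<in> sets borel" and B: "B \<in> sets borel" and "B \<subseteq> A" and \<psi>: "\<psi> \<in> l2"
  shows "E A (E B \<psi>) = E B \<psi>"
proof -
  have "E B \<psi> = E UNIV (E B \<psi>)" using B \<psi> by (simp add: E_UNIV E_l2)
  also have "\<dots> = E (A \<union> - A) (E B \<psi>)" by simp
  also have "\<dots> = (\<lambda>x. E A (E B \<psi>) x + E (- A) (E B \<psi>) x)"
    using A B \<psi> by (intro E_Un E_l2) auto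
  also have "E (- A) (E B \<psi>) = (\<lambda>x. 0)"
    using assms by (intro E_disjoint) auto
  finally show ?thesis by - (drule sym, simp)
qed

end

section \<open>Riemann sums of a spectral resolution and approximate resolvents\<close>

locale spectral_op = pvm E for E :: "real set \<Rightarrow> ('a \<Rightarrow> complex) \<Rightarrow> ('a \<Rightarrow> complex)" +
  fixes h :: "('a \<Rightarrow> complex) \<Rightarrow> ('a \<Rightarrow> complex)" and T :: "'a l2_op"
  assumes T_eq: "T = {(\<phi>, h \<phi>) | \<phi>. \<phi> \<in> l2 \<and> h \<phi> \<in> l2}"
    and h_lin: "\<And>\<phi> \<psi> c. h (\<lambda>x. \<phi> x + c * \<psi> x) = (\<lambda>x. h \<phi> x + c * h \<psi> x)"
    and h_sym: "\<And>\<phi> \<psi>. \<phi> \<in> l2 \<Longrightarrow> h \<phi> \<in> l2 \<Longrightarrow> \<psi> \<in> l2 \<Longrightarrow> h \<psi> \<in> l2 \<Longrightarrow>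
      l2_inner \<phi> (h \<psi>) = l2_inner (h \<phi>) \<psi>"
    and res: "spectral_resolution T E"
begin

lemma h_l2:
  assumes "\<phi> \<in> l2" "integrable (diag_measure E \<phi>) (\<lambda>t. t\<^sup>2)"
  shows "h \<phi> \<in> l2"
proof -
  have "\<phi> \<in> Domain T" using res assms unfolding spectral_resolution_def by simp
  thus ?thesis unfolding T_eq by auto
qed

lemma inner_h:
  assumes "\<phi> \<in> l2" "h \<phi> \<in> l2"
  shows "l2_inner \<phi> (h \<phi>) = complex_of_real (\<integral>t. t \<partial>diag_measure E \<phi>)"
proof -
  have "(\<phi>, h \<phi>) \<in> T" using assms unfolding T_eq by auto
  thus ?thesis using res unfolding spectral_resolution_def by blast
qed

definition cell :: "nat \<Rightarrow> int \<Rightarrow> real set" where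
  "cell k j = {t. \<lfloor>real k * t\<rfloor> = j}"

definition block :: "nat \<Rightarrow> int \<Rightarrow> real set" where
  "block k L = {t. - L \<le> \<lfloor>real k * t\<rfloor> \<and> \<lfloor>real k * t\<rfloor> < L}"

text \<open>The Riemann sum of the integral of t against E over \<open>block k L\<close>, taken at
  the left end points of cells of length 1 / k.\<close>

definition grid_op :: "nat \<Rightarrow> int \<Rightarrow> ('a \<Rightarrow> complex) \<Rightarrow> ('a \<Rightarrow> complex)" where
  "grid_op k L \<phi> = (\<lambda>x. \<Sum>j\<in>{-L..<L}. complex_of_real (of_int j / real k) * E (cell k j) \<phi> x)"

lemma cell_borel [measurable, simp]: "cell k j \<in> sets borel"
  unfolding cell_def by measurable

lemma block_borel [measurable, simp]: "block k L \<in> sets borel"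
  unfolding block_def by measurable

lemma block_eq: "block k L = (\<Union>j\<in>{-L..<L}. cell k j)"
  by (auto simp: block_def cell_def)

lemma cell_disjoint: "disjoint_family_on (cell k) I"
  by (auto simp: disjoint_family_on_def cell_def)

lemma cell_inter: "i \<noteq> j \<Longrightarrow> cell k i \<inter> cell k j = {}"
  by (auto simp: cell_def)

lemma E_block: "\<psi> \<in> l2 \<Longrightarrow> E (block k L) \<psi> = (\<lambda>x. \<Sum>j\<in>{-L..<L}. E (cell k j) \<psi> x)"
  unfolding block_eq by (rule E_UN_finite) (auto simp: cell_disjoint)

lemma grid_op_l2: "\<phi> \<in> l2 \<Longrightarrow> grid_op k L \<phi> \<in> l2"
  unfolding grid_op_def by (intro l2_sum l2_scale E_l2) auto

lemma grid_op_lin: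
  assumes "\<phi> \<in> l2" "\<psi> \<in> l2"
  shows "grid_op k L (\<lambda>x. \<phi> x + c * \<psi> x) = (\<lambda>x. grid_op k L \<phi> x + c * grid_op k L \<psi> x)"
  unfolding grid_op_def using assms
  by (simp add: E_lin algebra_simps sum.distrib sum_distrib_left)

lemma inner_grid_op:
  assumes "\<phi> \<in> l2" "\<psi> \<in> l2"
  shows "l2_inner \<phi> (grid_op k L \<psi>) =
    (\<Sum>j\<in>{-L..<L}. complex_of_real (of_int j / real k) * l2_inner \<phi> (E (cell k j) \<psi>))"
  unfolding grid_op_def using assms
  by (subst l2_inner_sum_right)
    (auto intro!: l2_scale E_l2 simp: l2_inner_scale_right simp del: of_real_divide)

lemma grid_op_sym:
  assumes "\<phi> \<in> l2" "\<psi> \<in> l2"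
  shows "l2_inner \<phi> (grid_op k L \<psi>) = cnj (l2_inner \<psi> (grid_op k L \<phi>))"
proof -
  have "l2_inner \<phi> (E (cell k j) \<psi>) = cnj (l2_inner \<psi> (E (cell k j) \<phi>))" for j
    using E_sym[of "cell k j" \<phi> \<psi>] l2_inner_commute[of "E (cell k j) \<phi>" \<psi>] assms by simp
  thus ?thesis using assms by (simp add: inner_grid_op)
qed

text \<open>On a bounded spectral block the diagonal measure has bounded support, so the second
  moment is finite and \<phi> lies in the domain. There t differs from the left end point of its
  cell by at most 1 / k, which bounds the difference of the two quadratic forms.\<close>

lemma block_vector:
  assumes k: "k > 0" and \<phi>: "\<phi> \<in> l2" and inv: "E (block k L) \<phi> = \<phi>"
  shows "h \<phi> \<in> l2"
    and "\<bar>Re (l2_inner \<phi> (h \<phi>)) - Re (l2_inner \<phi> (grid_op k L \<phi>))\<bar> \<le> (l2_norm \<phi>)\<^sup>2 / real k"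
proof -
  let ?m = "diag_measure E \<phi>"
  interpret finite_measure ?m by (rule finite_diag[OF \<phi>])
  have "E (- block k L) \<phi> = (\<lambda>x. 0)"
    using E_disjoint[of "block k L" "- block k L" \<phi>] \<phi> by (simp add: inv)
  hence "emeasure ?m (- block k L) = 0"
    using emeasure_diag[OF \<phi>, of "- block k L"] by (simp add: l2_norm_def)
  hence AE: "AE t in ?m. t \<in> block k L"
    by (intro AE_I[of _ _ "- block k L"]) auto
  have bnd: "\<bar>t\<bar> \<le> \<bar>real_of_int L\<bar> + 1" if "t \<in> block k L" for t
  proof -
    have *: "real_of_int (- L) \<le> real k * t" "real k * t < L"
      using that unfolding block_def by (auto simp: le_floor_iff floor_less_iff)
    hence "\<bar>real k * t\<bar> \<le> \<bar>real_of_int L\<bar>" by auto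
    moreover have "\<bar>t\<bar> \<le> \<bar>real k * t\<bar>"
      using k mult_right_mono[of 1 "real k" "\<bar>t\<bar>"] by (simp add: abs_mult)
    ultimately show ?thesis by linarith
  qed
  have int2: "integrable ?m (\<lambda>t. t\<^sup>2)"
  proof (rule integrable_const_bound)
    show "AE t in ?m. norm (t\<^sup>2) \<le> (\<bar>real_of_int L\<bar> + 1)\<^sup>2"
      using AE
    proof eventually_elim
      case (elim t)
      show ?case using power_mono[OF bnd[OF elim], of 2] by simp
    qed
  qed simp
  show hl2: "h \<phi> \<in> l2" by (rule h_l2[OF \<phi> int2])
  have int1: "integrable ?m (\<lambda>t. t)"
    by (rule integrable_const_bound[where B = "\<bar>real_of_int L\<bar> + 1"])
      (use AE bnd in \<open>auto elim!: eventually_mono\<close>)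
  have grid: "Re (l2_inner \<phi> (grid_op k L \<phi>)) = (\<Sum>j\<in>{-L..<L}. of_int j / real k * measure ?m (cell k j))"
    using \<phi> by (simp add: inner_grid_op inner_E measure_diag del: of_real_power)
  define s where "s t = (\<Sum>j\<in>{-L..<L}. of_int j / real k * indicator (cell k j) t)" for t :: real
  have s_int: "integrable ?m s"
    unfolding s_def by (intro Bochner_Integration.integrable_sum integrable_mult_right integrable_real_indicator)
      (auto simp: emeasure_eq_measure)
  have "Re (l2_inner \<phi> (grid_op k L \<phi>)) = (\<integral>t. s t \<partial>?m)"
    unfolding s_def grid
    by (subst Bochner_Integration.integral_sum) (auto simp: emeasure_eq_measure)
  hence "Re (l2_inner \<phi> (h \<phi>)) - Re (l2_inner \<phi> (grid_op k L \<phi>)) = (\<integral>t. t - s t \<partial>?m)"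
    using inner_h[OF \<phi> hl2] int1 s_int by simp
  also have "\<bar>\<dots>\<bar> \<le> (\<integral>t. \<bar>t - s t\<bar> \<partial>?m)" by (rule integral_abs_bound)
  also have "\<dots> \<le> (\<integral>t. 1 / real k \<partial>?m)"
  proof (rule integral_mono_AE)
    show "AE t in ?m. \<bar>t - s t\<bar> \<le> 1 / real k"
      using AE
    proof eventually_elim
      case (elim t)
      have "s t = (\<Sum>j\<in>{-L..<L}. if j = \<lfloor>real k * t\<rfloor> then of_int j / real k else 0)"
        unfolding s_def by (rule sum.cong) (auto simp: cell_def indicator_def)
      also have "\<dots> = of_int \<lfloor>real k * t\<rfloor> / real k"
        using elim by (simp add: block_def)
      finally have "t - s t = (real k * t - of_int \<lfloor>real k * t\<rfloor>) / real k"
        using k by (simp add: field_simps)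
      moreover have "\<bar>real k * t - of_int \<lfloor>real k * t\<rfloor>\<bar> \<le> 1" by linarith
      ultimately show ?case using k by (simp add: abs_divide divide_right_mono)
    qed
  qed (use int1 s_int in auto)
  also have "\<dots> = (l2_norm \<phi>)\<^sup>2 / real k"
    using measure_diag[OF \<phi>, of UNIV] \<phi> by (simp add: E_UNIV)
  finally show "\<bar>Re (l2_inner \<phi> (h \<phi>)) - Re (l2_inner \<phi> (grid_op k L \<phi>))\<bar> \<le> (l2_norm \<phi>)\<^sup>2 / real k" .
qed

text \<open>The spectral resolution describes h only through its quadratic form, so a mixed pairing
  is recovered by polarization with c = 1 and c = -1. The real part is enough, since the test vector
  used in \<open>block_error\<close> makes the pairing real.\<close>

lemma block_polarized:
  assumes k: "k > 0" and \<phi>: "\<phi> \<in> l2" "E (block k L) \<phi> = \<phi>" and \<chi>: "\<chi> \<in> l2" "E (block k L) \<chi> = \<chi>"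
  shows "2 * Re (l2_inner \<chi> (\<lambda>x. h \<phi> x - grid_op k L \<phi> x)) \<le> ((l2_norm \<chi>)\<^sup>2 + (l2_norm \<phi>)\<^sup>2) / real k"
proof -
  note hl2 = block_vector(1)[OF k \<phi>] block_vector(1)[OF k \<chi>]
  define q where "q c = Re (l2_inner (\<lambda>x. \<chi> x + c * \<phi> x) (h (\<lambda>x. \<chi> x + c * \<phi> x)))
      - Re (l2_inner (\<lambda>x. \<chi> x + c * \<phi> x) (grid_op k L (\<lambda>x. \<chi> x + c * \<phi> x)))" for c
  have nrm: "\<bar>q c\<bar> \<le> ((l2_norm \<chi>)\<^sup>2 + 2 * Re (c * l2_inner \<chi> \<phi>) + (cmod c)\<^sup>2 * (l2_norm \<phi>)\<^sup>2) / real k" for c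
  proof -
    have "\<bar>q c\<bar> \<le> (l2_norm (\<lambda>x. \<chi> x + c * \<phi> x))\<^sup>2 / real k"
      unfolding q_def using \<phi> \<chi> by (intro block_vector(2) k) (auto simp: l2_add_scaled E_lin)
    also have "(l2_norm (\<lambda>x. \<chi> x + c * \<phi> x))\<^sup>2 = (l2_norm \<chi>)\<^sup>2 + 2 * Re (c * l2_inner \<chi> \<phi>) + (cmod c)\<^sup>2 * (l2_norm \<phi>)\<^sup>2"
      using l2_norm_add_sq[OF \<chi>(1) l2_scale[OF \<phi>(1)], of c]
      by (simp add: l2_inner_scale_right l2_norm_scale power_mult_distrib)
    finally show ?thesis .
  qed
  define e where "e = (\<lambda>x. h \<phi> x - grid_op k L \<phi> x)"
  have sym: "l2_inner \<phi> (h \<chi>) = cnj (l2_inner \<chi> (h \<phi>))"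
    using h_sym[OF \<phi>(1) hl2(1) \<chi>(1) hl2(2)] l2_inner_commute[of "h \<phi>" \<chi>] by simp
  have qc: "q c = Re (l2_inner \<chi> (h \<chi>)) + 2 * Re (c * l2_inner \<chi> (h \<phi>)) + (cmod c)\<^sup>2 * Re (l2_inner \<phi> (h \<phi>))
     - (Re (l2_inner \<chi> (grid_op k L \<chi>)) + 2 * Re (c * l2_inner \<chi> (grid_op k L \<phi>))
        + (cmod c)\<^sup>2 * Re (l2_inner \<phi> (grid_op k L \<phi>)))" for c
  proof -
    have gen: "Re (l2_inner (\<lambda>x. \<chi> x + c * \<phi> x) (\<lambda>x. f x + c * g x))
        = Re (l2_inner \<chi> f) + 2 * Re (c * l2_inner \<chi> g) + (cmod c)\<^sup>2 * Re (l2_inner \<phi> g)"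
      if "f \<in> l2" "g \<in> l2" "l2_inner \<phi> f = cnj (l2_inner \<chi> g)" for f g
    proof -
      have "l2_inner (\<lambda>x. \<chi> x + c * \<phi> x) (\<lambda>x. f x + c * g x)
          = l2_inner \<chi> f + c * l2_inner \<chi> g + cnj (c * l2_inner \<chi> g) + (c * cnj c) * l2_inner \<phi> g"
        using that \<phi> \<chi> by (simp add: l2_inner_add_left l2_inner_add_right l2_add_scaled algebra_simps)
      thus ?thesis
        by (simp add: complex_norm_square[symmetric] del: of_real_power)
    qed
    show ?thesis unfolding q_def h_lin
      using gen[OF hl2(2,1) sym] gen[OF grid_op_l2[OF \<chi>(1)] grid_op_l2[OF \<phi>(1)] grid_op_sym[OF \<phi>(1) \<chi>(1), of k L]]
      by (simp add: grid_op_lin \<phi> \<chi>)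
  qed
  have "l2_inner \<chi> e = l2_inner \<chi> (h \<phi>) - l2_inner \<chi> (grid_op k L \<phi>)"
    unfolding e_def using \<phi> \<chi> hl2 by (intro l2_inner_diff_right grid_op_l2)
  hence "4 * Re (l2_inner \<chi> e) = q 1 - q (-1)"
    unfolding qc by simp
  also have "\<dots> \<le> 2 * ((l2_norm \<chi>)\<^sup>2 + (l2_norm \<phi>)\<^sup>2) / real k"
  proof -
    have "q 1 - q (-1) \<le> \<bar>q 1\<bar> + \<bar>q (-1)\<bar>" by linarith
    also have "\<dots> \<le> ((l2_norm \<chi>)\<^sup>2 + 2 * Re (1 * l2_inner \<chi> \<phi>) + (cmod 1)\<^sup>2 * (l2_norm \<phi>)\<^sup>2) / real k
      + ((l2_norm \<chi>)\<^sup>2 + 2 * Re ((-1) * l2_inner \<chi> \<phi>) + (cmod (-1))\<^sup>2 * (l2_norm \<phi>)\<^sup>2) / real k"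
      by (intro add_mono nrm)
    also have "\<dots> = 2 * ((l2_norm \<chi>)\<^sup>2 + (l2_norm \<phi>)\<^sup>2) / real k"
      by (simp add: add_divide_distrib diff_divide_distrib)
    finally show ?thesis .
  qed
  finally show ?thesis unfolding e_def by (simp add: add_divide_distrib)
qed

text \<open>The form bound becomes a norm bound by testing the error e against its own projection
  \<chi> to a block. As e is not known to lie in a bounded block, \<chi> is taken in a larger block
  N, to which \<phi> still belongs and on which the Riemann sum of \<phi> is unchanged; then N
  grows.\<close>

lemma block_error:
  assumes k: "k > 0" and \<phi>: "\<phi> \<in> l2" "E (block k L) \<phi> = \<phi>"
  shows "(l2_norm (\<lambda>x. h \<phi> x - grid_op k L \<phi> x))\<^sup>2 \<le> (l2_norm \<phi>)\<^sup>2 / real k"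
proof -
  define e where "e = (\<lambda>x. h \<phi> x - grid_op k L \<phi> x)"
  have e: "e \<in> l2" unfolding e_def
    using \<phi> by (intro l2_diff block_vector(1)[OF k] grid_op_l2)
  interpret finite_measure "diag_measure E e" by (rule finite_diag[OF e])
  have bound: "(l2_norm (E (block k N) e))\<^sup>2 \<le> (l2_norm \<phi>)\<^sup>2 / real k" if "N \<ge> L" for N
  proof -
    define \<chi> where "\<chi> = E (block k N) e"
    have \<chi>: "\<chi> \<in> l2" "E (block k N) \<chi> = \<chi>" using e by (auto simp: \<chi>_def E_l2 E_idem)
    have sub: "block k L \<subseteq> block k N" using that by (auto simp: block_def)
    have \<phi>N: "E (block k N) \<phi> = \<phi>"
      using E_mono[of "block k N" "block k L" \<phi>] sub \<phi> by simp
    have "E (cell k j) \<phi> = (\<lambda>x. 0)" if "j \<notin> {-L..<L}" for j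
      using E_disjoint[of "block k L" "cell k j" \<phi>] \<phi> that by (auto simp: block_def cell_def)
    hence "grid_op k N \<phi> = grid_op k L \<phi>"
      unfolding grid_op_def using that
      by (intro ext sum.mono_neutral_right) auto
    hence "2 * Re (l2_inner \<chi> e) \<le> ((l2_norm \<chi>)\<^sup>2 + (l2_norm \<phi>)\<^sup>2) / real k"
      using block_polarized[OF k \<phi>(1) \<phi>N \<chi>] by (simp add: e_def)
    moreover have "l2_inner \<chi> e = complex_of_real ((l2_norm \<chi>)\<^sup>2)"
      using inner_E[OF block_borel[of k N] e] E_sym[of "block k N" e e] e unfolding \<chi>_def by simp
    ultimately have "2 * (l2_norm \<chi>)\<^sup>2 \<le> ((l2_norm \<chi>)\<^sup>2 + (l2_norm \<phi>)\<^sup>2) / real k" by simp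
    \<comment> \<open>This absorbs one of the two copies of the squared norm of \<chi> on the
      left-hand side.\<close>
    moreover have "(l2_norm \<chi>)\<^sup>2 / real k \<le> (l2_norm \<chi>)\<^sup>2"
      using k by (simp add: divide_le_eq mult_le_cancel_left1)
    ultimately show ?thesis unfolding \<chi>_def by (simp add: add_divide_distrib)
  qed
  have "(\<lambda>i. measure (diag_measure E e) (block k (int i))) \<longlonglongrightarrow> measure (diag_measure E e) (\<Union>i. block k (int i))"
    by (rule finite_Lim_measure_incseq) (auto simp: incseq_def block_def)
  moreover have "(\<Union>i. block k (int i)) = UNIV"
  proof -
    have "t \<in> block k (int (nat (\<bar>\<lfloor>real k * t\<rfloor>\<bar> + 1)))" for t by (auto simp: block_def)
    thus ?thesis by blast
  qed
  ultimately have "(\<lambda>i. (l2_norm (E (block k (int i)) e))\<^sup>2) \<longlonglongrightarrow> (l2_norm e)\<^sup>2"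
    using e by (simp add: measure_diag E_UNIV)
  thus ?thesis unfolding e_def[symmetric]
    by (rule LIMSEQ_le_const2) (auto intro!: exI[of _ "nat L"] bound)
qed

text \<open>The vectors \<psi> are Riemann sums of 1 / (t - z) against E applied to U and play the
  role of the resolvent vector. Each lies in a bounded block, hence in the domain, and h acts on it
  as the grid operator up to the error of \<open>block_error\<close>. The pairing with U is the
  integral of a step function against the diagonal measure, so dominated convergence gives its
  limit.\<close>

lemma approximate_resolvent:
  assumes z: "Im z > 0" and U: "U \<in> l2"
  obtains \<psi> where "\<And>k. \<psi> k \<in> l2" "\<And>k. h (\<psi> k) \<in> l2"
    "(\<lambda>k. l2_norm (\<lambda>x. h (\<psi> k) x - z * \<psi> k x - U x)) \<longlonglongrightarrow> 0"
    "(\<lambda>k. l2_inner U (\<psi> k)) \<longlonglongrightarrow> (\<integral>t. 1 / (complex_of_real t - z) \<partial>diag_measure E U)"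
proof -
  let ?m = "diag_measure E U"
  interpret finite_measure ?m by (rule finite_diag[OF U])
  define K :: "nat \<Rightarrow> nat" where "K n = Suc n" for n
  \<comment> \<open>K^2 cells of length 1 / K on either side of 0 cover [-K, K), so mesh and range
    improve together.\<close>
  define L where "L n = int (K n) ^ 2" for n
  define c where "c n j = 1 / (complex_of_real (of_int j / real (K n)) - z)" for n and j :: int
  define \<psi> where "\<psi> n = (\<lambda>x. \<Sum>j\<in>{- L n..<L n}. c n j * E (cell (K n) j) U x)" for n
  define I where "I n = {- L n..<L n}" for n
  have K: "K n > 0" for n by (simp add: K_def)
  have nz: "cmod (complex_of_real t - z) \<ge> Im z" "complex_of_real t - z \<noteq> 0" for t
  proof -
    show "cmod (complex_of_real t - z) \<ge> Im z"
      using abs_Im_le_cmod[of "complex_of_real t - z"] z by simp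
    thus "complex_of_real t - z \<noteq> 0" using z by auto
  qed
  have c_bound: "cmod (1 / (complex_of_real t - z)) \<le> 1 / Im z" for t
    using nz[of t] z by (simp add: norm_divide divide_simps)
  have Ec: "E (cell (K n) j) U \<in> l2" for n j using U by (auto intro: E_l2)
  have \<psi>l2: "\<psi> n \<in> l2" for n unfolding \<psi>_def by (intro l2_sum l2_scale Ec)
  have E\<psi>: "E (cell (K n) j) (\<psi> n) = (\<lambda>x. c n j * E (cell (K n) j) U x)" if "j \<in> I n" for n j
  proof -
    have "E (cell (K n) j) (\<psi> n) = (\<lambda>x. \<Sum>i\<in>I n. c n i * E (cell (K n) j) (E (cell (K n) i) U) x)"
      unfolding \<psi>_def I_def by (subst E_sum) (auto intro!: l2_scale Ec simp: E_scale Ec)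
    also have "\<dots> = (\<lambda>x. \<Sum>i\<in>I n. if i = j then c n i * E (cell (K n) i) U x else 0)"
      using U by (intro ext sum.cong) (auto simp: E_idem E_disjoint cell_inter)
    also have "\<dots> = (\<lambda>x. c n j * E (cell (K n) j) U x)"
      using that by (simp add: I_def)
    finally show ?thesis .
  qed
  have inv: "E (block (K n) (L n)) (\<psi> n) = \<psi> n" for n
    using E\<psi>[of _ n] by (subst E_block[OF \<psi>l2]) (simp add: I_def \<psi>_def)
  have cell_norm_sum: "(\<Sum>j\<in>I n. (l2_norm (E (cell (K n) j) \<phi>))\<^sup>2) = (l2_norm (E (block (K n) (L n)) \<phi>))\<^sup>2"
    if "\<phi> \<in> l2" for n \<phi>
  proof -
    interpret F: finite_measure "diag_measure E \<phi>" by (rule finite_diag[OF that])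
    have "measure (diag_measure E \<phi>) (\<Union>j\<in>I n. cell (K n) j) = (\<Sum>j\<in>I n. measure (diag_measure E \<phi>) (cell (K n) j))"
      by (rule F.finite_measure_finite_Union) (auto simp: I_def cell_disjoint)
    thus ?thesis using that by (simp add: measure_diag block_eq I_def)
  qed
  have block_le: "(l2_norm (E (block (K n) (L n)) U))\<^sup>2 \<le> (l2_norm U)\<^sup>2" for n
    using norm_minus_E[of "block (K n) (L n)" U] U
      zero_le_power2[of "l2_norm (\<lambda>x. U x - E (block (K n) (L n)) U x)"] by simp
  have \<psi>_norm: "(l2_norm (\<psi> n))\<^sup>2 \<le> (l2_norm U)\<^sup>2 / (Im z)\<^sup>2" for n
  proof -
    have "(l2_norm (\<psi> n))\<^sup>2 = (\<Sum>j\<in>I n. (l2_norm (E (cell (K n) j) (\<psi> n)))\<^sup>2)"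
      using cell_norm_sum[OF \<psi>l2, of n n] by (simp add: inv)
    also have "\<dots> = (\<Sum>j\<in>I n. (cmod (c n j))\<^sup>2 * (l2_norm (E (cell (K n) j) U))\<^sup>2)"
      by (intro sum.cong) (auto simp: E\<psi> l2_norm_scale power_mult_distrib)
    also have "\<dots> \<le> (\<Sum>j\<in>I n. (1 / Im z)\<^sup>2 * (l2_norm (E (cell (K n) j) U))\<^sup>2)"
      unfolding c_def by (intro sum_mono mult_right_mono power_mono c_bound) auto
    also have "\<dots> = (1 / Im z)\<^sup>2 * (l2_norm (E (block (K n) (L n)) U))\<^sup>2"
      using cell_norm_sum[OF U, of n] by (simp add: sum_distrib_left[symmetric])
    also have "\<dots> \<le> (1 / Im z)\<^sup>2 * (l2_norm U)\<^sup>2" by (intro mult_left_mono block_le) auto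
    finally show ?thesis by (simp add: power_divide)
  qed
  have hl2: "h (\<psi> n) \<in> l2" for n
    by (rule block_vector(1)[OF K \<psi>l2 inv])
  \<comment> \<open>The residual has two sources: the replacement of h by the Riemann sum, and the
    part of U outside the block. On the block itself the grid operator minus z cancels the
    coefficients \<open>c n j\<close> exactly.\<close>
  have resid: "l2_norm (\<lambda>x. h (\<psi> n) x - z * \<psi> n x - U x)
      \<le> sqrt ((l2_norm U)\<^sup>2 / (Im z)\<^sup>2 / real (K n)) +
        sqrt ((l2_norm U)\<^sup>2 - (l2_norm (E (block (K n) (L n)) U))\<^sup>2)" for n
  proof -
    define e where "e = (\<lambda>x. h (\<psi> n) x - grid_op (K n) (L n) (\<psi> n) x)"
    have e: "e \<in> l2" unfolding e_def by (intro l2_diff hl2 grid_op_l2 \<psi>l2)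
    have "grid_op (K n) (L n) (\<psi> n) x - z * \<psi> n x = E (block (K n) (L n)) U x" for x
    proof -
      have "grid_op (K n) (L n) (\<psi> n) x - z * \<psi> n x =
          (\<Sum>j\<in>I n. (complex_of_real (of_int j / real (K n)) - z) * (c n j * E (cell (K n) j) U x))"
      proof -
        have "grid_op (K n) (L n) (\<psi> n) x =
            (\<Sum>j\<in>I n. complex_of_real (of_int j / real (K n)) * (c n j * E (cell (K n) j) U x))"
          unfolding grid_op_def I_def[symmetric] by (intro sum.cong) (auto simp: E\<psi>)
        moreover have "z * \<psi> n x = (\<Sum>j\<in>I n. z * (c n j * E (cell (K n) j) U x))"
          unfolding \<psi>_def I_def[symmetric] by (simp add: sum_distrib_left)
        ultimately show ?thesis
          unfolding left_diff_distrib sum_subtractf by simp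
      qed
      also have "\<dots> = (\<Sum>j\<in>I n. E (cell (K n) j) U x)"
        unfolding c_def mult.assoc[symmetric]
        by (intro sum.cong) (use nz(2) in \<open>simp_all del: of_real_divide\<close>)
      finally show ?thesis using E_block[OF U] by (simp add: I_def)
    qed
    hence eq: "(\<lambda>x. h (\<psi> n) x - z * \<psi> n x - U x) = (\<lambda>x. e x + (-1) * (U x - E (block (K n) (L n)) U x))"
      by (auto simp: e_def fun_eq_iff algebra_simps)
    have "l2_norm (\<lambda>x. h (\<psi> n) x - z * \<psi> n x - U x)
        \<le> l2_norm e + l2_norm (\<lambda>x. (-1) * (U x - E (block (K n) (L n)) U x))"
      unfolding eq using U by (intro l2_norm_triangle e l2_scale l2_diff E_l2) auto
    also have "l2_norm (\<lambda>x. (-1) * (U x - E (block (K n) (L n)) U x)) =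
        sqrt ((l2_norm U)\<^sup>2 - (l2_norm (E (block (K n) (L n)) U))\<^sup>2)"
      using norm_minus_E[of "block (K n) (L n)" U] U
      by (subst l2_norm_scale) (simp add: real_sqrt_unique)
    also have "l2_norm e \<le> sqrt ((l2_norm U)\<^sup>2 / (Im z)\<^sup>2 / real (K n))"
    proof (rule real_le_rsqrt)
      have "(l2_norm e)\<^sup>2 \<le> (l2_norm (\<psi> n))\<^sup>2 / real (K n)"
        unfolding e_def by (rule block_error[OF K \<psi>l2 inv])
      also have "\<dots> \<le> (l2_norm U)\<^sup>2 / (Im z)\<^sup>2 / real (K n)"
        by (intro divide_right_mono \<psi>_norm) auto
      finally show "(l2_norm e)\<^sup>2 \<le> (l2_norm U)\<^sup>2 / (Im z)\<^sup>2 / real (K n)" .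
    qed
    finally show ?thesis by simp
  qed
  have floor_K: "(\<lambda>n. of_int \<lfloor>real (K n) * t\<rfloor> / real (K n)) \<longlonglongrightarrow> t" for t
  proof (rule LIM_zero_cancel, rule Lim_null_comparison)
    show "\<forall>\<^sub>F n in sequentially. norm (of_int \<lfloor>real (K n) * t\<rfloor> / real (K n) - t) \<le> 1 / real (K n)"
    proof (rule always_eventually, rule allI)
      fix n
      have "of_int \<lfloor>real (K n) * t\<rfloor> / real (K n) - t = (of_int \<lfloor>real (K n) * t\<rfloor> - real (K n) * t) / real (K n)"
        using K[of n] by (simp add: field_simps)
      moreover have "\<bar>of_int \<lfloor>real (K n) * t\<rfloor> - real (K n) * t\<bar> \<le> 1" by linarith
      ultimately show "norm (of_int \<lfloor>real (K n) * t\<rfloor> / real (K n) - t) \<le> 1 / real (K n)"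
        by (simp add: abs_divide divide_right_mono)
    qed
    show "(\<lambda>n. 1 / real (K n)) \<longlonglongrightarrow> 0" unfolding K_def by (rule LIMSEQ_Suc[OF lim_1_over_n])
  qed
  have in_block: "\<forall>\<^sub>F n in sequentially. t \<in> block (K n) (L n)" for t
  proof -
    obtain N :: nat where N: "\<bar>t\<bar> + 1 < real N" using reals_Archimedean2 by blast
    have "t \<in> block (K n) (L n)" if "n \<ge> N" for n
    proof -
      have "\<bar>t\<bar> < real (K n)" using N that by (simp add: K_def)
      hence "\<bar>real (K n) * t\<bar> < real (K n) * real (K n)"
        using K[of n] by (simp add: abs_mult)
      hence "- (real (K n) ^ 2) \<le> real (K n) * t" "real (K n) * t < real (K n) ^ 2"
        by (auto simp: power2_eq_square)
      thus ?thesis by (simp add: block_def L_def le_floor_iff floor_less_iff)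
    qed
    thus ?thesis unfolding eventually_sequentially by blast
  qed
  have block_incseq: "(\<lambda>n. measure ?m (block (K n) (L n))) \<longlonglongrightarrow> measure ?m UNIV"
  proof -
    have "(\<lambda>n. \<integral>t. indicator (block (K n) (L n)) t \<partial>?m) \<longlonglongrightarrow> (\<integral>t. (1::real) \<partial>?m)"
    proof (rule integral_dominated_convergence[where w = "\<lambda>_. 1" and s = "\<lambda>n. indicator (block (K n) (L n))"
          and f = "\<lambda>_. 1"])
      show "AE t in ?m. (\<lambda>n. indicator (block (K n) (L n)) t) \<longlonglongrightarrow> (1::real)"
      proof (rule AE_I2)
        fix t
        show "(\<lambda>n. indicator (block (K n) (L n)) t) \<longlonglongrightarrow> (1::real)"
          by (rule tendsto_eventually) (use in_block[of t] in eventually_elim, simp)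
      qed
    qed (auto simp: indicator_def)
    thus ?thesis by simp
  qed
  have lim1: "(\<lambda>n. l2_norm (\<lambda>x. h (\<psi> n) x - z * \<psi> n x - U x)) \<longlonglongrightarrow> 0"
  proof (rule tendsto_sandwich[OF _ _ tendsto_const])
    show "\<forall>\<^sub>F n in sequentially. 0 \<le> l2_norm (\<lambda>x. h (\<psi> n) x - z * \<psi> n x - U x)" by simp
    show "\<forall>\<^sub>F n in sequentially. l2_norm (\<lambda>x. h (\<psi> n) x - z * \<psi> n x - U x)
        \<le> sqrt ((l2_norm U)\<^sup>2 / (Im z)\<^sup>2 / real (K n)) +
        sqrt ((l2_norm U)\<^sup>2 - (l2_norm (E (block (K n) (L n)) U))\<^sup>2)"
      using resid by simp
    have "(\<lambda>n. (l2_norm (E (block (K n) (L n)) U))\<^sup>2) \<longlonglongrightarrow> (l2_norm U)\<^sup>2"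
      using block_incseq U by (simp add: measure_diag E_UNIV)
    moreover have "(\<lambda>n. (l2_norm U)\<^sup>2 / (Im z)\<^sup>2 / real (K n)) \<longlonglongrightarrow> 0"
      unfolding K_def by (rule LIMSEQ_Suc[OF lim_const_over_n])
    ultimately have "(\<lambda>n. sqrt ((l2_norm U)\<^sup>2 / (Im z)\<^sup>2 / real (K n)) +
        sqrt ((l2_norm U)\<^sup>2 - (l2_norm (E (block (K n) (L n)) U))\<^sup>2)) \<longlonglongrightarrow>
        sqrt 0 + sqrt ((l2_norm U)\<^sup>2 - (l2_norm U)\<^sup>2)"
      by (intro tendsto_add tendsto_real_sqrt tendsto_diff tendsto_const)
    thus "(\<lambda>n. sqrt ((l2_norm U)\<^sup>2 / (Im z)\<^sup>2 / real (K n)) +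
        sqrt ((l2_norm U)\<^sup>2 - (l2_norm (E (block (K n) (L n)) U))\<^sup>2)) \<longlonglongrightarrow> 0" by simp
  qed
  have inner_\<psi>: "l2_inner U (\<psi> n) = (\<integral>t. (if t \<in> block (K n) (L n) then 1 / (complex_of_real (of_int \<lfloor>real (K n) * t\<rfloor> / real (K n)) - z) else 0) \<partial>?m)" for n
  proof -
    have "l2_inner U (\<psi> n) = (\<Sum>j\<in>I n. c n j * complex_of_real (measure ?m (cell (K n) j)))"
      unfolding \<psi>_def I_def[symmetric] using U
      by (subst l2_inner_sum_right)
        (auto simp: l2_inner_scale_right l2_scale Ec inner_E measure_diag I_def simp del: of_real_power)
    also have "\<dots> = (\<Sum>j\<in>I n. \<integral>t. indicator (cell (K n) j) t *\<^sub>R c n j \<partial>?m)"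
      by (intro sum.cong) (auto simp: scaleR_conv_of_real mult.commute emeasure_eq_measure)
    also have "\<dots> = (\<integral>t. (\<Sum>j\<in>I n. indicator (cell (K n) j) t *\<^sub>R c n j) \<partial>?m)"
      by (rule Bochner_Integration.integral_sum[symmetric])
        (auto intro!: integrable_scaleR_left simp: emeasure_eq_measure)
    also have "(\<lambda>t. \<Sum>j\<in>I n. indicator (cell (K n) j) t *\<^sub>R c n j) =
        (\<lambda>t. if t \<in> block (K n) (L n) then 1 / (complex_of_real (of_int \<lfloor>real (K n) * t\<rfloor> / real (K n)) - z) else 0)"
    proof
      fix t
      have "(\<Sum>j\<in>I n. indicator (cell (K n) j) t *\<^sub>R c n j) = (\<Sum>j\<in>I n. if j = \<lfloor>real (K n) * t\<rfloor> then c n j else 0)"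
        by (rule sum.cong) (auto simp: cell_def indicator_def)
      thus "(\<Sum>j\<in>I n. indicator (cell (K n) j) t *\<^sub>R c n j) = (if t \<in> block (K n) (L n) then 1 / (complex_of_real (of_int \<lfloor>real (K n) * t\<rfloor> / real (K n)) - z) else 0)"
        by (auto simp: I_def block_def c_def)
    qed
    finally show ?thesis .
  qed
  have lim2: "(\<lambda>n. l2_inner U (\<psi> n)) \<longlonglongrightarrow> (\<integral>t. 1 / (complex_of_real t - z) \<partial>?m)"
    unfolding inner_\<psi>
  proof (rule integral_dominated_convergence[where w = "\<lambda>_. 1 / Im z"])
    show "AE t in ?m. (\<lambda>n. if t \<in> block (K n) (L n) then 1 / (complex_of_real (of_int \<lfloor>real (K n) * t\<rfloor> / real (K n)) - z) else 0)
        \<longlonglongrightarrow> 1 / (complex_of_real t - z)"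
    proof (rule AE_I2)
      fix t
      have "(\<lambda>n. 1 / (complex_of_real (of_int \<lfloor>real (K n) * t\<rfloor> / real (K n)) - z)) \<longlonglongrightarrow> 1 / (complex_of_real t - z)"
        using nz by (intro tendsto_intros floor_K) auto
      moreover have "\<forall>\<^sub>F n in sequentially. 1 / (complex_of_real (of_int \<lfloor>real (K n) * t\<rfloor> / real (K n)) - z) =
          (if t \<in> block (K n) (L n) then 1 / (complex_of_real (of_int \<lfloor>real (K n) * t\<rfloor> / real (K n)) - z) else 0)"
        using in_block[of t] by eventually_elim simp
      ultimately show "(\<lambda>n. if t \<in> block (K n) (L n) then 1 / (complex_of_real (of_int \<lfloor>real (K n) * t\<rfloor> / real (K n)) - z) else 0)
        \<longlonglongrightarrow> 1 / (complex_of_real t - z)"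
        by (rule Lim_transform_eventually)
    qed
    show "AE t in ?m. norm (if t \<in> block (K n) (L n) then 1 / (complex_of_real (of_int \<lfloor>real (K n) * t\<rfloor> / real (K n)) - z) else 0) \<le> 1 / Im z" for n
      using c_bound z by (intro AE_I2) (auto simp del: of_real_divide)
  qed auto
  show thesis by (rule that[OF \<psi>l2 hl2 lim1 lim2])
qed

end

section \<open>Poisson kernels and weak convergence\<close>

text \<open>Pi times the Poisson kernel of the upper half plane. The value is Im (1 / (t - z)) with
  z = x + i y, and the total integral is pi rather than 1.\<close>

definition poisson :: "real \<Rightarrow> real \<Rightarrow> real \<Rightarrow> real" where
  "poisson x y t = y / ((t - x)\<^sup>2 + y\<^sup>2)"

lemma poisson_commute: "poisson x y t = poisson t y x"
  by (simp add: poisson_def power2_commute)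

lemma poisson_nonneg: "y > 0 \<Longrightarrow> poisson x y t \<ge> 0"
  by (simp add: poisson_def)

lemma poisson_le:
  assumes "y > 0"
  shows "poisson x y t \<le> 1 / y"
proof -
  have "poisson x y t \<le> y / y\<^sup>2"
    unfolding poisson_def using assms by (intro divide_left_mono mult_pos_pos add_nonneg_pos) auto
  thus ?thesis using assms by (simp add: power2_eq_square)
qed

lemma poisson_measurable [measurable]: "poisson x y \<in> borel_measurable borel"
  unfolding poisson_def by measurable

lemma continuous_poisson: "y > 0 \<Longrightarrow> continuous_on A (poisson x y)"
  unfolding poisson_def by (intro continuous_intros) (auto simp: add_nonneg_eq_0_iff)

lemma poisson_has_integral:
  assumes y: "y > 0"
  shows "integrable lborel (poisson x y)" "(\<integral>t. poisson x y t \<partial>lborel) = pi"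
proof -
  define F where "F t = arctan ((t - x) / y)" for t
  have deriv: "DERIV F t :> poisson x y t" for t
  proof -
    have "DERIV F t :> (1 / (1 + ((t - x) / y)\<^sup>2)) * (1 / y)"
      unfolding F_def using y by (auto intro!: derivative_eq_intros simp: inverse_eq_divide)
    also have "(1 / (1 + ((t - x) / y)\<^sup>2)) * (1 / y) = poisson x y t"
      using y by (simp add: poisson_def divide_simps add_pos_nonneg add_nonneg_eq_0_iff)
        (simp add: power2_eq_square algebra_simps)
    finally show ?thesis .
  qed
  have cont: "isCont (poisson x y) t" for t
    using continuous_poisson[OF y, of UNIV x] by (simp add: continuous_on_eq_continuous_at)
  have top: "(F \<longlongrightarrow> pi / 2) at_top"
    unfolding F_def
  proof (rule filterlim_compose[OF tendsto_arctan_at_top])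
    have "Z \<le> (t - x) / y" if "t \<ge> Z * y + x" for Z t using that y by (simp add: pos_le_divide_eq)
    thus "filterlim (\<lambda>t. (t - x) / y) at_top at_top"
      unfolding filterlim_at_top eventually_at_top_linorder by blast
  qed
  have bot: "(F \<longlongrightarrow> - (pi / 2)) at_bot"
    unfolding F_def
  proof (rule filterlim_compose[OF tendsto_arctan_at_bot])
    have "(t - x) / y \<le> Z" if "t \<le> Z * y + x" for Z t using that y by (simp add: pos_divide_le_eq)
    thus "filterlim (\<lambda>t. (t - x) / y) at_bot at_bot"
      unfolding filterlim_at_bot eventually_at_bot_linorder by blast
  qed
  have "((F \<circ> real_of_ereal) \<longlongrightarrow> - (pi/2)) (at_right (-\<infinity>))" "((F \<circ> real_of_ereal) \<longlongrightarrow> pi/2) (at_left \<infinity>)"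
    using top bot by (simp_all add: ereal_tendsto_simps)
  note FTC = interval_integral_FTC_nonneg[of "-\<infinity>" \<infinity> F "poisson x y" "- (pi/2)" "pi/2", OF _ deriv cont _ this]
  have "set_integrable lborel (einterval (-\<infinity>) \<infinity>) (poisson x y)"
    by (rule FTC(1)) (auto simp: poisson_nonneg y)
  thus "integrable lborel (poisson x y)" by (simp add: set_integrable_def)
  have "(LBINT t=-\<infinity>..\<infinity>. poisson x y t) = pi / 2 - - (pi / 2)"
    by (rule FTC(2)) (auto simp: poisson_nonneg y)
  thus "(\<integral>t. poisson x y t \<partial>lborel) = pi"
    by (simp add: interval_lebesgue_integral_def set_lebesgue_integral_def)
qed

text \<open>Near t uniform continuity applies. At distance at least d from t the kernel of width y
  is at most 2 y / d times the kernel of width d, so the tail is controlled by the known integral of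
  a kernel, uniformly in t.\<close>

lemma poisson_approx:
  fixes f :: "real \<Rightarrow> real"
  assumes f: "uniformly_continuous_on UNIV f" and bound: "\<And>t. \<bar>f t\<bar> \<le> B" and \<eta>: "\<eta> > 0"
  obtains y0 where "y0 > 0"
    "\<And>y t. 0 < y \<Longrightarrow> y \<le> y0 \<Longrightarrow> \<bar>(\<integral>x. f x * poisson x y t \<partial>lborel) - pi * f t\<bar> \<le> \<eta>"
proof -
  have cf: "continuous_on UNIV f" using f by (rule uniformly_continuous_imp_continuous)
  hence mf [measurable]: "f \<in> borel_measurable borel" by (rule borel_measurable_continuous_onI)
  have B: "B \<ge> 0" using bound[of 0] by auto
  define \<epsilon> where "\<epsilon> = \<eta> / (2 * pi)"
  have \<epsilon>: "\<epsilon> > 0" using \<eta> by (simp add: \<epsilon>_def)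
  then obtain d where d: "d > 0" "\<And>x t. \<bar>x - t\<bar> < d \<Longrightarrow> \<bar>f x - f t\<bar> < \<epsilon>"
    using f unfolding uniformly_continuous_on_def dist_real_def by (metis UNIV_I)
  \<comment> \<open>Chosen so that the tail term 4 B y pi / d is at most \<eta> / 2; B + 1 in place
    of B keeps the denominator positive.\<close>
  define y0 where "y0 = \<eta> * d / (8 * (B + 1) * pi)"
  have y0: "y0 > 0" using \<eta> d B by (simp add: y0_def)
  have "\<bar>(\<integral>x. f x * poisson x y t \<partial>lborel) - pi * f t\<bar> \<le> \<eta>" if y: "0 < y" "y \<le> y0" for y t
  proof -
    note I = poisson_has_integral[OF y(1), of t] and D = poisson_has_integral[OF d(1), of t]
    have int: "integrable lborel (\<lambda>x. f x * poisson t y x)"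
    proof (rule Bochner_Integration.integrable_bound)
      show "integrable lborel (\<lambda>x. B * poisson t y x)" using I(1) by simp
      show "AE x in lborel. norm (f x * poisson t y x) \<le> norm (B * poisson t y x)"
        using bound B poisson_nonneg[OF y(1)] by (intro AE_I2) (auto simp: abs_mult intro!: mult_right_mono)
    qed measurable
    have pw: "\<bar>(f x - f t) * poisson t y x\<bar> \<le> \<epsilon> * poisson t y x + (4 * B * y / d) * poisson t d x" for x
    proof (cases "\<bar>x - t\<bar> < d")
      case True
      have "\<bar>(f x - f t) * poisson t y x\<bar> \<le> \<epsilon> * poisson t y x"
        using d(2)[OF True] poisson_nonneg[OF y(1)] by (auto simp: abs_mult intro!: mult_right_mono)
      moreover have "(4 * B * y / d) * poisson t d x \<ge> 0"
        using B y d poisson_nonneg[OF d(1)] by (intro mult_nonneg_nonneg divide_nonneg_nonneg) auto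
      ultimately show ?thesis by linarith
    next
      case False
      hence sq: "d\<^sup>2 \<le> (x - t)\<^sup>2" using d(1) by (simp add: abs_le_square_iff[symmetric])
      have pos: "(x - t)\<^sup>2 > 0" "d\<^sup>2 > 0" using sq d(1) by (auto intro: less_le_trans[of _ "d\<^sup>2"])
      have "poisson t y x \<le> y / (x - t)\<^sup>2"
        unfolding poisson_def using pos y by (intro divide_left_mono mult_pos_pos add_pos_nonneg) auto
      also have "\<dots> = 2 * y / (2 * (x - t)\<^sup>2)" using pos by simp
      also have "\<dots> \<le> 2 * y / ((x - t)\<^sup>2 + d\<^sup>2)"
        using sq pos y by (intro divide_left_mono mult_pos_pos add_pos_nonneg) auto
      also have "\<dots> = (2 * y / d) * poisson t d x" using d(1) by (simp add: poisson_def)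
      finally have le: "poisson t y x \<le> (2 * y / d) * poisson t d x" .
      have "\<bar>f x - f t\<bar> \<le> 2 * B" using bound[of x] bound[of t] by linarith
      hence "\<bar>(f x - f t) * poisson t y x\<bar> \<le> (2 * B) * ((2 * y / d) * poisson t d x)"
        unfolding abs_mult using le B poisson_nonneg[OF y(1), of t x] by (intro mult_mono) auto
      moreover have "\<epsilon> * poisson t y x \<ge> 0" using \<epsilon> poisson_nonneg[OF y(1)] by simp
      ultimately show ?thesis by (simp add: algebra_simps)
    qed
    have "(\<integral>x. f x * poisson x y t \<partial>lborel) - pi * f t = (\<integral>x. (f x - f t) * poisson t y x \<partial>lborel)"
      using I int by (simp add: poisson_commute[of _ y t] left_diff_distrib)
    also have "\<bar>\<dots>\<bar> \<le> (\<integral>x. \<bar>(f x - f t) * poisson t y x\<bar> \<partial>lborel)" by (rule integral_abs_bound)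
    also have "\<dots> \<le> (\<integral>x. \<epsilon> * poisson t y x + (4 * B * y / d) * poisson t d x \<partial>lborel)"
      using I D int pw by (intro integral_mono) (auto simp: left_diff_distrib)
    also have "\<dots> = \<epsilon> * pi + (4 * B * y / d) * pi" using I D by simp
    also have "(4 * B * y / d) * pi \<le> \<eta> / 2"
    proof -
      have "4 * B * y \<le> 4 * (B + 1) * y0" using y B by (intro mult_mono) auto
      hence "(4 * B * y / d) * pi \<le> (4 * (B + 1) * y0 / d) * pi"
        using d by (intro mult_right_mono divide_right_mono) auto
      also have "\<dots> = \<eta> / 2" unfolding y0_def using d B by (simp add: field_simps add_nonneg_eq_0_iff)
      finally show ?thesis .
    qed
    also have "\<epsilon> * pi = \<eta> / 2" by (simp add: \<epsilon>_def)
    finally show ?thesis by simp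
  qed
  thus thesis using that y0 by blast
qed

lemma finite_borel_measureD:
  assumes "finite_borel_measure \<kappa>"
  shows "sets \<kappa> = sets borel" "space \<kappa> = UNIV" "finite_measure \<kappa>"
  using assms sets_eq_imp_space_eq[of \<kappa> borel] by (auto simp: finite_borel_measure_def)

lemma integrable_bounded_borel:
  fixes f :: "real \<Rightarrow> real"
  assumes "finite_borel_measure \<kappa>" "f \<in> borel_measurable borel" "\<And>t. \<bar>f t\<bar> \<le> B"
  shows "integrable \<kappa> f"
proof -
  interpret finite_measure \<kappa> using assms(1) by (simp add: finite_borel_measureD)
  have "f \<in> borel_measurable \<kappa>"
    using assms(2) finite_borel_measureD(1)[OF assms(1)] measurable_cong_sets[of \<kappa> borel borel borel] by auto
  thus ?thesis using assms(3) by (intro integrable_const_bound[where B = B]) auto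
qed

lemma integral_abs_le_measure:
  fixes f :: "real \<Rightarrow> real"
  assumes "finite_borel_measure \<kappa>" "f \<in> borel_measurable borel" "\<And>t. \<bar>f t\<bar> \<le> B"
  shows "\<bar>\<integral>t. f t \<partial>\<kappa>\<bar> \<le> B * measure \<kappa> UNIV"
proof -
  interpret finite_measure \<kappa> using assms(1) by (simp add: finite_borel_measureD)
  have "\<bar>\<integral>t. f t \<partial>\<kappa>\<bar> \<le> (\<integral>t. \<bar>f t\<bar> \<partial>\<kappa>)" by (rule integral_abs_bound)
  also have "\<dots> \<le> (\<integral>t. B \<partial>\<kappa>)"
    using integrable_bounded_borel[OF assms] assms(3) by (intro integral_mono) auto
  also have "\<dots> = B * measure \<kappa> UNIV"
    using finite_borel_measureD(2)[OF assms(1)] by simp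
  finally show ?thesis .
qed

definition poisson_transform :: "real measure \<Rightarrow> real \<Rightarrow> real \<Rightarrow> real" where
  "poisson_transform \<kappa> x y = (\<integral>t. poisson x y t \<partial>\<kappa>)"

lemma poisson_transform_measurable:
  assumes "finite_borel_measure \<kappa>"
  shows "(\<lambda>x. poisson_transform \<kappa> x y) \<in> borel_measurable borel"
proof -
  interpret finite_measure \<kappa> using assms by (simp add: finite_borel_measureD)
  note [measurable_cong] = finite_borel_measureD(1)[OF assms]
  show ?thesis unfolding poisson_transform_def poisson_def by measurable
qed

lemma poisson_transform_bounds:
  assumes "finite_borel_measure \<kappa>" "y > 0"
  shows "\<bar>poisson_transform \<kappa> x y\<bar> \<le> 1 / y * measure \<kappa> UNIV"
  unfolding poisson_transform_def using assms poisson_nonneg poisson_le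
  by (intro integral_abs_le_measure) (auto simp: abs_le_iff intro: order.trans[of _ 0])

text \<open>Fubini. Compact support of f confines the double integral to a set of finite product
  measure, on which the integrand is bounded.\<close>

lemma integral_poisson_smoothing:
  fixes f :: "real \<Rightarrow> real"
  assumes \<kappa>: "finite_borel_measure \<kappa>" and f: "f \<in> borel_measurable borel" "\<And>t. \<bar>f t\<bar> \<le> B"
    and supp: "\<And>t. \<bar>t\<bar> > R \<Longrightarrow> f t = 0" and y: "y > 0"
  shows "(\<integral>t. (\<integral>x. f x * poisson x y t \<partial>lborel) \<partial>\<kappa>) = (\<integral>x. f x * poisson_transform \<kappa> x y \<partial>lborel)"
proof -
  interpret finite_measure \<kappa> using \<kappa> by (simp add: finite_borel_measureD)
  interpret P: pair_sigma_finite lborel \<kappa> by standard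
  note [measurable_cong] = finite_borel_measureD(1)[OF \<kappa>]
  note [measurable] = f(1)
  have sp: "space \<kappa> = UNIV" using finite_borel_measureD(2)[OF \<kappa>] .
  have "integrable (lborel \<Otimes>\<^sub>M \<kappa>) (\<lambda>(x, t). f x * poisson x y t)"
  proof (rule integrableI_bounded_set[where A = "{-R..R} \<times> UNIV" and B = "B * (1 / y)"])
    show "{-R..R} \<times> UNIV \<in> sets (lborel \<Otimes>\<^sub>M \<kappa>)"
      using sp sets.top[of \<kappa>] by (intro pair_measureI) auto
    show "(\<lambda>(x, t). f x * poisson x y t) \<in> borel_measurable (lborel \<Otimes>\<^sub>M \<kappa>)"
      unfolding poisson_def by measurable
    have "emeasure (lborel \<Otimes>\<^sub>M \<kappa>) ({-R..R} \<times> UNIV) = emeasure lborel {-R..R} * emeasure \<kappa> UNIV"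
      using sp sets.top[of \<kappa>] by (intro emeasure_pair_measure_Times) auto
    also have "\<dots> < \<infinity>" using emeasure_finite[of UNIV] by (auto simp: ennreal_mult_less_top ennreal_mult_eq_top_iff less_top[symmetric] emeasure_lborel_Icc_eq)
    finally show "emeasure (lborel \<Otimes>\<^sub>M \<kappa>) ({-R..R} \<times> UNIV) < \<infinity>" .
    have "\<bar>f x * poisson x y t\<bar> \<le> B * (1 / y)" for x t
      unfolding abs_mult using f(2)[of x] poisson_nonneg[OF y] poisson_le[OF y] y
      by (intro mult_mono) auto
    thus "AE x in lborel \<Otimes>\<^sub>M \<kappa>. x \<in> {- R..R} \<times> UNIV \<longrightarrow> norm (case x of (x, t) \<Rightarrow> f x * poisson x y t) \<le> B * (1 / y)"
      by (intro AE_I2) auto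
    have "f x = 0 \<or> x \<in> {-R..R}" for x
      using supp[of x] by (cases "\<bar>x\<bar> > R") (auto simp: not_less abs_le_iff)
    thus "AE x in lborel \<Otimes>\<^sub>M \<kappa>. x \<notin> {- R..R} \<times> UNIV \<longrightarrow> (case x of (x, t) \<Rightarrow> f x * poisson x y t) = 0"
      by (intro AE_I2) fastforce
  qed
  from P.Fubini_integral[OF this] show ?thesis by (simp add: poisson_transform_def)
qed

lemma smoothing_error:
  fixes f :: "real \<Rightarrow> real"
  assumes \<kappa>: "finite_borel_measure \<kappa>" and f: "f \<in> borel_measurable borel" "\<And>t. \<bar>f t\<bar> \<le> B"
    and supp: "\<And>t. \<bar>t\<bar> > R \<Longrightarrow> f t = 0" and y: "y > 0"
    and close: "\<And>t. \<bar>(\<integral>x. f x * poisson x y t \<partial>lborel) - pi * f t\<bar> \<le> \<eta>"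
  shows "\<bar>(\<integral>x. f x * poisson_transform \<kappa> x y \<partial>lborel) - pi * (\<integral>t. f t \<partial>\<kappa>)\<bar> \<le> \<eta> * measure \<kappa> UNIV"
proof -
  note [measurable] = f(1)
  let ?g = "\<lambda>t. \<integral>x. f x * poisson x y t \<partial>lborel"
  have g [measurable]: "?g \<in> borel_measurable borel" unfolding poisson_def by measurable
  have g_bd: "\<bar>?g t\<bar> \<le> \<eta> + pi * B" for t
  proof -
    have "\<bar>pi * f t\<bar> \<le> pi * B" using f(2)[of t] by (simp add: abs_mult)
    thus ?thesis using close[of t] by linarith
  qed
  have "(\<integral>x. f x * poisson_transform \<kappa> x y \<partial>lborel) - pi * (\<integral>t. f t \<partial>\<kappa>) = (\<integral>t. ?g t - pi * f t \<partial>\<kappa>)"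
    using integral_poisson_smoothing[OF \<kappa> f supp y] integrable_bounded_borel[OF \<kappa> f]
      integrable_bounded_borel[OF \<kappa> g g_bd] by simp
  also have "\<bar>\<dots>\<bar> \<le> \<eta> * measure \<kappa> UNIV"
    by (rule integral_abs_le_measure[OF \<kappa> _ close]) measurable
  finally show ?thesis .
qed

text \<open>A Poisson transform at one fixed height y, integrated against f, equals pi times the
  integral of f up to an error \<eta> times the total mass. The masses are bounded uniformly in n,
  so a single height serves all n, and at that height dominated convergence on [-R, R]
  applies.\<close>

lemma weak_convergence_compact_support:
  fixes f :: "real \<Rightarrow> real" and \<rho> \<nu> :: "nat \<Rightarrow> real measure"
  assumes \<rho>: "\<And>n. finite_borel_measure (\<rho> n)" and \<nu>: "\<And>n. finite_borel_measure (\<nu> n)"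
    and \<mu>: "finite_borel_measure \<mu>"
    and mass: "\<And>n. measure (\<rho> n) UNIV + measure (\<nu> n) UNIV \<le> measure \<mu> UNIV"
    and lim: "\<And>x y. y > 0 \<Longrightarrow> (\<lambda>n. poisson_transform (\<rho> n) x y + poisson_transform (\<nu> n) x y) \<longlonglongrightarrow> poisson_transform \<mu> x y"
    and f: "continuous_on UNIV f" and supp: "\<And>t. \<bar>t\<bar> > R \<Longrightarrow> f t = 0"
  shows "(\<lambda>n. (\<integral>t. f t \<partial>\<rho> n) + (\<integral>t. f t \<partial>\<nu> n)) \<longlonglongrightarrow> (\<integral>t. f t \<partial>\<mu>)"
proof -
  define m where "m = measure \<mu> UNIV"
  have mf [measurable]: "f \<in> borel_measurable borel" using f by (rule borel_measurable_continuous_onI)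
  have "compact (f ` {-R..R})" using f by (intro compact_continuous_image) (auto intro: continuous_on_subset)
  then obtain B0 where B0: "\<And>t. t \<in> {-R..R} \<Longrightarrow> \<bar>f t\<bar> \<le> B0"
    using compact_imp_bounded bounded_iff by (metis imageI real_norm_def)
  define B where "B = max B0 0"
  have B: "\<bar>f t\<bar> \<le> B" for t
    using B0[of t] supp[of t] by (cases "\<bar>t\<bar> > R") (auto simp: B_def le_max_iff_disj abs_le_iff not_less)
  have uc: "uniformly_continuous_on UNIV f"
  proof -
    have ucK: "uniformly_continuous_on {-R-1..R+1} f"
      using f by (intro compact_uniformly_continuous) (auto intro: continuous_on_subset)
    show ?thesis
      unfolding uniformly_continuous_on_def
    proof (intro allI impI)
      fix e :: real assume "e > 0"
      then obtain d where d: "d > 0" "\<And>x x'. x \<in> {-R-1..R+1} \<Longrightarrow> x' \<in> {-R-1..R+1} \<Longrightarrow> dist x' x < d \<Longrightarrow> dist (f x') (f x) < e"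
        using ucK unfolding uniformly_continuous_on_def by metis
      have "dist (f x') (f x) < e" if "dist x' x < min d 1" for x x'
      proof (cases "x \<in> {-R-1..R+1} \<and> x' \<in> {-R-1..R+1}")
        case True thus ?thesis using d(2)[of x x'] that by auto
      next
        case False
        hence "\<bar>x\<bar> > R" "\<bar>x'\<bar> > R" using that by (auto simp: dist_real_def)
        thus ?thesis using supp[of x] supp[of x'] \<open>e > 0\<close> by simp
      qed
      thus "\<exists>d>0. \<forall>x\<in>UNIV. \<forall>x'\<in>UNIV. dist x' x < d \<longrightarrow> dist (f x') (f x) < e"
        using d(1) by (intro exI[of _ "min d 1"]) auto
    qed
  qed
  let ?I = "\<lambda>n. (\<integral>t. f t \<partial>\<rho> n) + (\<integral>t. f t \<partial>\<nu> n)"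
  show ?thesis
  proof (rule LIMSEQ_I)
    fix r :: real assume r: "r > 0"
    \<comment> \<open>Three errors below r pi / 3 each: smoothing of the approximants, whose masses
      add up to at most m; smoothing of \<mu>; and the dominated convergence at height y.\<close>
    define \<eta> where "\<eta> = r * pi / (3 * (m + 1))"
    have m: "m \<ge> 0" by (simp add: m_def)
    have \<eta>: "\<eta> > 0" using r m by (simp add: \<eta>_def)
    obtain y where y: "y > 0" "\<And>t. \<bar>(\<integral>x. f x * poisson x y t \<partial>lborel) - pi * f t\<bar> \<le> \<eta>"
      using poisson_approx[OF uc B \<eta>] by (metis order_refl)
    let ?P = "\<lambda>n x. poisson_transform (\<rho> n) x y + poisson_transform (\<nu> n) x y"
    have bdd: "\<bar>f x * poisson_transform \<kappa> x y\<bar> \<le> indicator {-R..R} x * (B * (1 / y * measure \<kappa> UNIV))"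
      if "finite_borel_measure \<kappa>" for \<kappa> x
      using supp[of x] B[of x] poisson_transform_bounds[OF that y(1), of x]
        mult_mono[OF B[of x] poisson_transform_bounds[OF that y(1), of x]] B[of 0]
      by (cases "\<bar>x\<bar> > R") (auto simp: abs_mult indicator_def)
    have integ: "integrable lborel (\<lambda>x. f x * poisson_transform \<kappa> x y)" if \<kappa>: "finite_borel_measure \<kappa>" for \<kappa>
    proof (rule Bochner_Integration.integrable_bound)
      show "integrable lborel (\<lambda>x. indicator {-R..R} x * (B * (1 / y * measure \<kappa> UNIV)))"
        by (intro integrable_mult_left integrable_real_indicator) (auto simp: emeasure_lborel_Icc_eq)
      note [measurable] = poisson_transform_measurable[OF \<kappa>]
      show "(\<lambda>x. f x * poisson_transform \<kappa> x y) \<in> borel_measurable lborel" by measurable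
      show "AE x in lborel. norm (f x * poisson_transform \<kappa> x y) \<le> norm (indicator {- R..R} x * (B * (1 / y * measure \<kappa> UNIV)))"
        using bdd[OF \<kappa>] by (intro AE_I2) (smt (verit) real_norm_def)
    qed
    have "(\<lambda>n. \<integral>x. f x * ?P n x \<partial>lborel) \<longlonglongrightarrow> (\<integral>x. f x * poisson_transform \<mu> x y \<partial>lborel)"
    proof (rule integral_dominated_convergence[where w = "\<lambda>x. indicator {-R..R} x * (B * (1 / y * m))"])
      note [measurable] = poisson_transform_measurable[OF \<mu>] poisson_transform_measurable[OF \<rho>]
        poisson_transform_measurable[OF \<nu>]
      show "(\<lambda>x. f x * ?P n x) \<in> borel_measurable lborel" for n by measurable
      show "(\<lambda>x. f x * poisson_transform \<mu> x y) \<in> borel_measurable lborel" by measurable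
      show "integrable lborel (\<lambda>x. indicator {-R..R} x * (B * (1 / y * m)))"
        by (intro integrable_mult_left integrable_real_indicator) (auto simp: emeasure_lborel_Icc_eq)
      show "AE x in lborel. (\<lambda>n. f x * ?P n x) \<longlonglongrightarrow> f x * poisson_transform \<mu> x y"
        by (intro AE_I2 tendsto_mult tendsto_const lim y)
      show "AE x in lborel. norm (f x * ?P n x) \<le> indicator {-R..R} x * (B * (1 / y * m))" for n
      proof (rule AE_I2)
        fix x :: real
        have "\<bar>f x * ?P n x\<bar> \<le> \<bar>f x * poisson_transform (\<rho> n) x y\<bar> + \<bar>f x * poisson_transform (\<nu> n) x y\<bar>"
          unfolding distrib_left by (rule abs_triangle_ineq)
        also have "\<dots> \<le> indicator {-R..R} x * (B * (1 / y * measure (\<rho> n) UNIV)) + indicator {-R..R} x * (B * (1 / y * measure (\<nu> n) UNIV))"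
          by (intro add_mono bdd \<rho> \<nu>)
        also have "\<dots> = indicator {-R..R} x * (B * (1 / y * (measure (\<rho> n) UNIV + measure (\<nu> n) UNIV)))"
          by (simp add: algebra_simps add_divide_distrib)
        also have "\<dots> \<le> indicator {-R..R} x * (B * (1 / y * m))"
          unfolding m_def using mass[of n] y(1) B[of 0] by (intro mult_left_mono) auto
        finally show "norm (f x * ?P n x) \<le> indicator {-R..R} x * (B * (1 / y * m))" by simp
      qed
    qed
    from LIMSEQ_D[OF this, of "r * pi / 3"] r
    obtain N where N: "\<And>n. n \<ge> N \<Longrightarrow> \<bar>(\<integral>x. f x * ?P n x \<partial>lborel) - (\<integral>x. f x * poisson_transform \<mu> x y \<partial>lborel)\<bar> < r * pi / 3"
      by auto
    have "norm (?I n - (\<integral>t. f t \<partial>\<mu>)) < r" if n: "n \<ge> N" for n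
    proof -
      note E = smoothing_error[where R = R, OF _ mf B supp y]
      have sum: "(\<integral>x. f x * ?P n x \<partial>lborel) = (\<integral>x. f x * poisson_transform (\<rho> n) x y \<partial>lborel) + (\<integral>x. f x * poisson_transform (\<nu> n) x y \<partial>lborel)"
        using integ[OF \<rho>] integ[OF \<nu>] by (simp add: distrib_left)
      have "\<eta> * measure (\<rho> n) UNIV + \<eta> * measure (\<nu> n) UNIV \<le> \<eta> * m"
        unfolding distrib_left[symmetric] m_def using mass[of n] \<eta> by (intro mult_left_mono) auto
      moreover have "\<eta> * m < r * pi / 3"
      proof -
        have "\<eta> * m < \<eta> * (m + 1)" using \<eta> by simp
        also have "\<dots> = r * pi / 3" using m by (simp add: \<eta>_def field_simps add_nonneg_eq_0_iff)
        finally show ?thesis .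
      qed
      ultimately have "\<bar>pi * ?I n - pi * (\<integral>t. f t \<partial>\<mu>)\<bar> < pi * r"
        using E[OF \<rho>[of n]] E[OF \<nu>[of n]] E[OF \<mu>, folded m_def] N[OF n, unfolded sum]
        unfolding distrib_left mult.commute[of pi r] by linarith
      thus ?thesis
        unfolding right_diff_distrib[symmetric] abs_mult by simp
    qed
    thus "\<exists>N. \<forall>n\<ge>N. norm (?I n - (\<integral>t. f t \<partial>\<mu>)) < r" by blast
  qed
qed

text \<open>No mass can escape: the approximants never carry more mass than \<mu>, while a cutoff
  function that captures almost all of \<mu> has almost the same integral against them for large n.
  Hence the tails are uniformly small, and the compactly supported case extends to bounded
  functions.\<close>

lemma weak_convergence_of_poisson_transforms:
  fixes f :: "real \<Rightarrow> real" and \<rho> \<nu> :: "nat \<Rightarrow> real measure"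
  assumes \<rho>: "\<And>n. finite_borel_measure (\<rho> n)" and \<nu>: "\<And>n. finite_borel_measure (\<nu> n)"
    and \<mu>: "finite_borel_measure \<mu>"
    and mass: "\<And>n. measure (\<rho> n) UNIV + measure (\<nu> n) UNIV \<le> measure \<mu> UNIV"
    and lim: "\<And>x y. y > 0 \<Longrightarrow> (\<lambda>n. poisson_transform (\<rho> n) x y + poisson_transform (\<nu> n) x y) \<longlonglongrightarrow> poisson_transform \<mu> x y"
    and f: "continuous_on UNIV f" and bd: "bounded (range f)"
  shows "(\<lambda>n. (\<integral>t. f t \<partial>\<rho> n) + (\<integral>t. f t \<partial>\<nu> n)) \<longlonglongrightarrow> (\<integral>t. f t \<partial>\<mu>)"
proof -
  define m where "m = measure \<mu> UNIV"
  have mf [measurable]: "f \<in> borel_measurable borel" using f by (rule borel_measurable_continuous_onI)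
  obtain B where B: "B > 0" "\<And>t. \<bar>f t\<bar> \<le> B" using bd by (auto simp: bounded_pos)
  let ?I = "\<lambda>g n. (\<integral>t. g t \<partial>\<rho> n) + (\<integral>t. g t \<partial>\<nu> n)"
  interpret M: finite_measure \<mu> using finite_borel_measureD[OF \<mu>] by simp
  note [measurable_cong] = finite_borel_measureD(1)[OF \<mu>]
  define \<chi> :: "real \<Rightarrow> real \<Rightarrow> real" where "\<chi> R t = max 0 (min 1 (R + 1 - \<bar>t\<bar>))" for R t
  have \<chi>: "0 \<le> \<chi> R t" "\<chi> R t \<le> 1" "\<bar>t\<bar> > R + 1 \<Longrightarrow> \<chi> R t = 0" "\<bar>t\<bar> \<le> R \<Longrightarrow> \<chi> R t = 1" for R t
    by (auto simp: \<chi>_def)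
  have \<chi>c: "continuous_on UNIV (\<chi> R)" for R unfolding \<chi>_def by (intro continuous_intros)
  hence \<chi>m [measurable]: "\<chi> R \<in> borel_measurable borel" for R by (intro borel_measurable_continuous_onI)
  have int1: "integrable \<kappa> (\<chi> R)" if "finite_borel_measure \<kappa>" for \<kappa> R
    using \<chi> by (intro integrable_bounded_borel[OF that, of _ 1]) auto
  have int2: "integrable \<kappa> (\<lambda>t. f t * \<chi> R t)" if "finite_borel_measure \<kappa>" for \<kappa> R
  proof (rule integrable_bounded_borel[OF that])
    show "\<bar>f t * \<chi> R t\<bar> \<le> B * 1" for t
      unfolding abs_mult using B \<chi>[of R t] by (intro mult_mono) auto
  qed measurable
  have tail: "\<bar>(\<integral>t. f t \<partial>\<kappa>) - (\<integral>t. f t * \<chi> R t \<partial>\<kappa>)\<bar> \<le> B * (measure \<kappa> UNIV - (\<integral>t. \<chi> R t \<partial>\<kappa>))"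
    if \<kappa>: "finite_borel_measure \<kappa>" for \<kappa> R
  proof -
    interpret finite_measure \<kappa> using finite_borel_measureD[OF \<kappa>] by simp
    note If = integrable_bounded_borel[OF \<kappa> mf B(2)]
    have "(\<integral>t. f t \<partial>\<kappa>) - (\<integral>t. f t * \<chi> R t \<partial>\<kappa>) = (\<integral>t. f t * (1 - \<chi> R t) \<partial>\<kappa>)"
      using If int2[OF \<kappa>, of R] by (simp add: right_diff_distrib)
    also have "\<bar>\<dots>\<bar> \<le> (\<integral>t. \<bar>f t * (1 - \<chi> R t)\<bar> \<partial>\<kappa>)" by (rule integral_abs_bound)
    also have "\<dots> \<le> (\<integral>t. B * (1 - \<chi> R t) \<partial>\<kappa>)"
    proof (rule integral_mono)
      show "integrable \<kappa> (\<lambda>t. \<bar>f t * (1 - \<chi> R t)\<bar>)"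
        using If int2[OF \<kappa>, of R] by (intro integrable_abs) (simp add: right_diff_distrib)
      show "\<bar>f t * (1 - \<chi> R t)\<bar> \<le> B * (1 - \<chi> R t)" for t
        unfolding abs_mult using B \<chi>[of R t] by (intro mult_mono) auto
    qed (use int1[OF \<kappa>] in auto)
    also have "\<dots> = B * (measure \<kappa> UNIV - (\<integral>t. \<chi> R t \<partial>\<kappa>))"
      using int1[OF \<kappa>, of R] finite_borel_measureD(2)[OF \<kappa>] by simp
    finally show ?thesis .
  qed
  have conv: "?I g \<longlonglongrightarrow> (\<integral>t. g t \<partial>\<mu>)" if "continuous_on UNIV g" "\<And>t. \<bar>t\<bar> > R \<Longrightarrow> g t = 0" for g :: "real \<Rightarrow> real" and R
    by (rule weak_convergence_compact_support[OF \<rho> \<nu> \<mu> mass lim that])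
  show ?thesis
  proof (rule LIMSEQ_I)
    fix r :: real assume r: "r > 0"
    \<comment> \<open>The tails of the approximants cost 2 B \<eta>, the tail of \<mu> costs B
      \<eta>, and convergence for the truncated function another B \<eta>; the total stays below 5 B
      \<eta> = r.\<close>
    define \<eta> where "\<eta> = r / (5 * B)"
    have \<eta>: "\<eta> > 0" using r B by (simp add: \<eta>_def)
    have "(\<lambda>k. \<integral>t. \<chi> (real k) t \<partial>\<mu>) \<longlonglongrightarrow> (\<integral>t. 1 \<partial>\<mu>)"
    proof (rule integral_dominated_convergence[where w = "\<lambda>_. 1"])
      show "AE t in \<mu>. (\<lambda>k. \<chi> (real k) t) \<longlonglongrightarrow> 1"
      proof (rule AE_I2, rule tendsto_eventually)
        fix t
        obtain N :: nat where "\<bar>t\<bar> < real N" using reals_Archimedean2 by blast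
        thus "\<forall>\<^sub>F k in sequentially. \<chi> (real k) t = 1"
          unfolding eventually_sequentially by (intro exI[of _ N]) (auto intro!: \<chi>)
      qed
    qed (use \<chi> in auto)
    hence "(\<lambda>k. \<integral>t. \<chi> (real k) t \<partial>\<mu>) \<longlonglongrightarrow> m"
      using finite_borel_measureD(2)[OF \<mu>] by (simp add: m_def)
    from LIMSEQ_D[OF this \<eta>] obtain k where k: "\<bar>(\<integral>t. \<chi> (real k) t \<partial>\<mu>) - m\<bar> < \<eta>" by fastforce
    define R where "R = real k"
    have fc: "continuous_on UNIV (\<lambda>t. f t * \<chi> R t)" by (intro continuous_intros f \<chi>c)
    have "?I (\<chi> R) \<longlonglongrightarrow> (\<integral>t. \<chi> R t \<partial>\<mu>)" by (rule conv[of "\<chi> R" "R + 1"]) (use \<chi> \<chi>c in auto)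
    from LIMSEQ_D[OF this \<eta>] obtain N1 where N1: "\<And>n. n \<ge> N1 \<Longrightarrow> \<bar>?I (\<chi> R) n - (\<integral>t. \<chi> R t \<partial>\<mu>)\<bar> < \<eta>" by auto
    have "?I (\<lambda>t. f t * \<chi> R t) \<longlonglongrightarrow> (\<integral>t. f t * \<chi> R t \<partial>\<mu>)" by (rule conv[of "\<lambda>t. f t * \<chi> R t" "R + 1"]) (use \<chi> fc in auto)
    from LIMSEQ_D[OF this, of "B * \<eta>"] B \<eta> obtain N2 where N2:
      "\<And>n. n \<ge> N2 \<Longrightarrow> \<bar>?I (\<lambda>t. f t * \<chi> R t) n - (\<integral>t. f t * \<chi> R t \<partial>\<mu>)\<bar> < B * \<eta>" by auto
    have "norm (?I f n - (\<integral>t. f t \<partial>\<mu>)) < r" if n: "n \<ge> max N1 N2" for n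
    proof -
      have "m - ?I (\<chi> R) n < 2 * \<eta>" using N1[of n] n k by (auto simp: R_def abs_less_iff)
      hence "measure (\<rho> n) UNIV + measure (\<nu> n) UNIV - ?I (\<chi> R) n \<le> 2 * \<eta>"
        using mass[of n] by (simp add: m_def)
      hence t1: "B * (measure (\<rho> n) UNIV - (\<integral>t. \<chi> R t \<partial>\<rho> n)) + B * (measure (\<nu> n) UNIV - (\<integral>t. \<chi> R t \<partial>\<nu> n)) \<le> B * (2 * \<eta>)"
        unfolding distrib_left[symmetric] using B by (intro mult_left_mono) auto
      have t2: "B * (measure \<mu> UNIV - (\<integral>t. \<chi> R t \<partial>\<mu>)) \<le> B * \<eta>"
        using k B by (intro mult_left_mono) (auto simp: R_def m_def abs_less_iff)
      have "B * \<eta> * 5 = r" using B by (simp add: \<eta>_def)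
      moreover have "B * \<eta> > 0" using B \<eta> by simp
      ultimately show ?thesis
        using t1 t2 tail[OF \<rho>[of n], of R] tail[OF \<nu>[of n], of R] tail[OF \<mu>, of R] N2[of n] n
        by (simp add: abs_le_iff abs_less_iff)
    qed
    thus "\<exists>N. \<forall>n\<ge>N. norm (?I f n - (\<integral>t. f t \<partial>\<mu>)) < r" by blast
  qed
qed

section \<open>Complex matrices and vectors\<close>

lemma mat_adjoint_dim [simp]:
  "dim_row (mat_adjoint A) = dim_col A" "dim_col (mat_adjoint A) = dim_row A"
  by (simp_all add: mat_adjoint_def)

lemma mat_adjoint_carrier [simp]: "A \<in> carrier_mat n m \<Longrightarrow> mat_adjoint A \<in> carrier_mat m n"
  by auto

lemma mat_adjoint_index [simp]:
  "i < dim_col A \<Longrightarrow> j < dim_row A \<Longrightarrow> mat_adjoint (A :: complex mat) $$ (i, j) = cnj (A $$ (j, i))"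
  by (simp add: mat_adjoint_def mat_of_rows_index)

lemma mat_adjoint_adjoint [simp]: "mat_adjoint (mat_adjoint (A :: complex mat)) = A"
  by (rule eq_matI) auto

lemma mat_adjoint_mult:
  fixes A B :: "complex mat"
  assumes "A \<in> carrier_mat n m" "B \<in> carrier_mat m k"
  shows "mat_adjoint (A * B) = mat_adjoint B * mat_adjoint A"
  using assms by (intro eq_matI) (auto simp: scalar_prod_def mult.commute)

lemma mat_adjoint_one [simp]: "mat_adjoint (1\<^sub>m n :: complex mat) = 1\<^sub>m n"
  by (rule eq_matI) auto

lemma inner_adjoint:
  fixes A :: "complex mat"
  assumes "A \<in> carrier_mat n m" "v \<in> carrier_vec m" "w \<in> carrier_vec n"
  shows "(A *\<^sub>v v) \<bullet>c w = v \<bullet>c (mat_adjoint A *\<^sub>v w)"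
proof -
  have "(A *\<^sub>v v) \<bullet>c w = (\<Sum>i<n. \<Sum>j<m. A $$ (i, j) * v $ j * cnj (w $ i))"
    using assms by (auto simp: scalar_prod_def sum_distrib_right atLeast0LessThan)
  also have "\<dots> = (\<Sum>j<m. \<Sum>i<n. A $$ (i, j) * v $ j * cnj (w $ i))" by (rule sum.swap)
  also have "\<dots> = v \<bullet>c (mat_adjoint A *\<^sub>v w)"
    using assms by (auto simp: scalar_prod_def sum_distrib_left atLeast0LessThan mult_ac intro!: sum.cong)
  finally show ?thesis .
qed

lemma inner_commute:
  fixes v w :: "complex vec"
  assumes "v \<in> carrier_vec n" "w \<in> carrier_vec n"
  shows "w \<bullet>c v = cnj (v \<bullet>c w)"
  using assms by (auto simp: scalar_prod_def mult.commute)

lemma inner_add_left: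
  fixes v w :: "complex vec"
  assumes "v \<in> carrier_vec n" "w \<in> carrier_vec n" "x \<in> carrier_vec n"
  shows "(v + w) \<bullet>c x = v \<bullet>c x + w \<bullet>c x"
  using assms by (intro add_scalar_prod_distrib) auto

lemma inner_diff_left:
  fixes v w :: "complex vec"
  assumes "v \<in> carrier_vec n" "w \<in> carrier_vec n" "x \<in> carrier_vec n"
  shows "(v - w) \<bullet>c x = v \<bullet>c x - w \<bullet>c x"
  using assms by (intro minus_scalar_prod_distrib) auto

lemma inner_smult_left:
  fixes v w :: "complex vec"
  assumes "v \<in> carrier_vec n" "w \<in> carrier_vec n"
  shows "(c \<cdot>\<^sub>v v) \<bullet>c w = c * (v \<bullet>c w)"
  using assms by simp

lemma inner_add_right:
  fixes v w :: "complex vec"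
  assumes "v \<in> carrier_vec n" "w \<in> carrier_vec n" "x \<in> carrier_vec n"
  shows "x \<bullet>c (v + w) = x \<bullet>c v + x \<bullet>c w"
  using assms by (auto simp: scalar_prod_def algebra_simps sum.distrib)

lemma inner_smult_right:
  fixes v w :: "complex vec"
  assumes "v \<in> carrier_vec n" "w \<in> carrier_vec n"
  shows "v \<bullet>c (c \<cdot>\<^sub>v w) = cnj c * (v \<bullet>c w)"
  using assms by (auto simp: scalar_prod_def sum_distrib_left mult_ac intro!: sum.cong)

lemma cvec_norm_nonneg [simp]: "cvec_norm v \<ge> 0"
  by (simp add: cvec_norm_def sum_nonneg)

lemma cvec_norm_sq: "(cvec_norm v)\<^sup>2 = (\<Sum>i<dim_vec v. (cmod (v $ i))\<^sup>2)"
  by (simp add: cvec_norm_def sum_nonneg)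

lemma inner_self: "v \<bullet>c v = complex_of_real ((cvec_norm v)\<^sup>2)"
  unfolding cvec_norm_sq
  by (auto simp: scalar_prod_def atLeast0LessThan complex_norm_square simp del: of_real_power)

lemma cvec_norm_L2: "cvec_norm v = L2_set (\<lambda>i. cmod (v $ i)) {..<dim_vec v}"
  by (simp add: cvec_norm_def L2_set_def)

lemma inner_Cauchy_Schwarz:
  assumes "v \<in> carrier_vec n" "w \<in> carrier_vec n"
  shows "cmod (v \<bullet>c w) \<le> cvec_norm v * cvec_norm w"
proof -
  have "cmod (v \<bullet>c w) = cmod (\<Sum>i<n. v $ i * cnj (w $ i))"
    using assms by (auto simp: scalar_prod_def atLeast0LessThan)
  also have "\<dots> \<le> (\<Sum>i<n. \<bar>cmod (v $ i)\<bar> * \<bar>cmod (w $ i)\<bar>)"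
    by (rule order.trans[OF norm_sum]) (simp add: norm_mult)
  also have "\<dots> \<le> cvec_norm v * cvec_norm w"
    using assms L2_set_mult_ineq[of "\<lambda>i. cmod (v $ i)" "\<lambda>i. cmod (w $ i)" "{..<n}"] by (simp add: cvec_norm_L2)
  finally show ?thesis .
qed

lemma cvec_norm_eq_0: "v \<in> carrier_vec n \<Longrightarrow> cvec_norm v = 0 \<longleftrightarrow> v = 0\<^sub>v n"
  by (auto simp: cvec_norm_L2 L2_set_eq_0_iff)

lemma cmod_le_cvec_norm: "i < dim_vec v \<Longrightarrow> cmod (v $ i) \<le> cvec_norm v"
  unfolding cvec_norm_L2 by (rule member_le_L2_set) auto

lemma cvec_norm_mult_mat_le:
  assumes A: "A \<in> carrier_mat n n"
  obtains C where "C \<ge> 0" "\<And>v. v \<in> carrier_vec n \<Longrightarrow> cvec_norm (A *\<^sub>v v) \<le> C * cvec_norm v"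
proof -
  define K where "K i = (\<Sum>j<n. cmod (A $$ (i, j)))" for i
  define C where "C = L2_set K {..<n}"
  have "cvec_norm (A *\<^sub>v v) \<le> C * cvec_norm v" if v: "v \<in> carrier_vec n" for v
  proof -
    have "cmod ((A *\<^sub>v v) $ i) \<le> K i * cvec_norm v" if "i < n" for i
    proof -
      have "cmod ((A *\<^sub>v v) $ i) = cmod (\<Sum>j<n. A $$ (i, j) * v $ j)"
        using A v that by (auto simp: scalar_prod_def atLeast0LessThan)
      also have "\<dots> \<le> (\<Sum>j<n. cmod (A $$ (i, j)) * cvec_norm v)"
        using v cmod_le_cvec_norm[of _ v]
        by (intro order.trans[OF norm_sum] sum_mono) (auto simp: norm_mult intro!: mult_left_mono)
      finally show ?thesis by (simp add: K_def sum_distrib_right)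
    qed
    hence "cvec_norm (A *\<^sub>v v) \<le> L2_set (\<lambda>i. K i * cvec_norm v) {..<n}"
      using A by (auto simp: cvec_norm_L2[of "A *\<^sub>v v"] intro!: L2_set_mono)
    also have "\<dots> = C * cvec_norm v"
      unfolding C_def by (subst L2_set_left_distrib) auto
    finally show ?thesis .
  qed
  moreover have "C \<ge> 0" by (simp add: C_def)
  ultimately show thesis using that by blast
qed

section \<open>Resolvents of matrices as rational functions\<close>

text \<open>Polynomial dependence on z is recorded for functions instead of polynomial matrices:
  determinants, cofactors and inner products are then covered by closure under sums and
  products.\<close>

definition polyfun :: "(complex \<Rightarrow> complex) \<Rightarrow> bool" where
  "polyfun f \<longleftrightarrow> (\<exists>p. \<forall>z. f z = poly p z)"

lemma polyfun_const: "polyfun (\<lambda>_. c)"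
  unfolding polyfun_def by (intro exI[of _ "[:c:]"]) simp

lemma polyfun_id: "polyfun (\<lambda>z. z)"
  unfolding polyfun_def by (intro exI[of _ "[:0, 1:]"]) simp

lemma polyfun_add: "polyfun f \<Longrightarrow> polyfun g \<Longrightarrow> polyfun (\<lambda>z. f z + g z)"
  unfolding polyfun_def by (metis poly_add)

lemma polyfun_diff: "polyfun f \<Longrightarrow> polyfun g \<Longrightarrow> polyfun (\<lambda>z. f z - g z)"
  unfolding polyfun_def by (metis poly_diff)

lemma polyfun_mult: "polyfun f \<Longrightarrow> polyfun g \<Longrightarrow> polyfun (\<lambda>z. f z * g z)"
  unfolding polyfun_def by (metis poly_mult)

lemma polyfun_sum: "(\<And>i. i \<in> I \<Longrightarrow> polyfun (f i)) \<Longrightarrow> polyfun (\<lambda>z. \<Sum>i\<in>I. f i z)"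
  by (induction I rule: infinite_finite_induct) (auto intro: polyfun_const polyfun_add)

lemma polyfun_prod: "(\<And>i. i \<in> I \<Longrightarrow> polyfun (f i)) \<Longrightarrow> polyfun (\<lambda>z. \<Prod>i\<in>I. f i z)"
  by (induction I rule: infinite_finite_induct) (auto intro: polyfun_const polyfun_mult)

lemma polyfun_det:
  assumes "\<And>z. B z \<in> carrier_mat n n" "\<And>i j. i < n \<Longrightarrow> j < n \<Longrightarrow> polyfun (\<lambda>z. B z $$ (i, j))"
  shows "polyfun (\<lambda>z. det (B z))"
proof -
  have "(\<lambda>z. det (B z)) = (\<lambda>z. \<Sum>p\<in>{p. p permutes {0..<n}}. signof p * (\<Prod>i = 0..<n. B z $$ (i, p i)))"
  proof
    fix z
    have "dim_row (B z) = n" "dim_col (B z) = n" using assms(1)[of z] by auto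
    thus "det (B z) = (\<Sum>p\<in>{p. p permutes {0..<n}}. signof p * (\<Prod>i = 0..<n. B z $$ (i, p i)))"
      by (simp add: det_def)
  qed
  moreover have "p i < n" if "p permutes {0..<n}" "i < n" for p i
    using that permutes_in_image[of p "{0..<n}" i] by simp
  ultimately show ?thesis
    by (auto intro!: polyfun_sum polyfun_mult polyfun_const polyfun_prod assms(2))
qed

definition shifted :: "complex mat \<Rightarrow> complex \<Rightarrow> complex mat" where
  "shifted A z = A - z \<cdot>\<^sub>m 1\<^sub>m (dim_row A)"

lemma shifted_carrier [simp]: "A \<in> carrier_mat n n \<Longrightarrow> shifted A z \<in> carrier_mat n n"
  by (auto simp: shifted_def)

lemma shifted_index:
  "A \<in> carrier_mat n n \<Longrightarrow> i < n \<Longrightarrow> j < n \<Longrightarrow> shifted A z $$ (i, j) = A $$ (i, j) - (if i = j then z else 0)"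
  by (auto simp: shifted_def)

lemma shifted_mult_vec:
  assumes "A \<in> carrier_mat n n" "v \<in> carrier_vec n"
  shows "shifted A z *\<^sub>v v = A *\<^sub>v v - z \<cdot>\<^sub>v v"
proof -
  have "(z \<cdot>\<^sub>m 1\<^sub>m n) *\<^sub>v v = z \<cdot>\<^sub>v v"
    using assms by (intro eq_vecI) (auto simp: smult_scalar_prod_distrib)
  thus ?thesis using assms unfolding shifted_def
    by (subst minus_mult_distrib_mat_vec[of _ n n]) auto
qed

lemma polyfun_shifted: "A \<in> carrier_mat n n \<Longrightarrow> i < n \<Longrightarrow> j < n \<Longrightarrow> polyfun (\<lambda>z. shifted A z $$ (i, j))"
  by (cases "i = j") (auto simp: shifted_index intro!: polyfun_diff polyfun_const polyfun_id)

lemma polyfun_det_shifted: "A \<in> carrier_mat n n \<Longrightarrow> polyfun (\<lambda>z. det (shifted A z))"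
  by (rule polyfun_det[of _ n]) (auto intro: polyfun_shifted)

lemma polyfun_adj_shifted:
  assumes A: "A \<in> carrier_mat n n" and "i < n" "j < n"
  shows "polyfun (\<lambda>z. adj_mat (shifted A z) $$ (i, j))"
proof -
  have "polyfun (\<lambda>z. det (mat_delete (shifted A z) j i))"
  proof (rule polyfun_det)
    show "mat_delete (shifted A z) j i \<in> carrier_mat (n - 1) (n - 1)" for z
      using A by (simp add: mat_delete_def shifted_def)
    fix k l assume "k < n - 1" "l < n - 1"
    thus "polyfun (\<lambda>z. mat_delete (shifted A z) j i $$ (k, l))"
      using A by (auto simp: mat_delete_def shifted_def intro!: polyfun_shifted[OF A, unfolded shifted_def])
        (auto intro!: polyfun_diff polyfun_mult polyfun_const polyfun_id)
  qed
  moreover have "adj_mat (shifted A z) $$ (i, j) = (-1) ^ (j + i) * det (mat_delete (shifted A z) j i)" for z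
    using assms by (simp add: adj_mat_def cofactor_def shifted_def)
  ultimately show ?thesis
    by (auto intro!: polyfun_mult polyfun_const)
qed

text \<open>Cramer's rule; the value is \<open>0\<close> where \<open>A - z\<close> is singular.\<close>
definition resolvent :: "complex mat \<Rightarrow> complex \<Rightarrow> complex mat" where
  "resolvent A z = (1 / det (shifted A z)) \<cdot>\<^sub>m adj_mat (shifted A z)"

lemma resolvent_carrier [simp]: "A \<in> carrier_mat n n \<Longrightarrow> resolvent A z \<in> carrier_mat n n"
  unfolding resolvent_def using adj_mat(1)[of "shifted A z" n] by simp

lemma resolvent_inverse:
  assumes "A \<in> carrier_mat n n" "det (shifted A z) \<noteq> 0"
  shows "shifted A z * resolvent A z = 1\<^sub>m n" "resolvent A z * shifted A z = 1\<^sub>m n"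
proof -
  have c: "shifted A z \<in> carrier_mat n n" using assms by simp
  note adj = adj_mat[OF c]
  show "shifted A z * resolvent A z = 1\<^sub>m n"
    unfolding resolvent_def using adj c assms(2)
    by (subst mult_smult_distrib[OF c adj(1)]) auto
  show "resolvent A z * shifted A z = 1\<^sub>m n"
    unfolding resolvent_def using adj c assms(2)
    by (subst mult_smult_assoc_mat[OF adj(1) c]) auto
qed

lemma resolvent_solves:
  assumes "A \<in> carrier_mat n n" "det (shifted A z) \<noteq> 0" "u \<in> carrier_vec n"
  shows "shifted A z *\<^sub>v (resolvent A z *\<^sub>v u) = u"
  using assms resolvent_inverse[OF assms(1,2)]
  by (subst assoc_mult_mat_vec[symmetric, of _ n n _ n]) auto

lemma resolvent_unique:
  assumes "A \<in> carrier_mat n n" "det (shifted A z) \<noteq> 0" "v \<in> carrier_vec n"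
  shows "resolvent A z *\<^sub>v (shifted A z *\<^sub>v v) = v"
  using assms resolvent_inverse[OF assms(1,2)]
  by (subst assoc_mult_mat_vec[symmetric, of _ n n _ n]) auto

text \<open>Cramer's rule. The identity holds for every z: where the determinant vanishes both sides
  are 0 by the convention for division by zero, so no exceptional set has to be carried
  along.\<close>

lemma polyfun_resolvent_inner:
  assumes A: "A \<in> carrier_mat n n" and "u \<in> carrier_vec n" "w \<in> carrier_vec n"
  obtains p where "\<And>z. (resolvent A z *\<^sub>v u) \<bullet>c w = poly p z / det (shifted A z)"
proof -
  have "polyfun (\<lambda>z. \<Sum>i<n. (\<Sum>j<n. adj_mat (shifted A z) $$ (i, j) * u $ j) * cnj (w $ i))"
    by (intro polyfun_sum polyfun_mult polyfun_const polyfun_adj_shifted[OF A]) auto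
  then obtain p where p: "\<And>z. (\<Sum>i<n. (\<Sum>j<n. adj_mat (shifted A z) $$ (i, j) * u $ j) * cnj (w $ i)) = poly p z"
    unfolding polyfun_def by blast
  have "(resolvent A z *\<^sub>v u) \<bullet>c w = poly p z / det (shifted A z)" for z
  proof -
    have adj: "adj_mat (shifted A z) \<in> carrier_mat n n" using A by (intro adj_mat) auto
    have "(resolvent A z *\<^sub>v u) \<bullet>c w = (\<Sum>i<n. (\<Sum>j<n. resolvent A z $$ (i, j) * u $ j) * cnj (w $ i))"
      using assms carrier_matD[OF resolvent_carrier[OF A, of z]]
      by (auto simp: scalar_prod_def atLeast0LessThan)
    also have "\<dots> = (\<Sum>i<n. (\<Sum>j<n. adj_mat (shifted A z) $$ (i, j) * u $ j) * cnj (w $ i)) / det (shifted A z)"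
      using adj by (simp add: resolvent_def sum_divide_distrib sum_distrib_right)
    finally show ?thesis by (simp add: p)
  qed
  thus thesis using that by blast
qed

text \<open>At a pole of a / b the product of i e with the quotient would not tend to 0 along the
  vertical line. Hence every zero of b in S is matched by a zero of a, a common linear factor can be
  removed, and induction on the degree of b clears S. Approach from above suffices, which matters
  because the estimates are available only in the upper half plane.\<close>

lemma cancel_poles:
  fixes a b :: "complex poly"
  assumes "b \<noteq> 0"
    and "\<And>z0. z0 \<in> S \<Longrightarrow>
      ((\<lambda>e. \<i> * of_real e * (poly a (z0 + \<i> * of_real e) / poly b (z0 + \<i> * of_real e))) \<longlongrightarrow> 0) (at_right 0)"
  shows "\<exists>a' b'. a * b' = a' * b \<and> (\<forall>z\<in>S. poly b' z \<noteq> 0) \<and> b' \<noteq> 0"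
  using assms
proof (induction "degree b" arbitrary: a b rule: less_induct)
  case less
  show ?case
  proof (cases "\<forall>z\<in>S. poly b z \<noteq> 0")
    case True
    thus ?thesis using less.prems(1) by (intro exI[of _ a] exI[of _ b]) auto
  next
    case False
    then obtain z0 where z0: "z0 \<in> S" "poly b z0 = 0" by auto
    then obtain b1 where b1: "b = [:-z0, 1:] * b1" by (auto simp: poly_eq_0_iff_dvd dvd_def)
    have b1_nz: "b1 \<noteq> 0" using less.prems(1) b1 by auto
    \<comment> \<open>A nonzero polynomial has finitely many roots, so a short vertical segment
      above z, without z itself, avoids them.\<close>
    have nz: "\<forall>\<^sub>F e in at_right 0. poly p (z + \<i> * complex_of_real e) \<noteq> 0" if "p \<noteq> 0" for p z
    proof -
      have "finite ((\<lambda>w. Im (w - z)) ` {w. poly p w = 0})" using that poly_roots_finite by auto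
      hence "\<forall>\<^sub>F e in at_right 0. \<forall>c\<in>(\<lambda>w. Im (w - z)) ` {w. poly p w = 0} - {0}. e \<noteq> c"
        by (intro eventually_ball_finite ballI finite_Diff) (auto intro: tendsto_imp_eventually_ne[OF tendsto_ident_at])
      moreover have "\<forall>\<^sub>F e in at_right 0. e > (0::real)" by (rule eventually_at_right_less)
      ultimately show ?thesis
      proof eventually_elim
        case (elim e)
        show ?case
        proof
          assume "poly p (z + \<i> * complex_of_real e) = 0"
          hence "e \<in> (\<lambda>w. Im (w - z)) ` {w. poly p w = 0}"
            by (intro image_eqI[of _ _ "z + \<i> * complex_of_real e"]) auto
          thus False using elim by auto
        qed
      qed
    qed
    have path: "((\<lambda>e. z + \<i> * complex_of_real e) \<longlongrightarrow> z) (at_right 0)" for z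
      by (rule tendsto_eq_intros refl | simp)+
    have poly_path: "((\<lambda>e. poly p (z + \<i> * complex_of_real e)) \<longlongrightarrow> poly p z) (at_right 0)" for p z
      by (rule isCont_tendsto_compose[OF _ path]) simp
    have "((\<lambda>e. \<i> * of_real e * (poly a (z0 + \<i> * of_real e) / poly b (z0 + \<i> * of_real e)) *
        poly b1 (z0 + \<i> * of_real e)) \<longlongrightarrow> 0 * poly b1 z0) (at_right 0)"
      by (intro tendsto_mult less.prems(2) z0(1) poly_path)
    moreover have "\<forall>\<^sub>F e in at_right 0. \<i> * of_real e * (poly a (z0 + \<i> * of_real e) / poly b (z0 + \<i> * of_real e)) *
        poly b1 (z0 + \<i> * of_real e) = poly a (z0 + \<i> * of_real e)"
      using nz[OF less.prems(1), of z0] by eventually_elim (simp add: b1 field_simps)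
    ultimately have "((\<lambda>e. poly a (z0 + \<i> * of_real e)) \<longlongrightarrow> 0) (at_right 0)"
      by (simp add: tendsto_cong)
    hence "poly a z0 = 0"
      using tendsto_unique[OF _ poly_path[of a z0]] by (metis trivial_limit_at_right_real)
    then obtain a1 where a1: "a = [:-z0, 1:] * a1" by (auto simp: poly_eq_0_iff_dvd dvd_def)
    have "\<exists>a' b'. a1 * b' = a' * b1 \<and> (\<forall>z\<in>S. poly b' z \<noteq> 0) \<and> b' \<noteq> 0"
    proof (rule less.hyps)
      show "degree b1 < degree b" using b1_nz unfolding b1 by (subst degree_mult_eq) auto
      show "b1 \<noteq> 0" by fact
      fix z assume "z \<in> S"
      have "\<forall>\<^sub>F e in at_right 0. \<i> * of_real e * (poly a (z + \<i> * of_real e) / poly b (z + \<i> * of_real e)) =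
          \<i> * of_real e * (poly a1 (z + \<i> * of_real e) / poly b1 (z + \<i> * of_real e))"
        using nz[OF less.prems(1), of z]
      proof eventually_elim
        case (elim e)
        have "poly [:- z0, 1:] w = w - z0" for w by simp
        thus ?case using elim unfolding a1 b1 poly_mult by simp
      qed
      thus "((\<lambda>e. \<i> * of_real e * (poly a1 (z + \<i> * of_real e) / poly b1 (z + \<i> * of_real e))) \<longlongrightarrow> 0) (at_right 0)"
        using less.prems(2)[OF \<open>z \<in> S\<close>] by (simp add: tendsto_cong)
    qed
    then obtain a' b' where "a1 * b' = a' * b1" "\<forall>z\<in>S. poly b' z \<noteq> 0" "b' \<noteq> 0" by blast
    moreover from this(1) have "a * b' = a' * b" unfolding a1 b1 by (metis mult.assoc mult.left_commute)
    ultimately show ?thesis by blast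
  qed
qed

section \<open>The Poisson formula in the upper half plane\<close>

text \<open>Cauchy's theorem on half discs; by the decay of h the arc contributes O(1 / R). At z
  only continuity is demanded, because the function to which this is applied is a difference
  quotient at z.\<close>

lemma halfplane_integral_zero:
  fixes h :: "complex \<Rightarrow> complex"
  assumes cont: "continuous_on {w. Im w \<ge> 0} h"
    and holo: "\<And>w. Im w > 0 \<Longrightarrow> w \<noteq> z \<Longrightarrow> h field_differentiable at w"
    and decay: "\<And>w. Im w \<ge> 0 \<Longrightarrow> cmod w \<ge> R0 \<Longrightarrow> cmod (h w) \<le> C / (cmod w)\<^sup>2"
    and int: "integrable lborel (\<lambda>t. h (complex_of_real t))"
  shows "(\<integral>t. h (complex_of_real t) \<partial>lborel) = 0"
proof -
  define S where "S = {w. Im w \<ge> 0}"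
  have S: "convex S" unfolding S_def by (rule convex_halfspace_Im_ge)
  have intS: "interior S = {w. Im w > 0}"
    unfolding S_def using interior_halfspace_ge[of \<i> 0] by (simp add: inner_complex_def)
  have bound: "cmod (integral {-R..R} (\<lambda>t. h (complex_of_real t))) \<le> \<bar>C\<bar> * pi / R" if R: "R \<ge> max R0 1" for R
  proof -
    have R1: "R \<ge> 1" "R \<ge> R0" "R > 0" using R by auto
    let ?l = "linepath (complex_of_real (-R)) (complex_of_real R)" and ?c = "part_circlepath 0 R 0 pi"
    have img_c: "path_image ?c \<subseteq> S \<inter> {w. cmod w = R}"
    proof
      fix w assume "w \<in> path_image ?c"
      then obtain x where x: "x \<in> {0..1}" "w = ?c x" by (auto simp: path_image_def)
      have w: "w = of_real R * exp (\<i> * of_real (linepath 0 pi x))"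
        using x by (simp add: part_circlepath_def)
      have lp: "linepath 0 pi x = x * pi" by (simp add: linepath_def)
      have "Im w = R * sin (x * pi)"
        unfolding w lp cis_conv_exp[symmetric] by simp
      also have "\<dots> \<ge> 0"
        using x R1 by (intro mult_nonneg_nonneg sin_ge_zero) (auto simp: mult_le_cancel_right2)
      finally show "w \<in> S \<inter> {w. cmod w = R}"
        using R1 by (simp add: S_def w norm_mult)
    qed
    have img_l: "path_image ?l \<subseteq> S"
      using S by (simp add: path_image_linepath closed_segment_subset S_def)
    have start: "pathstart ?c = complex_of_real R" by (simp add: part_circlepath_def pathstart_def linepath_def)
    have fin: "pathfinish ?c = complex_of_real (-R)" by (simp add: part_circlepath_def pathfinish_def linepath_def)
    have vp: "valid_path (?l +++ ?c)"
      by (intro valid_path_join) (auto simp: start)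
    have "(h has_contour_integral 0) (?l +++ ?c)"
    proof (rule Cauchy_theorem_convex[OF _ S, of h "{z}"])
      show "continuous_on S h" using cont by (simp add: S_def)
      show "\<And>x. x \<in> interior S - {z} \<Longrightarrow> h field_differentiable at x" using holo intS by auto
      show "path_image (?l +++ ?c) \<subseteq> S" using img_l img_c by (auto simp: path_image_join start)
    qed (auto simp: vp start fin)
    moreover have ci_l: "h contour_integrable_on ?l"
      by (rule contour_integrable_continuous_linepath)
        (use cont img_l in \<open>auto simp: path_image_linepath S_def intro: continuous_on_subset\<close>)
    moreover have ci_c: "h contour_integrable_on ?c"
      by (rule contour_integrable_continuous_part_circlepath)
        (use cont img_c in \<open>auto simp: S_def intro: continuous_on_subset\<close>)
    ultimately have "contour_integral ?l h + contour_integral ?c h = 0"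
      using contour_integral_join[OF ci_l ci_c] by (simp add: contour_integral_unique)
    moreover have "cmod (contour_integral ?c h) \<le> (\<bar>C\<bar> / R\<^sup>2) * R * \<bar>pi - 0\<bar>"
    proof (rule contour_integral_bound_part_circlepath[OF ci_c])
      fix w assume "w \<in> path_image ?c"
      hence w: "Im w \<ge> 0" "cmod w = R" using img_c by (auto simp: S_def)
      have "cmod (h w) \<le> C / R\<^sup>2" using decay[OF w(1)] w(2) R1 by simp
      also have "\<dots> \<le> \<bar>C\<bar> / R\<^sup>2" by (intro divide_right_mono) auto
      finally show "cmod (h w) \<le> \<bar>C\<bar> / R\<^sup>2" .
    qed (use R1 in auto)
    moreover have "contour_integral ?l h = integral {-R..R} (\<lambda>t. h (complex_of_real t))"
      using contour_integral_linepath_Reals_eq[of "complex_of_real (-R)" "complex_of_real R" h] R1 by simp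
    ultimately show ?thesis
      using R1 by (simp add: power2_eq_square add_eq_0_iff norm_minus_cancel)
  qed
  have "(\<lambda>n. \<integral>t. indicator {- real n..real n} t *\<^sub>R h (complex_of_real t) \<partial>lborel) \<longlonglongrightarrow> (\<integral>t. h (complex_of_real t) \<partial>lborel)"
  proof (rule integral_dominated_convergence[where w = "\<lambda>t. norm (h (complex_of_real t))"])
    note [measurable] = borel_measurable_integrable[OF int]
    show "AE t in lborel. (\<lambda>n. indicator {- real n..real n} t *\<^sub>R h (complex_of_real t)) \<longlonglongrightarrow> h (complex_of_real t)"
    proof (rule AE_I2, rule tendsto_eventually)
      fix t :: real
      obtain N :: nat where "\<bar>t\<bar> < real N" using reals_Archimedean2 by blast
      thus "\<forall>\<^sub>F n in sequentially. indicator {- real n..real n} t *\<^sub>R h (complex_of_real t) = h (complex_of_real t)"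
        unfolding eventually_sequentially by (intro exI[of _ N]) (auto simp: indicator_def)
    qed
    show "(\<lambda>t. indicator {- real n..real n} t *\<^sub>R h (complex_of_real t)) \<in> borel_measurable lborel" for n
      by measurable
  qed (use int in \<open>auto intro!: AE_I2 simp: indicator_def\<close>)
  moreover have "(\<integral>t. indicator {- real n..real n} t *\<^sub>R h (complex_of_real t) \<partial>lborel) = integral {- real n..real n} (\<lambda>t. h (complex_of_real t))" for n
  proof -
    have "set_integrable lborel {- real n..real n} (\<lambda>t. h (complex_of_real t))"
      unfolding set_integrable_def using int by (intro integrable_mult_indicator) auto
    from set_borel_integral_eq_integral(2)[OF this] show ?thesis
      by (simp add: set_lebesgue_integral_def)
  qed
  ultimately have lim: "(\<lambda>n. integral {- real n..real n} (\<lambda>t. h (complex_of_real t))) \<longlonglongrightarrow> (\<integral>t. h (complex_of_real t) \<partial>lborel)"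
    by simp
  have "(\<lambda>n. integral {- real n..real n} (\<lambda>t. h (complex_of_real t))) \<longlonglongrightarrow> 0"
  proof (rule Lim_null_comparison)
    show "\<forall>\<^sub>F n in sequentially. cmod (integral {- real n..real n} (\<lambda>t. h (complex_of_real t))) \<le> \<bar>C\<bar> * pi / real n"
    proof -
      obtain N :: nat where "max R0 1 < real N" using reals_Archimedean2 by blast
      thus ?thesis unfolding eventually_sequentially by (intro exI[of _ N]) (auto intro!: bound)
    qed
    show "(\<lambda>n. \<bar>C\<bar> * pi / real n) \<longlonglongrightarrow> 0" by (rule lim_const_over_n)
  qed
  thus ?thesis using lim LIMSEQ_unique by blast
qed

text \<open>Boundedness gives no decay for g itself. Subtracting the value at z and dividing by (w -
  z)(w - cnj z) produces decay of order |w|^-2 without a pole at z, and on the real line the result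
  is a constant multiple of g(t) - g(z) times the Poisson kernel. The vanishing of its integral is
  the Poisson formula.\<close>

lemma poisson_formula:
  fixes g :: "complex \<Rightarrow> complex"
  assumes cont: "continuous_on {w. Im w \<ge> 0} g"
    and holo: "\<And>w. Im w > 0 \<Longrightarrow> g field_differentiable at w"
    and bound: "\<And>w. Im w \<ge> 0 \<Longrightarrow> cmod (g w) \<le> K"
    and y: "y > 0"
  shows "integrable lborel (\<lambda>t. Im (g (complex_of_real t)) * poisson x y t)"
    and "(\<integral>t. Im (g (complex_of_real t)) * poisson x y t \<partial>lborel) = pi * Im (g (Complex x y))"
proof -
  define z where "z = Complex x y"
  have Imz: "Im z = y" "Re z = x" by (auto simp: z_def)
  define dq where "dq w = (if w = z then deriv g z else (g w - g z) / (w - z))" for w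
  define h where "h w = dq w * (2 * \<i> * of_real y / (w - cnj z))" for w
  have K: "K \<ge> 0" using bound[of z] y Imz norm_ge_zero[of "g z"] by linarith
  have nz: "w - cnj z \<noteq> 0" if "Im w \<ge> 0" for w
    using that y Imz by (auto simp: complex_eq_iff)
  have dq_lim: "(dq \<longlongrightarrow> dq z) (at z)"
  proof -
    have "(g has_field_derivative deriv g z) (at z)"
      using holo[of z] y Imz by (simp add: field_differentiable_derivI)
    hence "((\<lambda>w. (g w - g z) / (w - z)) \<longlongrightarrow> deriv g z) (at z)" by (simp add: has_field_derivative_iff)
    moreover have "\<forall>\<^sub>F w in at z. (g w - g z) / (w - z) = dq w"
      by (auto simp: dq_def eventually_at_filter)
    moreover have "dq z = deriv g z" by (simp add: dq_def)
    ultimately show ?thesis using Lim_transform_eventually[of _ "deriv g z" "at z" dq] by simp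
  qed
  have dq_cont: "continuous_on {w. Im w \<ge> 0} dq"
  proof (rule continuous_on_eq_continuous_within[THEN iffD2], rule ballI)
    fix w assume w: "w \<in> {w. Im w \<ge> 0}"
    show "continuous (at w within {w. Im w \<ge> 0}) dq"
    proof (cases "w = z")
      case True
      thus ?thesis using dq_lim by (auto simp: continuous_within intro: tendsto_within_subset)
    next
      case False
      have "continuous (at w within {w. Im w \<ge> 0}) (\<lambda>w. (g w - g z) / (w - z))"
        using cont w False by (intro continuous_intros) (auto simp: continuous_on_eq_continuous_within)
      moreover have "\<forall>\<^sub>F v in at w within {w. Im w \<ge> 0}. (g v - g z) / (v - z) = dq v"
        using tendsto_imp_eventually_ne[OF tendsto_ident_at False, of "{w. Im w \<ge> 0}"]
        by eventually_elim (simp add: dq_def)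
      moreover have "dq w = (g w - g z) / (w - z)" using False by (simp add: dq_def)
      ultimately show ?thesis
        unfolding continuous_within
        using Lim_transform_eventually[of _ "(g w - g z) / (w - z)" "at w within {w. Im w \<ge> 0}" dq] by simp
    qed
  qed
  have h_cont: "continuous_on {w. Im w \<ge> 0} h"
    unfolding h_def using nz by (intro continuous_intros dq_cont) auto
  have h_real: "h (complex_of_real t) = 2 * \<i> * ((g (of_real t) - g z) * of_real (poisson x y t))" for t
  proof -
    have ne: "complex_of_real t \<noteq> z" using y Imz by auto
    have "(complex_of_real t - z) * (complex_of_real t - cnj z) = of_real ((t - x)\<^sup>2 + y\<^sup>2)"
      by (simp add: complex_eq_iff Imz power2_eq_square algebra_simps)
    thus ?thesis using ne unfolding h_def dq_def poisson_def
      by (simp add: divide_simps)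
  qed
  have h_decay: "cmod (h w) \<le> (16 * y * K) / (cmod w)\<^sup>2" if w: "Im w \<ge> 0" "cmod w \<ge> 2 * cmod z + 1" for w
  proof -
    have ne: "w \<noteq> z" using w(2) norm_ge_zero[of z] by (intro notI) (simp del: norm_ge_zero)
    have b1: "cmod (w - z) \<ge> cmod w / 2" "cmod (w - cnj z) \<ge> cmod w / 2"
      using norm_triangle_ineq2[of w z] norm_triangle_ineq2[of w "cnj z"] w(2) by auto
    have pos: "cmod w > 0" using w(2) norm_ge_zero[of z] by linarith
    have "cmod (h w) = cmod (g w - g z) * (2 * y) / (cmod (w - z) * cmod (w - cnj z))"
      using ne y by (simp add: h_def dq_def norm_mult norm_divide)
    also have "\<dots> \<le> (2 * K) * (2 * y) / ((cmod w / 2) * (cmod w / 2))"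
    proof (intro frac_le mult_right_mono mult_mono b1)
      show "cmod (g w - g z) \<le> 2 * K"
        using norm_triangle_ineq4[of "g w" "g z"] bound[OF w(1)] bound[of z] y Imz by linarith
    qed (use K y pos in auto)
    also have "\<dots> = (16 * y * K) / (cmod w)\<^sup>2" by (simp add: power2_eq_square)
    finally show ?thesis .
  qed
  have cr: "continuous_on UNIV (\<lambda>t. g (complex_of_real t))"
    by (rule continuous_on_compose2[OF cont]) (auto intro!: continuous_intros)
  have gm [measurable]: "(\<lambda>t. g (complex_of_real t)) \<in> borel_measurable borel"
    by (rule borel_measurable_continuous_onI[OF cr])
  note P = poisson_has_integral[OF y, of x]
  have intg: "integrable lborel (\<lambda>t. g (complex_of_real t) * of_real (poisson x y t))"
  proof (rule Bochner_Integration.integrable_bound)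
    show "integrable lborel (\<lambda>t. K * poisson x y t)" using P by simp
    show "AE t in lborel. norm (g (complex_of_real t) * of_real (poisson x y t)) \<le> norm (K * poisson x y t)"
      using bound K poisson_nonneg[OF y, of x]
      by (intro AE_I2) (auto simp: norm_mult intro!: mult_right_mono)
  qed measurable
  have intc: "integrable lborel (\<lambda>t. g z * complex_of_real (poisson x y t))"
    using P by (intro integrable_mult_right integrable_of_real)
  have "integrable lborel (\<lambda>t. h (complex_of_real t))"
    unfolding h_real left_diff_distrib
    by (rule integrable_mult_right, rule Bochner_Integration.integrable_diff[OF intg intc])
  hence "(\<integral>t. h (complex_of_real t) \<partial>lborel) = 0"
  proof (rule halfplane_integral_zero[OF h_cont _ h_decay, rotated -1])
    fix w assume w: "Im w > 0" "w \<noteq> z"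
    have "(\<lambda>w. (g w - g z) / (w - z) * (2 * \<i> * of_real y / (w - cnj z))) field_differentiable at w"
      using w nz[of w] by (intro derivative_intros field_differentiable_mult field_differentiable_divide
        field_differentiable_diff holo field_differentiable_const field_differentiable_ident) auto
    moreover have "\<forall>\<^sub>F v in nhds w. (g v - g z) / (v - z) * (2 * \<i> * of_real y / (v - cnj z)) = h v"
    proof -
      have "\<forall>\<^sub>F v in nhds w. v \<noteq> z" using w(2) by (rule t1_space_nhds)
      thus ?thesis by eventually_elim (simp add: h_def dq_def)
    qed
    ultimately show "h field_differentiable at w"
      unfolding field_differentiable_def using DERIV_cong_ev[OF refl _ refl, of _ h w] by metis
  qed
  hence "(\<integral>t. (g (of_real t) - g z) * complex_of_real (poisson x y t) \<partial>lborel) = 0"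
    unfolding h_real by simp
  hence "(\<integral>t. g (of_real t) * complex_of_real (poisson x y t) \<partial>lborel) = (\<integral>t. g z * complex_of_real (poisson x y t) \<partial>lborel)"
    unfolding left_diff_distrib using intg intc by simp
  also have "\<dots> = g z * of_real pi"
    using P by (simp add: integral_of_real)
  finally have eq: "(\<integral>t. g (of_real t) * complex_of_real (poisson x y t) \<partial>lborel) = g z * of_real pi" .
  have Im_eq: "Im (g (of_real t)) * poisson x y t = Im (g (of_real t) * complex_of_real (poisson x y t))" for t
    by simp
  show "integrable lborel (\<lambda>t. Im (g (complex_of_real t)) * poisson x y t)"
    unfolding Im_eq using intg by (rule integrable_Im)
  have "(\<integral>t. Im (g (of_real t) * complex_of_real (poisson x y t)) \<partial>lborel) = Im (\<integral>t. g (of_real t) * complex_of_real (poisson x y t) \<partial>lborel)"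
    using intg by (rule integral_Im)
  thus "(\<integral>t. Im (g (complex_of_real t)) * poisson x y t \<partial>lborel) = pi * Im (g (Complex x y))"
    unfolding Im_eq eq z_def by simp
qed

section \<open>Limits of vectors and of rational functions along vertical lines\<close>

lemma tendsto_inner:
  fixes X :: "'b \<Rightarrow> complex vec" and r :: "complex vec"
  assumes "\<And>i. i < n \<Longrightarrow> ((\<lambda>e. X e $ i) \<longlongrightarrow> r $ i) Fl" "\<And>e. X e \<in> carrier_vec n"
    "r \<in> carrier_vec n" "w \<in> carrier_vec n"
  shows "((\<lambda>e. X e \<bullet>c w) \<longlongrightarrow> r \<bullet>c w) Fl"
proof -
  have eq: "v \<bullet>c w = (\<Sum>i<n. v $ i * cnj (w $ i))" for v
    using assms(4) by (auto simp: scalar_prod_def atLeast0LessThan)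
  show ?thesis unfolding eq by (intro tendsto_sum tendsto_mult tendsto_const assms(1)) auto
qed

lemma tendsto_mult_mat_vec:
  fixes X :: "'b \<Rightarrow> complex vec" and r :: "complex vec"
  assumes "\<And>i. i < m \<Longrightarrow> ((\<lambda>e. X e $ i) \<longlongrightarrow> r $ i) Fl" "\<And>e. X e \<in> carrier_vec m"
    "r \<in> carrier_vec m" "B \<in> carrier_mat n m" "i < n"
  shows "((\<lambda>e. (B *\<^sub>v X e) $ i) \<longlongrightarrow> (B *\<^sub>v r) $ i) Fl"
proof -
  have eq: "(B *\<^sub>v v) $ i = (\<Sum>j<m. B $$ (i, j) * v $ j)" if "v \<in> carrier_vec m" for v
    using assms(4,5) that by (auto simp: scalar_prod_def atLeast0LessThan)
  show ?thesis unfolding eq[OF assms(2)] eq[OF assms(3)]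
    by (intro tendsto_sum tendsto_mult tendsto_const assms(1)) auto
qed

lemma vertical_path: "((\<lambda>e. z + \<i> * complex_of_real e) \<longlongrightarrow> z) (at_right 0)"
  by (rule tendsto_eq_intros refl | simp)+

lemma vertical_path_rational:
  assumes "poly b z \<noteq> (0::complex)"
  shows "((\<lambda>e. poly a (z + \<i> * complex_of_real e) / poly b (z + \<i> * complex_of_real e)) \<longlongrightarrow> poly a z / poly b z) (at_right 0)"
  by (intro tendsto_divide isCont_tendsto_compose[OF _ vertical_path] assms) simp_all

lemma hermitian_inner_real:
  fixes H :: "complex mat"
  assumes "H \<in> carrier_mat n n" "mat_adjoint H = H" "v \<in> carrier_vec n"
  shows "Im ((H *\<^sub>v v) \<bullet>c v) = 0"
proof -
  have "(H *\<^sub>v v) \<bullet>c v = v \<bullet>c (H *\<^sub>v v)" using inner_adjoint[of H n n v v] assms by simp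
  also have "\<dots> = cnj ((H *\<^sub>v v) \<bullet>c v)" using assms by (intro inner_commute) auto
  finally show ?thesis by (metis Reals_cnj_iff complex_is_Real_iff)
qed

section \<open>Dissipative perturbations of Hermitian matrices\<close>

locale dissipative =
  fixes H P :: "complex mat" and n r :: nat
  assumes H: "H \<in> carrier_mat n n" and P: "P \<in> carrier_mat n r" and herm: "mat_adjoint H = H"
begin

definition A :: "complex mat" where
  "A = H - \<i> \<cdot>\<^sub>m (P * mat_adjoint P)"

lemma A_carrier [simp]: "A \<in> carrier_mat n n"
  unfolding A_def using H P by (intro minus_carrier_mat smult_carrier_mat mult_carrier_mat) auto

lemma mult_vec_carriers [simp]:
  "mat_adjoint P *\<^sub>v v \<in> carrier_vec r" "P *\<^sub>v v \<in> carrier_vec n" "H *\<^sub>v v \<in> carrier_vec n"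
  "A *\<^sub>v v \<in> carrier_vec n" "shifted A z *\<^sub>v v \<in> carrier_vec n"
  using H P carrier_matD[OF A_carrier] carrier_matD[OF shifted_carrier[OF A_carrier, of z]]
  by (auto intro!: carrier_vecI)

lemma A_mult_vec:
  assumes v: "v \<in> carrier_vec n"
  shows "A *\<^sub>v v = H *\<^sub>v v - \<i> \<cdot>\<^sub>v (P *\<^sub>v (mat_adjoint P *\<^sub>v v))"
proof -
  have PP: "P * mat_adjoint P \<in> carrier_mat n n" using P by (intro mult_carrier_mat) auto
  have "(\<i> \<cdot>\<^sub>m (P * mat_adjoint P)) *\<^sub>v v = \<i> \<cdot>\<^sub>v ((P * mat_adjoint P) *\<^sub>v v)"
    using PP v by (intro eq_vecI) auto
  also have "(P * mat_adjoint P) *\<^sub>v v = P *\<^sub>v (mat_adjoint P *\<^sub>v v)"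
    using P v by (intro assoc_mult_mat_vec) auto
  finally show ?thesis unfolding A_def using H PP v by (subst minus_mult_distrib_mat_vec[of _ n n]) auto
qed

lemma inner_A:
  assumes v: "v \<in> carrier_vec n" and w: "w \<in> carrier_vec n"
  shows "(A *\<^sub>v v) \<bullet>c w = (H *\<^sub>v v) \<bullet>c w - \<i> * ((mat_adjoint P *\<^sub>v v) \<bullet>c (mat_adjoint P *\<^sub>v w))"
proof -
  have "(A *\<^sub>v v) \<bullet>c w = (H *\<^sub>v v) \<bullet>c w - \<i> * ((P *\<^sub>v (mat_adjoint P *\<^sub>v v)) \<bullet>c w)"
    unfolding A_mult_vec[OF v] using w by (simp add: inner_diff_left[of _ n] inner_smult_left[of _ n])
  also have "(P *\<^sub>v (mat_adjoint P *\<^sub>v v)) \<bullet>c w = (mat_adjoint P *\<^sub>v v) \<bullet>c (mat_adjoint P *\<^sub>v w)"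
    using P w by (intro inner_adjoint) auto
  finally show ?thesis .
qed

text \<open>The source of all estimates for A. For Im z > 0 both terms have the same sign, which
  gives invertibility and the resolvent bound. For real z only the boundary term survives, so a
  kernel vector of A - z must be annihilated by the adjoint of P and is then an eigenvector of
  H.\<close>

lemma Im_inner_shifted:
  assumes v: "v \<in> carrier_vec n"
  shows "Im ((shifted A z *\<^sub>v v) \<bullet>c v) = - (cvec_norm (mat_adjoint P *\<^sub>v v))\<^sup>2 - Im z * (cvec_norm v)\<^sup>2"
proof -
  have "(shifted A z *\<^sub>v v) \<bullet>c v = (A *\<^sub>v v) \<bullet>c v - z * (v \<bullet>c v)"
    using v H by (simp add: shifted_mult_vec[of _ n] inner_diff_left[of _ n] mult_mat_vec_carrier[of _ n n])
  thus ?thesis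
    using hermitian_inner_real[OF H herm v] by (simp add: inner_A[OF v v] inner_self del: of_real_power)
qed

lemma shifted_lower_bound:
  assumes v: "v \<in> carrier_vec n"
  shows "Im z * cvec_norm v \<le> cvec_norm (shifted A z *\<^sub>v v)"
proof (cases "cvec_norm v = 0")
  case False
  hence pos: "cvec_norm v > 0" by (simp add: less_le)
  have sv: "shifted A z *\<^sub>v v \<in> carrier_vec n" using v by (intro mult_mat_vec_carrier[of _ n n]) auto
  have "Im z * (cvec_norm v)\<^sup>2 \<le> - Im ((shifted A z *\<^sub>v v) \<bullet>c v)"
    unfolding Im_inner_shifted[OF v] by simp
  also have "\<dots> \<le> cmod ((shifted A z *\<^sub>v v) \<bullet>c v)"
    using abs_Im_le_cmod[of "(shifted A z *\<^sub>v v) \<bullet>c v"] by linarith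
  also have "\<dots> \<le> cvec_norm (shifted A z *\<^sub>v v) * cvec_norm v" by (rule inner_Cauchy_Schwarz[OF sv v])
  finally show ?thesis using pos by (simp add: power2_eq_square)
qed simp

lemma det_shifted_nonzero: "Im z > 0 \<Longrightarrow> det (shifted A z) \<noteq> 0"
proof
  assume z: "Im z > 0" and "det (shifted A z) = 0"
  then obtain v where v: "v \<in> carrier_vec n" "v \<noteq> 0\<^sub>v n" "shifted A z *\<^sub>v v = 0\<^sub>v n"
    using det_0_iff_vec_prod_zero[of "shifted A z" n] by auto
  have "cvec_norm (0\<^sub>v n) = 0" using cvec_norm_eq_0[of "0\<^sub>v n" n] by simp
  hence "cvec_norm v \<le> 0"
    using shifted_lower_bound[OF v(1), of z] v(3) z by (simp add: mult_le_0_iff)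
  thus False using v cvec_norm_eq_0[OF v(1)] cvec_norm_nonneg[of v] by linarith
qed

definition eig :: "complex \<Rightarrow> complex vec set" where
  "eig t = {e \<in> carrier_vec n. H *\<^sub>v e = t \<cdot>\<^sub>v e \<and> mat_adjoint P *\<^sub>v e = 0\<^sub>v r}"

lemma eigI:
  assumes v: "v \<in> carrier_vec n" and "shifted A (complex_of_real t) *\<^sub>v v = 0\<^sub>v n"
  shows "v \<in> eig (complex_of_real t)"
proof -
  have "0\<^sub>v n \<bullet>c v = (0::complex)" using v by (intro scalar_prod_left_zero) auto
  hence "(cvec_norm (mat_adjoint P *\<^sub>v v))\<^sup>2 = 0"
    using Im_inner_shifted[OF v, of "complex_of_real t"] assms(2) by simp
  hence P0: "mat_adjoint P *\<^sub>v v = 0\<^sub>v r"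
    using cvec_norm_eq_0[of "mat_adjoint P *\<^sub>v v" r] P v by auto
  have Av: "A *\<^sub>v v = H *\<^sub>v v"
    unfolding A_mult_vec[OF v] P0 using H P v by (intro eq_vecI) auto
  have d: "H *\<^sub>v v - complex_of_real t \<cdot>\<^sub>v v = 0\<^sub>v n"
    using assms(2) v by (simp add: shifted_mult_vec[of _ n] Av)
  have "H *\<^sub>v v = complex_of_real t \<cdot>\<^sub>v v"
  proof (rule eq_vecI)
    fix i assume "i < dim_vec (complex_of_real t \<cdot>\<^sub>v v)"
    hence i: "i < n" using v by simp
    have "(H *\<^sub>v v - complex_of_real t \<cdot>\<^sub>v v) $ i = 0" unfolding d using i by simp
    thus "(H *\<^sub>v v) $ i = (complex_of_real t \<cdot>\<^sub>v v) $ i" using i v H by simp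
  qed (use H v in auto)
  thus ?thesis using v P0 by (simp add: eig_def)
qed

text \<open>Members of \<open>eig\<close> are eigenvectors of the adjoint of A as well, since the
  dissipative term vanishes on them from either side. This makes up for A not being normal in
  general.\<close>

lemma inner_shifted_eig:
  assumes v: "v \<in> carrier_vec n" and e: "e \<in> eig (complex_of_real t)"
  shows "(shifted A z *\<^sub>v v) \<bullet>c e = (complex_of_real t - z) * (v \<bullet>c e)"
proof -
  have e': "e \<in> carrier_vec n" "H *\<^sub>v e = complex_of_real t \<cdot>\<^sub>v e" "mat_adjoint P *\<^sub>v e = 0\<^sub>v r"
    using e by (auto simp: eig_def)
  have "(H *\<^sub>v v) \<bullet>c e = v \<bullet>c (H *\<^sub>v e)" using inner_adjoint[of H n n v e] H herm v e' by simp
  also have "\<dots> = complex_of_real t * (v \<bullet>c e)" using v e' by (simp add: inner_smult_right[of _ n])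
  finally have "(A *\<^sub>v v) \<bullet>c e = complex_of_real t * (v \<bullet>c e)"
    unfolding inner_A[OF v e'(1)] e'(3) by simp
  thus ?thesis
    using v e' by (simp add: shifted_mult_vec[of _ n] inner_diff_left[of _ n] mult_mat_vec_carrier[of _ n n] algebra_simps)
qed

context
  fixes u :: "complex vec"
  assumes u: "u \<in> carrier_vec n"
begin

definition F :: "complex \<Rightarrow> complex" where
  "F z = (resolvent A z *\<^sub>v u) \<bullet>c u"

lemma resolvent_vec_carrier [simp]: "resolvent A z *\<^sub>v u \<in> carrier_vec n"
  using u by (intro mult_mat_vec_carrier[of _ n n]) auto

lemma Im_F:
  assumes "det (shifted A z) \<noteq> 0"
  shows "Im (F z) = (cvec_norm (mat_adjoint P *\<^sub>v (resolvent A z *\<^sub>v u)))\<^sup>2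
    + Im z * (cvec_norm (resolvent A z *\<^sub>v u))\<^sup>2"
proof -
  let ?v = "resolvent A z *\<^sub>v u"
  have "u = shifted A z *\<^sub>v ?v" using resolvent_solves[OF A_carrier assms u] by simp
  hence "F z = ?v \<bullet>c (shifted A z *\<^sub>v ?v)" by (simp add: F_def)
  also have "\<dots> = cnj ((shifted A z *\<^sub>v ?v) \<bullet>c ?v)"
    by (intro inner_commute[of _ n]) (auto simp: u)
  finally show ?thesis using Im_inner_shifted[of ?v z] by simp
qed

lemma resolvent_bound:
  assumes "Im z > 0"
  shows "cvec_norm (resolvent A z *\<^sub>v u) \<le> cvec_norm u / Im z"
  using shifted_lower_bound[of "resolvent A z *\<^sub>v u" z] assms
    resolvent_solves[OF A_carrier det_shifted_nonzero[OF assms] u]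
  by (simp add: pos_le_divide_eq mult.commute)

lemma F_bound:
  assumes "Im z > 0"
  shows "cmod (F z) \<le> (cvec_norm u)\<^sup>2 / Im z"
proof -
  have "cmod (F z) \<le> cvec_norm (resolvent A z *\<^sub>v u) * cvec_norm u"
    unfolding F_def by (rule inner_Cauchy_Schwarz[OF _ u]) simp
  also have "\<dots> \<le> (cvec_norm u / Im z) * cvec_norm u"
    by (intro mult_right_mono resolvent_bound assms) simp
  finally show ?thesis by (simp add: power2_eq_square)
qed

text \<open>As A need not be normal, the residue cannot be read off from an orthogonal eigenbasis.
  The vectors v \<epsilon> are bounded by the norm of u and have rational components, so they
  converge to some s in the kernel of A - t. Their pairing with an eigenvector does not depend on
  \<epsilon>, which identifies -s as the orthogonal projection of u.\<close>

lemma residue_at_real_point: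
  fixes t :: real
  obtains p where "p \<in> eig t" "\<And>e. e \<in> eig t \<Longrightarrow> (u - p) \<bullet>c e = 0"
    "((\<lambda>\<epsilon>. \<i> * of_real \<epsilon> * F (t + \<i> * of_real \<epsilon>)) \<longlongrightarrow> - complex_of_real ((cvec_norm p)\<^sup>2)) (at_right 0)"
proof -
  define v where "v \<epsilon> = (\<i> * complex_of_real \<epsilon>) \<cdot>\<^sub>v (resolvent A (t + \<i> * of_real \<epsilon>) *\<^sub>v u)" for \<epsilon>
  have vc [simp]: "v \<epsilon> \<in> carrier_vec n" for \<epsilon> unfolding v_def by auto
  obtain q where q: "\<And>z. det (shifted A z) = poly q z"
    using polyfun_det_shifted[OF A_carrier] unfolding polyfun_def by blast
  have q_upper: "poly q z \<noteq> 0" if "Im z > 0" for z using det_shifted_nonzero[OF that] q by simp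
  have q0: "q \<noteq> 0" using q_upper[of \<i>] by auto
  have v_bound: "cvec_norm (v \<epsilon>) \<le> cvec_norm u" if "\<epsilon> > 0" for \<epsilon>
  proof -
    have "cvec_norm (v \<epsilon>) = \<epsilon> * cvec_norm (resolvent A (t + \<i> * of_real \<epsilon>) *\<^sub>v u)"
      unfolding v_def cvec_norm_def using that
      by (simp add: norm_mult power_mult_distrib sum_distrib_left[symmetric] real_sqrt_mult)
    also have "\<dots> \<le> \<epsilon> * (cvec_norm u / \<epsilon>)"
      using resolvent_bound[of "t + \<i> * of_real \<epsilon>"] that by (intro mult_left_mono) auto
    finally show ?thesis using that by simp
  qed
  have ev_pos: "\<forall>\<^sub>F \<epsilon> in at_right 0. \<epsilon> > (0::real)" by (rule eventually_at_right_less)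
  have "\<exists>l. ((\<lambda>\<epsilon>. v \<epsilon> $ i) \<longlongrightarrow> l) (at_right 0)" if i: "i < n" for i
  proof -
    obtain pp where pp: "\<And>z. (resolvent A z *\<^sub>v u) \<bullet>c unit_vec n i = poly pp z / det (shifted A z)"
      using polyfun_resolvent_inner[OF A_carrier u, of "unit_vec n i"] by auto
    have comp: "(resolvent A z *\<^sub>v u) $ i = poly pp z / poly q z" for z
    proof -
      have "conjugate (unit_vec n i) = (unit_vec n i :: complex vec)" by (intro eq_vecI) (auto simp: unit_vec_def)
      thus ?thesis using pp[of z] i by (simp add: q)
    qed
    \<comment> \<open>On the line z = t + i \<epsilon> the factor i \<epsilon> is z - t, so it
      becomes a linear polynomial factor.\<close>
    define a where "a = [:- complex_of_real t, 1:] * pp"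
    have v_eq: "v \<epsilon> $ i = poly a (t + \<i> * of_real \<epsilon>) / poly q (t + \<i> * of_real \<epsilon>)" for \<epsilon>
    proof -
      have "v \<epsilon> $ i = \<i> * of_real \<epsilon> * (resolvent A (t + \<i> * of_real \<epsilon>) *\<^sub>v u) $ i"
        unfolding v_def by (rule index_smult_vec) (use i carrier_vecD[OF resolvent_vec_carrier] in auto)
      thus ?thesis unfolding comp by (simp add: a_def algebra_simps)
    qed
    have "\<exists>a' b'. a * b' = a' * q \<and> (\<forall>z\<in>{complex_of_real t}. poly b' z \<noteq> 0) \<and> b' \<noteq> 0"
    proof (rule cancel_poles[OF q0])
      fix z0 assume "z0 \<in> {complex_of_real t}"
      hence z0: "z0 = complex_of_real t" by simp
      have "((\<lambda>\<epsilon>. \<i> * of_real \<epsilon> * v \<epsilon> $ i) \<longlongrightarrow> 0) (at_right 0)"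
      proof (rule Lim_null_comparison)
        show "\<forall>\<^sub>F \<epsilon> in at_right 0. norm (\<i> * of_real \<epsilon> * v \<epsilon> $ i) \<le> \<epsilon> * cvec_norm u"
          using ev_pos
        proof eventually_elim
          case (elim \<epsilon>)
          have "cmod (v \<epsilon> $ i) \<le> cvec_norm u"
            using cmod_le_cvec_norm[of i "v \<epsilon>"] i v_bound[OF elim] carrier_vecD[OF vc[of \<epsilon>]] by simp
          thus ?case using elim by (simp add: norm_mult)
        qed
        show "((\<lambda>\<epsilon>. \<epsilon> * cvec_norm u) \<longlongrightarrow> 0) (at_right 0)"
          by (rule tendsto_eq_intros refl | simp)+
      qed
      thus "((\<lambda>e. \<i> * of_real e * (poly a (z0 + \<i> * of_real e) / poly q (z0 + \<i> * of_real e))) \<longlongrightarrow> 0) (at_right 0)"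
        unfolding v_eq z0 .
    qed
    then obtain a' b' where ab: "a * b' = a' * q" "poly b' (complex_of_real t) \<noteq> 0" by auto
    have "\<forall>\<^sub>F \<epsilon> in at_right 0. poly b' (complex_of_real t + \<i> * of_real \<epsilon>) \<noteq> 0"
    proof (rule tendsto_imp_eventually_ne[OF _ ab(2)])
      show "((\<lambda>\<epsilon>. poly b' (complex_of_real t + \<i> * of_real \<epsilon>)) \<longlongrightarrow> poly b' (complex_of_real t)) (at_right 0)"
        by (rule isCont_tendsto_compose[OF _ vertical_path]) simp
    qed
    hence "\<forall>\<^sub>F \<epsilon> in at_right 0. poly a' (complex_of_real t + \<i> * of_real \<epsilon>) / poly b' (complex_of_real t + \<i> * of_real \<epsilon>) = v \<epsilon> $ i"
      using ev_pos
    proof eventually_elim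
      case (elim \<epsilon>)
      have "poly (a * b') (complex_of_real t + \<i> * of_real \<epsilon>) = poly (a' * q) (complex_of_real t + \<i> * of_real \<epsilon>)"
        by (simp only: ab(1))
      thus ?case unfolding v_eq using elim q_upper[of "complex_of_real t + \<i> * of_real \<epsilon>"] by (simp add: frac_eq_eq)
    qed
    from Lim_transform_eventually[OF vertical_path_rational[OF ab(2)] this] show ?thesis by blast
  qed
  then obtain L where L: "\<And>i. i < n \<Longrightarrow> ((\<lambda>\<epsilon>. v \<epsilon> $ i) \<longlongrightarrow> L i) (at_right 0)" by metis
  define s where "s = vec n L"
  have sc [simp]: "s \<in> carrier_vec n" by (simp add: s_def)
  have lim: "((\<lambda>\<epsilon>. v \<epsilon> $ i) \<longlongrightarrow> s $ i) (at_right 0)" if "i < n" for i using L[OF that] that by (simp add: s_def)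
  have resol: "shifted A (t + \<i> * of_real \<epsilon>) *\<^sub>v v \<epsilon> = (\<i> * complex_of_real \<epsilon>) \<cdot>\<^sub>v u" if "\<epsilon> > 0" for \<epsilon>
  proof -
    have "det (shifted A (t + \<i> * of_real \<epsilon>)) \<noteq> 0" using that by (intro det_shifted_nonzero) simp
    thus ?thesis unfolding v_def
      using resolvent_solves[OF A_carrier _ u] by (subst mult_mat_vec[of _ n n]) auto
  qed
  have "shifted A t *\<^sub>v s = 0\<^sub>v n"
  proof (rule eq_vecI)
    fix i assume "i < dim_vec (0\<^sub>v n :: complex vec)"
    hence i: "i < n" by simp
    have l1: "((\<lambda>\<epsilon>. (shifted A t *\<^sub>v v \<epsilon>) $ i) \<longlongrightarrow> (shifted A t *\<^sub>v s) $ i) (at_right 0)"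
      by (rule tendsto_mult_mat_vec[of n, where n = n]) (auto intro: lim i)
    have l2: "((\<lambda>\<epsilon>. \<i> * complex_of_real \<epsilon> * u $ i + \<i> * complex_of_real \<epsilon> * v \<epsilon> $ i) \<longlongrightarrow>
        \<i> * complex_of_real 0 * u $ i + \<i> * complex_of_real 0 * s $ i) (at_right 0)"
      by (intro tendsto_intros lim i)
    have ev: "\<forall>\<^sub>F \<epsilon> in at_right 0. (shifted A t *\<^sub>v v \<epsilon>) $ i = \<i> * complex_of_real \<epsilon> * u $ i + \<i> * complex_of_real \<epsilon> * v \<epsilon> $ i"
      using ev_pos
    proof eventually_elim
      case (elim \<epsilon>)
      have Av: "A *\<^sub>v v \<epsilon> \<in> carrier_vec n" by (intro mult_mat_vec_carrier[of _ n n]) auto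
      have "(shifted A (t + \<i> * of_real \<epsilon>) *\<^sub>v v \<epsilon>) $ i = \<i> * complex_of_real \<epsilon> * u $ i"
        unfolding resol[OF elim] using i u by simp
      moreover have sh: "(shifted A z *\<^sub>v v \<epsilon>) $ i = (A *\<^sub>v v \<epsilon>) $ i - z * v \<epsilon> $ i" for z
      proof -
        have d: "i < dim_vec (v \<epsilon>)" using i unfolding carrier_vecD[OF vc[of \<epsilon>]] .
        show ?thesis unfolding shifted_mult_vec[OF A_carrier vc]
          using d by (subst index_minus_vec(1)) (simp_all del: index_mult_mat_vec)
      qed
      ultimately show ?case unfolding sh by (simp add: algebra_simps del: index_mult_mat_vec)
    qed
    have "(shifted A t *\<^sub>v s) $ i = \<i> * complex_of_real 0 * u $ i + \<i> * complex_of_real 0 * s $ i"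
      by (rule tendsto_unique[OF trivial_limit_at_right_real l1 iffD2[OF tendsto_cong[OF ev] l2]])
    thus "(shifted A t *\<^sub>v s) $ i = 0\<^sub>v n $ i" using i by simp
  qed (simp add: carrier_matD(1)[OF shifted_carrier[OF A_carrier]])
  hence s_eig: "s \<in> eig t" by (intro eigI) auto
  \<comment> \<open>Pairing the equation for v \<epsilon> with e replaces A by the number t; the
    factor i \<epsilon> then cancels, and only a sign remains.\<close>
  have s_inner: "s \<bullet>c e = - (u \<bullet>c e)" if e: "e \<in> eig t" for e
  proof -
    have e': "e \<in> carrier_vec n" using e by (simp add: eig_def)
    have "((\<lambda>\<epsilon>. v \<epsilon> \<bullet>c e) \<longlongrightarrow> s \<bullet>c e) (at_right 0)"
      by (rule tendsto_inner[of n]) (auto intro: lim e')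
    moreover have "\<forall>\<^sub>F \<epsilon> in at_right 0. v \<epsilon> \<bullet>c e = - (u \<bullet>c e)"
      using ev_pos
    proof eventually_elim
      case (elim \<epsilon>)
      have "(complex_of_real t - (t + \<i> * of_real \<epsilon>)) * (v \<epsilon> \<bullet>c e) = \<i> * complex_of_real \<epsilon> * (u \<bullet>c e)"
        unfolding inner_shifted_eig[OF vc e, symmetric] resol[OF elim]
        using u e' by (simp add: inner_smult_left[of _ n])
      hence m: "- (\<i> * complex_of_real \<epsilon> * (v \<epsilon> \<bullet>c e)) = \<i> * complex_of_real \<epsilon> * (u \<bullet>c e)"
        by (simp add: algebra_simps)
      have "\<i> * complex_of_real \<epsilon> * (v \<epsilon> \<bullet>c e) = \<i> * complex_of_real \<epsilon> * (- (u \<bullet>c e))"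
        using arg_cong[OF m, of uminus] by simp
      thus ?case using elim by (subst (asm) mult_cancel_left) auto
    qed
    ultimately have "((\<lambda>\<epsilon>. - (u \<bullet>c e)) \<longlongrightarrow> s \<bullet>c e) (at_right (0::real))"
      by (simp add: tendsto_cong)
    from tendsto_unique[OF trivial_limit_at_right_real this tendsto_const] show ?thesis .
  qed
  define p where "p = (-1) \<cdot>\<^sub>v s"
  have pc: "p \<in> carrier_vec n" by (simp add: p_def)
  have p_eig: "p \<in> eig t"
    using s_eig H P unfolding eig_def p_def
    by (auto simp: mult_mat_vec[of _ n n] mult_mat_vec[of _ r n] smult_smult_assoc mult.commute intro!: eq_vecI)
  have p_inner: "p \<bullet>c e = u \<bullet>c e" if "e \<in> eig t" for e
    using s_inner[OF that] that by (simp add: p_def inner_smult_left[of _ n] eig_def)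
  have orth: "(u - p) \<bullet>c e = 0" if "e \<in> eig t" for e
    using p_inner[OF that] that pc u by (simp add: inner_diff_left[of _ n] eig_def)
  have "((\<lambda>\<epsilon>. v \<epsilon> \<bullet>c u) \<longlongrightarrow> s \<bullet>c u) (at_right 0)"
    by (rule tendsto_inner[of n]) (auto intro: lim u)
  moreover have "v \<epsilon> \<bullet>c u = \<i> * of_real \<epsilon> * F (t + \<i> * of_real \<epsilon>)" for \<epsilon>
    unfolding v_def F_def using u by (simp add: inner_smult_left[of _ n])
  moreover have "s \<bullet>c u = - complex_of_real ((cvec_norm p)\<^sup>2)"
  proof -
    have "u \<bullet>c p = complex_of_real ((cvec_norm p)\<^sup>2)"
      using p_inner[OF p_eig] by (simp only: inner_self)
    hence "p \<bullet>c u = complex_of_real ((cvec_norm p)\<^sup>2)"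
      using inner_commute[OF u pc] by (simp del: of_real_power)
    moreover have "p \<bullet>c u = - (s \<bullet>c u)" using u by (simp add: p_def inner_smult_left[of _ n])
    ultimately show ?thesis by (metis minus_minus)
  qed
  ultimately show thesis using that[OF p_eig orth] by simp
qed

text \<open>\<open>F_bound\<close> degenerates at the real axis. For |z| at least C + 1, with C a
  bound for A, pairing the resolvent equation with its solution v bounds the norm of v by that of u
  whatever the size of Im z.\<close>

lemma F_bounded_at_infinity:
  obtains K R where "R > 0" "\<And>z. Im z > 0 \<Longrightarrow> cmod z \<ge> R \<Longrightarrow> cmod (F z) \<le> K"
proof -
  obtain C where C: "C \<ge> 0" "\<And>v. v \<in> carrier_vec n \<Longrightarrow> cvec_norm (A *\<^sub>v v) \<le> C * cvec_norm v"
    using cvec_norm_mult_mat_le[OF A_carrier] by blast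
  have "cmod (F z) \<le> (cvec_norm u)\<^sup>2" if z: "Im z > 0" "cmod z \<ge> C + 1" for z
  proof -
    define v where "v = resolvent A z *\<^sub>v u"
    have v: "v \<in> carrier_vec n" by (simp add: v_def)
    have "A *\<^sub>v v - z \<cdot>\<^sub>v v = u"
      using resolvent_solves[OF A_carrier det_shifted_nonzero[OF z(1)] u] v
      by (simp add: shifted_mult_vec[OF A_carrier] v_def)
    hence "u \<bullet>c v = (A *\<^sub>v v) \<bullet>c v - z * (v \<bullet>c v)"
      using v by (metis inner_diff_left inner_smult_left mult_vec_carriers(4) smult_carrier_vec)
    hence "z * complex_of_real ((cvec_norm v)\<^sup>2) = (A *\<^sub>v v) \<bullet>c v - u \<bullet>c v" by (simp add: inner_self)
    hence "cmod z * (cvec_norm v)\<^sup>2 = cmod ((A *\<^sub>v v) \<bullet>c v - u \<bullet>c v)"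
      by (metis abs_of_nonneg norm_mult norm_of_real zero_le_power2)
    also have "\<dots> \<le> cmod ((A *\<^sub>v v) \<bullet>c v) + cmod (u \<bullet>c v)" by (rule norm_triangle_ineq4)
    also have "\<dots> \<le> C * cvec_norm v * cvec_norm v + cvec_norm u * cvec_norm v"
    proof (rule add_mono)
      have "cmod ((A *\<^sub>v v) \<bullet>c v) \<le> cvec_norm (A *\<^sub>v v) * cvec_norm v"
        by (rule inner_Cauchy_Schwarz[OF _ v]) simp
      also have "\<dots> \<le> C * cvec_norm v * cvec_norm v" using C(2)[OF v] by (intro mult_right_mono) auto
      finally show "cmod ((A *\<^sub>v v) \<bullet>c v) \<le> C * cvec_norm v * cvec_norm v" .
    qed (rule inner_Cauchy_Schwarz[OF u v])
    finally have "(cmod z - C) * (cvec_norm v)\<^sup>2 \<le> cvec_norm u * cvec_norm v"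
      by (simp add: algebra_simps power2_eq_square)
    moreover have "1 * (cvec_norm v)\<^sup>2 \<le> (cmod z - C) * (cvec_norm v)\<^sup>2"
      using z(2) by (intro mult_right_mono) auto
    ultimately have "cvec_norm v * cvec_norm v \<le> cvec_norm u * cvec_norm v" by (simp add: power2_eq_square)
    hence "cvec_norm v \<le> cvec_norm u"
      by (cases "cvec_norm v = 0") (auto simp: mult_le_cancel_right less_le)
    hence "cvec_norm v * cvec_norm u \<le> (cvec_norm u)\<^sup>2" by (simp add: power2_eq_square mult_right_mono)
    moreover have "cmod (F z) \<le> cvec_norm v * cvec_norm u"
      unfolding F_def v_def by (rule inner_Cauchy_Schwarz[OF _ u]) simp
    ultimately show ?thesis by simp
  qed
  thus thesis using that[of "C + 1"] C by auto
qed

lemma Im_cauchy_kernel: "Im (1 / (complex_of_real s - Complex x y)) = poisson x y s"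
  by (simp add: poisson_def Im_divide power2_eq_square)

text \<open>F may have real poles, so the half plane formula is applied to G, which is F minus its
  principal parts there. The poles are simple with known residues, hence G is continuous and bounded
  on the closed half plane, and the subtracted terms contribute Poisson kernels at the points of Z.
  The separate function g is needed because F takes the conventional value 0 on Z.\<close>

theorem finite_volume_poisson_formula:
  obtains Z pr g where "finite Z"
    "\<And>t. pr t \<in> eig (complex_of_real t)"
    "\<And>t e. e \<in> eig (complex_of_real t) \<Longrightarrow> (u - pr t) \<bullet>c e = 0"
    "\<And>t. t \<notin> Z \<Longrightarrow> det (shifted A (complex_of_real t)) \<noteq> 0 \<and> cvec_norm (pr t) = 0"
    "continuous_on UNIV g" "\<And>t. t \<notin> Z \<Longrightarrow> g t = Im (F (complex_of_real t))"
    "\<And>x y. y > 0 \<Longrightarrow> integrable lborel (\<lambda>t. g t * poisson x y t)"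
    "\<And>x y. y > 0 \<Longrightarrow> pi * Im (F (Complex x y)) =
       (\<integral>t. g t * poisson x y t \<partial>lborel) + pi * (\<Sum>s\<in>Z. (cvec_norm (pr s))\<^sup>2 * poisson x y s)"
proof -
  have "\<forall>t::real. \<exists>p. p \<in> eig t \<and> (\<forall>e. e \<in> eig t \<longrightarrow> (u - p) \<bullet>c e = 0) \<and>
    ((\<lambda>\<epsilon>. \<i> * of_real \<epsilon> * F (t + \<i> * of_real \<epsilon>)) \<longlongrightarrow> - complex_of_real ((cvec_norm p)\<^sup>2)) (at_right 0)"
    using residue_at_real_point by metis
  then obtain pr :: "real \<Rightarrow> complex vec" where pr': "\<forall>t::real. pr t \<in> eig t \<and> (\<forall>e. e \<in> eig t \<longrightarrow> (u - pr t) \<bullet>c e = 0) \<and>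
    ((\<lambda>\<epsilon>. \<i> * of_real \<epsilon> * F (t + \<i> * of_real \<epsilon>)) \<longlongrightarrow> - complex_of_real ((cvec_norm (pr t))\<^sup>2)) (at_right 0)"
    by (rule exE[OF choice])
  have pr: "\<And>t::real. pr t \<in> eig t" "\<And>t e. e \<in> eig (complex_of_real t) \<Longrightarrow> (u - pr t) \<bullet>c e = 0"
    "\<And>t. ((\<lambda>\<epsilon>. \<i> * of_real \<epsilon> * F (complex_of_real t + \<i> * of_real \<epsilon>)) \<longlongrightarrow> - complex_of_real ((cvec_norm (pr t))\<^sup>2)) (at_right 0)"
    using pr' by blast+
  obtain q where q: "\<And>z. det (shifted A z) = poly q z"
    using polyfun_det_shifted[OF A_carrier] unfolding polyfun_def by blast
  have q_upper: "poly q z \<noteq> 0" if "Im z > 0" for z using det_shifted_nonzero[OF that] q by simp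
  have q0: "q \<noteq> 0" using q_upper[of \<i>] by auto
  obtain p where p: "\<And>z. F z = poly p z / poly q z"
    using polyfun_resolvent_inner[OF A_carrier u u] unfolding F_def q by blast
  define Z where "Z = {t. poly q (complex_of_real t) = 0}"
  have "finite (complex_of_real -` {z. poly q z = 0})"
    by (rule finite_vimageI[OF poly_roots_finite[OF q0]]) (auto intro: injI)
  hence Z: "finite Z" by (simp add: Z_def vimage_def)
  have pr0: "cvec_norm (pr t) = 0" if "t \<notin> Z" for t
  proof -
    have "((\<lambda>\<epsilon>. \<i> * of_real \<epsilon> * F (complex_of_real t + \<i> * of_real \<epsilon>)) \<longlongrightarrow> \<i> * of_real 0 * (poly p t / poly q t)) (at_right 0)"
      unfolding p using that by (intro tendsto_mult tendsto_intros vertical_path_rational) (simp add: Z_def)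
    from tendsto_unique[OF trivial_limit_at_right_real pr(3)[of t] this] show ?thesis by simp
  qed
  define w where "w s = complex_of_real ((cvec_norm (pr s))\<^sup>2)" for s
  define D where "D = (\<Prod>s\<in>Z. [:complex_of_real s, -1:])"
  \<comment> \<open>P1 / Q1 is F minus the sum of \<open>w s / (s - z)\<close> over the common
    denominator q D. It is kept as a quotient of polynomials so that common zeros can be
    cancelled.\<close>
  define P1 where "P1 = p * D - q * (\<Sum>s\<in>Z. [:w s:] * (\<Prod>s'\<in>Z - {s}. [:complex_of_real s', -1:]))"
  define Q1 where "Q1 = q * D"
  have D0: "D \<noteq> 0" unfolding D_def by (simp add: Z)
  have Q10: "Q1 \<noteq> 0" using D0 q0 by (simp add: Q1_def)
  have polyD: "poly D z = (\<Prod>s\<in>Z. complex_of_real s - z)" for z by (simp add: D_def poly_prod)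
  have ratio: "poly P1 z / poly Q1 z = F z - (\<Sum>s\<in>Z. w s / (complex_of_real s - z))"
    if "poly q z \<noteq> 0" "\<And>s. s \<in> Z \<Longrightarrow> z \<noteq> complex_of_real s" for z
  proof -
    have Dz: "poly D z \<noteq> 0" using that(2) Z by (auto simp: polyD prod_zero_iff)
    have "w s * (\<Prod>s'\<in>Z - {s}. complex_of_real s' - z) = poly D z * (w s / (complex_of_real s - z))" if "s \<in> Z" for s
      unfolding polyD using \<open>\<And>s. s \<in> Z \<Longrightarrow> z \<noteq> complex_of_real s\<close>[OF that] prod.remove[OF Z that, of "\<lambda>s. complex_of_real s - z"] by simp
    hence "(\<Sum>s\<in>Z. w s * (\<Prod>s'\<in>Z - {s}. complex_of_real s' - z)) = poly D z * (\<Sum>s\<in>Z. w s / (complex_of_real s - z))"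
      by (simp add: sum_distrib_left)
    hence "poly P1 z = poly p z * poly D z - poly q z * (poly D z * (\<Sum>s\<in>Z. w s / (complex_of_real s - z)))"
      by (simp add: P1_def poly_sum poly_prod)
    thus ?thesis using Dz that(1) unfolding p Q1_def by (simp add: field_simps)
  qed
  have ratio_upper: "poly P1 z / poly Q1 z = F z - (\<Sum>s\<in>Z. w s / (complex_of_real s - z))" if "Im z > 0" for z
    using that by (intro ratio q_upper) auto
  have ev_pos: "\<forall>\<^sub>F \<epsilon> in at_right 0. \<epsilon> > (0::real)" by (rule eventually_at_right_less)
  \<comment> \<open>Above the real axis F is locally bounded; on it the limits for F and for the
    subtracted sum agree by the residue computation. Either way the quotient times i e tends to
    0.\<close>
  have "\<exists>a b. P1 * b = a * Q1 \<and> (\<forall>z\<in>{z. Im z \<ge> 0}. poly b z \<noteq> 0) \<and> b \<noteq> 0"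
  proof (rule cancel_poles[OF Q10])
    fix z0 assume "z0 \<in> {z. Im z \<ge> 0}"
    hence z0: "Im z0 \<ge> 0" by simp
    define wz where "wz = (\<Sum>s\<in>Z. if z0 = complex_of_real s then - w s else 0)"
    have summand: "((\<lambda>e. \<i> * of_real e * (w s / (complex_of_real s - (z0 + \<i> * of_real e)))) \<longlongrightarrow>
        (if z0 = complex_of_real s then - w s else 0)) (at_right 0)" for s
    proof (cases "z0 = complex_of_real s")
      case True
      have "\<forall>\<^sub>F e in at_right 0. - w s = \<i> * of_real e * (w s / (complex_of_real s - (z0 + \<i> * of_real e)))"
        using ev_pos by eventually_elim (simp add: True)
      from Lim_transform_eventually[OF tendsto_const this] show ?thesis by (simp add: True)
    next
      case False
      have "((\<lambda>e. \<i> * of_real e * (w s / (complex_of_real s - (z0 + \<i> * of_real e)))) \<longlongrightarrow>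
          \<i> * of_real 0 * (w s / (complex_of_real s - z0))) (at_right 0)"
        by (intro tendsto_mult tendsto_divide tendsto_intros vertical_path) (use False in auto)
      thus ?thesis using False by simp
    qed
    have sum: "((\<lambda>e. \<i> * of_real e * (\<Sum>s\<in>Z. w s / (complex_of_real s - (z0 + \<i> * of_real e)))) \<longlongrightarrow> wz) (at_right 0)"
      unfolding sum_distrib_left wz_def by (intro tendsto_sum summand)
    have Flim: "((\<lambda>e. \<i> * of_real e * F (z0 + \<i> * of_real e)) \<longlongrightarrow> wz) (at_right 0)"
    proof (cases "Im z0 > 0")
      case True
      have "wz = 0" unfolding wz_def by (rule sum.neutral) (use True in auto)
      moreover have "((\<lambda>e. \<i> * of_real e * F (z0 + \<i> * of_real e)) \<longlongrightarrow> 0) (at_right 0)"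
      proof (rule Lim_null_comparison)
        show "\<forall>\<^sub>F e in at_right 0. norm (\<i> * of_real e * F (z0 + \<i> * of_real e)) \<le> e * ((cvec_norm u)\<^sup>2 / Im z0)"
          using ev_pos
        proof eventually_elim
          case (elim e)
          have "cmod (F (z0 + \<i> * of_real e)) \<le> (cvec_norm u)\<^sup>2 / Im (z0 + \<i> * of_real e)"
            by (rule F_bound) (use True elim in simp)
          also have "\<dots> \<le> (cvec_norm u)\<^sup>2 / Im z0" using True elim by (intro divide_left_mono) auto
          finally have "cmod (F (z0 + \<i> * of_real e)) \<le> (cvec_norm u)\<^sup>2 / Im z0" .
          from mult_left_mono[OF this, of e] show ?case using elim by (simp add: norm_mult)
        qed
        show "((\<lambda>e. e * ((cvec_norm u)\<^sup>2 / Im z0)) \<longlongrightarrow> 0) (at_right 0)"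
          by (rule tendsto_eq_intros refl | simp)+
      qed
      ultimately show ?thesis by simp
    next
      case False
      then obtain t where t: "z0 = complex_of_real t" using z0 by (metis complex_eq_iff Im_complex_of_real Re_complex_of_real order_antisym_conv linorder_not_less)
      have "wz = (\<Sum>s\<in>Z. if s = t then - w s else 0)" unfolding wz_def t by (rule sum.cong) auto
      hence "wz = (if t \<in> Z then - w t else 0)" using Z by simp
      hence "wz = - w t" using pr0[of t] by (auto simp: w_def)
      thus ?thesis using pr(3)[of t] unfolding t by (simp add: w_def)
    qed
    have "((\<lambda>e. \<i> * of_real e * F (z0 + \<i> * of_real e) - \<i> * of_real e * (\<Sum>s\<in>Z. w s / (complex_of_real s - (z0 + \<i> * of_real e)))) \<longlongrightarrow> wz - wz) (at_right 0)"
      by (intro tendsto_diff Flim sum)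
    moreover have "\<forall>\<^sub>F e in at_right 0. \<i> * of_real e * F (z0 + \<i> * of_real e) - \<i> * of_real e * (\<Sum>s\<in>Z. w s / (complex_of_real s - (z0 + \<i> * of_real e)))
        = \<i> * of_real e * (poly P1 (z0 + \<i> * of_real e) / poly Q1 (z0 + \<i> * of_real e))"
      using ev_pos
    proof eventually_elim
      case (elim e)
      show ?case by (subst ratio_upper) (use z0 elim in \<open>simp_all add: right_diff_distrib\<close>)
    qed
    ultimately show "((\<lambda>e. \<i> * of_real e * (poly P1 (z0 + \<i> * of_real e) / poly Q1 (z0 + \<i> * of_real e))) \<longlongrightarrow> 0) (at_right 0)"
      using Lim_transform_eventually by fastforce
  qed
  then obtain a b where ab: "P1 * b = a * Q1" "\<And>z. Im z \<ge> 0 \<Longrightarrow> poly b z \<noteq> 0" by auto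
  define G where "G z = poly a z / poly b z" for z
  have G_eq: "G z = F z - (\<Sum>s\<in>Z. w s / (complex_of_real s - z))"
    if "poly q z \<noteq> 0" "\<And>s. s \<in> Z \<Longrightarrow> z \<noteq> complex_of_real s" "Im z \<ge> 0" for z
  proof -
    have "poly Q1 z \<noteq> 0" using that Z by (auto simp: Q1_def polyD prod_zero_iff)
    moreover have "poly (P1 * b) z = poly (a * Q1) z" by (simp only: ab(1))
    ultimately have "poly a z / poly b z = poly P1 z / poly Q1 z" using ab(2)[OF that(3)] by (simp add: frac_eq_eq)
    thus ?thesis unfolding G_def using ratio[OF that(1,2)] by simp
  qed
  have G_upper: "G z = F z - (\<Sum>s\<in>Z. w s / (complex_of_real s - z))" if "Im z > 0" for z
    using that by (intro G_eq q_upper) auto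
  have G_cont: "continuous_on {z. Im z \<ge> 0} G"
    unfolding G_def using ab(2) by (intro continuous_intros) auto
  have G_holo: "G field_differentiable at z" if "Im z > 0" for z
    unfolding G_def field_differentiable_def using ab(2)[of z] that
    by (intro exI) (auto intro!: derivative_eq_intros poly_DERIV)
  obtain K0 R0 where KR: "R0 > 0" "\<And>z. Im z > 0 \<Longrightarrow> cmod z \<ge> R0 \<Longrightarrow> cmod (F z) \<le> K0"
    using F_bounded_at_infinity by blast
  \<comment> \<open>Large enough that F is bounded by K0 outside and that z keeps distance at least
    1 from every point of Z.\<close>
  define R where "R = R0 + (\<Sum>s\<in>Z. \<bar>s\<bar> + 1)"
  define K1 where "K1 = K0 + (\<Sum>s\<in>Z. cmod (w s))"
  have G_far_upper: "cmod (G z) \<le> K1" if z: "Im z > 0" "cmod z \<ge> R" for z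
  proof -
    have "0 \<le> (\<Sum>s\<in>Z. \<bar>s\<bar> + 1)" by (intro sum_nonneg) auto
    hence R0: "cmod z \<ge> R0" using z(2) unfolding R_def by linarith
    have "cmod (w s / (complex_of_real s - z)) \<le> cmod (w s)" if s: "s \<in> Z" for s
    proof -
      have "\<bar>s\<bar> + 1 \<le> (\<Sum>s\<in>Z. \<bar>s\<bar> + 1)" using s Z by (intro member_le_sum) auto
      hence "cmod z \<ge> \<bar>s\<bar> + 1" using z(2) KR(1) unfolding R_def by linarith
      hence "cmod (complex_of_real s - z) \<ge> 1"
        using norm_triangle_ineq2[of z "complex_of_real s"] by (simp add: norm_minus_commute)
      thus ?thesis using mult_left_mono[of 1 "cmod (complex_of_real s - z)" "cmod (w s)"]
        by (simp add: norm_divide divide_le_eq)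
    qed
    hence "cmod (\<Sum>s\<in>Z. w s / (complex_of_real s - z)) \<le> (\<Sum>s\<in>Z. cmod (w s))"
      by (intro order.trans[OF norm_sum] sum_mono)
    thus ?thesis unfolding G_upper[OF z(1)] K1_def
      using norm_triangle_ineq4[of "F z" "\<Sum>s\<in>Z. w s / (complex_of_real s - z)"] KR(2)[OF z(1) R0] by linarith
  qed
  \<comment> \<open>Real points are reached from above: G has no pole there, and moving upwards does
    not decrease the modulus of a real number.\<close>
  have G_far: "cmod (G z) \<le> K1" if z: "Im z \<ge> 0" "cmod z \<ge> R" for z
  proof (cases "Im z > 0")
    case True thus ?thesis using G_far_upper z by simp
  next
    case False
    hence Imz: "Im z = 0" using z by simp
    have "((\<lambda>e. cmod (G (z + \<i> * of_real e))) \<longlongrightarrow> cmod (G z)) (at_right 0)"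
      unfolding G_def by (intro tendsto_norm vertical_path_rational ab(2) z(1))
    moreover have "\<forall>\<^sub>F e in at_right 0. cmod (G (z + \<i> * of_real e)) \<le> K1"
      using ev_pos
    proof eventually_elim
      case (elim e)
      have "cmod z = \<bar>Re (z + \<i> * of_real e)\<bar>" using Imz by (simp add: cmod_eq_Re)
      also have "\<dots> \<le> cmod (z + \<i> * of_real e)" by (rule abs_Re_le_cmod)
      finally show ?case using z(2) elim Imz by (intro G_far_upper) auto
    qed
    ultimately show ?thesis by (rule tendsto_upperbound) simp
  qed
  have "compact ({z. Im z \<ge> 0} \<inter> cball 0 R)"
    by (intro closed_Int_compact closed_halfspace_Im_ge compact_cball)
  hence "compact (G ` ({z. Im z \<ge> 0} \<inter> cball 0 R))"
    by (intro compact_continuous_image continuous_on_subset[OF G_cont]) auto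
  then obtain K2 where "\<forall>z\<in>{z. Im z \<ge> 0} \<inter> cball 0 R. cmod (G z) \<le> K2"
    using compact_imp_bounded[of "G ` ({z. Im z \<ge> 0} \<inter> cball 0 R)"] unfolding bounded_iff by auto
  hence K2: "\<And>z. Im z \<ge> 0 \<Longrightarrow> cmod z \<le> R \<Longrightarrow> cmod (G z) \<le> K2" by (simp add: dist_norm)
  have G_bound: "cmod (G z) \<le> max K1 K2" if "Im z \<ge> 0" for z
    using G_far[OF that] K2[OF that] by (cases "cmod z \<le> R") (auto simp: le_max_iff_disj)
  note PF = poisson_formula[OF G_cont G_holo G_bound]
  define g where "g t = Im (G (complex_of_real t))" for t
  have gc: "continuous_on UNIV g"
    unfolding g_def by (intro continuous_intros continuous_on_compose2[OF G_cont]) auto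
  have g_eq: "g t = Im (F (complex_of_real t))" if "t \<notin> Z" for t
  proof -
    have "G (complex_of_real t) = F (complex_of_real t) - (\<Sum>s\<in>Z. w s / (complex_of_real s - complex_of_real t))"
      using that by (intro G_eq) (auto simp: Z_def)
    \<comment> \<open>The subtracted terms are real on the real line, so the imaginary parts of G
      and F agree there.\<close>
    moreover have "(\<Sum>s\<in>Z. w s / (complex_of_real s - complex_of_real t)) = complex_of_real (\<Sum>s\<in>Z. (cvec_norm (pr s))\<^sup>2 / (s - t))"
      by (simp add: w_def)
    ultimately show ?thesis unfolding g_def by (simp del: of_real_sum)
  qed
  show thesis
  proof (rule that[OF Z pr(1) pr(2) _ gc g_eq])
    show "det (shifted A (complex_of_real t)) \<noteq> 0 \<and> cvec_norm (pr t) = 0" if "t \<notin> Z" for t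
      using that pr0[OF that] by (simp add: q Z_def)
    fix x y :: real assume y: "y > 0"
    show "integrable lborel (\<lambda>t. g t * poisson x y t)"
      unfolding g_def by (rule PF(1)[OF _ _ y]) auto
    have "(\<integral>t. g t * poisson x y t \<partial>lborel) = pi * Im (G (Complex x y))"
      unfolding g_def by (rule PF(2)[OF _ _ y]) auto
    moreover have "Im (w s / (complex_of_real s - Complex x y)) = (cvec_norm (pr s))\<^sup>2 * poisson x y s" for s
    proof -
      have "w s / (complex_of_real s - Complex x y) = complex_of_real ((cvec_norm (pr s))\<^sup>2) * (1 / (complex_of_real s - Complex x y))"
        by (simp add: w_def)
      thus ?thesis by (simp only: Im_complex_of_real Re_complex_of_real times_complex.sel Im_cauchy_kernel)
    qed
    ultimately show "pi * Im (F (Complex x y)) =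
       (\<integral>t. g t * poisson x y t \<partial>lborel) + pi * (\<Sum>s\<in>Z. (cvec_norm (pr s))\<^sup>2 * poisson x y s)"
      using y by (simp add: G_upper algebra_simps)
  qed auto
qed

end

end

section \<open>Diagonalization of Hermitian matrices and inverse square roots\<close>

definition real_diag :: "nat \<Rightarrow> (nat \<Rightarrow> real) \<Rightarrow> complex mat" where
  "real_diag n f = mat n n (\<lambda>(i, j). if i = j then complex_of_real (f i) else 0)"

lemma real_diag_carrier [simp]: "real_diag n f \<in> carrier_mat n n"
  by (simp add: real_diag_def)

lemma mult_index_sum:
  "A \<in> carrier_mat n m \<Longrightarrow> B \<in> carrier_mat m k \<Longrightarrow> i < n \<Longrightarrow> j < k \<Longrightarrow>
    (A * B) $$ (i, j) = (\<Sum>l<m. A $$ (i, l) * B $$ (l, j))"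
  by (auto simp: scalar_prod_def atLeast0LessThan)

lemma real_diag_mult: "real_diag n f * real_diag n g = real_diag n (\<lambda>i. f i * g i)"
proof (rule eq_matI)
  fix i j assume "i < dim_row (real_diag n (\<lambda>i. f i * g i))" "j < dim_col (real_diag n (\<lambda>i. f i * g i))"
  hence ij: "i < n" "j < n" by (auto simp: real_diag_def)
  have "(real_diag n f * real_diag n g) $$ (i, j) = (\<Sum>l<n. if i = l then complex_of_real (f i) * real_diag n g $$ (i, j) else 0)"
    unfolding mult_index_sum[OF real_diag_carrier real_diag_carrier ij]
    using ij by (intro sum.cong) (auto simp: real_diag_def)
  also have "\<dots> = real_diag n (\<lambda>i. f i * g i) $$ (i, j)"
    using ij by (simp add: real_diag_def)
  finally show "(real_diag n f * real_diag n g) $$ (i, j) = real_diag n (\<lambda>i. f i * g i) $$ (i, j)" .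
qed (auto simp: real_diag_def)

lemma mat_adjoint_real_diag: "mat_adjoint (real_diag n f) = real_diag n f"
  by (rule eq_matI) (auto simp: real_diag_def)

text \<open>v is completed to a basis and Gram-Schmidt is applied, which leaves the first vector
  unchanged; only normalization remains.\<close>

lemma unitary_with_first_column:
  fixes v :: "complex vec"
  assumes v: "v \<in> carrier_vec n" "v \<noteq> 0\<^sub>v n"
  obtains W c where "W \<in> carrier_mat n n" "mat_adjoint W * W = 1\<^sub>m n" "0 < n" "col W 0 = c \<cdot>\<^sub>v v"
proof -
  interpret cof_vec_space n "TYPE(complex)" .
  define b where "b = basis_completion v"
  define ws where "ws = gram_schmidt n b"
  from basis_completion[OF v, folded b_def]
  have dist_b: "distinct b" and indep: "\<not> lin_dep (set b)" and b: "set b \<subseteq> carrier_vec n"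
    and hdb: "hd b = v" and len_b: "length b = n" by auto
  have n: "n > 0" using v by (cases n) auto
  from hdb len_b n obtain vs where bv: "b = v # vs" by (cases b) auto
  from gram_schmidt_result[OF b dist_b indep refl, folded ws_def]
  have ws: "set ws \<subseteq> carrier_vec n" "corthogonal ws" "length ws = n" by (auto simp: len_b)
  from gram_schmidt_hd[OF v(1), of vs, folded bv] have hdws: "hd ws = v" unfolding ws_def .
  have wsc: "ws ! i \<in> carrier_vec n" if "i < n" for i using ws that by auto
  have ws0: "ws ! 0 = v" using hdws ws(3) n by (metis hd_conv_nth length_greater_0_conv)
  define k where "k i = inverse (cvec_norm (ws ! i))" for i
  have norm_nz: "cvec_norm (ws ! i) \<noteq> 0" if "i < n" for i
    using corthogonalD[OF ws(2), of i i] that ws(3) by (auto simp: inner_self)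
  define W where "W = mat_of_cols n (map (\<lambda>i. complex_of_real (k i) \<cdot>\<^sub>v ws ! i) [0..<n])"
  have W: "W \<in> carrier_mat n n" unfolding W_def
    using mat_of_cols_carrier(1)[of n "map (\<lambda>i. complex_of_real (k i) \<cdot>\<^sub>v ws ! i) [0..<n]"] by simp
  have colW: "col W i = complex_of_real (k i) \<cdot>\<^sub>v ws ! i" if "i < n" for i
    unfolding W_def using that wsc[OF that] by (subst col_mat_of_cols) auto
  have "mat_adjoint W * W = 1\<^sub>m n"
  proof (rule eq_matI)
    fix i j assume "i < dim_row (1\<^sub>m n :: complex mat)" "j < dim_col (1\<^sub>m n :: complex mat)"
    hence ij: "i < n" "j < n" by auto
    have "(mat_adjoint W * W) $$ (i, j) = col W j \<bullet>c col W i"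
      using W ij by (auto simp: scalar_prod_def mult.commute)
    also have "\<dots> = complex_of_real (k i * k j) * (ws ! j \<bullet>c ws ! i)"
      using ij wsc by (simp add: colW inner_smult_left[of _ n] inner_smult_right[of _ n])
    also have "\<dots> = (if i = j then 1 else 0)"
    proof (cases "i = j")
      case True
      have "complex_of_real (k i * k i) * (ws ! i \<bullet>c ws ! i) = complex_of_real ((k i * cvec_norm (ws ! i))\<^sup>2)"
        by (simp add: inner_self power2_eq_square)
      also have "k i * cvec_norm (ws ! i) = 1" using norm_nz[OF ij(1)] by (simp add: k_def)
      finally show ?thesis using True by simp
    next
      case False
      thus ?thesis using corthogonalD[OF ws(2), of j i] ij ws(3) by simp
    qed
    finally show "(mat_adjoint W * W) $$ (i, j) = 1\<^sub>m n $$ (i, j)" using ij by simp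
  qed (use W in auto)
  thus thesis using that[OF W _ n] colW[OF n] ws0 by metis
qed

text \<open>Deflation: conjugation by a unitary matrix whose first column is an eigenvector
  trivializes the first column of B, and since B is Hermitian also its first row. The induction
  hypothesis handles the remaining block.\<close>

lemma hermitian_diagonalization:
  fixes H :: "complex mat"
  assumes "H \<in> carrier_mat n n" "mat_adjoint H = H"
  shows "\<exists>U d. U \<in> carrier_mat n n \<and> mat_adjoint U * U = 1\<^sub>m n \<and> H * U = U * real_diag n d"
  using assms
proof (induction n arbitrary: H)
  case 0
  thus ?case by (intro exI[of _ "1\<^sub>m 0"] exI[of _ "\<lambda>_. 0"]) (auto intro!: eq_matI simp: real_diag_def)
next
  case (Suc m)
  note H = Suc.prems(1) and herm = Suc.prems(2)
  let ?n = "Suc m"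
  have "degree (char_poly H) = ?n" using degree_monic_char_poly[OF H] by simp
  hence "\<not> constant (poly (char_poly H))" by (simp add: constant_degree)
  then obtain e where "poly (char_poly H) e = 0" using fundamental_theorem_of_algebra by blast
  hence "eigenvalue H e" using eigenvalue_root_char_poly[OF H] by simp
  then obtain v where v: "v \<in> carrier_vec ?n" "v \<noteq> 0\<^sub>v ?n" "H *\<^sub>v v = e \<cdot>\<^sub>v v"
    using H by (auto simp: eigenvalue_def eigenvector_def)
  obtain W c where W: "W \<in> carrier_mat ?n ?n" "mat_adjoint W * W = 1\<^sub>m ?n" "col W 0 = c \<cdot>\<^sub>v v"
    using unitary_with_first_column[OF v(1,2)] by metis
  have W': "W * mat_adjoint W = 1\<^sub>m ?n"
    by (rule mat_mult_left_right_inverse[OF _ W(1,2)]) (use W in auto)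
  define B where "B = mat_adjoint W * (H * W)"
  have Wa: "mat_adjoint W \<in> carrier_mat ?n ?n" using W by auto
  have HW: "H * W \<in> carrier_mat ?n ?n" using H W by auto
  have B: "B \<in> carrier_mat ?n ?n" unfolding B_def using Wa HW by auto
  have WB: "W * B = H * W"
    unfolding B_def using W(1) Wa HW W' by (subst assoc_mult_mat[symmetric, OF W(1) Wa HW]) auto
  have B_herm: "mat_adjoint B = B"
    unfolding B_def using H W(1) Wa HW herm
    by (simp add: mat_adjoint_mult[OF Wa HW] mat_adjoint_mult[OF H W(1)] assoc_mult_mat[OF Wa H W(1)])
  have B_sym: "B $$ (j, i) = cnj (B $$ (i, j))" if "i < ?n" "j < ?n" for i j
    using arg_cong[OF B_herm, of "\<lambda>M. M $$ (j, i)"] that B by simp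
  have col0: "B $$ (i, 0) = (if i = 0 then e else 0)" if i: "i < ?n" for i
  proof -
    have "B $$ (i, 0) = row (mat_adjoint W) i \<bullet> col (H * W) 0"
      unfolding B_def using i Wa HW by (subst index_mult_mat(1)) auto
    also have "col (H * W) 0 = H *\<^sub>v col W 0"
      by (rule col_mult2[OF H W(1)]) simp
    also have "\<dots> = e \<cdot>\<^sub>v col W 0"
      unfolding W(3) using H v by (simp add: mult_mat_vec[of _ ?n ?n] smult_smult_assoc mult.commute)
    also have "row (mat_adjoint W) i \<bullet> (e \<cdot>\<^sub>v col W 0) = e * (row (mat_adjoint W) i \<bullet> col W 0)"
      by (rule scalar_prod_smult_distrib[of _ ?n]) (use i W(1) in \<open>auto intro: row_carrier_vec col_carrier_vec\<close>)
    also have "row (mat_adjoint W) i \<bullet> col W 0 = (mat_adjoint W * W) $$ (i, 0)"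
      using i W Wa by (subst index_mult_mat(1)) auto
    finally show ?thesis using i by (simp add: W(2))
  qed
  have row0: "B $$ (0, j) = (if j = 0 then e else 0)" if "j < ?n" for j
    using B_sym[of j 0] col0[OF that] B_sym[of 0 0] col0[of 0] that by (auto split: if_splits)
  have e_real: "e = complex_of_real (Re e)"
    using B_sym[of 0 0] col0[of 0] by (simp add: complex_eq_iff)
  define B3 where "B3 = mat m m (\<lambda>(i, j). B $$ (Suc i, Suc j))"
  have B3: "B3 \<in> carrier_mat m m" by (simp add: B3_def)
  have "mat_adjoint B3 = B3"
    by (rule eq_matI) (auto simp: B3_def B_sym[of "Suc _" "Suc _", symmetric])
  then obtain U3 d3 where U3: "U3 \<in> carrier_mat m m" "mat_adjoint U3 * U3 = 1\<^sub>m m" "B3 * U3 = U3 * real_diag m d3"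
    using Suc.IH[OF B3] by blast
  \<comment> \<open>The block diagonal matrix with blocks 1 and U3.\<close>
  define U' where "U' = mat ?n ?n (\<lambda>(i, j). case i of 0 \<Rightarrow> (case j of 0 \<Rightarrow> 1 | Suc j' \<Rightarrow> 0)
      | Suc i' \<Rightarrow> (case j of 0 \<Rightarrow> 0 | Suc j' \<Rightarrow> U3 $$ (i', j')))"
  define d where "d i = (case i of 0 \<Rightarrow> Re e | Suc i' \<Rightarrow> d3 i')" for i
  have U': "U' \<in> carrier_mat ?n ?n" by (simp add: U'_def)
  have Ua: "mat_adjoint U' \<in> carrier_mat ?n ?n" using U' by auto
  have UU3: "(\<Sum>l<m. cnj (U3 $$ (l, i)) * U3 $$ (l, j)) = (if i = j then 1 else 0)" if "i < m" "j < m" for i j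
    using arg_cong[OF U3(2), of "\<lambda>M. M $$ (i, j)"] that U3(1) mult_index_sum[of "mat_adjoint U3" m m U3 m i j] by auto
  have BU3: "(\<Sum>l<m. B $$ (Suc i, Suc l) * U3 $$ (l, j)) = U3 $$ (i, j) * complex_of_real (d3 j)" if "i < m" "j < m" for i j
  proof -
    have "(B3 * U3) $$ (i, j) = (\<Sum>l<m. B $$ (Suc i, Suc l) * U3 $$ (l, j))"
      using that U3(1) B3 mult_index_sum[OF B3 U3(1), of i j] by (simp add: B3_def)
    moreover have "(U3 * real_diag m d3) $$ (i, j) = U3 $$ (i, j) * complex_of_real (d3 j)"
      using that mult_index_sum[OF U3(1) real_diag_carrier, of i j d3] by (simp add: real_diag_def if_distrib cong: if_cong)
    ultimately show ?thesis by (simp add: U3(3))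
  qed
  have "mat_adjoint U' * U' = 1\<^sub>m ?n"
  proof (rule eq_matI)
    fix i j assume "i < dim_row (1\<^sub>m ?n :: complex mat)" "j < dim_col (1\<^sub>m ?n :: complex mat)"
    hence ij: "i < ?n" "j < ?n" by auto
    have "(mat_adjoint U' * U') $$ (i, j) = (\<Sum>l<Suc m. cnj (U' $$ (l, i)) * U' $$ (l, j))"
      using mult_index_sum[OF Ua U' ij] U' ij by simp
    also have "\<dots> = (if i = j then 1 else 0)"
      unfolding sum.lessThan_Suc_shift using ij UU3
      by (cases i; cases j) (auto simp: U'_def)
    finally show "(mat_adjoint U' * U') $$ (i, j) = 1\<^sub>m ?n $$ (i, j)" using ij by simp
  qed (use U' in auto)
  note UU' = this
  have BU': "B * U' = U' * real_diag ?n d"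
  proof (rule eq_matI)
    fix i j assume "i < dim_row (U' * real_diag ?n d)" "j < dim_col (U' * real_diag ?n d)"
    hence ij: "i < ?n" "j < ?n" using U' by (auto simp: real_diag_def)
    have r: "(U' * real_diag ?n d) $$ (i, j) = U' $$ (i, j) * complex_of_real (d j)"
      using ij mult_index_sum[OF U' real_diag_carrier ij, of d] by (simp add: real_diag_def if_distrib cong: if_cong del: sum.lessThan_Suc)
    have "(B * U') $$ (i, j) = (\<Sum>l<Suc m. B $$ (i, l) * U' $$ (l, j))"
      by (rule mult_index_sum[OF B U' ij])
    also have "\<dots> = U' $$ (i, j) * complex_of_real (d j)"
      unfolding sum.lessThan_Suc_shift using ij BU3 col0 row0 e_real
      by (cases i; cases j) (auto simp: U'_def d_def)
    finally show "(B * U') $$ (i, j) = (U' * real_diag ?n d) $$ (i, j)" using r by simp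
  qed (use B U' in \<open>auto simp: real_diag_def\<close>)
  define U where "U = W * U'"
  have U: "U \<in> carrier_mat ?n ?n" unfolding U_def using W U' by auto
  have "mat_adjoint U * U = mat_adjoint U' * (mat_adjoint W * (W * U'))"
    unfolding U_def mat_adjoint_mult[OF W(1) U'] using W Wa U' Ua by (intro assoc_mult_mat) auto
  also have "mat_adjoint W * (W * U') = (mat_adjoint W * W) * U'"
    using W Wa U' by (intro assoc_mult_mat[symmetric]) auto
  finally have 1: "mat_adjoint U * U = 1\<^sub>m ?n" using U' by (simp add: W(2) UU')
  have "H * U = (H * W) * U'" unfolding U_def using H W U' by (intro assoc_mult_mat[symmetric]) auto
  also have "\<dots> = W * (B * U')" unfolding WB[symmetric] using W B U' by (intro assoc_mult_mat) auto
  also have "\<dots> = U * real_diag ?n d" unfolding BU' U_def using W U'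
    by (intro assoc_mult_mat[symmetric]) (auto intro: real_diag_carrier)
  finally show ?case using U 1 by blast
qed

lemma inner_real_diag:
  assumes "y \<in> carrier_vec n"
  shows "(real_diag n f *\<^sub>v y) \<bullet>c y = complex_of_real (\<Sum>i<n. f i * (cmod (y $ i))\<^sup>2)"
proof -
  have "(real_diag n f *\<^sub>v y) $ i = complex_of_real (f i) * y $ i" if "i < n" for i
  proof -
    have "(real_diag n f *\<^sub>v y) $ i = (\<Sum>j<n. (if i = j then complex_of_real (f i) else 0) * y $ j)"
      using assms that by (auto simp: real_diag_def scalar_prod_def atLeast0LessThan)
    also have "\<dots> = (\<Sum>j<n. if i = j then complex_of_real (f i) * y $ i else 0)"
      by (intro sum.cong) auto
    finally show ?thesis using that by simp
  qed
  hence "(real_diag n f *\<^sub>v y) \<bullet>c y = (\<Sum>i<n. complex_of_real (f i) * y $ i * cnj (y $ i))"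
    using assms by (auto simp: scalar_prod_def atLeast0LessThan real_diag_def)
  also have "\<dots> = (\<Sum>i<n. complex_of_real (f i * (cmod (y $ i))\<^sup>2))"
    by (intro sum.cong) (simp_all add: complex_norm_square mult.assoc del: of_real_power)
  finally show ?thesis by simp
qed

lemma trace_commute:
  fixes A B :: "complex mat"
  assumes "A \<in> carrier_mat n n" "B \<in> carrier_mat n n"
  shows "(\<Sum>i<n. (A * B) $$ (i, i)) = (\<Sum>i<n. (B * A) $$ (i, i))"
proof -
  have "(\<Sum>i<n. (A * B) $$ (i, i)) = (\<Sum>i<n. \<Sum>l<n. A $$ (i, l) * B $$ (l, i))"
    using mult_index_sum[OF assms] by simp
  also have "\<dots> = (\<Sum>l<n. \<Sum>i<n. B $$ (l, i) * A $$ (i, l))" by (subst sum.swap) (simp add: mult.commute)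
  also have "\<dots> = (\<Sum>i<n. (B * A) $$ (i, i))" using mult_index_sum[OF assms(2,1)] by simp
  finally show ?thesis .
qed

text \<open>The argument does not require X and Y to commute. Both squares invert A, so X^2 = Y^2,
  and D = X - Y satisfies X D + D Y = 0. Multiplying by D and taking the trace gives a sum of the
  quadratic forms of X and Y on the columns of D; all terms are nonnegative, so every column is
  0.\<close>

lemma pos_inv_sqrt_unique:
  fixes A :: "complex mat"
  assumes A: "A \<in> carrier_mat n n" and X: "is_pos_inv_sqrt A X" and Y: "is_pos_inv_sqrt A Y"
  shows "X = Y"
proof -
  have Xc: "X \<in> carrier_mat n n" "mat_adjoint X = X" "X * X * A = 1\<^sub>m n"
    and Xp: "\<And>v. v \<in> carrier_vec n \<Longrightarrow> v \<noteq> 0\<^sub>v n \<Longrightarrow> Re ((X *\<^sub>v v) \<bullet>c v) > 0"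
    and Yc: "Y \<in> carrier_mat n n" "mat_adjoint Y = Y" "Y * Y * A = 1\<^sub>m n"
    and Yp: "\<And>v. v \<in> carrier_vec n \<Longrightarrow> v \<noteq> 0\<^sub>v n \<Longrightarrow> Re ((Y *\<^sub>v v) \<bullet>c v) > 0"
    using X Y A by (auto simp: is_pos_inv_sqrt_def)
  have XX: "X * X \<in> carrier_mat n n" and YY: "Y * Y \<in> carrier_mat n n" using Xc Yc by auto
  have AXX: "A * (X * X) = 1\<^sub>m n" by (rule mat_mult_left_right_inverse[OF XX A Xc(3)])
  have "Y * Y = (Y * Y) * (A * (X * X))" unfolding AXX by (rule right_mult_one_mat[OF YY, symmetric])
  also have "\<dots> = (Y * Y * A) * (X * X)" by (rule assoc_mult_mat[symmetric, OF YY A XX])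
  finally have sq: "Y * Y = X * X" unfolding Yc(3) left_mult_one_mat[OF XX] .
  define D where "D = X - Y"
  have D: "D \<in> carrier_mat n n" unfolding D_def using Xc Yc by auto
  have D_herm: "mat_adjoint D = D"
  proof (rule eq_matI)
    fix i j assume "i < dim_row D" "j < dim_col D"
    hence ij: "i < n" "j < n" using D by auto
    show "mat_adjoint D $$ (i, j) = D $$ (i, j)"
      using arg_cong[OF Xc(2), of "\<lambda>M. M $$ (i, j)"] arg_cong[OF Yc(2), of "\<lambda>M. M $$ (i, j)"] ij Xc(1) Yc(1)
      unfolding D_def by simp
  qed (use D in auto)
  have XD: "X * D = X * X - X * Y" and DY: "D * Y = X * Y - Y * Y"
    unfolding D_def using Xc Yc by (auto simp: mult_minus_distrib_mat[of _ n n _ n] minus_mult_distrib_mat[of _ n n _ _ n])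
  have XDY: "X * D + D * Y = 0\<^sub>m n n"
    unfolding XD DY sq using Xc Yc by (intro eq_matI) auto
  have XDc: "X * D \<in> carrier_mat n n" and DYc: "D * Y \<in> carrier_mat n n" and YDc: "Y * D \<in> carrier_mat n n"
    using Xc Yc D by auto
  have diag: "(D * (Z * D)) $$ (i, i) = (Z *\<^sub>v col D i) \<bullet>c col D i" if "Z \<in> carrier_mat n n" "i < n" for Z i
  proof -
    have "(D * (Z * D)) $$ (i, i) = row D i \<bullet> col (Z * D) i"
      using that D by (subst index_mult_mat(1)) auto
    also have "col (Z * D) i = Z *\<^sub>v col D i" by (rule col_mult2[OF that(1) D that(2)])
    also have "row D i = conjugate (col D i)"
    proof (rule eq_vecI)
      fix j assume "j < dim_vec (conjugate (col D i))"
      thus "row D i $ j = conjugate (col D i) $ j"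
        using D that(2) arg_cong[OF D_herm, of "\<lambda>M. M $$ (i, j)"] by simp
    qed (use D in auto)
    also have "conjugate (col D i) \<bullet> (Z *\<^sub>v col D i) = (Z *\<^sub>v col D i) \<bullet>c col D i"
      using that D by (intro comm_scalar_prod[of _ n]) auto
    finally show ?thesis .
  qed
  have "0 = (\<Sum>i<n. (D * (X * D + D * Y)) $$ (i, i))"
    unfolding XDY using D by simp
  also have "D * (X * D + D * Y) = D * (X * D) + D * (D * Y)"
    by (rule mult_add_distrib_mat[OF D XDc DYc])
  also have "(\<Sum>i<n. (D * (X * D) + D * (D * Y)) $$ (i, i)) = (\<Sum>i<n. (D * (X * D)) $$ (i, i)) + (\<Sum>i<n. (D * (D * Y)) $$ (i, i))"
    unfolding sum.distrib[symmetric] using D DYc by (intro sum.cong) auto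
  also have "(\<Sum>i<n. (D * (D * Y)) $$ (i, i)) = (\<Sum>i<n. (D * (Y * D)) $$ (i, i))"
  proof -
    have "(\<Sum>i<n. (D * (D * Y)) $$ (i, i)) = (\<Sum>i<n. (D * Y * D) $$ (i, i))" by (rule trace_commute[OF D DYc])
    also have "D * Y * D = D * (Y * D)" by (rule assoc_mult_mat[OF D Yc(1) D])
    finally show ?thesis .
  qed
  finally have "(\<Sum>i<n. (X *\<^sub>v col D i) \<bullet>c col D i + (Y *\<^sub>v col D i) \<bullet>c col D i) = 0"
    using Xc Yc by (simp add: diag sum.distrib)
  hence "(\<Sum>i<n. Re ((X *\<^sub>v col D i) \<bullet>c col D i) + Re ((Y *\<^sub>v col D i) \<bullet>c col D i)) = 0"
    unfolding plus_complex.sel(1)[symmetric] Re_sum[symmetric] by simp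
  moreover have nonneg: "Re ((X *\<^sub>v v) \<bullet>c v) \<ge> 0" "Re ((Y *\<^sub>v v) \<bullet>c v) \<ge> 0" if "v \<in> carrier_vec n" for v
    using Xp[OF that] Yp[OF that] Xc Yc by (cases "v = 0\<^sub>v n", auto intro: less_imp_le)+
  ultimately have zero: "Re ((X *\<^sub>v col D i) \<bullet>c col D i) + Re ((Y *\<^sub>v col D i) \<bullet>c col D i) = 0" if "i < n" for i
    using that D by (subst (asm) sum_nonneg_eq_0_iff) (auto intro!: add_nonneg_nonneg)
  have "col D i = 0\<^sub>v n" if "i < n" for i
    using zero[OF that] Xp[of "col D i"] nonneg(2)[of "col D i"] D that by fastforce
  hence "D = 0\<^sub>m n n" using D by (intro mat_col_eqI) auto
  show ?thesis
  proof (rule eq_matI)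
    fix i j assume "i < dim_row Y" "j < dim_col Y"
    hence ij: "i < n" "j < n" using Yc by auto
    have "D $$ (i, j) = 0" using \<open>D = 0\<^sub>m n n\<close> ij by simp
    thus "X $$ (i, j) = Y $$ (i, j)" using ij Xc Yc by (simp add: D_def)
  qed (use Xc Yc in auto)
qed

text \<open>Existence comes from functional calculus in an orthonormal eigenbasis of H:
  \<open>conj f\<close> has the eigenvalue f i on the i-th basis vector, and products of such
  matrices multiply the functions.\<close>

lemma one_plus_square_inv_sqrt:
  fixes H :: "complex mat"
  assumes H: "H \<in> carrier_mat n n" and herm: "mat_adjoint H = H"
  shows "\<exists>!X. is_pos_inv_sqrt (1\<^sub>m n + H * H) X"
proof -
  obtain U d where U: "U \<in> carrier_mat n n" "mat_adjoint U * U = 1\<^sub>m n" "H * U = U * real_diag n d"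
    using hermitian_diagonalization[OF assms] by blast
  have Ua: "mat_adjoint U \<in> carrier_mat n n" using U by auto
  have UU: "U * mat_adjoint U = 1\<^sub>m n" by (rule mat_mult_left_right_inverse[OF Ua U(1,2)])
  define conj where "conj f = U * (real_diag n f * mat_adjoint U)" for f
  have conjc: "conj f \<in> carrier_mat n n" for f
    unfolding conj_def using U Ua by (intro mult_carrier_mat[of _ n n]) auto
  have dU: "real_diag n f * mat_adjoint U \<in> carrier_mat n n" for f using Ua by (intro mult_carrier_mat[of _ n n]) auto
  have conj_mult: "conj f * conj g = conj (\<lambda>i. f i * g i)" for f g
  proof -
    have "conj f * conj g = U * ((real_diag n f * mat_adjoint U) * (U * (real_diag n g * mat_adjoint U)))"
      unfolding conj_def by (rule assoc_mult_mat[OF U(1) dU]) (use conjc[of g] in \<open>simp add: conj_def\<close>)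
    also have "(real_diag n f * mat_adjoint U) * (U * (real_diag n g * mat_adjoint U)) =
        real_diag n f * (mat_adjoint U * (U * (real_diag n g * mat_adjoint U)))"
      by (rule assoc_mult_mat[OF real_diag_carrier Ua]) (use conjc[of g] in \<open>simp add: conj_def\<close>)
    also have "mat_adjoint U * (U * (real_diag n g * mat_adjoint U)) = (mat_adjoint U * U) * (real_diag n g * mat_adjoint U)"
      by (rule assoc_mult_mat[symmetric, OF Ua U(1) dU])
    also have "\<dots> = real_diag n g * mat_adjoint U" unfolding U(2) by (rule left_mult_one_mat[OF dU])
    also have "real_diag n f * (real_diag n g * mat_adjoint U) = (real_diag n f * real_diag n g) * mat_adjoint U"
      by (rule assoc_mult_mat[symmetric, OF real_diag_carrier real_diag_carrier Ua])
    finally show ?thesis by (simp add: conj_def real_diag_mult)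
  qed
  have conj1: "conj (\<lambda>_. 1) = 1\<^sub>m n"
  proof -
    have "real_diag n (\<lambda>_. 1) = 1\<^sub>m n" by (rule eq_matI) (auto simp: real_diag_def)
    thus ?thesis unfolding conj_def by (simp add: left_mult_one_mat[OF Ua] UU)
  qed
  have Hc: "H = conj d"
  proof -
    have "conj d = (H * U) * mat_adjoint U"
      unfolding conj_def U(3) by (rule assoc_mult_mat[symmetric, OF U(1) real_diag_carrier Ua])
    also have "\<dots> = H * (U * mat_adjoint U)" by (rule assoc_mult_mat[OF H U(1) Ua])
    finally show ?thesis using H by (simp add: UU)
  qed
  have A: "1\<^sub>m n + H * H = conj (\<lambda>i. 1 + d i * d i)"
  proof -
    have "conj (\<lambda>i. 1 + d i * d i) = conj (\<lambda>_. 1) + conj (\<lambda>i. d i * d i)"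
    proof -
      have s: "real_diag n (\<lambda>i. 1 + d i * d i) = real_diag n (\<lambda>_. 1) + real_diag n (\<lambda>i. d i * d i)"
        by (rule eq_matI) (auto simp: real_diag_def)
      show ?thesis unfolding conj_def s
        by (subst add_mult_distrib_mat[OF real_diag_carrier real_diag_carrier Ua])
          (rule mult_add_distrib_mat[OF U(1) dU dU])
    qed
    thus ?thesis by (simp add: conj1 Hc conj_mult)
  qed
  define f where "f i = 1 / sqrt (1 + d i * d i)" for i
  have f: "f i > 0" "f i * f i * (1 + d i * d i) = 1" for i
  proof -
    have p: "1 + d i * d i > 0" by (simp add: add_pos_nonneg)
    thus "f i > 0" by (simp add: f_def)
    have "f i * f i = 1 / (1 + d i * d i)" using p by (simp add: f_def)
    thus "f i * f i * (1 + d i * d i) = 1" using p by simp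
  qed
  have "is_pos_inv_sqrt (1\<^sub>m n + H * H) (conj f)"
    unfolding is_pos_inv_sqrt_def
  proof (intro conjI ballI impI)
    have dim: "dim_row (1\<^sub>m n + H * H) = n" using H by simp
    show "conj f \<in> carrier_mat (dim_row (1\<^sub>m n + H * H)) (dim_row (1\<^sub>m n + H * H))" unfolding dim by (rule conjc)
    show "mat_adjoint (conj f) = conj f"
      unfolding conj_def mat_adjoint_mult[OF U(1) dU] mat_adjoint_mult[OF real_diag_carrier Ua]
      using U(1) Ua by (simp add: mat_adjoint_real_diag assoc_mult_mat[OF U(1) real_diag_carrier Ua])
    show "conj f * conj f * (1\<^sub>m n + H * H) = 1\<^sub>m (dim_row (1\<^sub>m n + H * H))"
      unfolding A conj_mult f(2) conj1 using dim by (simp add: A)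
    fix v :: "complex vec" assume "v \<in> carrier_vec (dim_row (1\<^sub>m n + H * H))" "v \<noteq> 0\<^sub>v (dim_row (1\<^sub>m n + H * H))"
    hence v: "v \<in> carrier_vec n" "v \<noteq> 0\<^sub>v n" unfolding dim by auto
    define y where "y = mat_adjoint U *\<^sub>v v"
    have y: "y \<in> carrier_vec n" unfolding y_def using Ua v by auto
    have "U *\<^sub>v y = v" unfolding y_def using U(1) Ua v UU by (subst assoc_mult_mat_vec[symmetric, OF U(1) Ua]) auto
    hence "y \<noteq> 0\<^sub>v n" using v U(1) by auto
    then obtain i where i: "i < n" "y $ i \<noteq> 0" using y by (metis eq_vecI carrier_vecD index_zero_vec)
    have dy: "real_diag n f *\<^sub>v y \<in> carrier_vec n" using y by (intro mult_mat_vec_carrier[OF real_diag_carrier])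
    have "conj f *\<^sub>v v = U *\<^sub>v (real_diag n f *\<^sub>v y)"
      unfolding conj_def y_def using v
      by (simp add: assoc_mult_mat_vec[OF U(1) dU] assoc_mult_mat_vec[OF real_diag_carrier Ua])
    hence "(conj f *\<^sub>v v) \<bullet>c v = (real_diag n f *\<^sub>v y) \<bullet>c y"
      using inner_adjoint[OF U(1) dy v(1)] by (simp add: y_def)
    also have "\<dots> = complex_of_real (\<Sum>i<n. f i * (cmod (y $ i))\<^sup>2)" by (rule inner_real_diag[OF y])
    finally have "Re ((conj f *\<^sub>v v) \<bullet>c v) = (\<Sum>i<n. f i * (cmod (y $ i))\<^sup>2)" by simp
    also have "\<dots> > 0" using i f(1) by (intro sum_pos2[of _ i]) (auto intro!: mult_nonneg_nonneg intro: less_imp_le)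
    finally show "Re ((conj f *\<^sub>v v) \<bullet>c v) > 0" .
  qed
  moreover have "1\<^sub>m n + H * H \<in> carrier_mat n n" using H by auto
  ultimately show ?thesis using pos_inv_sqrt_unique by (intro ex1I) auto
qed

section \<open>Full row rank and right inverses\<close>

lemma full_rank_iff_surjective:
  fixes A :: "complex mat"
  assumes A: "A \<in> carrier_mat n nc"
  shows "vec_space.rank n A = n \<longleftrightarrow> (\<forall>y\<in>carrier_vec n. \<exists>x\<in>carrier_vec nc. A *\<^sub>v x = y)"
proof -
  interpret vec_space "TYPE(complex)" n .
  have cols: "set (cols A) \<subseteq> carrier_vec n" using A cols_dim by blast
  have cs: "span (set (cols A)) = {y \<in> carrier_vec n. \<exists>x\<in>carrier_vec nc. A *\<^sub>v x = y}"
    using col_space_eq[OF A] A unfolding col_space_def by auto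
  show ?thesis
  proof
    assume full: "rank A = n"
    have "lin_indpt {}" by (simp add: lin_dep_def)
    then obtain S where S: "maximal S (\<lambda>T. T \<subseteq> set (cols A) \<and> lin_indpt T)" "finite S"
      using maximal_exists_superset[of "set (cols A)" "\<lambda>T. T \<subseteq> set (cols A) \<and> lin_indpt T" "{}"] by auto
    have card: "card S = n" using rank_card_indpt[OF A S(1)] full by simp
    have S': "S \<subseteq> set (cols A)" "lin_indpt S" using S(1) by (auto simp: maximal_def)
    have "basis S"
      by (rule dim_li_is_basis) (use S S' card cols fin_dim dim_is_n in auto)
    hence "span S = carrier_vec n" by (simp add: basis_def)
    hence "carrier_vec n \<subseteq> span (set (cols A))" using span_is_monotone[OF S'(1)] by simp
    thus "\<forall>y\<in>carrier_vec n. \<exists>x\<in>carrier_vec nc. A *\<^sub>v x = y" unfolding cs by auto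
  next
    assume "\<forall>y\<in>carrier_vec n. \<exists>x\<in>carrier_vec nc. A *\<^sub>v x = y"
    hence "span (set (cols A)) = carrier_vec n" unfolding cs by auto
    hence "span_vs (set (cols A)) = V" by (simp add: module_vec_def)
    thus "rank A = n" unfolding rank_def using dim_is_n by simp
  qed
qed

lemma mat_eqI_mult_vec:
  fixes A B :: "complex mat"
  assumes A: "A \<in> carrier_mat n m" and B: "B \<in> carrier_mat n m"
    and "\<And>v. v \<in> carrier_vec m \<Longrightarrow> A *\<^sub>v v = B *\<^sub>v v"
  shows "A = B"
proof (rule mat_col_eqI)
  fix j assume j: "j < dim_col B"
  have "A *\<^sub>v unit_vec m j = B *\<^sub>v unit_vec m j" by (rule assms(3)) simp
  moreover have "C *\<^sub>v unit_vec m j = col C j" if "C \<in> carrier_mat n m" for C :: "complex mat"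
    using j B that by (intro eq_vecI) (auto simp: scalar_prod_right_unit)
  ultimately show "col A j = col B j" using A B by simp
qed (use A B in auto)

lemma right_inverse_iff_surjective:
  fixes A :: "complex mat"
  assumes A: "A \<in> carrier_mat n nc"
  shows "(\<exists>B\<in>carrier_mat nc n. A * B = 1\<^sub>m n) \<longleftrightarrow> (\<forall>y\<in>carrier_vec n. \<exists>x\<in>carrier_vec nc. A *\<^sub>v x = y)"
proof
  assume "\<exists>B\<in>carrier_mat nc n. A * B = 1\<^sub>m n"
  then obtain B where B: "B \<in> carrier_mat nc n" "A * B = 1\<^sub>m n" by blast
  show "\<forall>y\<in>carrier_vec n. \<exists>x\<in>carrier_vec nc. A *\<^sub>v x = y"
  proof
    fix y :: "complex vec" assume y: "y \<in> carrier_vec n"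
    have "A *\<^sub>v (B *\<^sub>v y) = (A * B) *\<^sub>v y" by (rule assoc_mult_mat_vec[symmetric, OF A B(1) y])
    thus "\<exists>x\<in>carrier_vec nc. A *\<^sub>v x = y"
      using B y by (intro bexI[of _ "B *\<^sub>v y"]) (auto intro: mult_mat_vec_carrier)
  qed
next
  assume s: "\<forall>y\<in>carrier_vec n. \<exists>x\<in>carrier_vec nc. A *\<^sub>v x = y"
  hence "\<forall>i. \<exists>x. x \<in> carrier_vec nc \<and> A *\<^sub>v x = unit_vec n i" by auto
  then obtain X where X: "\<And>i. X i \<in> carrier_vec nc" "\<And>i. A *\<^sub>v X i = unit_vec n i" by metis
  define B where "B = mat_of_cols nc (map X [0..<n])"
  have B: "B \<in> carrier_mat nc n" unfolding B_def using mat_of_cols_carrier(1)[of nc "map X [0..<n]"] by simp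
  have "A * B = 1\<^sub>m n"
  proof (rule mat_col_eqI)
    fix j assume "j < dim_col (1\<^sub>m n :: complex mat)"
    hence j: "j < n" by simp
    have "col B j = X j" unfolding B_def using j X(1) by (subst col_mat_of_cols) auto
    thus "col (A * B) j = col (1\<^sub>m n) j" using col_mult2[OF A B j] X(2) j by simp
  qed (use A B in auto)
  thus "\<exists>B\<in>carrier_mat nc n. A * B = 1\<^sub>m n" using B by blast
qed

text \<open>This turns full row rank into the nonvanishing of one determinant, which for \<beta> on
  the real line is a rational function. A kernel vector of the Gram matrix is annihilated by the
  adjoint of A and hence orthogonal to the range of A.\<close>

lemma det_gram_nonzero_iff_surjective:
  fixes A :: "complex mat"
  assumes A: "A \<in> carrier_mat n nc"
  shows "det (A * mat_adjoint A) \<noteq> 0 \<longleftrightarrow> (\<forall>y\<in>carrier_vec n. \<exists>x\<in>carrier_vec nc. A *\<^sub>v x = y)"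
proof -
  have Aa: "mat_adjoint A \<in> carrier_mat nc n" using A by auto
  have AA: "A * mat_adjoint A \<in> carrier_mat n n" using A Aa by auto
  show ?thesis
  proof
    assume "det (A * mat_adjoint A) \<noteq> 0"
    hence "A * mat_adjoint A \<in> Units (ring_mat TYPE(complex) n ())" by (rule det_non_zero_imp_unit[OF AA])
    then obtain G where G: "G \<in> carrier_mat n n" "A * mat_adjoint A * G = 1\<^sub>m n"
      by (auto simp: Units_def ring_mat_def)
    have "A * (mat_adjoint A * G) = 1\<^sub>m n" using G(2) assoc_mult_mat[OF A Aa G(1)] by simp
    moreover have "mat_adjoint A * G \<in> carrier_mat nc n" using Aa G(1) by auto
    ultimately show "\<forall>y\<in>carrier_vec n. \<exists>x\<in>carrier_vec nc. A *\<^sub>v x = y"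
      using right_inverse_iff_surjective[OF A] by blast
  next
    assume s: "\<forall>y\<in>carrier_vec n. \<exists>x\<in>carrier_vec nc. A *\<^sub>v x = y"
    show "det (A * mat_adjoint A) \<noteq> 0"
    proof
      assume "det (A * mat_adjoint A) = 0"
      then obtain v where v: "v \<in> carrier_vec n" "v \<noteq> 0\<^sub>v n" "(A * mat_adjoint A) *\<^sub>v v = 0\<^sub>v n"
        using det_0_iff_vec_prod_zero[OF AA] by auto
      have av: "mat_adjoint A *\<^sub>v v \<in> carrier_vec nc" using Aa v by (intro mult_mat_vec_carrier)
      have "A *\<^sub>v (mat_adjoint A *\<^sub>v v) = 0\<^sub>v n" using v(3) assoc_mult_mat_vec[OF A Aa v(1)] by simp
      hence "(mat_adjoint A *\<^sub>v v) \<bullet>c (mat_adjoint A *\<^sub>v v) = 0"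
        using inner_adjoint[OF A av v(1)] v(1) by simp
      hence "cvec_norm (mat_adjoint A *\<^sub>v v) = 0" by (simp add: inner_self)
      hence Av0: "mat_adjoint A *\<^sub>v v = 0\<^sub>v nc" using cvec_norm_eq_0[OF av] by simp
      obtain x where x: "x \<in> carrier_vec nc" "A *\<^sub>v x = v" using s v(1) by blast
      have "v \<bullet>c v = x \<bullet>c (mat_adjoint A *\<^sub>v v)" using inner_adjoint[OF A x(1) v(1)] x(2) by simp
      also have "\<dots> = 0" unfolding Av0 using x(1) by (simp add: scalar_prod_def)
      finally have "cvec_norm v = 0" by (simp add: inner_self)
      thus False using v cvec_norm_eq_0[OF v(1)] by simp
    qed
  qed
qed

lemma the_mat_inverse:
  fixes X :: "complex mat"
  assumes X: "X \<in> carrier_mat n n" and Y: "Y \<in> carrier_mat n n" and XY: "X * Y = 1\<^sub>m n"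
  shows "the (mat_inverse X) = Y"
proof -
  have YX: "Y * X = 1\<^sub>m n" by (rule mat_mult_left_right_inverse[OF X Y XY])
  have "X \<in> Units (ring_mat TYPE(complex) n ())"
    unfolding Units_def using X Y XY YX by (auto simp: ring_mat_def)
  then obtain B where B: "mat_inverse X = Some B"
    using mat_inverse(1)[OF X, of "()"] by (cases "mat_inverse X") auto
  have B': "B * X = 1\<^sub>m n" "B \<in> carrier_mat n n" using mat_inverse(2)[OF X B] by auto
  have "B = B * (X * Y)" unfolding XY using B'(2) by simp
  also have "\<dots> = (B * X) * Y" by (rule assoc_mult_mat[symmetric, OF B'(2) X Y])
  also have "\<dots> = Y" unfolding B'(1) using Y by simp
  finally show ?thesis using B by simp
qed

lemma analytic_rational:
  fixes a b :: "complex poly"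
  assumes "poly b z \<noteq> 0"
  shows "(\<lambda>w. poly a w / poly b w) analytic_on {z}"
proof -
  have "open {w. poly b w \<noteq> 0}"
    by (intro open_Collect_neq continuous_intros)
  moreover have "(\<lambda>w. poly a w / poly b w) holomorphic_on {w. poly b w \<noteq> 0}"
    by (intro holomorphic_intros) auto
  ultimately show ?thesis using assms by (auto simp: analytic_at)
qed

section \<open>Boundary resolvents\<close>

locale shells =
  fixes M :: "'a shell_model"
  assumes partition: "shell_partition M"
    and hopping: "shell_hopping M"
    and factorization: "hop_factorization M"
begin

abbreviation "sz \<equiv> shell_size M"
abbreviation "rk \<equiv> hop_rank M"
abbreviation "len m n \<equiv> length (sites M m n)"
abbreviation "Hm \<equiv> ham_mat M"
abbreviation "Uh \<equiv> Ups_hat M"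
abbreviation "Ph \<equiv> Phi_hat M"

lemma Ups_carrier: "Ups M n \<in> carrier_mat (sz n) (rk n)"
  and Phi_carrier: "Phi M n \<in> carrier_mat (sz n) (rk (Suc n))"
  using factorization unfolding hop_factorization_def by auto

lemma rk_0 [simp]: "rk 0 = Suc 0"
  by (simp add: hop_rank_def)

lemma sites_Suc: "sites M 0 (Suc n) = sites M 0 n @ shell M (Suc n)"
  by (simp add: sites_def)

lemma sites_same: "sites M n n = shell M n"
  by (simp add: sites_def)

lemma sz_le_len: "m \<le> k \<Longrightarrow> k \<le> n \<Longrightarrow> sz k \<le> len m n"
proof -
  assume "m \<le> k" "k \<le> n"
  hence "k \<in> set [m..<Suc n]" unfolding set_upt by auto
  hence "length (shell M k) \<in> set (map length (map (shell M) [m..<Suc n]))" unfolding set_map by blast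
  thus ?thesis unfolding sites_def length_concat shell_size_def by (rule member_le_sum_list) simp
qed

lemma len_Suc: "len 0 (Suc n) = len 0 n + sz (Suc n)"
  by (simp add: sites_Suc shell_size_def)

lemma len_same: "len n n = sz n"
  by (simp add: sites_same shell_size_def)

lemma Hm_carrier [simp]: "Hm m n \<in> carrier_mat (len m n) (len m n)"
  by (simp add: ham_mat_def)

lemma Hm_herm: "mat_adjoint (Hm m n) = Hm m n"
proof -
  have "cnj (hop M x y) = hop M y x" for x y using hopping unfolding shell_hopping_def by metis
  thus ?thesis by (intro eq_matI) (auto simp: ham_mat_def)
qed

lemma Uh_carrier: "m \<le> n \<Longrightarrow> Uh m n \<in> carrier_mat (len m n) (rk m)"
  using carrier_append_rows[OF Ups_carrier[of m] zero_carrier_mat[of "len m n - sz m" "rk m"]] sz_le_len[of m m n]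
  by (simp add: Ups_hat_def)

lemma Ph_carrier: "m \<le> n \<Longrightarrow> Ph m n \<in> carrier_mat (len m n) (rk (Suc n))"
  using carrier_append_rows[OF zero_carrier_mat[of "len m n - sz n" "rk (Suc n)"] Phi_carrier[of n]] sz_le_len[of m n n]
  by (simp add: Phi_hat_def)

text \<open>Excludes all eigenvalues of \<open>ham_mat M m n\<close>, also those at which the
  boundary resolvent has only removable singularities. On the real line these are finitely many
  points, and elsewhere the blocks can be computed from the plain matrix inverse.\<close>

definition nonres :: "nat \<Rightarrow> nat \<Rightarrow> complex \<Rightarrow> bool" where
  "nonres m n z \<longleftrightarrow> det (shifted (Hm m n) z) \<noteq> 0"

abbreviation "Res m n z \<equiv> resolvent (Hm m n) z"

text \<open>The columns of the two boundary matrices in one numbering, so that the entries of all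
  four blocks have the single form
  \<open>(Res m n z *\<^sub>v bcol m n j) \<bullet>c bcol m n i\<close>.\<close>

definition bcol :: "nat \<Rightarrow> nat \<Rightarrow> nat \<Rightarrow> complex vec" where
  "bcol m n i = (if i < rk m then col (Uh m n) i else col (Ph m n) (i - rk m))"

lemma bcol_carrier: "m \<le> n \<Longrightarrow> i < rk m + rk (Suc n) \<Longrightarrow> bcol m n i \<in> carrier_vec (len m n)"
  using Uh_carrier[of m n] Ph_carrier[of m n] by (auto simp: bcol_def intro!: carrier_vecI)

lemma sandwich_index:
  fixes X Y G :: "complex mat"
  assumes X: "X \<in> carrier_mat N a" and Y: "Y \<in> carrier_mat N b" and G: "G \<in> carrier_mat N N"
    and ij: "i < a" "j < b"
  shows "(mat_adjoint X * G * Y) $$ (i, j) = (G *\<^sub>v col Y j) \<bullet>c col X i"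
proof -
  have Xa: "mat_adjoint X \<in> carrier_mat a N" using X by auto
  have GY: "G * Y \<in> carrier_mat N b" using G Y by auto
  have "(mat_adjoint X * G * Y) $$ (i, j) = (mat_adjoint X * (G * Y)) $$ (i, j)"
    by (simp only: assoc_mult_mat[OF Xa G Y])
  also have "\<dots> = row (mat_adjoint X) i \<bullet> col (G * Y) j" using ij Xa GY by (subst index_mult_mat(1)) auto
  also have "col (G * Y) j = G *\<^sub>v col Y j" by (rule col_mult2[OF G Y ij(2)])
  also have "row (mat_adjoint X) i = conjugate (col X i)" using X ij by (intro eq_vecI) auto
  also have "conjugate (col X i) \<bullet> (G *\<^sub>v col Y j) = (G *\<^sub>v col Y j) \<bullet>c col X i"
    using X G by (intro comm_scalar_prod[of _ N]) (auto intro!: carrier_vecI)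
  finally show ?thesis .
qed

lemma raw_index:
  assumes mn: "m \<le> n" and nr: "nonres m n z" and ij: "i < rk m + rk (Suc n)" "j < rk m + rk (Suc n)"
  shows "bdry_resolvent_raw M m n z $$ (i, j) = (Res m n z *\<^sub>v bcol m n j) \<bullet>c bcol m n i"
proof -
  have sh: "Hm m n - z \<cdot>\<^sub>m 1\<^sub>m (len m n) = shifted (Hm m n) z"
    by (simp add: shifted_def ham_mat_def)
  have G: "the (mat_inverse (Hm m n - z \<cdot>\<^sub>m 1\<^sub>m (len m n))) = Res m n z"
    unfolding sh using resolvent_inverse[OF Hm_carrier] nr
    by (intro the_mat_inverse[of _ "len m n"]) (auto simp: nonres_def)
  note c = Uh_carrier[OF mn] Ph_carrier[OF mn] resolvent_carrier[OF Hm_carrier, of m n z]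
  have d: "dim_row (mat_adjoint (Uh m n) * Res m n z * Uh m n) = rk m"
    "dim_col (mat_adjoint (Uh m n) * Res m n z * Uh m n) = rk m"
    "dim_row (mat_adjoint (Ph m n) * Res m n z * Ph m n) = rk (Suc n)"
    "dim_col (mat_adjoint (Ph m n) * Res m n z * Ph m n) = rk (Suc n)"
    using c by auto
  show ?thesis
    unfolding bdry_resolvent_raw_def Let_def G bcol_def
    using ij c d sandwich_index[OF _ _ c(3)] by (subst index_mat_four_block(1)) auto
qed

lemma nonres_poly:
  obtains q where "\<And>z. det (shifted (Hm m n) z) = poly q z" "q \<noteq> 0"
proof -
  obtain q where q: "\<And>z. det (shifted (Hm m n) z) = poly q z"
    using polyfun_det_shifted[OF Hm_carrier] unfolding polyfun_def by blast
  \<comment> \<open>With an empty boundary matrix the dissipative matrix is the Hermitian one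
    itself, so the determinant does not vanish at z = i.\<close>
  interpret D: dissipative "Hm m n" "0\<^sub>m (len m n) 0" "len m n" 0
    by standard (auto simp: Hm_herm)
  have "D.A = Hm m n" unfolding D.A_def by (intro eq_matI) (auto simp: ham_mat_def scalar_prod_def)
  hence "poly q \<i> \<noteq> 0" using D.det_shifted_nonzero[of \<i>] q by simp
  hence "q \<noteq> 0" by auto
  thus thesis using that q by blast
qed

lemma nonres_nhds: "nonres m n z \<Longrightarrow> \<forall>\<^sub>F w in nhds z. nonres m n w"
proof -
  assume nr: "nonres m n z"
  obtain q where q: "\<And>z. det (shifted (Hm m n) z) = poly q z" "q \<noteq> 0" using nonres_poly by blast
  have "open {w. poly q w \<noteq> 0}" by (intro open_Collect_neq continuous_intros)
  thus ?thesis using nr by (auto simp: eventually_nhds nonres_def q)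
qed

lemma finite_not_nonres: "finite {t::real. \<not> nonres m n (complex_of_real t)}"
proof -
  obtain q where q: "\<And>z. det (shifted (Hm m n) z) = poly q z" "q \<noteq> 0" using nonres_poly by blast
  have "finite (complex_of_real -` {z. poly q z = 0})"
    by (rule finite_vimageI[OF poly_roots_finite[OF q(2)]]) (auto intro: injI)
  thus ?thesis by (simp add: nonres_def q vimage_def)
qed

lemma raw_rational:
  assumes "m \<le> n" "i < rk m + rk (Suc n)" "j < rk m + rk (Suc n)"
  shows "\<exists>p q. (\<forall>z. det (shifted (Hm m n) z) = poly q z) \<and> q \<noteq> 0 \<and>
    (\<forall>z. nonres m n z \<longrightarrow> bdry_resolvent_raw M m n z $$ (i, j) = poly p z / poly q z)"
proof -
  obtain q where q: "\<And>z. det (shifted (Hm m n) z) = poly q z" "q \<noteq> 0" using nonres_poly by blast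
  obtain p where "\<And>z. (Res m n z *\<^sub>v bcol m n j) \<bullet>c bcol m n i = poly p z / det (shifted (Hm m n) z)"
    using polyfun_resolvent_inner[OF Hm_carrier bcol_carrier[OF assms(1,3)] bcol_carrier[OF assms(1,2)]] by blast
  thus ?thesis using q raw_index[OF assms(1) _ assms(2,3)] by (intro exI[of _ p] exI[of _ q]) auto
qed

lemma raw_analytic:
  assumes "m \<le> n" "i < rk m + rk (Suc n)" "j < rk m + rk (Suc n)" "nonres m n z"
  shows "\<exists>f. f analytic_on {z} \<and> (\<forall>\<^sub>F w in at z. f w = bdry_resolvent_raw M m n w $$ (i, j)) \<and>
    f z = bdry_resolvent_raw M m n z $$ (i, j)"
proof -
  obtain p q where pq': "(\<forall>z. det (shifted (Hm m n) z) = poly q z) \<and> q \<noteq> 0 \<and>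
    (\<forall>z. nonres m n z \<longrightarrow> bdry_resolvent_raw M m n z $$ (i, j) = poly p z / poly q z)"
    using raw_rational[OF assms(1-3)] by (elim exE)
  hence pq: "\<And>z. det (shifted (Hm m n) z) = poly q z" "q \<noteq> 0"
    "\<And>z. nonres m n z \<Longrightarrow> bdry_resolvent_raw M m n z $$ (i, j) = poly p z / poly q z"
    by auto
  have "\<forall>\<^sub>F w in nhds z. poly p w / poly q w = bdry_resolvent_raw M m n w $$ (i, j)"
    using nonres_nhds[OF assms(4)] by eventually_elim (simp add: pq(3))
  hence ev: "\<forall>\<^sub>F w in at z. poly p w / poly q w = bdry_resolvent_raw M m n w $$ (i, j)"
    using eventually_nhds_conv_at by blast
  have "poly q z \<noteq> 0" using assms(4) unfolding nonres_def pq(1) .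
  thus ?thesis
    using analytic_rational[of q z p] ev pq(3)[OF assms(4), symmetric] by (intro exI[of _ "\<lambda>w. poly p w / poly q w"] conjI)
qed

lemma bdry_resolvent_index:
  assumes "m \<le> n" "nonres m n z" "i < rk m + rk (Suc n)" "j < rk m + rk (Suc n)"
  shows "bdry_resolvent M m n z $$ (i, j) = (Res m n z *\<^sub>v bcol m n j) \<bullet>c bcol m n i"
proof -
  obtain f where f: "f analytic_on {z}" "\<forall>\<^sub>F w in at z. f w = bdry_resolvent_raw M m n w $$ (i, j)"
    "f z = bdry_resolvent_raw M m n z $$ (i, j)" using raw_analytic[OF assms(1,3,4,2)] by auto
  have "bdry_resolvent M m n z $$ (i, j) = remove_sings (\<lambda>w. bdry_resolvent_raw M m n w $$ (i, j)) z"
    using assms by (simp add: bdry_resolvent_def Let_def)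
  also have "\<dots> = remove_sings f z"
    by (rule remove_sings_cong) (use f(2) in \<open>auto elim: eventually_mono\<close>)
  also have "\<dots> = f z" by (rule remove_sings_at_analytic[OF f(1)])
  finally show ?thesis using f(3) raw_index[OF assms] by simp
qed

lemma nonres_not_singular1:
  assumes "m \<le> n" "nonres m n z"
  shows "z \<notin> singular_set1 M m n"
proof -
  have "extends_analytically (\<lambda>w. bdry_resolvent_raw M m n w $$ (i, j)) z"
    if ij: "i < rk m + rk (Suc n)" "j < rk m + rk (Suc n)" for i j
    unfolding extends_analytically_def using raw_analytic[OF assms(1) ij assms(2)] by auto
  thus ?thesis by (simp add: singular_set1_def)
qed

lemma block_carriers [simp]:
  "alpha M m n z \<in> carrier_mat (rk m) (rk m)" "beta M m n z \<in> carrier_mat (rk m) (rk (Suc n))"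
  "gamma M m n z \<in> carrier_mat (rk (Suc n)) (rk m)" "delta M m n z \<in> carrier_mat (rk (Suc n)) (rk (Suc n))"
  by (simp_all add: alpha_def beta_def gamma_def delta_def)

lemma block_eqs:
  assumes mn: "m \<le> n" and nr: "nonres m n z"
  shows "alpha M m n z = mat_adjoint (Uh m n) * Res m n z * Uh m n"
    "beta M m n z = mat_adjoint (Uh m n) * Res m n z * Ph m n"
    "gamma M m n z = mat_adjoint (Ph m n) * Res m n z * Uh m n"
    "delta M m n z = mat_adjoint (Ph m n) * Res m n z * Ph m n"
proof -
  note c = Uh_carrier[OF mn] Ph_carrier[OF mn] resolvent_carrier[OF Hm_carrier, of m n z]
  note S = sandwich_index[OF _ _ c(3)]
  note B = bdry_resolvent_index[OF mn nr]
  show "alpha M m n z = mat_adjoint (Uh m n) * Res m n z * Uh m n"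
    using c by (intro eq_matI) (auto simp: alpha_def S B bcol_def simp del: assoc_mult_mat index_mult_mat(1))
  show "beta M m n z = mat_adjoint (Uh m n) * Res m n z * Ph m n"
    using c by (intro eq_matI) (auto simp: beta_def S B bcol_def simp del: assoc_mult_mat index_mult_mat(1))
  show "gamma M m n z = mat_adjoint (Ph m n) * Res m n z * Uh m n"
    using c by (intro eq_matI) (auto simp: gamma_def S B bcol_def simp del: assoc_mult_mat index_mult_mat(1))
  show "delta M m n z = mat_adjoint (Ph m n) * Res m n z * Ph m n"
    using c by (intro eq_matI) (auto simp: delta_def S B bcol_def simp del: assoc_mult_mat index_mult_mat(1))
qed

lemma sandwich_mult_vec:
  fixes X Y G :: "complex mat"
  assumes "X \<in> carrier_mat N a" "Y \<in> carrier_mat N b" "G \<in> carrier_mat N N" "v \<in> carrier_vec b"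
  shows "(mat_adjoint X * G * Y) *\<^sub>v v = mat_adjoint X *\<^sub>v (G *\<^sub>v (Y *\<^sub>v v))"
proof -
  have "mat_adjoint X \<in> carrier_mat a N" "mat_adjoint X * G \<in> carrier_mat a N" "Y *\<^sub>v v \<in> carrier_vec N"
    using assms by (auto intro: mult_mat_vec_carrier)
  thus ?thesis using assms
    by (simp add: assoc_mult_mat_vec[of "mat_adjoint X * G" a N Y b v]
        assoc_mult_mat_vec[of "mat_adjoint X" a N G N "Y *\<^sub>v v"] del: assoc_mult_mat)
qed

lemma block_mult_vec:
  assumes mn: "m \<le> n" and nr: "nonres m n z"
  shows "v \<in> carrier_vec (rk m) \<Longrightarrow> alpha M m n z *\<^sub>v v = mat_adjoint (Uh m n) *\<^sub>v (Res m n z *\<^sub>v (Uh m n *\<^sub>v v))"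
    "w \<in> carrier_vec (rk (Suc n)) \<Longrightarrow> beta M m n z *\<^sub>v w = mat_adjoint (Uh m n) *\<^sub>v (Res m n z *\<^sub>v (Ph m n *\<^sub>v w))"
    "v \<in> carrier_vec (rk m) \<Longrightarrow> gamma M m n z *\<^sub>v v = mat_adjoint (Ph m n) *\<^sub>v (Res m n z *\<^sub>v (Uh m n *\<^sub>v v))"
    "w \<in> carrier_vec (rk (Suc n)) \<Longrightarrow> delta M m n z *\<^sub>v w = mat_adjoint (Ph m n) *\<^sub>v (Res m n z *\<^sub>v (Ph m n *\<^sub>v w))"
  unfolding block_eqs[OF mn nr]
  using Uh_carrier[OF mn] Ph_carrier[OF mn] resolvent_carrier[OF Hm_carrier, of m n z]
  by (auto intro!: sandwich_mult_vec)

lemma resolvent_herm: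
  assumes "nonres m n (complex_of_real t)"
  shows "mat_adjoint (Res m n (complex_of_real t)) = Res m n (complex_of_real t)"
proof -
  let ?S = "shifted (Hm m n) (complex_of_real t)" and ?G = "Res m n (complex_of_real t)" and ?N = "len m n"
  have S: "?S \<in> carrier_mat ?N ?N" and G: "?G \<in> carrier_mat ?N ?N" by simp_all
  have Ga: "mat_adjoint ?G \<in> carrier_mat ?N ?N" using G by auto
  note inv = resolvent_inverse[OF Hm_carrier assms[unfolded nonres_def]]
  have Sa: "mat_adjoint ?S = ?S"
  proof (rule eq_matI)
    fix i j assume "i < dim_row ?S" "j < dim_col ?S"
    hence ij: "i < ?N" "j < ?N" using S by auto
    have "cnj (Hm m n $$ (j, i)) = Hm m n $$ (i, j)"
      using arg_cong[OF Hm_herm, of "\<lambda>X. X $$ (i, j)" m n] ij by (simp add: ham_mat_def)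
    thus "mat_adjoint ?S $$ (i, j) = ?S $$ (i, j)" using ij carrier_matD[OF S] by (simp add: shifted_index[OF Hm_carrier])
  qed (simp_all only: mat_adjoint_dim carrier_matD[OF S])
  have "mat_adjoint ?G * ?S = mat_adjoint (?S * ?G)" using mat_adjoint_mult[OF S G] Sa by simp
  also have "\<dots> = 1\<^sub>m ?N" using inv by simp
  finally have GS: "mat_adjoint ?G * ?S = 1\<^sub>m ?N" .
  have "mat_adjoint ?G = mat_adjoint ?G * (?S * ?G)" unfolding inv(1) by (rule right_mult_one_mat[OF Ga, symmetric])
  also have "\<dots> = (mat_adjoint ?G * ?S) * ?G" by (rule assoc_mult_mat[symmetric, OF Ga S G])
  finally show ?thesis unfolding GS left_mult_one_mat[OF G] .
qed

lemma sandwich_adjoint: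
  fixes X Y G :: "complex mat"
  assumes X: "X \<in> carrier_mat N a" and Y: "Y \<in> carrier_mat N b" and G: "G \<in> carrier_mat N N" and "mat_adjoint G = G"
  shows "mat_adjoint (mat_adjoint X * G * Y) = mat_adjoint Y * G * X"
proof -
  have Xa: "mat_adjoint X \<in> carrier_mat a N" "mat_adjoint Y \<in> carrier_mat b N" using X Y by auto
  have "mat_adjoint (mat_adjoint X * G * Y) = mat_adjoint Y * mat_adjoint (mat_adjoint X * G)"
    by (rule mat_adjoint_mult[of _ a N _ b]) (use Xa G Y in auto)
  also have "mat_adjoint (mat_adjoint X * G) = G * X"
    using mat_adjoint_mult[OF Xa(1) G] assms(4) by simp
  finally show ?thesis using assoc_mult_mat[OF Xa(2) G X] by simp
qed

lemma blocks_herm: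
  assumes mn: "m \<le> n" and nr: "nonres m n (complex_of_real t)"
  shows "mat_adjoint (alpha M m n (complex_of_real t)) = alpha M m n (complex_of_real t)"
    "mat_adjoint (beta M m n (complex_of_real t)) = gamma M m n (complex_of_real t)"
    "mat_adjoint (delta M m n (complex_of_real t)) = delta M m n (complex_of_real t)"
proof -
  note U = Uh_carrier[OF mn] and P = Ph_carrier[OF mn]
  note G = resolvent_carrier[OF Hm_carrier] resolvent_herm[OF nr]
  show "mat_adjoint (alpha M m n (complex_of_real t)) = alpha M m n (complex_of_real t)"
    unfolding block_eqs[OF mn nr] by (rule sandwich_adjoint[OF U U G])
  show "mat_adjoint (beta M m n (complex_of_real t)) = gamma M m n (complex_of_real t)"
    unfolding block_eqs[OF mn nr] by (rule sandwich_adjoint[OF U P G])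
  show "mat_adjoint (delta M m n (complex_of_real t)) = delta M m n (complex_of_real t)"
    unfolding block_eqs[OF mn nr] by (rule sandwich_adjoint[OF P P G])
qed

end

section \<open>Transfer matrices\<close>

lemma vec_eqI_inner:
  fixes a b :: "complex vec"
  assumes "a \<in> carrier_vec n" "b \<in> carrier_vec n" "\<And>w. w \<in> carrier_vec n \<Longrightarrow> a \<bullet>c w = b \<bullet>c w"
  shows "a = b"
proof (rule eq_vecI)
  fix i assume "i < dim_vec b"
  hence i: "i < n" using assms by simp
  have "conjugate (unit_vec n i) = (unit_vec n i :: complex vec)" by (intro eq_vecI) (auto simp: unit_vec_def)
  thus "a $ i = b $ i" using assms(3)[of "unit_vec n i"] assms(1,2) i by simp
qed (use assms in auto)

lemma inner_append:
  fixes a b c d :: "complex vec"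
  assumes "a \<in> carrier_vec n" "b \<in> carrier_vec m" "c \<in> carrier_vec n" "d \<in> carrier_vec m"
  shows "(a @\<^sub>v b) \<bullet>c (c @\<^sub>v d) = a \<bullet>c c + b \<bullet>c d"
proof -
  have "conjugate (c @\<^sub>v d) = conjugate c @\<^sub>v conjugate d" by (intro eq_vecI) auto
  thus ?thesis using assms by (simp add: scalar_prod_append[of _ n _ m])
qed

lemma adjoint_append_rows_mult_vec:
  fixes X Y :: "complex mat"
  assumes X: "X \<in> carrier_mat n k" and Y: "Y \<in> carrier_mat m k" and a: "a \<in> carrier_vec n" and b: "b \<in> carrier_vec m"
  shows "mat_adjoint (X @\<^sub>r Y) *\<^sub>v (a @\<^sub>v b) = mat_adjoint X *\<^sub>v a + mat_adjoint Y *\<^sub>v b"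
proof (rule vec_eqI_inner)
  have XY: "X @\<^sub>r Y \<in> carrier_mat (n + m) k" using X Y by (rule carrier_append_rows)
  have ab: "a @\<^sub>v b \<in> carrier_vec (n + m)" using a b by simp
  have ca: "mat_adjoint X *\<^sub>v a \<in> carrier_vec k" "mat_adjoint Y *\<^sub>v b \<in> carrier_vec k"
    using X Y by (auto intro!: carrier_vecI)
  show "mat_adjoint (X @\<^sub>r Y) *\<^sub>v (a @\<^sub>v b) \<in> carrier_vec k" using XY by (auto intro!: carrier_vecI)
  show "mat_adjoint X *\<^sub>v a + mat_adjoint Y *\<^sub>v b \<in> carrier_vec k" using ca by simp
  fix w :: "complex vec" assume w: "w \<in> carrier_vec k"
  have "(mat_adjoint (X @\<^sub>r Y) *\<^sub>v (a @\<^sub>v b)) \<bullet>c w = (a @\<^sub>v b) \<bullet>c ((X @\<^sub>r Y) *\<^sub>v w)"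
    using inner_adjoint[OF mat_adjoint_carrier[OF XY] ab w] by simp
  also have "(X @\<^sub>r Y) *\<^sub>v w = (X *\<^sub>v w) @\<^sub>v (Y *\<^sub>v w)" by (rule mat_mult_append[OF X Y w])
  also have "(a @\<^sub>v b) \<bullet>c ((X *\<^sub>v w) @\<^sub>v (Y *\<^sub>v w)) = a \<bullet>c (X *\<^sub>v w) + b \<bullet>c (Y *\<^sub>v w)"
    by (rule inner_append[OF a b]) (use X Y in \<open>auto intro!: carrier_vecI\<close>)
  also have "\<dots> = (mat_adjoint X *\<^sub>v a) \<bullet>c w + (mat_adjoint Y *\<^sub>v b) \<bullet>c w"
    using inner_adjoint[OF mat_adjoint_carrier[OF X] a w] inner_adjoint[OF mat_adjoint_carrier[OF Y] b w] by simp
  also have "\<dots> = (mat_adjoint X *\<^sub>v a + mat_adjoint Y *\<^sub>v b) \<bullet>c w" by (rule inner_add_left[OF ca w, symmetric])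
  finally show "(mat_adjoint (X @\<^sub>r Y) *\<^sub>v (a @\<^sub>v b)) \<bullet>c w = (mat_adjoint X *\<^sub>v a + mat_adjoint Y *\<^sub>v b) \<bullet>c w" .
qed

lemma append_rows_index:
  assumes "X \<in> carrier_mat n k" "Y \<in> carrier_mat m k" "i < n + m" "j < k"
  shows "(X @\<^sub>r Y) $$ (i, j) = (if i < n then X $$ (i, j) else Y $$ (i - n, j))"
  using assms unfolding append_rows_def by (subst index_mat_four_block(1)) auto

lemma append_rows_dim:
  assumes "X \<in> carrier_mat n k" "Y \<in> carrier_mat m k"
  shows "dim_row (X @\<^sub>r Y) = n + m" "dim_col (X @\<^sub>r Y) = k"
  using carrier_append_rows[OF assms] by auto

lemma chain_cong: "(\<And>i. i \<le> n \<Longrightarrow> T i = T' i) \<Longrightarrow> chain T n v = chain T' n v"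
  by (induction n) auto

lemma chain_set_0: "chain_set TT 0 = {T *\<^sub>v vec_of_list [1, 0] | T. T \<in> TT 0}"
proof -
  have "\<exists>T. T 0 \<in> TT 0 \<and> x = T 0 *\<^sub>v v" if "X \<in> TT 0" "x = X *\<^sub>v v" for X x v
    using that by (intro exI[of _ "\<lambda>_. X"]) simp
  thus ?thesis unfolding chain_set_def by auto
qed

lemma chain_set_Suc: "chain_set TT (Suc n) = {T *\<^sub>v u | T u. T \<in> TT (Suc n) \<and> u \<in> chain_set TT n}"
proof (intro Set.set_eqI iffI)
  fix x assume "x \<in> chain_set TT (Suc n)"
  then obtain T where T: "x = chain T (Suc n) (vec_of_list [1, 0])" "\<forall>i\<le>Suc n. T i \<in> TT i"
    unfolding chain_set_def by blast
  hence "chain T n (vec_of_list [1, 0]) \<in> chain_set TT n" unfolding chain_set_def by auto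
  thus "x \<in> {T *\<^sub>v u | T u. T \<in> TT (Suc n) \<and> u \<in> chain_set TT n}" using T by auto
next
  fix x assume "x \<in> {T *\<^sub>v u | T u. T \<in> TT (Suc n) \<and> u \<in> chain_set TT n}"
  then obtain S T where S: "x = S *\<^sub>v chain T n (vec_of_list [1, 0])" "S \<in> TT (Suc n)" "\<forall>i\<le>n. T i \<in> TT i"
    unfolding chain_set_def by auto
  define T' where "T' = T(Suc n := S)"
  have "chain T' n (vec_of_list [1, 0]) = chain T n (vec_of_list [1, 0])"
    by (rule chain_cong) (auto simp: T'_def)
  hence "x = chain T' (Suc n) (vec_of_list [1, 0])" using S by (simp add: T'_def)
  moreover have "\<forall>i\<le>Suc n. T' i \<in> TT i" using S by (auto simp: T'_def le_Suc_eq)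
  ultimately show "x \<in> chain_set TT (Suc n)" unfolding chain_set_def by blast
qed

lemma chain_set_mono: "(\<And>i. TT i \<subseteq> TT' i) \<Longrightarrow> chain_set TT n \<subseteq> chain_set TT' n"
  unfolding chain_set_def by blast

section \<open>Block structure of the finite-volume matrices\<close>

context shells
begin

lemma sites_nth_last:
  assumes "i < len 0 n" "i \<ge> len 0 n - sz n"
  shows "sites M 0 n ! i = shell M n ! (i - (len 0 n - sz n))"
proof (cases n)
  case 0
  thus ?thesis by (simp add: sites_same shell_size_def)
next
  case (Suc k)
  thus ?thesis using assms by (simp add: sites_Suc shell_size_def nth_append)
qed

lemma sites_nth_inner:
  assumes "i < len 0 n - sz n"
  shows "\<exists>l<n. sites M 0 n ! i \<in> set (shell M l)"
proof (cases n)
  case 0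
  thus ?thesis using assms by (simp add: sites_same shell_size_def)
next
  case (Suc k)
  hence "sites M 0 n ! i = sites M 0 k ! i" "i < len 0 k" using assms by (auto simp: sites_Suc shell_size_def nth_append)
  hence "sites M 0 n ! i \<in> set (sites M 0 k)" by simp
  then obtain l where "l \<in> set [0..<Suc k]" "sites M 0 n ! i \<in> set (shell M l)"
    unfolding sites_def[of M 0 k] set_concat set_map by blast
  thus ?thesis using Suc by (intro exI[of _ l]) (auto simp: less_Suc_eq)
qed

lemma Ph_index:
  assumes "i < len 0 n" "j < rk (Suc n)"
  shows "Ph 0 n $$ (i, j) = (if i < len 0 n - sz n then 0 else Phi M n $$ (i - (len 0 n - sz n), j))"
  using assms sz_le_len[of 0 n n] append_rows_index[OF zero_carrier_mat Phi_carrier, of i "len 0 n - sz n" n j]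
  by (simp add: Phi_hat_def)

text \<open>Among the shells up to n only the last one is coupled to shell n + 1. The zero rows of
  \<open>Phi_hat\<close> express this for the inner shells, and on the last shell the identity is
  the given factorization of the hopping block.\<close>

lemma hop_coupling:
  assumes i: "i < sz (Suc n)" and j: "j < len 0 n"
  shows "hop M (shell M (Suc n) ! i) (sites M 0 n ! j) = - (Ups M (Suc n) * mat_adjoint (Ph 0 n)) $$ (i, j)"
proof -
  have Pa: "mat_adjoint (Ph 0 n) \<in> carrier_mat (rk (Suc n)) (len 0 n)" using Ph_carrier[of 0 n] by auto
  have R: "(Ups M (Suc n) * mat_adjoint (Ph 0 n)) $$ (i, j) = (\<Sum>l<rk (Suc n). Ups M (Suc n) $$ (i, l) * cnj (Ph 0 n $$ (j, l)))"
    using mult_index_sum[OF Ups_carrier Pa i j] Ph_carrier[of 0 n] j by simp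
  show ?thesis
  proof (cases "j < len 0 n - sz n")
    case True
    then obtain l where l: "l < n" "sites M 0 n ! j \<in> set (shell M l)" using sites_nth_inner by blast
    have "shell M (Suc n) ! i \<in> set (shell M (Suc n))" using i by (simp add: shell_size_def)
    hence "hop M (shell M (Suc n) ! i) (sites M 0 n ! j) = 0"
      using hopping l unfolding shell_hopping_def by (metis add_2_eq_Suc' Suc_le_mono Suc_leI)
    moreover have "(Ups M (Suc n) * mat_adjoint (Ph 0 n)) $$ (i, j) = 0"
      unfolding R using True j by (intro sum.neutral) (simp add: Ph_index)
    ultimately show ?thesis by simp
  next
    case False
    define j' where "j' = j - (len 0 n - sz n)"
    have j': "j' < sz n" using False j sz_le_len[of 0 n n] by (simp add: j'_def)
    have Pha: "mat_adjoint (Phi M n) \<in> carrier_mat (rk (Suc n)) (sz n)" using Phi_carrier[of n] by auto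
    have "hop_block M (Suc n) = - (Ups M (Suc n) * mat_adjoint (Phi M n))"
      using factorization unfolding hop_factorization_def by (metis diff_Suc_1 le_add1 plus_1_eq_Suc)
    hence "hop_block M (Suc n) $$ (i, j') = - (\<Sum>l<rk (Suc n). Ups M (Suc n) $$ (i, l) * cnj (Phi M n $$ (j', l)))"
      using mult_index_sum[OF Ups_carrier Pha i j'] Phi_carrier[of n] Ups_carrier[of "Suc n"] i j' by simp
    moreover have "hop_block M (Suc n) $$ (i, j') = hop M (shell M (Suc n) ! i) (sites M 0 n ! j)"
      using i j' False j by (simp add: hop_block_def sites_nth_last j'_def)
    moreover have "(\<Sum>l<rk (Suc n). Ups M (Suc n) $$ (i, l) * cnj (Phi M n $$ (j', l))) =
        (\<Sum>l<rk (Suc n). Ups M (Suc n) $$ (i, l) * cnj (Ph 0 n $$ (j, l)))"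
      using j False by (intro sum.cong) (auto simp: Ph_index j'_def)
    ultimately show ?thesis unfolding R by simp
  qed
qed

lemma Hm_Suc:
  "Hm 0 (Suc n) = four_block_mat (Hm 0 n) (- (Ph 0 n * mat_adjoint (Ups M (Suc n))))
     (- (Ups M (Suc n) * mat_adjoint (Ph 0 n))) (Hm (Suc n) (Suc n))"
proof -
  have c: "Ph 0 n \<in> carrier_mat (len 0 n) (rk (Suc n))" "Ups M (Suc n) \<in> carrier_mat (sz (Suc n)) (rk (Suc n))"
    using Ph_carrier[of 0 n] Ups_carrier by auto
  have hs: "hop M y x = cnj (hop M x y)" for x y using hopping unfolding shell_hopping_def by blast
  have adj: "(Ph 0 n * mat_adjoint (Ups M (Suc n))) $$ (j, i) = cnj ((Ups M (Suc n) * mat_adjoint (Ph 0 n)) $$ (i, j))"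
    if "i < sz (Suc n)" "j < len 0 n" for i j
    using that c mult_index_sum[OF c(1) mat_adjoint_carrier[OF c(2)] that(2,1)]
      mult_index_sum[OF c(2) mat_adjoint_carrier[OF c(1)] that] by (simp add: mult.commute)
  show ?thesis
  proof (rule eq_matI)
    fix i j assume "i < dim_row (four_block_mat (Hm 0 n) (- (Ph 0 n * mat_adjoint (Ups M (Suc n))))
     (- (Ups M (Suc n) * mat_adjoint (Ph 0 n))) (Hm (Suc n) (Suc n)))"
     "j < dim_col (four_block_mat (Hm 0 n) (- (Ph 0 n * mat_adjoint (Ups M (Suc n))))
     (- (Ups M (Suc n) * mat_adjoint (Ph 0 n))) (Hm (Suc n) (Suc n)))"
    hence ij: "i < len 0 n + sz (Suc n)" "j < len 0 n + sz (Suc n)" by (auto simp: ham_mat_def len_same)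
    have L: "Hm 0 (Suc n) $$ (i, j) = hop M (sites M 0 (Suc n) ! i) (sites M 0 (Suc n) ! j)"
      using ij by (simp add: ham_mat_def len_Suc)
    consider "i < len 0 n" "j < len 0 n" | "i < len 0 n" "\<not> j < len 0 n" | "\<not> i < len 0 n" "j < len 0 n"
      | "\<not> i < len 0 n" "\<not> j < len 0 n" by blast
    thus "Hm 0 (Suc n) $$ (i, j) = four_block_mat (Hm 0 n) (- (Ph 0 n * mat_adjoint (Ups M (Suc n))))
     (- (Ups M (Suc n) * mat_adjoint (Ph 0 n))) (Hm (Suc n) (Suc n)) $$ (i, j)"
    proof cases
      case 1
      thus ?thesis unfolding L using ij by (subst index_mat_four_block(1)) (auto simp: ham_mat_def len_same sites_Suc nth_append)
    next
      case 2
      define j' where "j' = j - len 0 n"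
      have j': "j' < sz (Suc n)" using 2 ij by (simp add: j'_def)
      have "hop M (sites M 0 n ! i) (shell M (Suc n) ! j') = - (Ph 0 n * mat_adjoint (Ups M (Suc n))) $$ (i, j')"
        unfolding hs[of "sites M 0 n ! i" "shell M (Suc n) ! j'"] hop_coupling[OF j' 2(1)] adj[OF j' 2(1)] by simp
      thus ?thesis unfolding L using ij 2 c j'
        by (subst index_mat_four_block(1)) (auto simp: ham_mat_def len_same sites_Suc nth_append j'_def)
    next
      case 3
      define i' where "i' = i - len 0 n"
      have i': "i' < sz (Suc n)" using 3 ij by (simp add: i'_def)
      show ?thesis unfolding L using ij 3 c i' hop_coupling[OF i' 3(2)]
        by (subst index_mat_four_block(1)) (auto simp: ham_mat_def len_same sites_Suc nth_append i'_def)
    next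
      case 4
      thus ?thesis unfolding L using ij
        by (subst index_mat_four_block(1)) (auto simp: ham_mat_def len_same sites_Suc sites_same nth_append shell_size_def)
    qed
  qed (auto simp: ham_mat_def len_Suc len_same)
qed

text \<open>The coupling factors through the boundary columns, so each piece sees the other only as
  a source on its boundary: the adjoint of \<Upsilon> applied to \<phi> drives the inner piece, the
  adjoint of \<Phi> applied to \<psi> drives the outer one.\<close>

lemma shifted_append:
  assumes \<psi>: "\<psi> \<in> carrier_vec (len 0 n)" and \<phi>: "\<phi> \<in> carrier_vec (sz (Suc n))"
  shows "shifted (Hm 0 (Suc n)) z *\<^sub>v (\<psi> @\<^sub>v \<phi>) =
    (shifted (Hm 0 n) z *\<^sub>v \<psi> - Ph 0 n *\<^sub>v (mat_adjoint (Ups M (Suc n)) *\<^sub>v \<phi>)) @\<^sub>v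
    (shifted (Hm (Suc n) (Suc n)) z *\<^sub>v \<phi> - Ups M (Suc n) *\<^sub>v (mat_adjoint (Ph 0 n) *\<^sub>v \<psi>))"
proof -
  let ?P = "Ph 0 n" and ?U = "Ups M (Suc n)"
  have P: "?P \<in> carrier_mat (len 0 n) (rk (Suc n))" and U: "?U \<in> carrier_mat (sz (Suc n)) (rk (Suc n))"
    using Ph_carrier[of 0 n] Ups_carrier by auto
  have Pa: "mat_adjoint ?P \<in> carrier_mat (rk (Suc n)) (len 0 n)" and Ua: "mat_adjoint ?U \<in> carrier_mat (rk (Suc n)) (sz (Suc n))"
    using P U by auto
  have V: "Hm (Suc n) (Suc n) \<in> carrier_mat (sz (Suc n)) (sz (Suc n))" using Hm_carrier[of "Suc n" "Suc n"] by (simp add: len_same)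
  have PU: "- (?P * mat_adjoint ?U) \<in> carrier_mat (len 0 n) (sz (Suc n))" and UP: "- (?U * mat_adjoint ?P) \<in> carrier_mat (sz (Suc n)) (len 0 n)"
    using P U Pa Ua by auto
  have neg: "(- (X * Y)) *\<^sub>v v = - (X *\<^sub>v (Y *\<^sub>v v))" if "X \<in> carrier_mat a b" "Y \<in> carrier_mat b d" "v \<in> carrier_vec d"
    for X Y :: "complex mat" and v a b d
  proof -
    have XY: "X * Y \<in> carrier_mat a d" using that by auto
    hence "(- (X * Y)) *\<^sub>v v = - ((X * Y) *\<^sub>v v)"
      using that(3) by (intro eq_vecI) (auto simp: scalar_prod_def sum_negf)
    thus ?thesis by (simp only: assoc_mult_mat_vec[OF that])
  qed
  have app: "\<psi> @\<^sub>v \<phi> \<in> carrier_vec (len 0 (Suc n))" using \<psi> \<phi> by (simp add: len_Suc)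
  have "Hm 0 (Suc n) *\<^sub>v (\<psi> @\<^sub>v \<phi>) = (Hm 0 n *\<^sub>v \<psi> + (- (?P * mat_adjoint ?U)) *\<^sub>v \<phi>) @\<^sub>v
      ((- (?U * mat_adjoint ?P)) *\<^sub>v \<psi> + Hm (Suc n) (Suc n) *\<^sub>v \<phi>)"
    unfolding Hm_Suc by (rule four_block_mat_mult_vec[OF Hm_carrier PU UP V \<psi> \<phi>])
  also have "(- (?P * mat_adjoint ?U)) *\<^sub>v \<phi> = - (?P *\<^sub>v (mat_adjoint ?U *\<^sub>v \<phi>))" by (rule neg[OF P Ua \<phi>])
  also have "(- (?U * mat_adjoint ?P)) *\<^sub>v \<psi> = - (?U *\<^sub>v (mat_adjoint ?P *\<^sub>v \<psi>))" by (rule neg[OF U Pa \<psi>])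
  finally have H: "Hm 0 (Suc n) *\<^sub>v (\<psi> @\<^sub>v \<phi>) = (Hm 0 n *\<^sub>v \<psi> + - (?P *\<^sub>v (mat_adjoint ?U *\<^sub>v \<phi>))) @\<^sub>v
      (- (?U *\<^sub>v (mat_adjoint ?P *\<^sub>v \<psi>)) + Hm (Suc n) (Suc n) *\<^sub>v \<phi>)" .
  have d: "Hm 0 n *\<^sub>v \<psi> \<in> carrier_vec (len 0 n)" "?P *\<^sub>v (mat_adjoint ?U *\<^sub>v \<phi>) \<in> carrier_vec (len 0 n)"
    "?U *\<^sub>v (mat_adjoint ?P *\<^sub>v \<psi>) \<in> carrier_vec (sz (Suc n))" "Hm (Suc n) (Suc n) *\<^sub>v \<phi> \<in> carrier_vec (sz (Suc n))"
    using P U V carrier_matD[OF Hm_carrier[of 0 n]] by (auto intro!: carrier_vecI)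
  have gen: "((a + - b) @\<^sub>v (- c + e)) - (z \<cdot>\<^sub>v (\<psi> @\<^sub>v \<phi>)) = (a - z \<cdot>\<^sub>v \<psi> - b) @\<^sub>v (e - z \<cdot>\<^sub>v \<phi> - c)"
    if "a \<in> carrier_vec (len 0 n)" "b \<in> carrier_vec (len 0 n)" "c \<in> carrier_vec (sz (Suc n))" "e \<in> carrier_vec (sz (Suc n))" for a b c e
    using that \<psi> \<phi> by (intro eq_vecI) auto
  have V': "\<phi> \<in> carrier_vec (len (Suc n) (Suc n))" using \<phi> by (simp add: len_same)
  show ?thesis
    unfolding shifted_mult_vec[OF Hm_carrier app] shifted_mult_vec[OF Hm_carrier \<psi>] shifted_mult_vec[OF Hm_carrier V'] H
    by (rule gen[OF d])
qed

lemma Uh_same: "Uh n n = Ups M n"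
  using Ups_carrier[of n] append_rows_dim[OF Ups_carrier[of n] zero_carrier_mat[of 0 "rk n"]]
  by (intro eq_matI) (auto simp: Ups_hat_def len_same append_rows_index[OF Ups_carrier[of n] zero_carrier_mat])

lemma Ph_same: "Ph n n = Phi M n"
  using Phi_carrier[of n] append_rows_dim[OF zero_carrier_mat[of 0 "rk (Suc n)"] Phi_carrier[of n]]
  by (intro eq_matI) (auto simp: Phi_hat_def len_same append_rows_index[OF zero_carrier_mat Phi_carrier[of n]])

lemma Uh_Suc: "Uh 0 (Suc n) = Uh 0 n @\<^sub>r 0\<^sub>m (sz (Suc n)) (rk 0)"
proof (rule eq_matI)
  note I1 = append_rows_index[OF Uh_carrier[of 0 n] zero_carrier_mat[of "sz (Suc n)" "rk 0"]]
  note D1 = append_rows_dim[OF Uh_carrier[of 0 n] zero_carrier_mat[of "sz (Suc n)" "rk 0"]]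
  note I2 = append_rows_index[OF Ups_carrier[of 0] zero_carrier_mat]
  note D2 = append_rows_dim[OF Ups_carrier[of 0] zero_carrier_mat]
  show "dim_row (Uh 0 (Suc n)) = dim_row (Uh 0 n @\<^sub>r 0\<^sub>m (sz (Suc n)) (rk 0))"
    "dim_col (Uh 0 (Suc n)) = dim_col (Uh 0 n @\<^sub>r 0\<^sub>m (sz (Suc n)) (rk 0))"
    using D1 Uh_carrier[of 0 "Suc n"] by (auto simp: len_Suc)
  fix i j assume "i < dim_row (Uh 0 n @\<^sub>r 0\<^sub>m (sz (Suc n)) (rk 0))" "j < dim_col (Uh 0 n @\<^sub>r 0\<^sub>m (sz (Suc n)) (rk 0))"
  hence ij: "i < len 0 n + sz (Suc n)" "j < rk 0" using D1 by auto
  have le: "sz 0 \<le> len 0 n" using sz_le_len by simp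
  have "Uh 0 (Suc n) $$ (i, j) = (if i < sz 0 then Ups M 0 $$ (i, j) else 0)"
    using ij le unfolding Ups_hat_def by (subst I2) (auto simp: len_Suc)
  moreover have "Uh 0 n $$ (i, j) = (if i < sz 0 then Ups M 0 $$ (i, j) else 0)" if "i < len 0 n"
    using ij le that unfolding Ups_hat_def by (subst I2) auto
  ultimately show "Uh 0 (Suc n) $$ (i, j) = (Uh 0 n @\<^sub>r 0\<^sub>m (sz (Suc n)) (rk 0)) $$ (i, j)"
    using ij le by (subst I1) auto
qed

lemma Ph_Suc: "Ph 0 (Suc n) = 0\<^sub>m (len 0 n) (rk (Suc (Suc n))) @\<^sub>r Phi M (Suc n)"
  by (simp add: Phi_hat_def len_Suc)

lemma Uh_Suc_mult:
  assumes "\<psi> \<in> carrier_vec (len 0 n)" "\<phi> \<in> carrier_vec (sz (Suc n))"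
  shows "mat_adjoint (Uh 0 (Suc n)) *\<^sub>v (\<psi> @\<^sub>v \<phi>) = mat_adjoint (Uh 0 n) *\<^sub>v \<psi>"
proof -
  have "mat_adjoint (0\<^sub>m (sz (Suc n)) (rk 0)) *\<^sub>v \<phi> = 0\<^sub>v (rk 0)"
    using assms by (intro eq_vecI) (auto simp: scalar_prod_def)
  moreover have "mat_adjoint (Uh 0 n) *\<^sub>v \<psi> \<in> carrier_vec (rk 0)" using Uh_carrier[of 0 n] by (auto intro!: carrier_vecI)
  ultimately show ?thesis
    unfolding Uh_Suc using adjoint_append_rows_mult_vec[OF Uh_carrier[of 0 n] zero_carrier_mat assms] by simp
qed

lemma Ph_Suc_mult:
  assumes "\<psi> \<in> carrier_vec (len 0 n)" "\<phi> \<in> carrier_vec (sz (Suc n))"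
  shows "mat_adjoint (Ph 0 (Suc n)) *\<^sub>v (\<psi> @\<^sub>v \<phi>) = mat_adjoint (Phi M (Suc n)) *\<^sub>v \<phi>"
proof -
  have "mat_adjoint (0\<^sub>m (len 0 n) (rk (Suc (Suc n)))) *\<^sub>v \<psi> = 0\<^sub>v (rk (Suc (Suc n)))"
    using assms by (intro eq_vecI) (auto simp: scalar_prod_def)
  moreover have "mat_adjoint (Phi M (Suc n)) *\<^sub>v \<phi> \<in> carrier_vec (rk (Suc (Suc n)))"
    using Phi_carrier[of "Suc n"] by (auto intro!: carrier_vecI)
  ultimately show ?thesis
    unfolding Ph_Suc using adjoint_append_rows_mult_vec[OF zero_carrier_mat Phi_carrier[of "Suc n"] assms] by simp
qed

lemma Ph_Suc_apply:
  assumes "c \<in> carrier_vec (rk (Suc (Suc n)))"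
  shows "Ph 0 (Suc n) *\<^sub>v c = 0\<^sub>v (len 0 n) @\<^sub>v (Phi M (Suc n) *\<^sub>v c)"
proof -
  have "0\<^sub>m (len 0 n) (rk (Suc (Suc n))) *\<^sub>v c = 0\<^sub>v (len 0 n)"
    using assms by (intro eq_vecI) (auto simp: scalar_prod_def)
  thus ?thesis unfolding Ph_Suc using mat_mult_append[OF zero_carrier_mat Phi_carrier[of "Suc n"] assms] by simp
qed

end

lemma vec_cancel:
  fixes u v :: "'a :: ab_group_add vec"
  assumes "u \<in> carrier_vec n" "v \<in> carrier_vec n"
  shows "u + v - u = v" "u + (v - u) = v"
    "w \<in> carrier_vec n \<Longrightarrow> u + (v - w) = u - w + v"
  using assms by (auto intro!: eq_vecI)

section \<open>Gluing and splitting of solutions\<close>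

context shells
begin

text \<open>A solution on the shells up to \<open>n + 1\<close> with boundary datum \<open>c'\<close> is glued from solutions on
  the shells up to \<open>n\<close> and on the shell \<open>n + 1\<close>.\<close>
lemma glue_solution:
  assumes nr: "nonres 0 n z" "nonres (Suc n) (Suc n) z" "nonres 0 (Suc n) z"
    and c: "c \<in> carrier_vec (rk (Suc n))" and c': "c' \<in> carrier_vec (rk (Suc (Suc n)))"
    and eq: "alpha M (Suc n) (Suc n) z *\<^sub>v (delta M 0 n z *\<^sub>v c) + beta M (Suc n) (Suc n) z *\<^sub>v c' = c"
  obtains \<psi> \<phi> where "\<psi> \<in> carrier_vec (len 0 n)" "\<phi> \<in> carrier_vec (sz (Suc n))"
    "Res 0 (Suc n) z *\<^sub>v (Ph 0 (Suc n) *\<^sub>v c') = \<psi> @\<^sub>v \<phi>" "c = mat_adjoint (Ups M (Suc n)) *\<^sub>v \<phi>"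
    "beta M 0 (Suc n) z *\<^sub>v c' = beta M 0 n z *\<^sub>v c"
    "delta M 0 (Suc n) z *\<^sub>v c' = gamma M (Suc n) (Suc n) z *\<^sub>v (delta M 0 n z *\<^sub>v c) + delta M (Suc n) (Suc n) z *\<^sub>v c'"
proof -
  let ?U = "Ups M (Suc n)" and ?F = "Phi M (Suc n)" and ?P = "Ph 0 n"
  let ?G0 = "Res 0 n z" and ?G1 = "Res (Suc n) (Suc n) z"
  have P: "?P \<in> carrier_mat (len 0 n) (rk (Suc n))" and U: "?U \<in> carrier_mat (sz (Suc n)) (rk (Suc n))"
    and Fc: "?F \<in> carrier_mat (sz (Suc n)) (rk (Suc (Suc n)))"
    using Ph_carrier[of 0 n] Ups_carrier Phi_carrier by auto
  have V: "Hm (Suc n) (Suc n) \<in> carrier_mat (sz (Suc n)) (sz (Suc n))" using Hm_carrier[of "Suc n" "Suc n"] by (simp add: len_same)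
  have G1: "?G1 \<in> carrier_mat (sz (Suc n)) (sz (Suc n))" by (rule resolvent_carrier[OF V])
  have G0: "?G0 \<in> carrier_mat (len 0 n) (len 0 n)" by (rule resolvent_carrier[OF Hm_carrier])
  define a where "a = delta M 0 n z *\<^sub>v c"
  have a: "a \<in> carrier_vec (rk (Suc n))" unfolding a_def using carrier_matD[OF block_carriers(4)[of 0 n z]] by (auto intro!: carrier_vecI)
  define \<psi> where "\<psi> = ?G0 *\<^sub>v (?P *\<^sub>v c)"
  have \<psi>: "\<psi> \<in> carrier_vec (len 0 n)" unfolding \<psi>_def using carrier_matD[OF G0] by (auto intro!: carrier_vecI)
  have Pc: "?P *\<^sub>v c \<in> carrier_vec (len 0 n)" using P by (auto intro!: carrier_vecI)
  have Ua: "?U *\<^sub>v a \<in> carrier_vec (sz (Suc n))" using U by (auto intro!: carrier_vecI)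
  have Fc': "?F *\<^sub>v c' \<in> carrier_vec (sz (Suc n))" using Fc by (auto intro!: carrier_vecI)
  define \<phi> where "\<phi> = ?G1 *\<^sub>v (?U *\<^sub>v a + ?F *\<^sub>v c')"
  have \<phi>: "\<phi> \<in> carrier_vec (sz (Suc n))" unfolding \<phi>_def using carrier_matD[OF G1] by (auto intro!: carrier_vecI)
  have \<phi>_split: "\<phi> = ?G1 *\<^sub>v (?U *\<^sub>v a) + ?G1 *\<^sub>v (?F *\<^sub>v c')"
    unfolding \<phi>_def by (rule mult_add_distrib_mat_vec[OF G1 Ua Fc'])
  have parts: "?G1 *\<^sub>v (?U *\<^sub>v a) \<in> carrier_vec (sz (Suc n))" "?G1 *\<^sub>v (?F *\<^sub>v c') \<in> carrier_vec (sz (Suc n))"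
    using carrier_matD[OF G1] by (auto intro!: carrier_vecI)
  note B0 = block_mult_vec[OF _ nr(1)] and B1 = block_mult_vec[OF order.refl nr(2), unfolded Uh_same Ph_same]
  have P\<psi>: "mat_adjoint ?P *\<^sub>v \<psi> = a" unfolding a_def \<psi>_def by (rule B0(4)[OF _ c, symmetric]) simp
  have U\<phi>: "mat_adjoint ?U *\<^sub>v \<phi> = c"
  proof -
    have "mat_adjoint ?U *\<^sub>v \<phi> = mat_adjoint ?U *\<^sub>v (?G1 *\<^sub>v (?U *\<^sub>v a)) + mat_adjoint ?U *\<^sub>v (?G1 *\<^sub>v (?F *\<^sub>v c'))"
      unfolding \<phi>_split by (rule mult_add_distrib_mat_vec[OF mat_adjoint_carrier[OF U] parts])
    thus ?thesis using eq by (simp only: B1(1)[OF a] B1(2)[OF c'] a_def[symmetric])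
  qed
  have F\<phi>: "mat_adjoint ?F *\<^sub>v \<phi> = gamma M (Suc n) (Suc n) z *\<^sub>v a + delta M (Suc n) (Suc n) z *\<^sub>v c'"
    unfolding \<phi>_split B1(3)[OF a] B1(4)[OF c'] by (rule mult_add_distrib_mat_vec[OF mat_adjoint_carrier[OF Fc] parts])
  have s0: "shifted (Hm 0 n) z *\<^sub>v \<psi> = ?P *\<^sub>v c"
    unfolding \<psi>_def by (rule resolvent_solves[OF Hm_carrier _ Pc]) (use nr in \<open>simp add: nonres_def\<close>)
  have s1: "shifted (Hm (Suc n) (Suc n)) z *\<^sub>v \<phi> = ?U *\<^sub>v a + ?F *\<^sub>v c'"
    unfolding \<phi>_def by (rule resolvent_solves[OF V]) (use nr Ua Fc' in \<open>auto simp: nonres_def\<close>)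
  have app: "\<psi> @\<^sub>v \<phi> \<in> carrier_vec (len 0 (Suc n))" using \<psi> \<phi> by (simp add: len_Suc)
  \<comment> \<open>The sources c and a were chosen to cancel the coupling terms, so only the source
    c' at the new outer boundary is left.\<close>
  have "shifted (Hm 0 (Suc n)) z *\<^sub>v (\<psi> @\<^sub>v \<phi>) = (?P *\<^sub>v c - ?P *\<^sub>v c) @\<^sub>v (?U *\<^sub>v a + ?F *\<^sub>v c' - ?U *\<^sub>v a)"
    unfolding shifted_append[OF \<psi> \<phi>] U\<phi> P\<psi> s0 s1 ..
  also have "?P *\<^sub>v c - ?P *\<^sub>v c = 0\<^sub>v (len 0 n)" using Pc by simp
  also have "?U *\<^sub>v a + ?F *\<^sub>v c' - ?U *\<^sub>v a = ?F *\<^sub>v c'" by (rule vec_cancel(1)[OF Ua Fc'])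
  also have "0\<^sub>v (len 0 n) @\<^sub>v ?F *\<^sub>v c' = Ph 0 (Suc n) *\<^sub>v c'" by (rule Ph_Suc_apply[OF c', symmetric])
  finally have sol: "Res 0 (Suc n) z *\<^sub>v (Ph 0 (Suc n) *\<^sub>v c') = \<psi> @\<^sub>v \<phi>"
    using resolvent_unique[OF Hm_carrier _ app, of z] nr(3) by (simp add: nonres_def)
  note B01 = block_mult_vec[OF _ nr(3)]
  have "beta M 0 (Suc n) z *\<^sub>v c' = mat_adjoint (Uh 0 (Suc n)) *\<^sub>v (\<psi> @\<^sub>v \<phi>)"
    using B01(2)[OF _ c'] by (simp add: sol)
  also have "\<dots> = beta M 0 n z *\<^sub>v c" using Uh_Suc_mult[OF \<psi> \<phi>] B0(2)[OF _ c] by (simp add: \<psi>_def)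
  finally have b: "beta M 0 (Suc n) z *\<^sub>v c' = beta M 0 n z *\<^sub>v c" .
  have "delta M 0 (Suc n) z *\<^sub>v c' = mat_adjoint (Ph 0 (Suc n)) *\<^sub>v (\<psi> @\<^sub>v \<phi>)"
    using B01(4)[OF _ c'] by (simp add: sol)
  also have "\<dots> = gamma M (Suc n) (Suc n) z *\<^sub>v (delta M 0 n z *\<^sub>v c) + delta M (Suc n) (Suc n) z *\<^sub>v c'"
    unfolding Ph_Suc_mult[OF \<psi> \<phi>] F\<phi> a_def ..
  finally show thesis using that[OF \<psi> \<phi> sol U\<phi>[symmetric] b] by simp
qed

text \<open>The converse of gluing: the solution on all shells is cut after shell n, and c is read
  off as the strength with which the outer piece drives the inner one. Unique solvability on each
  piece then gives the matching condition.\<close>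

lemma split_solution:
  assumes nr: "nonres 0 n z" "nonres (Suc n) (Suc n) z" "nonres 0 (Suc n) z"
    and c': "c' \<in> carrier_vec (rk (Suc (Suc n)))"
  obtains c where "c \<in> carrier_vec (rk (Suc n))"
    "alpha M (Suc n) (Suc n) z *\<^sub>v (delta M 0 n z *\<^sub>v c) + beta M (Suc n) (Suc n) z *\<^sub>v c' = c"
proof -
  let ?U = "Ups M (Suc n)" and ?F = "Phi M (Suc n)" and ?P = "Ph 0 n"
  let ?G0 = "Res 0 n z" and ?G1 = "Res (Suc n) (Suc n) z"
  have P: "?P \<in> carrier_mat (len 0 n) (rk (Suc n))" and U: "?U \<in> carrier_mat (sz (Suc n)) (rk (Suc n))"
    and Fc: "?F \<in> carrier_mat (sz (Suc n)) (rk (Suc (Suc n)))"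
    using Ph_carrier[of 0 n] Ups_carrier Phi_carrier by auto
  have V: "Hm (Suc n) (Suc n) \<in> carrier_mat (sz (Suc n)) (sz (Suc n))" using Hm_carrier[of "Suc n" "Suc n"] by (simp add: len_same)
  have G1: "?G1 \<in> carrier_mat (sz (Suc n)) (sz (Suc n))" by (rule resolvent_carrier[OF V])
  define x where "x = Res 0 (Suc n) z *\<^sub>v (Ph 0 (Suc n) *\<^sub>v c')"
  have x: "x \<in> carrier_vec (len 0 n + sz (Suc n))"
    unfolding x_def using carrier_matD[OF resolvent_carrier[OF Hm_carrier, of 0 "Suc n" z]] by (auto intro!: carrier_vecI simp: len_Suc)
  define \<psi> where "\<psi> = vec_first x (len 0 n)"
  define \<phi> where "\<phi> = vec_last x (sz (Suc n))"
  have \<psi>: "\<psi> \<in> carrier_vec (len 0 n)" and \<phi>: "\<phi> \<in> carrier_vec (sz (Suc n))" and x_eq: "x = \<psi> @\<^sub>v \<phi>"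
    using x vec_first_last_append[OF x] by (auto simp: \<psi>_def \<phi>_def)
  define c where "c = mat_adjoint ?U *\<^sub>v \<phi>"
  have c: "c \<in> carrier_vec (rk (Suc n))" unfolding c_def using U by (auto intro!: carrier_vecI)
  have Pc: "?P *\<^sub>v c \<in> carrier_vec (len 0 n)" using P by (auto intro!: carrier_vecI)
  have Pp: "Ph 0 (Suc n) *\<^sub>v c' \<in> carrier_vec (len 0 (Suc n))" using Ph_carrier[of 0 "Suc n"] by (auto intro!: carrier_vecI)
  define a where "a = mat_adjoint ?P *\<^sub>v \<psi>"
  have a: "a \<in> carrier_vec (rk (Suc n))" unfolding a_def using P by (auto intro!: carrier_vecI)
  have Ua: "?U *\<^sub>v a \<in> carrier_vec (sz (Suc n))" and Fc': "?F *\<^sub>v c' \<in> carrier_vec (sz (Suc n))"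
    using U Fc by (auto intro!: carrier_vecI)
  have sh: "shifted (Hm 0 n) z *\<^sub>v \<psi> \<in> carrier_vec (len 0 n)" "shifted (Hm (Suc n) (Suc n)) z *\<^sub>v \<phi> \<in> carrier_vec (sz (Suc n))"
    using carrier_matD[OF shifted_carrier[OF Hm_carrier[of 0 n], of z]] carrier_matD[OF shifted_carrier[OF V, of z]] by (auto intro!: carrier_vecI)
  have "shifted (Hm 0 (Suc n)) z *\<^sub>v x = Ph 0 (Suc n) *\<^sub>v c'"
    unfolding x_def by (rule resolvent_solves[OF Hm_carrier _ Pp]) (use nr(3) in \<open>simp add: nonres_def\<close>)
  hence "(shifted (Hm 0 n) z *\<^sub>v \<psi> - ?P *\<^sub>v c) @\<^sub>v (shifted (Hm (Suc n) (Suc n)) z *\<^sub>v \<phi> - ?U *\<^sub>v a) = 0\<^sub>v (len 0 n) @\<^sub>v (?F *\<^sub>v c')"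
    unfolding x_eq shifted_append[OF \<psi> \<phi>] Ph_Suc_apply[OF c'] c_def a_def .
  hence e: "shifted (Hm 0 n) z *\<^sub>v \<psi> - ?P *\<^sub>v c = 0\<^sub>v (len 0 n)" "shifted (Hm (Suc n) (Suc n)) z *\<^sub>v \<phi> - ?U *\<^sub>v a = ?F *\<^sub>v c'"
    using append_vec_eq[of "shifted (Hm 0 n) z *\<^sub>v \<psi> - ?P *\<^sub>v c" "len 0 n" "0\<^sub>v (len 0 n)"] Pc sh by auto
  have move: "p = q + s" if "p - q = s" "p \<in> carrier_vec k" "q \<in> carrier_vec k" for p q s :: "complex vec" and k
    using that by (intro eq_vecI) auto
  have "shifted (Hm 0 n) z *\<^sub>v \<psi> = ?P *\<^sub>v c" using move[OF e(1) sh(1) Pc] Pc by simp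
  hence \<psi>_eq: "\<psi> = ?G0 *\<^sub>v (?P *\<^sub>v c)" using resolvent_unique[OF Hm_carrier _ \<psi>, of z] nr(1) by (simp add: nonres_def)
  have a_eq: "a = delta M 0 n z *\<^sub>v c"
    using block_mult_vec(4)[OF _ nr(1) c] unfolding a_def by (simp add: \<psi>_eq[symmetric])
  have "shifted (Hm (Suc n) (Suc n)) z *\<^sub>v \<phi> = ?U *\<^sub>v a + ?F *\<^sub>v c'" by (rule move[OF e(2) sh(2) Ua])
  hence "\<phi> = ?G1 *\<^sub>v (?U *\<^sub>v a + ?F *\<^sub>v c')" using resolvent_unique[OF V _ \<phi>, of z] nr(2) by (simp add: nonres_def)
  hence \<phi>_split: "\<phi> = ?G1 *\<^sub>v (?U *\<^sub>v a) + ?G1 *\<^sub>v (?F *\<^sub>v c')"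
    using mult_add_distrib_mat_vec[OF G1 Ua Fc'] by simp
  have parts: "?G1 *\<^sub>v (?U *\<^sub>v a) \<in> carrier_vec (sz (Suc n))" "?G1 *\<^sub>v (?F *\<^sub>v c') \<in> carrier_vec (sz (Suc n))"
    using carrier_matD[OF G1] by (auto intro!: carrier_vecI)
  note B1 = block_mult_vec[OF order.refl nr(2), unfolded Uh_same Ph_same]
  have ceq: "c = mat_adjoint ?U *\<^sub>v (?G1 *\<^sub>v (?U *\<^sub>v a)) + mat_adjoint ?U *\<^sub>v (?G1 *\<^sub>v (?F *\<^sub>v c'))"
    unfolding c_def by (subst \<phi>_split) (rule mult_add_distrib_mat_vec[OF mat_adjoint_carrier[OF U] parts])
  have "alpha M (Suc n) (Suc n) z *\<^sub>v a + beta M (Suc n) (Suc n) z *\<^sub>v c' = c"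
    unfolding B1(1)[OF a] B1(2)[OF c'] by (rule ceq[symmetric])
  hence "alpha M (Suc n) (Suc n) z *\<^sub>v (delta M 0 n z *\<^sub>v c) + beta M (Suc n) (Suc n) z *\<^sub>v c' = c"
    by (simp only: a_eq)
  thus thesis using that c by blast
qed

text \<open>Such a c satisfies the matching condition with outer datum 0, so it glues to a solution
  without source on the whole volume. That solution is 0 since z is not an eigenvalue, and c is
  boundary data of it.\<close>

lemma alpha_delta_injective:
  assumes nr: "nonres 0 n z" "nonres (Suc n) (Suc n) z" "nonres 0 (Suc n) z"
    and c: "c \<in> carrier_vec (rk (Suc n))"
    and eq: "alpha M (Suc n) (Suc n) z *\<^sub>v (delta M 0 n z *\<^sub>v c) = c"
  shows "c = 0\<^sub>v (rk (Suc n))"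
proof -
  let ?o = "0\<^sub>v (rk (Suc (Suc n))) :: complex vec"
  have mz: "X *\<^sub>v 0\<^sub>v m = 0\<^sub>v k" if "X \<in> carrier_mat k m" for X :: "complex mat" and k m
    using that by (intro eq_vecI) (auto simp: scalar_prod_def)
  have "alpha M (Suc n) (Suc n) z *\<^sub>v (delta M 0 n z *\<^sub>v c) + beta M (Suc n) (Suc n) z *\<^sub>v ?o = c"
    unfolding eq mz[OF block_carriers(2)] using c by simp
  then obtain \<psi> \<phi> where s: "\<psi> \<in> carrier_vec (len 0 n)" "\<phi> \<in> carrier_vec (sz (Suc n))"
    "Res 0 (Suc n) z *\<^sub>v (Ph 0 (Suc n) *\<^sub>v ?o) = \<psi> @\<^sub>v \<phi>" "c = mat_adjoint (Ups M (Suc n)) *\<^sub>v \<phi>"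
    using glue_solution[OF nr c zero_carrier_vec] by metis
  have "Ph 0 (Suc n) *\<^sub>v ?o = 0\<^sub>v (len 0 (Suc n))" by (rule mz[OF Ph_carrier]) simp
  hence "\<psi> @\<^sub>v \<phi> = 0\<^sub>v (len 0 n) @\<^sub>v 0\<^sub>v (sz (Suc n))"
    using s(3) mz[OF resolvent_carrier[OF Hm_carrier, of 0 "Suc n" z]] by (auto simp: len_Suc intro!: eq_vecI)
  hence "\<phi> = 0\<^sub>v (sz (Suc n))" using append_vec_eq[of \<psi> "len 0 n" "0\<^sub>v (len 0 n)"] s(1) by simp
  thus ?thesis unfolding s(4) by (simp add: mz[OF mat_adjoint_carrier[OF Ups_carrier]])
qed

section \<open>Products of transfer matrices\<close>

lemma vec_of_list_1_0: "vec_of_list [1, 0 :: complex] = vec 1 (\<lambda>_. 1) @\<^sub>v vec 1 (\<lambda>_. 0)"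
  by (intro eq_vecI) (auto simp: vec_of_list_index less_Suc_eq nth_Cons split: nat.splits)

lemma transfer_apply:
  assumes B: "B \<in> carrier_mat (rk (Suc n)) (rk m)" and b: "b \<in> carrier_mat (rk (Suc n)) (rk m)"
    and p: "p \<in> carrier_vec (rk m)" and a: "a \<in> carrier_vec (rk m)"
  shows "transfer_mat M m n z B b *\<^sub>v (p @\<^sub>v a) = (B *\<^sub>v p - b *\<^sub>v a) @\<^sub>v
    (delta M m n z *\<^sub>v (B *\<^sub>v p - b *\<^sub>v a) + gamma M m n z *\<^sub>v a)"
proof -
  note D = block_carriers(4)[of m n z] and G = block_carriers(3)[of m n z]
  have Db: "delta M m n z * b \<in> carrier_mat (rk (Suc n)) (rk m)" and DB: "delta M m n z * B \<in> carrier_mat (rk (Suc n)) (rk m)"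
    by (rule mult_carrier_mat[OF D b], rule mult_carrier_mat[OF D B])
  have v: "B *\<^sub>v p \<in> carrier_vec (rk (Suc n))" "b *\<^sub>v a \<in> carrier_vec (rk (Suc n))"
    "gamma M m n z *\<^sub>v a \<in> carrier_vec (rk (Suc n))" "delta M m n z *\<^sub>v (b *\<^sub>v a) \<in> carrier_vec (rk (Suc n))"
    "delta M m n z *\<^sub>v (B *\<^sub>v p) \<in> carrier_vec (rk (Suc n))"
    using B b carrier_matD[OF D] carrier_matD[OF G] by (auto intro!: carrier_vecI)
  have nb: "(- b) *\<^sub>v a = - (b *\<^sub>v a)" using b a by (intro eq_vecI) (auto simp: scalar_prod_def sum_negf)
  have "transfer_mat M m n z B b *\<^sub>v (p @\<^sub>v a) = (B *\<^sub>v p + (- b) *\<^sub>v a) @\<^sub>v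
      ((delta M m n z * B) *\<^sub>v p + (gamma M m n z - delta M m n z * b) *\<^sub>v a)"
    unfolding transfer_mat_def
    by (rule four_block_mat_mult_vec[OF B _ DB _ p a]) (use b minus_carrier_mat[OF Db] in auto)
  also have "(gamma M m n z - delta M m n z * b) *\<^sub>v a = gamma M m n z *\<^sub>v a - delta M m n z *\<^sub>v (b *\<^sub>v a)"
    by (subst minus_mult_distrib_mat_vec[OF G Db a]) (simp only: assoc_mult_mat_vec[OF D b a])
  also have "(delta M m n z * B) *\<^sub>v p = delta M m n z *\<^sub>v (B *\<^sub>v p)" by (rule assoc_mult_mat_vec[OF D B p])
  also have "B *\<^sub>v p + (- b) *\<^sub>v a = B *\<^sub>v p - b *\<^sub>v a" unfolding nb using v by (intro eq_vecI) auto
  also have "delta M m n z *\<^sub>v (B *\<^sub>v p) + (gamma M m n z *\<^sub>v a - delta M m n z *\<^sub>v (b *\<^sub>v a)) =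
      delta M m n z *\<^sub>v (B *\<^sub>v p - b *\<^sub>v a) + gamma M m n z *\<^sub>v a"
    unfolding mult_minus_distrib_mat_vec[OF D v(1,2)] by (rule vec_cancel(3)[OF v(5,3,4)])
  finally show ?thesis .
qed

text \<open>\<open>direct_set\<close> with each right inverse replaced by its single column. The
  condition on entry 0 says \<beta> c = 1, as \<open>rk 0\<close> is 1.\<close>

definition direct_vecs :: "nat \<Rightarrow> complex \<Rightarrow> complex vec set" where
  "direct_vecs n z = {c @\<^sub>v (delta M 0 n z *\<^sub>v c) | c. c \<in> carrier_vec (rk (Suc n)) \<and> (beta M 0 n z *\<^sub>v c) $ 0 = 1}"

lemma one_vec: "(x :: complex vec) \<in> carrier_vec (rk 0) \<Longrightarrow> x $ 0 = 1 \<Longrightarrow> x = vec 1 (\<lambda>_. 1)"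
  by (intro eq_vecI) auto

lemma right_inverses_col:
  assumes "B \<in> right_inverses M 0 n z"
  shows "B *\<^sub>v vec 1 (\<lambda>_. 1) = col B 0" "col B 0 \<in> carrier_vec (rk (Suc n))" "(beta M 0 n z *\<^sub>v col B 0) $ 0 = 1"
proof -
  have B: "B \<in> carrier_mat (rk (Suc n)) 1" "beta M 0 n z * B = 1\<^sub>m 1" using assms by (auto simp: right_inverses_def)
  show "B *\<^sub>v vec 1 (\<lambda>_. 1) = col B 0" using B(1) by (intro eq_vecI) (auto simp: scalar_prod_def)
  show "col B 0 \<in> carrier_vec (rk (Suc n))" using B(1) by (auto intro!: carrier_vecI)
  have "beta M 0 n z *\<^sub>v col B 0 = col (beta M 0 n z * B) 0" by (rule col_mult2[symmetric, OF block_carriers(2) B(1)]) simp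
  thus "(beta M 0 n z *\<^sub>v col B 0) $ 0 = 1" unfolding B(2) by simp
qed

lemma right_inverses_of_vec:
  assumes c: "c \<in> carrier_vec (rk (Suc n))" "(beta M 0 n z *\<^sub>v c) $ 0 = 1"
  shows "mat_of_cols (rk (Suc n)) [c] \<in> right_inverses M 0 n z" "col (mat_of_cols (rk (Suc n)) [c]) 0 = c"
proof -
  let ?B = "mat_of_cols (rk (Suc n)) [c]"
  have B: "?B \<in> carrier_mat (rk (Suc n)) 1" using mat_of_cols_carrier(1)[of "rk (Suc n)" "[c]"] by simp
  show col: "col ?B 0 = c" using c(1) by (subst col_mat_of_cols) auto
  have "beta M 0 n z * ?B = 1\<^sub>m 1"
  proof (rule mat_col_eqI)
    fix j assume "j < dim_col (1\<^sub>m 1 :: complex mat)"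
    hence j: "j = 0" by simp
    have "col (beta M 0 n z * ?B) 0 = beta M 0 n z *\<^sub>v c"
      using col_mult2[OF block_carriers(2) B, of 0 0 z] col by simp
    also have "\<dots> = vec 1 (\<lambda>_. 1)" by (rule one_vec[OF _ c(2)]) (use carrier_matD[OF block_carriers(2)[of 0 n z]] in \<open>auto intro!: carrier_vecI\<close>)
    also have "\<dots> = col (1\<^sub>m 1) 0" by (intro eq_vecI) auto
    finally show "col (beta M 0 n z * ?B) j = col (1\<^sub>m 1) j" by (simp add: j)
  qed (use B carrier_matD[OF block_carriers(2)[of 0 n z]] in auto)
  thus "?B \<in> right_inverses M 0 n z" using B by (simp add: right_inverses_def)
qed

lemma direct_set_eq: "direct_set M n z = direct_vecs n z"
proof (intro Set.set_eqI iffI)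
  fix u assume "u \<in> direct_set M n z"
  then obtain B where B: "u = col B 0 @\<^sub>v col (delta M 0 n z * B) 0" "B \<in> right_inverses M 0 n z"
    by (auto simp: direct_set_def)
  have Bc: "B \<in> carrier_mat (rk (Suc n)) 1" using B(2) by (auto simp: right_inverses_def)
  have "col (delta M 0 n z * B) 0 = delta M 0 n z *\<^sub>v col B 0" by (rule col_mult2[OF block_carriers(4) Bc]) simp
  thus "u \<in> direct_vecs n z" using B right_inverses_col[OF B(2)] by (auto simp: direct_vecs_def)
next
  fix u assume "u \<in> direct_vecs n z"
  then obtain c where c: "u = c @\<^sub>v (delta M 0 n z *\<^sub>v c)" "c \<in> carrier_vec (rk (Suc n))" "(beta M 0 n z *\<^sub>v c) $ 0 = 1"
    by (auto simp: direct_vecs_def)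
  note R = right_inverses_of_vec[OF c(2,3)]
  have Bc: "mat_of_cols (rk (Suc n)) [c] \<in> carrier_mat (rk (Suc n)) 1" using R(1) by (auto simp: right_inverses_def)
  have "col (delta M 0 n z * mat_of_cols (rk (Suc n)) [c]) 0 = delta M 0 n z *\<^sub>v c"
    using col_mult2[OF block_carriers(4) Bc, of 0 0 z] R(2) by simp
  hence "u = col (mat_of_cols (rk (Suc n)) [c]) 0 @\<^sub>v col (delta M 0 n z * mat_of_cols (rk (Suc n)) [c]) 0"
    by (simp only: R(2) c(1))
  thus "u \<in> direct_set M n z" using R(1) unfolding direct_set_def by blast
qed

text \<open>The conditions under which the recursion over shells runs up to n: the accumulated and
  the single-shell matrices are invertible at z at every stage, and each single-shell \<beta> has a
  right inverse. Surjectivity of \<open>beta M 0 n z\<close> comes out of the recursion.\<close>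

definition good :: "nat \<Rightarrow> complex \<Rightarrow> bool" where
  "good n z \<longleftrightarrow> (\<forall>i\<le>n. nonres 0 i z \<and> nonres i i z \<and> right_inverses M i i z \<noteq> {})"

lemma restricted_subset: "restricted_transfer_set M m n z \<subseteq> transfer_set M m n z"
  unfolding restricted_transfer_set_def transfer_set_def by blast

text \<open>By the equations defining B and b, the vector c' = B c - b a with a = \<delta> c
  satisfies \<alpha> a + \<beta> c' = c. This is the matching condition, so gluing identifies the
  lower half of the new vector as \<delta> c' for the larger volume and preserves the
  normalization.\<close>

lemma transfer_chain_subset_direct:
  "good n z \<Longrightarrow> chain_set (\<lambda>i. transfer_set M i i z) n \<subseteq> direct_vecs n z"
proof (induction n)
  case 0
  show ?case unfolding chain_set_0
  proof clarify
    fix T assume "T \<in> transfer_set M 0 0 z"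
    then obtain B b where T: "T = transfer_mat M 0 0 z B b" "B \<in> right_inverses M 0 0 z" "b \<in> alpha_lifts M 0 0 z"
      by (auto simp: transfer_set_def)
    have c: "B \<in> carrier_mat (rk (Suc 0)) (rk 0)" "b \<in> carrier_mat (rk (Suc 0)) (rk 0)"
      using T by (auto simp: right_inverses_def alpha_lifts_def)
    note R = right_inverses_col[OF T(2)]
    have z0: "b *\<^sub>v vec (Suc 0) (\<lambda>_. 0) = 0\<^sub>v (rk (Suc 0))" using c by (intro eq_vecI) (auto simp: scalar_prod_def)
    have g0: "gamma M 0 0 z *\<^sub>v vec (Suc 0) (\<lambda>_. 0) = 0\<^sub>v (rk (Suc 0))" using carrier_matD[OF block_carriers(3)[of 0 0 z]] by (intro eq_vecI) (auto simp: scalar_prod_def)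
    have dc: "delta M 0 0 z *\<^sub>v col B 0 \<in> carrier_vec (rk (Suc 0))" using carrier_matD[OF block_carriers(4)[of 0 0 z]] by (auto intro!: carrier_vecI)
    have m0: "v - 0\<^sub>v k = v" if "v \<in> carrier_vec k" for v :: "complex vec" and k using that by (intro eq_vecI) auto
    have "T *\<^sub>v vec_of_list [1, 0] = col B 0 @\<^sub>v (delta M 0 0 z *\<^sub>v col B 0)"
      unfolding T(1) vec_of_list_1_0 using transfer_apply[OF c, of "vec 1 (\<lambda>_. 1)" "vec 1 (\<lambda>_. 0)" z] R dc
      by (simp add: z0 g0 m0)
    thus "T *\<^sub>v vec_of_list [1, 0] \<in> direct_vecs 0 z" using R by (auto simp: direct_vecs_def)
  qed
next
  case (Suc n)
  have g: "good n z" and nr: "nonres 0 n z" "nonres (Suc n) (Suc n) z" "nonres 0 (Suc n) z"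
    using Suc.prems by (auto simp: good_def)
  show ?case unfolding chain_set_Suc
  proof clarify
    fix T u assume T: "T \<in> transfer_set M (Suc n) (Suc n) z" and u: "u \<in> chain_set (\<lambda>i. transfer_set M i i z) n"
    from T obtain B b where B: "T = transfer_mat M (Suc n) (Suc n) z B b" "B \<in> right_inverses M (Suc n) (Suc n) z" "b \<in> alpha_lifts M (Suc n) (Suc n) z"
      by (auto simp: transfer_set_def)
    from u Suc.IH[OF g] obtain c where c: "u = c @\<^sub>v (delta M 0 n z *\<^sub>v c)" "c \<in> carrier_vec (rk (Suc n))" "(beta M 0 n z *\<^sub>v c) $ 0 = 1"
      by (auto simp: direct_vecs_def)
    let ?a = "delta M 0 n z *\<^sub>v c" and ?be = "beta M (Suc n) (Suc n) z" and ?al = "alpha M (Suc n) (Suc n) z"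
    have a: "?a \<in> carrier_vec (rk (Suc n))" using carrier_matD[OF block_carriers(4)[of 0 n z]] by (auto intro!: carrier_vecI)
    have Bc: "B \<in> carrier_mat (rk (Suc (Suc n))) (rk (Suc n))" "?be * B = 1\<^sub>m (rk (Suc n))"
      and bc: "b \<in> carrier_mat (rk (Suc (Suc n))) (rk (Suc n))" "?be * b = ?al"
      using B by (auto simp: right_inverses_def alpha_lifts_def)
    define c' where "c' = B *\<^sub>v c - b *\<^sub>v ?a"
    have v: "B *\<^sub>v c \<in> carrier_vec (rk (Suc (Suc n)))" "b *\<^sub>v ?a \<in> carrier_vec (rk (Suc (Suc n)))"
      using Bc bc by (auto intro!: carrier_vecI)
    have c': "c' \<in> carrier_vec (rk (Suc (Suc n)))" using v by (simp add: c'_def)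
    have ala: "?al *\<^sub>v ?a \<in> carrier_vec (rk (Suc n))" using carrier_matD[OF block_carriers(1)[of "Suc n" "Suc n" z]] by (auto intro!: carrier_vecI)
    have "?be *\<^sub>v c' = ?be *\<^sub>v (B *\<^sub>v c) - ?be *\<^sub>v (b *\<^sub>v ?a)"
      unfolding c'_def by (rule mult_minus_distrib_mat_vec[OF block_carriers(2) v])
    also have "?be *\<^sub>v (B *\<^sub>v c) = c"
      using assoc_mult_mat_vec[OF block_carriers(2) Bc(1) c(2), of "Suc n" z] c(2) by (simp add: Bc(2))
    also have "?be *\<^sub>v (b *\<^sub>v ?a) = ?al *\<^sub>v ?a"
      using assoc_mult_mat_vec[OF block_carriers(2) bc(1) a, of "Suc n" z] by (simp add: bc(2))
    finally have "?al *\<^sub>v ?a + ?be *\<^sub>v c' = c" using vec_cancel(2)[OF ala c(2)] by simp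
    then obtain "beta M 0 (Suc n) z *\<^sub>v c' = beta M 0 n z *\<^sub>v c"
      "delta M 0 (Suc n) z *\<^sub>v c' = gamma M (Suc n) (Suc n) z *\<^sub>v ?a + delta M (Suc n) (Suc n) z *\<^sub>v c'"
      using glue_solution[OF nr c(2) c'] by metis
    moreover have "T *\<^sub>v u = c' @\<^sub>v (delta M (Suc n) (Suc n) z *\<^sub>v c' + gamma M (Suc n) (Suc n) z *\<^sub>v ?a)"
      unfolding B(1) c(1) c'_def by (rule transfer_apply[OF Bc(1) bc(1) c(2) a])
    moreover have "gamma M (Suc n) (Suc n) z *\<^sub>v ?a \<in> carrier_vec (rk (Suc (Suc n)))" "delta M (Suc n) (Suc n) z *\<^sub>v c' \<in> carrier_vec (rk (Suc (Suc n)))"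
      using carrier_matD[OF block_carriers(3)[of "Suc n" "Suc n" z]] carrier_matD[OF block_carriers(4)[of "Suc n" "Suc n" z]] by (auto intro!: carrier_vecI)
    ultimately have "T *\<^sub>v u = c' @\<^sub>v (delta M 0 (Suc n) z *\<^sub>v c')" "(beta M 0 (Suc n) z *\<^sub>v c') $ 0 = 1"
      using c(3) by (simp_all add: comm_add_vec[of _ "rk (Suc (Suc n))"])
    thus "T *\<^sub>v u \<in> direct_vecs (Suc n) z" using c' unfolding direct_vecs_def by blast
  qed
qed

text \<open>A right inverse of \<open>beta\<close> can be corrected by a rank one term so as to map a prescribed
  nonzero \<open>w\<close> to a prescribed preimage of \<open>w\<close>.\<close>
lemma right_inverse_through:
  assumes ne: "right_inverses M n n z \<noteq> {}" and w: "w \<in> carrier_vec (rk n)" "w \<noteq> 0\<^sub>v (rk n)"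
    and c: "c \<in> carrier_vec (rk (Suc n))" "beta M n n z *\<^sub>v c = w"
  obtains B where "B \<in> right_inverses M n n z" "B *\<^sub>v w = c"
proof -
  let ?be = "beta M n n z"
  obtain B0 where B0: "B0 \<in> carrier_mat (rk (Suc n)) (rk n)" "?be * B0 = 1\<^sub>m (rk n)"
    using ne by (auto simp: right_inverses_def)
  define s where "s = w \<bullet>c w"
  have s: "s \<noteq> 0" using w cvec_norm_eq_0[OF w(1)] by (simp add: s_def inner_self)
  define d where "d = c - B0 *\<^sub>v w"
  have B0w: "B0 *\<^sub>v w \<in> carrier_vec (rk (Suc n))" using B0 by (auto intro!: carrier_vecI)
  have d: "d \<in> carrier_vec (rk (Suc n))" using c B0w by (simp add: d_def)
  have bd: "?be *\<^sub>v d = 0\<^sub>v (rk n)"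
  proof -
    have "?be *\<^sub>v d = w - ?be *\<^sub>v (B0 *\<^sub>v w)"
      unfolding d_def c(2)[symmetric] by (rule mult_minus_distrib_mat_vec[OF block_carriers(2) c(1)]) (use B0w c in simp)
    also have "?be *\<^sub>v (B0 *\<^sub>v w) = w"
      using assoc_mult_mat_vec[OF block_carriers(2) B0(1) w(1), of n z] w by (simp add: B0(2))
    finally show ?thesis using w by simp
  qed
  \<comment> \<open>The rank one map v -> ((v, w) / (w, w)) d. As d lies in the kernel of \<beta>,
    adding it to B0 keeps a right inverse, and it moves the image of w by d.\<close>
  define R where "R = mat (rk (Suc n)) (rk n) (\<lambda>(i, j). d $ i * cnj (w $ j) / s)"
  have R: "R \<in> carrier_mat (rk (Suc n)) (rk n)" by (simp add: R_def)
  have Rv: "R *\<^sub>v v = ((v \<bullet>c w) / s) \<cdot>\<^sub>v d" if v: "v \<in> carrier_vec (rk n)" for v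
    using v w(1) d by (intro eq_vecI) (auto simp: R_def scalar_prod_def sum_distrib_left sum_divide_distrib mult_ac intro!: sum.cong)
  define B where "B = B0 + R"
  have B: "B \<in> carrier_mat (rk (Suc n)) (rk n)" unfolding B_def using R B0 by simp
  have "?be * B = ?be * B0 + ?be * R" unfolding B_def by (rule mult_add_distrib_mat[OF block_carriers(2) B0(1) R])
  also have "?be * R = 0\<^sub>m (rk n) (rk n)"
  proof (rule mat_eqI_mult_vec)
    show "?be * R \<in> carrier_mat (rk n) (rk n)" using R by (intro mult_carrier_mat[OF block_carriers(2)])
    fix v :: "complex vec" assume v: "v \<in> carrier_vec (rk n)"
    have "(?be * R) *\<^sub>v v = ?be *\<^sub>v (((v \<bullet>c w) / s) \<cdot>\<^sub>v d)"
      using assoc_mult_mat_vec[OF block_carriers(2) R v, of n z] Rv[OF v] by simp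
    also have "\<dots> = 0\<^sub>v (rk n)" unfolding mult_mat_vec[OF block_carriers(2) d] bd by (intro eq_vecI) auto
    finally show "(?be * R) *\<^sub>v v = 0\<^sub>m (rk n) (rk n) *\<^sub>v v" using v by (auto intro!: eq_vecI simp: scalar_prod_def)
  qed simp
  finally have BR1: "B \<in> right_inverses M n n z" using B B0(2) by (simp add: right_inverses_def)
  have "B *\<^sub>v w = B0 *\<^sub>v w + R *\<^sub>v w" unfolding B_def by (rule add_mult_distrib_mat_vec[OF B0(1) R w(1)])
  moreover have "R *\<^sub>v w = d" using Rv[OF w(1)] s d by (auto simp: s_def[symmetric])
  ultimately have "B *\<^sub>v w = c" using vec_cancel(2)[OF B0w c(1)] by (simp only: d_def)
  note BR = BR1 this
  thus thesis using that BR by blast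
qed

text \<open>With b = B \<alpha> the upper half of the product is B w, where w = c - \<alpha> a =
  \<beta> c'. A right inverse B with B w = c' exists as soon as w is nonzero, and w = 0 would force
  c = 0 by \<open>alpha_delta_injective\<close>, against the normalization. So the smaller family of
  transfer matrices already reaches every direct vector.\<close>

lemma direct_subset_restricted_chain:
  "good n z \<Longrightarrow> direct_vecs n z \<subseteq> chain_set (\<lambda>i. restricted_transfer_set M i i z) n"
proof (induction n)
  case 0
  show ?case
  proof
    fix u assume "u \<in> direct_vecs 0 z"
    then obtain c where c: "u = c @\<^sub>v (delta M 0 0 z *\<^sub>v c)" "c \<in> carrier_vec (rk (Suc 0))" "(beta M 0 0 z *\<^sub>v c) $ 0 = 1"
      by (auto simp: direct_vecs_def)
    define B where "B = mat_of_cols (rk (Suc 0)) [c]"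
    have R: "B \<in> right_inverses M 0 0 z" "col B 0 = c" unfolding B_def by (rule right_inverses_of_vec[OF c(2,3)])+
    have Bc: "B \<in> carrier_mat (rk (Suc 0)) (rk 0)" "beta M 0 0 z * B = 1\<^sub>m (rk 0)" using R by (auto simp: right_inverses_def)
    define b where "b = B * alpha M 0 0 z"
    have b: "b \<in> carrier_mat (rk (Suc 0)) (rk 0)" unfolding b_def using Bc carrier_matD[OF block_carriers(1)[of 0 0 z]] by auto
    have "beta M 0 0 z * b = alpha M 0 0 z"
      unfolding b_def assoc_mult_mat[symmetric, OF block_carriers(2) Bc(1) block_carriers(1)] Bc(2)
      by (rule left_mult_one_mat[OF block_carriers(1)])
    hence T: "transfer_mat M 0 0 z B b \<in> restricted_transfer_set M 0 0 z"
      unfolding restricted_transfer_set_def using R b by (auto simp: alpha_lifts_def b_def)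
    have z0: "b *\<^sub>v vec (Suc 0) (\<lambda>_. 0) = 0\<^sub>v (rk (Suc 0))" using b by (intro eq_vecI) (auto simp: scalar_prod_def)
    have g0: "gamma M 0 0 z *\<^sub>v vec (Suc 0) (\<lambda>_. 0) = 0\<^sub>v (rk (Suc 0))" using carrier_matD[OF block_carriers(3)[of 0 0 z]] by (intro eq_vecI) (auto simp: scalar_prod_def)
    have dc: "delta M 0 0 z *\<^sub>v c \<in> carrier_vec (rk (Suc 0))" using carrier_matD[OF block_carriers(4)[of 0 0 z]] by (auto intro!: carrier_vecI)
    have m0: "v - 0\<^sub>v k = v" if "v \<in> carrier_vec k" for v :: "complex vec" and k using that by (intro eq_vecI) auto
    have "transfer_mat M 0 0 z B b *\<^sub>v vec_of_list [1, 0] = u"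
      unfolding c(1) vec_of_list_1_0 using transfer_apply[OF Bc(1) b, of "vec 1 (\<lambda>_. 1)" "vec 1 (\<lambda>_. 0)" z] dc
        right_inverses_col(1)[OF R(1)] c(2) by (simp add: z0 g0 m0 R(2))
    thus "u \<in> chain_set (\<lambda>i. restricted_transfer_set M i i z) 0" unfolding chain_set_0 using T by blast
  qed
next
  case (Suc n)
  have g: "good n z" and nr: "nonres 0 n z" "nonres (Suc n) (Suc n) z" "nonres 0 (Suc n) z"
    and ne: "right_inverses M (Suc n) (Suc n) z \<noteq> {}"
    using Suc.prems by (auto simp: good_def)
  show ?case
  proof
    fix u assume "u \<in> direct_vecs (Suc n) z"
    then obtain c' where c': "u = c' @\<^sub>v (delta M 0 (Suc n) z *\<^sub>v c')" "c' \<in> carrier_vec (rk (Suc (Suc n)))" "(beta M 0 (Suc n) z *\<^sub>v c') $ 0 = 1"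
      by (auto simp: direct_vecs_def)
    obtain c where c: "c \<in> carrier_vec (rk (Suc n))"
      "alpha M (Suc n) (Suc n) z *\<^sub>v (delta M 0 n z *\<^sub>v c) + beta M (Suc n) (Suc n) z *\<^sub>v c' = c"
      using split_solution[OF nr c'(2)] by blast
    let ?a = "delta M 0 n z *\<^sub>v c" and ?be = "beta M (Suc n) (Suc n) z" and ?al = "alpha M (Suc n) (Suc n) z"
    obtain e: "beta M 0 (Suc n) z *\<^sub>v c' = beta M 0 n z *\<^sub>v c"
      "delta M 0 (Suc n) z *\<^sub>v c' = gamma M (Suc n) (Suc n) z *\<^sub>v ?a + delta M (Suc n) (Suc n) z *\<^sub>v c'"
      using glue_solution[OF nr c(1) c'(2) c(2)] by metis
    have a: "?a \<in> carrier_vec (rk (Suc n))" using carrier_matD[OF block_carriers(4)[of 0 n z]] by (auto intro!: carrier_vecI)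
    have ala: "?al *\<^sub>v ?a \<in> carrier_vec (rk (Suc n))" "?be *\<^sub>v c' \<in> carrier_vec (rk (Suc n))"
      using carrier_matD[OF block_carriers(1)[of "Suc n" "Suc n" z]] carrier_matD[OF block_carriers(2)[of "Suc n" "Suc n" z]] by (auto intro!: carrier_vecI)
    define w where "w = c - ?al *\<^sub>v ?a"
    have w: "w \<in> carrier_vec (rk (Suc n))" using c ala by (simp add: w_def)
    have bw: "?be *\<^sub>v c' = w" unfolding w_def using vec_cancel(1)[OF ala] by (simp only: c(2))
    have "w \<noteq> 0\<^sub>v (rk (Suc n))"
    proof
      assume w0: "w = 0\<^sub>v (rk (Suc n))"
      have "?al *\<^sub>v ?a = c" using c(2) ala(1) unfolding bw w0 by simp
      hence "c = 0\<^sub>v (rk (Suc n))" by (rule alpha_delta_injective[OF nr c(1)])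
      hence "(beta M 0 n z *\<^sub>v c) $ 0 = 0" using carrier_matD[OF block_carriers(2)[of 0 n z]] by (auto simp: scalar_prod_def)
      thus False using c'(3) e(1) by simp
    qed
    then obtain B where B: "B \<in> right_inverses M (Suc n) (Suc n) z" "B *\<^sub>v w = c'"
      using right_inverse_through[OF ne w _ c'(2) bw] by blast
    have Bc: "B \<in> carrier_mat (rk (Suc (Suc n))) (rk (Suc n))" "?be * B = 1\<^sub>m (rk (Suc n))" using B by (auto simp: right_inverses_def)
    define b where "b = B * ?al"
    have b: "b \<in> carrier_mat (rk (Suc (Suc n))) (rk (Suc n))" unfolding b_def using Bc carrier_matD[OF block_carriers(1)[of "Suc n" "Suc n" z]] by auto
    have "?be * b = ?al"
      unfolding b_def assoc_mult_mat[symmetric, OF block_carriers(2) Bc(1) block_carriers(1)] Bc(2)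
      by (rule left_mult_one_mat[OF block_carriers(1)])
    hence T: "transfer_mat M (Suc n) (Suc n) z B b \<in> restricted_transfer_set M (Suc n) (Suc n) z"
      unfolding restricted_transfer_set_def using B b by (auto simp: alpha_lifts_def b_def)
    have "B *\<^sub>v c - b *\<^sub>v ?a = c'"
    proof -
      have "b *\<^sub>v ?a = B *\<^sub>v (?al *\<^sub>v ?a)" unfolding b_def by (rule assoc_mult_mat_vec[OF Bc(1) block_carriers(1) a])
      thus ?thesis using mult_minus_distrib_mat_vec[OF Bc(1) c(1) ala(1)] B(2) by (simp add: w_def)
    qed
    hence "transfer_mat M (Suc n) (Suc n) z B b *\<^sub>v (c @\<^sub>v ?a) = c' @\<^sub>v (delta M (Suc n) (Suc n) z *\<^sub>v c' + gamma M (Suc n) (Suc n) z *\<^sub>v ?a)"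
      using transfer_apply[OF Bc(1) b c(1) a, of z] by simp
    also have "delta M (Suc n) (Suc n) z *\<^sub>v c' + gamma M (Suc n) (Suc n) z *\<^sub>v ?a = delta M 0 (Suc n) z *\<^sub>v c'"
      unfolding e(2) using carrier_matD[OF block_carriers(3)[of "Suc n" "Suc n" z]] carrier_matD[OF block_carriers(4)[of "Suc n" "Suc n" z]] by (intro comm_add_vec[of _ "rk (Suc (Suc n))"]) (auto intro!: carrier_vecI)
    finally have Tu: "transfer_mat M (Suc n) (Suc n) z B b *\<^sub>v (c @\<^sub>v ?a) = u" by (simp add: c'(1))
    have "c @\<^sub>v ?a \<in> direct_vecs n z" using c(1) c'(3) e(1) by (auto simp: direct_vecs_def)
    hence "c @\<^sub>v ?a \<in> chain_set (\<lambda>i. restricted_transfer_set M i i z) n" using Suc.IH[OF g] by blast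
    thus "u \<in> chain_set (\<lambda>i. restricted_transfer_set M i i z) (Suc n)"
      unfolding chain_set_Suc using T Tu by blast
  qed
qed

lemma chain_sets_eq:
  assumes "good n z"
  shows "chain_set (\<lambda>i. transfer_set M i i z) n = direct_set M n z"
    "chain_set (\<lambda>i. restricted_transfer_set M i i z) n = direct_set M n z"
proof -
  have "chain_set (\<lambda>i. restricted_transfer_set M i i z) n \<subseteq> chain_set (\<lambda>i. transfer_set M i i z) n"
    by (rule chain_set_mono[OF restricted_subset])
  thus "chain_set (\<lambda>i. transfer_set M i i z) n = direct_set M n z"
    "chain_set (\<lambda>i. restricted_transfer_set M i i z) n = direct_set M n z"
    using transfer_chain_subset_direct[OF assms] direct_subset_restricted_chain[OF assms]
    unfolding direct_set_eq by blast+
qed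

end

section \<open>The densities\<close>

lemma cvec_norm_append:
  "(cvec_norm (a @\<^sub>v b))\<^sup>2 = (cvec_norm a)\<^sup>2 + (cvec_norm b)\<^sup>2"
proof -
  have "complex_of_real ((cvec_norm (a @\<^sub>v b))\<^sup>2) = complex_of_real ((cvec_norm a)\<^sup>2 + (cvec_norm b)\<^sup>2)"
    unfolding inner_self[symmetric] of_real_add
    by (rule inner_append[of a "dim_vec a" b "dim_vec b"]) auto
  thus ?thesis by (simp only: of_real_eq_iff)
qed

lemma cvec_norm_smult: "cvec_norm (c \<cdot>\<^sub>v v) = cmod c * cvec_norm v"
proof -
  have "(cvec_norm (c \<cdot>\<^sub>v v))\<^sup>2 = (cmod c * cvec_norm v)\<^sup>2"
    unfolding power_mult_distrib cvec_norm_sq by (simp add: sum_distrib_left norm_mult power_mult_distrib)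
  thus ?thesis by simp
qed

text \<open>For Hermitian \<open>D\<close> the vectors \<open>c @ D c\<close> carry the norm \<open>\<langle>c, (1 + D\<^sup>2) c\<rangle>\<close>, so that
  \<open>w = (1 + D\<^sup>2)\<^bsup>-1\<^esup> g\<close> represents the functional \<open>c \<mapsto> \<langle>g, c\<rangle>\<close>.\<close>
locale graph_norm =
  fixes D X :: "complex mat" and g :: "complex vec" and k :: nat
  assumes D: "D \<in> carrier_mat k k" and D_herm: "mat_adjoint D = D" and g: "g \<in> carrier_vec k"
    and X: "is_pos_inv_sqrt (1\<^sub>m k + D * D) X"
begin

definition w :: "complex vec" where "w = X *\<^sub>v (X *\<^sub>v g)"

definition J :: "complex vec \<Rightarrow> complex vec" where "J c = c @\<^sub>v (D *\<^sub>v c)"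

lemma X_carrier: "X \<in> carrier_mat k k" and X_herm: "mat_adjoint X = X"
  using X D unfolding is_pos_inv_sqrt_def by auto

lemma D_vec [simp]: "D *\<^sub>v v \<in> carrier_vec k" and X_vec [simp]: "X *\<^sub>v v \<in> carrier_vec k"
  using D X_carrier by (auto intro!: carrier_vecI)

lemma w_carrier [simp]: "w \<in> carrier_vec k"
  by (simp add: w_def)

lemma g_eq: "g = w + D *\<^sub>v (D *\<^sub>v w)"
proof -
  let ?K = "1\<^sub>m k + D * D"
  have K: "?K \<in> carrier_mat k k" and XX: "X * X \<in> carrier_mat k k" using D X_carrier by auto
  have "X * X * ?K = 1\<^sub>m k" using X D unfolding is_pos_inv_sqrt_def by auto
  hence KX: "?K * (X * X) = 1\<^sub>m k" using mat_mult_left_right_inverse[OF XX K] by simp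
  have ww: "w = (X * X) *\<^sub>v g" unfolding w_def by (rule assoc_mult_mat_vec[symmetric, OF X_carrier X_carrier g])
  have "?K *\<^sub>v w = g" unfolding ww assoc_mult_mat_vec[symmetric, OF K XX g] KX using g by simp
  moreover have "?K *\<^sub>v w = 1\<^sub>m k *\<^sub>v w + (D * D) *\<^sub>v w"
    by (rule add_mult_distrib_mat_vec[OF _ _ w_carrier]) (use D in auto)
  ultimately show ?thesis using assoc_mult_mat_vec[OF D D w_carrier] by simp
qed

lemma J_carrier: "c \<in> carrier_vec k \<Longrightarrow> J c \<in> carrier_vec (k + k)"
  by (simp add: J_def)

lemma inner_J:
  assumes c: "c \<in> carrier_vec k"
  shows "c \<bullet>c g = J c \<bullet>c J w"
proof -
  have "c \<bullet>c g = c \<bullet>c w + c \<bullet>c (D *\<^sub>v (D *\<^sub>v w))"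
    by (rule inner_add_right[OF w_carrier D_vec[of "D *\<^sub>v w"] c, folded g_eq])
  also have "c \<bullet>c (D *\<^sub>v (D *\<^sub>v w)) = (D *\<^sub>v c) \<bullet>c (D *\<^sub>v w)"
    using inner_adjoint[OF D c D_vec] by (simp add: D_herm)
  finally show ?thesis unfolding J_def using inner_append[OF c D_vec w_carrier D_vec] by simp
qed

lemma norm_Xg: "(cvec_norm (X *\<^sub>v g))\<^sup>2 = (cvec_norm (J w))\<^sup>2"
proof -
  have "complex_of_real ((cvec_norm (X *\<^sub>v g))\<^sup>2) = (X *\<^sub>v g) \<bullet>c (X *\<^sub>v g)" by (simp only: inner_self)
  also have "\<dots> = g \<bullet>c w" using inner_adjoint[OF X_carrier g X_vec] by (simp add: X_herm w_def)
  also have "\<dots> = cnj (w \<bullet>c g)" by (rule inner_commute[OF w_carrier g])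
  also have "\<dots> = complex_of_real ((cvec_norm (J w))\<^sup>2)" unfolding inner_J[OF w_carrier] inner_self by simp
  finally show ?thesis by (simp only: of_real_eq_iff)
qed

lemma norm_J_ge:
  assumes c: "c \<in> carrier_vec k" "c \<bullet>c g = 1"
  shows "1 \<le> (cvec_norm (X *\<^sub>v g))\<^sup>2 * (cvec_norm (J c))\<^sup>2"
proof -
  have "1 \<le> cvec_norm (J c) * cvec_norm (J w)"
    using inner_Cauchy_Schwarz[OF J_carrier[OF c(1)] J_carrier[OF w_carrier]] inner_J[OF c(1)] c(2) by simp
  hence "1\<^sup>2 \<le> (cvec_norm (J c) * cvec_norm (J w))\<^sup>2" by (intro power_mono) auto
  thus ?thesis by (simp add: norm_Xg power_mult_distrib mult.commute)
qed

lemma norm_J_attained: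
  assumes "cvec_norm (X *\<^sub>v g) \<noteq> 0"
  obtains c where "c \<in> carrier_vec k" "c \<bullet>c g = 1" "(cvec_norm (J c))\<^sup>2 = 1 / (cvec_norm (X *\<^sub>v g))\<^sup>2"
proof
  define S where "S = (cvec_norm (X *\<^sub>v g))\<^sup>2"
  have S: "S \<noteq> 0" using assms by (simp add: S_def)
  \<comment> \<open>The pairing of w with g is S, so this multiple of w has pairing 1; it is the
    case of equality in Cauchy-Schwarz.\<close>
  let ?c = "complex_of_real (1 / S) \<cdot>\<^sub>v w"
  show "?c \<in> carrier_vec k" by simp
  have "w \<bullet>c g = complex_of_real S" unfolding inner_J[OF w_carrier] inner_self S_def norm_Xg ..
  thus "?c \<bullet>c g = 1" using inner_smult_left[OF w_carrier g] S by simp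
  have "J ?c = complex_of_real (1 / S) \<cdot>\<^sub>v J w"
    unfolding J_def mult_mat_vec[OF D w_carrier] using D by (intro eq_vecI) auto
  hence "cvec_norm (J ?c) = \<bar>1 / S\<bar> * cvec_norm (J w)" by (simp only: cvec_norm_smult norm_of_real)
  hence "(cvec_norm (J ?c))\<^sup>2 = (1 / S)\<^sup>2 * S" by (simp only: power_mult_distrib power2_abs S_def norm_Xg)
  thus "(cvec_norm (J ?c))\<^sup>2 = 1 / (cvec_norm (X *\<^sub>v g))\<^sup>2" using S by (simp add: S_def power2_eq_square)
qed

lemma inner_D_real: "v \<in> carrier_vec k \<Longrightarrow> Im ((D *\<^sub>v v) \<bullet>c v) = 0"
  by (rule hermitian_inner_real[OF D D_herm])

text \<open>The fixed point is (1 - i D)^-1 g = (1 + i D) w. The cross terms in its squared norm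
  cancel because D is Hermitian, and what remains is the squared norm of \<open>J w\<close>.\<close>

lemma norm_of_fixed_point:
  assumes x: "x \<in> carrier_vec k" "x = g + \<i> \<cdot>\<^sub>v (D *\<^sub>v x)"
  shows "(cvec_norm x)\<^sup>2 = (cvec_norm (X *\<^sub>v g))\<^sup>2"
proof -
  define y where "y = w + \<i> \<cdot>\<^sub>v (D *\<^sub>v w)"
  have y: "y \<in> carrier_vec k" by (simp add: y_def)
  have Dy: "D *\<^sub>v y = D *\<^sub>v w + \<i> \<cdot>\<^sub>v (D *\<^sub>v (D *\<^sub>v w))"
    unfolding y_def by (subst mult_add_distrib_mat_vec[OF D w_carrier]) (simp_all add: mult_mat_vec[OF D D_vec])
  define d where "d = x - y"
  have d: "d \<in> carrier_vec k" using x(1) y by (simp add: d_def)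
  have aux: "gg + ww2 - (ww + iDw) = \<i> \<cdot>\<^sub>v (Dx - (Dw + \<i> \<cdot>\<^sub>v DDw))"
    if "gg = ww + DDw" "ww2 = \<i> \<cdot>\<^sub>v Dx" "iDw = \<i> \<cdot>\<^sub>v Dw" "ww \<in> carrier_vec k" "DDw \<in> carrier_vec k" "Dx \<in> carrier_vec k" "Dw \<in> carrier_vec k"
    for gg ww2 ww iDw Dx Dw DDw :: "complex vec"
    using that(4-) unfolding that(1-3) by (intro eq_vecI) (auto simp: algebra_simps)
  have "d = (g + \<i> \<cdot>\<^sub>v (D *\<^sub>v x)) - (w + \<i> \<cdot>\<^sub>v (D *\<^sub>v w))" unfolding d_def y_def using x(2) by simp
  also have "\<dots> = \<i> \<cdot>\<^sub>v (D *\<^sub>v x - (D *\<^sub>v w + \<i> \<cdot>\<^sub>v (D *\<^sub>v (D *\<^sub>v w))))"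
    by (rule aux[OF g_eq refl refl w_carrier D_vec D_vec D_vec])
  also have "D *\<^sub>v x - (D *\<^sub>v w + \<i> \<cdot>\<^sub>v (D *\<^sub>v (D *\<^sub>v w))) = D *\<^sub>v d"
    unfolding d_def Dy[symmetric] by (rule mult_minus_distrib_mat_vec[symmetric, OF D x(1) y])
  finally have dd: "d = \<i> \<cdot>\<^sub>v (D *\<^sub>v d)" .
  \<comment> \<open>A vector fixed by i D has squared norm equal to i times a real number, hence is
    0; this is uniqueness of the fixed point.\<close>
  have "d \<bullet>c d = \<i> * ((D *\<^sub>v d) \<bullet>c d)" by (subst dd) (rule inner_smult_left[OF D_vec d])
  hence "complex_of_real ((cvec_norm d)\<^sup>2) = \<i> * ((D *\<^sub>v d) \<bullet>c d)" by (simp only: inner_self)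
  from arg_cong[OF this, of Re] have "(cvec_norm d)\<^sup>2 = 0" using inner_D_real[OF d] by simp
  hence "d = 0\<^sub>v k" using cvec_norm_eq_0[OF d] by simp
  hence "x = y" using x(1) y unfolding d_def
    by (intro eq_vecI) (auto simp: vec_eq_iff)
  have "y \<bullet>c y = w \<bullet>c y + \<i> * ((D *\<^sub>v w) \<bullet>c y)"
    by (subst (1) y_def) (simp add: inner_add_left[OF w_carrier _ y] inner_smult_left[OF D_vec y])
  also have "w \<bullet>c y = w \<bullet>c w - \<i> * (w \<bullet>c (D *\<^sub>v w))"
    unfolding y_def by (simp add: inner_add_right[OF w_carrier _ w_carrier] inner_smult_right[OF w_carrier D_vec])
  also have "(D *\<^sub>v w) \<bullet>c y = (D *\<^sub>v w) \<bullet>c w - \<i> * ((D *\<^sub>v w) \<bullet>c (D *\<^sub>v w))"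
    unfolding y_def by (simp add: inner_add_right[OF w_carrier _ D_vec] inner_smult_right[OF D_vec D_vec])
  also have "w \<bullet>c (D *\<^sub>v w) = (D *\<^sub>v w) \<bullet>c w" using inner_adjoint[OF D w_carrier w_carrier] by (simp add: D_herm)
  finally have "complex_of_real ((cvec_norm y)\<^sup>2) = complex_of_real ((cvec_norm w)\<^sup>2 + (cvec_norm (D *\<^sub>v w))\<^sup>2)"
    unfolding inner_self of_real_add by (simp add: algebra_simps)
  hence "(cvec_norm y)\<^sup>2 = (cvec_norm (J w))\<^sup>2" unfolding J_def cvec_norm_append by (simp only: of_real_eq_iff)
  thus ?thesis by (simp add: \<open>x = y\<close> norm_Xg)
qed

end

lemma mult_mat_unit_vec: "A \<in> carrier_mat n (Suc 0) \<Longrightarrow> A *\<^sub>v vec (Suc 0) (\<lambda>_. 1 :: complex) = col A 0"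
  by (intro eq_vecI) (auto simp: scalar_prod_def)

text \<open>The line is not a null set, so an almost sure property holds at some point outside a
  given finite set. It is used to extract from assumption (A2) one point of full rank that is not an
  eigenvalue.\<close>

lemma AE_lborel_witness:
  assumes "AE t::real in lborel. Q t" "finite {t. \<not> R t}"
  obtains t where "Q t" "R t"
proof -
  have "AE t in lborel. t \<notin> {t. \<not> R t}" using assms(2) by (intro AE_not_in finite_imp_null_set_lborel)
  with assms(1) have "AE t in lborel. Q t \<and> R t" by eventually_elim simp
  moreover have "\<not> (AE t::real in lborel. False)"
    using AE_iff_measurable[of "UNIV :: real set" lborel "\<lambda>_. False"] by simp
  ultimately have "\<exists>t. Q t \<and> R t"
    using eventually_happens'[of "ae_filter lborel"] unfolding trivial_limit_def by blast
  thus thesis using that by blast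
qed

section \<open>Exceptional energies and equality of the densities\<close>

context shells
begin

lemma right_inverses_nonempty_iff:
  "right_inverses M m n z \<noteq> {} \<longleftrightarrow> vec_space.rank (rk m) (beta M m n z) = rk m"
  "right_inverses M m n z \<noteq> {} \<longleftrightarrow> det (beta M m n z * mat_adjoint (beta M m n z)) \<noteq> 0"
  unfolding full_rank_iff_surjective[OF block_carriers(2)] det_gram_nonzero_iff_surjective[OF block_carriers(2)]
    right_inverse_iff_surjective[OF block_carriers(2), symmetric] right_inverses_def by blast+

lemma not_singular:
  assumes "m \<le> n" "nonres m n z" "right_inverses M m n z \<noteq> {}"
  shows "z \<notin> singular_set M m n"
  using assms nonres_not_singular1[OF assms(1,2)] right_inverses_nonempty_iff(1)[of m n z]
  by (simp add: singular_set_def)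

text \<open>Failure of full rank is the vanishing of a polynomial in t, so it occurs finitely often
  or everywhere, and a single point of full rank excludes the latter. Conjugation is not
  holomorphic, but on the real line the adjoint of \<beta> is \<gamma>, whose entries are rational
  in z.\<close>

lemma finite_no_right_inverse:
  assumes A2: "AE t in lborel. vec_space.rank (rk n) (beta M n n (complex_of_real t)) = rk n"
  shows "finite {t. nonres n n (complex_of_real t) \<and> right_inverses M n n (complex_of_real t) = {}}"
proof -
  let ?r = "rk n" and ?s = "rk (Suc n)" and ?H = "Hm n n"
  have "\<forall>i j. \<exists>p. i < ?r + ?s \<longrightarrow> j < ?r + ?s \<longrightarrow>
      (\<forall>z. (Res n n z *\<^sub>v bcol n n j) \<bullet>c bcol n n i = poly p z / det (shifted ?H z))"
    using polyfun_resolvent_inner[OF Hm_carrier bcol_carrier[OF order.refl] bcol_carrier[OF order.refl]] by metis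
  then obtain p where p: "\<And>i j z. i < ?r + ?s \<Longrightarrow> j < ?r + ?s \<Longrightarrow>
      (Res n n z *\<^sub>v bcol n n j) \<bullet>c bcol n n i = poly (p i j) z / det (shifted ?H z)"
    by metis
  \<comment> \<open>The product \<beta> \<gamma> with its denominator, the square of det (H - z),
    cleared.\<close>
  define G where "G z = mat ?r ?r (\<lambda>(a, b). \<Sum>l<?s. poly (p a (?r + l)) z * poly (p (?r + l) b) z)" for z
  have G: "G z \<in> carrier_mat ?r ?r" for z by (simp add: G_def)
  have "polyfun (\<lambda>z. det (G z))"
  proof (rule polyfun_det[OF G])
    fix i j assume ij: "i < ?r" "j < ?r"
    have "polyfun (\<lambda>z. poly q z)" for q by (auto simp: polyfun_def)
    thus "polyfun (\<lambda>z. G z $$ (i, j))" using ij by (auto simp: G_def intro!: polyfun_sum polyfun_mult)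
  qed
  then obtain q where q: "\<And>z. det (G z) = poly q z" by (auto simp: polyfun_def)
  have key: "right_inverses M n n z \<noteq> {} \<longleftrightarrow> poly q z \<noteq> 0" if nr: "nonres n n z" and z: "z = complex_of_real t" for z t
  proof -
    let ?d = "det (shifted ?H z)"
    have d: "?d \<noteq> 0" using nr by (simp add: nonres_def)
    have ind: "bdry_resolvent M n n z $$ (i, j) = poly (p i j) z / ?d" if "i < ?r + ?s" "j < ?r + ?s" for i j
      using bdry_resolvent_index[OF order.refl nr that] p[OF that] by simp
    have "beta M n n z * gamma M n n z = (1 / ?d ^ 2) \<cdot>\<^sub>m G z"
    proof (rule eq_matI)
      fix i j assume "i < dim_row ((1 / ?d ^ 2) \<cdot>\<^sub>m G z)" "j < dim_col ((1 / ?d ^ 2) \<cdot>\<^sub>m G z)"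
      hence ij: "i < ?r" "j < ?r" by (auto simp: G_def)
      have "(beta M n n z * gamma M n n z) $$ (i, j) = (\<Sum>l<?s. beta M n n z $$ (i, l) * gamma M n n z $$ (l, j))"
        by (rule mult_index_sum[OF block_carriers(2,3) ij])
      also have "\<dots> = (\<Sum>l<?s. (1 / ?d ^ 2) * (poly (p i (?r + l)) z * poly (p (?r + l) j) z))"
        using ij by (intro sum.cong) (auto simp: beta_def gamma_def ind power2_eq_square)
      also have "\<dots> = ((1 / ?d ^ 2) \<cdot>\<^sub>m G z) $$ (i, j)" using ij by (simp add: G_def sum_distrib_left)
      finally show "(beta M n n z * gamma M n n z) $$ (i, j) = ((1 / ?d ^ 2) \<cdot>\<^sub>m G z) $$ (i, j)" .
    qed (use carrier_matD[OF block_carriers(2)[of n n z]] carrier_matD[OF block_carriers(3)[of n n z]] carrier_matD[OF G] in auto)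
    hence "det (beta M n n z * mat_adjoint (beta M n n z)) = (1 / ?d ^ 2) ^ ?r * poly q z"
      using blocks_herm(2)[of n n t] nr carrier_matD[OF G] by (simp add: det_smult q z)
    thus ?thesis using d unfolding right_inverses_nonempty_iff(2) by simp
  qed
  obtain t0 where "vec_space.rank ?r (beta M n n (complex_of_real t0)) = ?r" "nonres n n (complex_of_real t0)"
    by (rule AE_lborel_witness[OF A2 finite_not_nonres])
  hence "poly q (complex_of_real t0) \<noteq> 0" using key right_inverses_nonempty_iff(1) by metis
  hence "finite {z. poly q z = 0}" by (intro poly_roots_finite) auto
  hence "finite (complex_of_real -` {z. poly q z = 0})" by (intro finite_vimageI) (auto intro: injI)
  thus ?thesis by (rule rev_finite_subset) (use key in auto)
qed

lemma finite_not_good: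
  assumes A2: "\<forall>n. AE t in lborel. vec_space.rank (rk n) (beta M n n (complex_of_real t)) = rk n"
  shows "finite {t::real. \<not> good n (complex_of_real t)}"
proof (rule finite_subset)
  show "{t::real. \<not> good n (complex_of_real t)} \<subseteq> (\<Union>i\<le>n. {t. \<not> nonres 0 i (complex_of_real t)} \<union>
     {t. \<not> nonres i i (complex_of_real t)} \<union>
     {t. nonres i i (complex_of_real t) \<and> right_inverses M i i (complex_of_real t) = {}})"
    by (auto simp: good_def)
  show "finite (\<Union>i\<le>n. {t. \<not> nonres 0 i (complex_of_real t)} \<union> {t. \<not> nonres i i (complex_of_real t)} \<union>
     {t. nonres i i (complex_of_real t) \<and> right_inverses M i i (complex_of_real t) = {}})"
    using finite_no_right_inverse A2 finite_not_nonres by (intro finite_UN_I finite_UnI) auto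
qed

context
  fixes n :: nat and t :: real
  assumes good: "good n (complex_of_real t)"
begin

abbreviation "\<gamma>\<^sub>1 \<equiv> col (gamma M 0 n (complex_of_real t)) 0"
abbreviation "isq \<equiv> pos_inv_sqrt (one_plus_delta_sq M n t)"

lemma nonres_0: "nonres 0 n (complex_of_real t)"
  using good by (simp add: good_def)

lemma ex1_isq: "\<exists>!X. is_pos_inv_sqrt (one_plus_delta_sq M n t) X"
  unfolding one_plus_delta_sq_def
  by (rule one_plus_square_inv_sqrt[OF block_carriers(4) blocks_herm(3)[OF _ nonres_0]]) simp

lemma graph_norm: "graph_norm (delta M 0 n (complex_of_real t)) isq \<gamma>\<^sub>1 (rk (Suc n))"
proof
  show "is_pos_inv_sqrt (1\<^sub>m (rk (Suc n)) + delta M 0 n (complex_of_real t) * delta M 0 n (complex_of_real t)) isq"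
    using theI'[OF ex1_isq] unfolding pos_inv_sqrt_def one_plus_delta_sq_def .
  show "\<gamma>\<^sub>1 \<in> carrier_vec (rk (Suc n))"
    using carrier_matD[OF block_carriers(3)[of 0 n "complex_of_real t"]] by (auto intro!: carrier_vecI)
qed (use blocks_herm(3)[OF _ nonres_0] in simp_all)

interpretation gn: graph_norm "delta M 0 n (complex_of_real t)" isq \<gamma>\<^sub>1 "rk (Suc n)"
  by (rule graph_norm)

lemma resolvent_density_eq: "pi * resolvent_density M n t = (cvec_norm (isq *\<^sub>v \<gamma>\<^sub>1))\<^sup>2"
proof -
  have "col (isq * gamma M 0 n (complex_of_real t)) 0 = isq *\<^sub>v \<gamma>\<^sub>1"
    by (rule col_mult2[OF gn.X_carrier block_carriers(3)]) simp
  thus ?thesis by (simp add: resolvent_density_def)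
qed

lemma beta_inner:
  assumes c: "c \<in> carrier_vec (rk (Suc n))"
  shows "(beta M 0 n (complex_of_real t) *\<^sub>v c) $ 0 = c \<bullet>c \<gamma>\<^sub>1"
proof -
  let ?b = "beta M 0 n (complex_of_real t)"
  note D = carrier_matD[OF block_carriers(2)[of 0 n "complex_of_real t"]]
  have g: "gamma M 0 n (complex_of_real t) = mat_adjoint ?b" using blocks_herm(2)[OF _ nonres_0] by simp
  have "(?b *\<^sub>v c) $ 0 = (\<Sum>j<rk (Suc n). ?b $$ (0, j) * c $ j)"
    using c D by (simp add: scalar_prod_def atLeast0LessThan)
  also have "\<dots> = c \<bullet>c \<gamma>\<^sub>1"
    unfolding g using c D by (auto simp: scalar_prod_def atLeast0LessThan mult.commute intro!: sum.cong)
  finally show ?thesis .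
qed

lemma direct_set_J: "direct_set M n (complex_of_real t) = {gn.J c | c. c \<in> carrier_vec (rk (Suc n)) \<and> c \<bullet>c \<gamma>\<^sub>1 = 1}"
  unfolding direct_set_eq direct_vecs_def gn.J_def using beta_inner by fastforce

text \<open>Assumption (A2) concerns single shells. A vector with \<beta> c = 1 for the whole volume
  is obtained as the upper half of a product of transfer matrices, each formed from a right inverse
  B and b = B \<alpha>.\<close>

lemma direct_set_nonempty: "direct_set M n (complex_of_real t) \<noteq> {}"
proof -
  have "\<exists>T. T \<in> transfer_set M i i (complex_of_real t)" if "i \<le> n" for i
  proof -
    obtain B where B: "B \<in> right_inverses M i i (complex_of_real t)" using good[unfolded good_def] \<open>i \<le> n\<close> by blast
    hence Bc: "B \<in> carrier_mat (rk (Suc i)) (rk i)" "beta M i i (complex_of_real t) * B = 1\<^sub>m (rk i)"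
      by (auto simp: right_inverses_def)
    have "beta M i i (complex_of_real t) * (B * alpha M i i (complex_of_real t)) = alpha M i i (complex_of_real t)"
      unfolding assoc_mult_mat[symmetric, OF block_carriers(2) Bc(1) block_carriers(1)] Bc(2)
      by (rule left_mult_one_mat[OF block_carriers(1)])
    hence "B * alpha M i i (complex_of_real t) \<in> alpha_lifts M i i (complex_of_real t)"
      using mult_carrier_mat[OF Bc(1) block_carriers(1)] by (simp add: alpha_lifts_def)
    thus ?thesis using B unfolding transfer_set_def by blast
  qed
  then obtain T where "\<And>i. i \<le> n \<Longrightarrow> T i \<in> transfer_set M i i (complex_of_real t)" by metis
  hence "chain T n (vec_of_list [1, 0]) \<in> chain_set (\<lambda>i. transfer_set M i i (complex_of_real t)) n"
    unfolding chain_set_def by blast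
  thus ?thesis using chain_sets_eq(1)[OF good] by auto
qed

abbreviation "S \<equiv> pi * resolvent_density M n t"

lemma S_pos: "S > 0"
proof -
  obtain c where "c \<in> carrier_vec (rk (Suc n))" "c \<bullet>c \<gamma>\<^sub>1 = 1" using direct_set_nonempty unfolding direct_set_J by auto
  from gn.norm_J_ge[OF this] have "(cvec_norm (isq *\<^sub>v \<gamma>\<^sub>1))\<^sup>2 \<noteq> 0" by auto
  thus ?thesis unfolding resolvent_density_eq by simp
qed

lemma direct_norm_ge: "u \<in> direct_set M n (complex_of_real t) \<Longrightarrow> 1 / S \<le> (cvec_norm u)\<^sup>2"
  using gn.norm_J_ge S_pos unfolding direct_set_J resolvent_density_eq by (auto simp: divide_simps mult.commute)

lemma direct_norm_attained: "\<exists>u\<in>direct_set M n (complex_of_real t). (cvec_norm u)\<^sup>2 = 1 / S"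
proof -
  have "cvec_norm (isq *\<^sub>v \<gamma>\<^sub>1) \<noteq> 0" using S_pos unfolding resolvent_density_eq by auto
  then obtain c where "c \<in> carrier_vec (rk (Suc n))" "c \<bullet>c \<gamma>\<^sub>1 = 1" "(cvec_norm (gn.J c))\<^sup>2 = 1 / S"
    unfolding resolvent_density_eq by (rule gn.norm_J_attained)
  thus ?thesis unfolding direct_set_J by blast
qed

lemma direct_norm_nonzero: "u \<in> direct_set M n (complex_of_real t) \<Longrightarrow> cvec_norm u \<noteq> 0"
  using direct_norm_ge[of u] S_pos by (auto simp: divide_simps split: if_splits)

lemma resolvent_density_ok: "resolvent_density_defined M n t"
  unfolding resolvent_density_defined_def using nonres_not_singular1[OF _ nonres_0] ex1_isq by simp

lemma direct_density_ok: "direct_density_defined M n t" "direct_density M n t = resolvent_density M n t"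
proof -
  let ?Y = "{(cvec_norm u)\<^sup>2 | u. u \<in> direct_set M n (complex_of_real t)}"
  have mem: "1 / S \<in> ?Y" and le: "\<And>y. y \<in> ?Y \<Longrightarrow> 1 / S \<le> y"
    using direct_norm_attained direct_norm_ge by force+
  have "right_inverses M 0 n (complex_of_real t) \<noteq> {}" using direct_set_nonempty by (auto simp: direct_set_def)
  hence "complex_of_real t \<notin> singular_set M 0 n" by (intro not_singular nonres_0) auto
  thus "direct_density_defined M n t"
    unfolding direct_density_defined_def has_least_def using direct_norm_nonzero mem le by blast
  have "(LEAST y. y \<in> ?Y) = 1 / S" by (rule Least_equality, rule mem, erule le)
  thus "direct_density M n t = resolvent_density M n t" by (simp add: direct_density_def)
qed

lemma chain_density_ok_aux:
  assumes TT: "chain_set (\<lambda>i. TT i i (complex_of_real t)) n = direct_set M n (complex_of_real t)"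
  shows "chain_density_defined M TT n t" "chain_density TT n t = resolvent_density M n t"
proof -
  let ?Y = "{inverse ((cvec_norm u)\<^sup>2) | u. u \<in> direct_set M n (complex_of_real t)}"
  have mem: "S \<in> ?Y" using direct_norm_attained S_pos by force
  have le: "y \<le> S" if "y \<in> ?Y" for y
  proof -
    obtain u where u: "y = inverse ((cvec_norm u)\<^sup>2)" "u \<in> direct_set M n (complex_of_real t)" using \<open>y \<in> ?Y\<close> by blast
    have "inverse ((cvec_norm u)\<^sup>2) \<le> inverse (1 / S)" using direct_norm_ge[OF u(2)] S_pos by (intro le_imp_inverse_le) auto
    thus ?thesis using u(1) by simp
  qed
  have "\<forall>i\<le>n. complex_of_real t \<notin> singular_set M i i" using good[unfolded good_def] not_singular by blast
  thus "chain_density_defined M TT n t"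
    unfolding chain_density_defined_def has_greatest_def TT using direct_norm_nonzero mem le by blast
  have "(GREATEST y. y \<in> ?Y) = S" by (rule Greatest_equality, rule mem, erule le)
  thus "chain_density TT n t = resolvent_density M n t" by (simp add: chain_density_def TT)
qed

lemma chain_density_ok:
  "chain_density_defined M (transfer_set M) n t" "chain_density (transfer_set M) n t = resolvent_density M n t"
  "chain_density_defined M (restricted_transfer_set M) n t"
  "chain_density (restricted_transfer_set M) n t = resolvent_density M n t"
  using chain_density_ok_aux[of "transfer_set M"] chain_density_ok_aux[of "restricted_transfer_set M"]
    chain_sets_eq[OF good] by blast+

text \<open>Moving the dissipative term of the equation for v to the right-hand side expresses v by
  the Hermitian resolvent with the additional source i P x. Applying the adjoint of P closes the
  equation for x, to which \<open>norm_of_fixed_point\<close> applies.\<close>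

lemma Im_F_eq_density:
  assumes "det (shifted (dissipative.A (Hm 0 n) (Ph 0 n)) (complex_of_real t)) \<noteq> 0"
  shows "Im (dissipative.F (Hm 0 n) (Ph 0 n) (col (Uh 0 n) 0) (complex_of_real t)) = S"
proof -
  let ?P = "Ph 0 n" and ?U = "Uh 0 n" and ?z = "complex_of_real t"
  interpret ds: dissipative "Hm 0 n" ?P "len 0 n" "rk (Suc n)"
    by unfold_locales (use Ph_carrier[of 0 n] Hm_herm in auto)
  define u where "u = col ?U 0"
  have u: "u \<in> carrier_vec (len 0 n)" using Uh_carrier[of 0 n] by (auto simp: u_def intro!: carrier_vecI)
  define v where "v = resolvent ds.A ?z *\<^sub>v u"
  have v: "v \<in> carrier_vec (len 0 n)" unfolding v_def by (rule ds.resolvent_vec_carrier[OF u])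
  define x where "x = mat_adjoint ?P *\<^sub>v v"
  have x: "x \<in> carrier_vec (rk (Suc n))" by (simp add: x_def)
  have "shifted ds.A ?z *\<^sub>v v = u" unfolding v_def by (rule resolvent_solves[OF ds.A_carrier assms u])
  hence eq: "Hm 0 n *\<^sub>v v - \<i> \<cdot>\<^sub>v (?P *\<^sub>v x) - ?z \<cdot>\<^sub>v v = u"
    unfolding shifted_mult_vec[OF ds.A_carrier v] ds.A_mult_vec[OF v] x_def .
  have aux: "a - ?z \<cdot>\<^sub>v v = u + b" if "a - b - ?z \<cdot>\<^sub>v v = u" "a \<in> carrier_vec (len 0 n)" "b \<in> carrier_vec (len 0 n)" for a b
    unfolding that(1)[symmetric] using that(2,3) v by (intro eq_vecI) auto
  have Px: "?P *\<^sub>v x \<in> carrier_vec (len 0 n)" by simp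
  have "shifted (Hm 0 n) ?z *\<^sub>v v = u + \<i> \<cdot>\<^sub>v (?P *\<^sub>v x)"
    unfolding shifted_mult_vec[OF Hm_carrier v] by (rule aux[OF eq]) simp_all
  hence vr: "v = Res 0 n ?z *\<^sub>v (u + \<i> \<cdot>\<^sub>v (?P *\<^sub>v x))"
    using resolvent_unique[OF Hm_carrier _ v, of ?z] nonres_0 by (simp add: nonres_def)
  note R = resolvent_carrier[OF Hm_carrier, of 0 n ?z]
  have Rv: "Res 0 n ?z *\<^sub>v y \<in> carrier_vec (len 0 n)" for y using carrier_matD[OF R] by (auto intro!: carrier_vecI)
  have v_eq: "v = Res 0 n ?z *\<^sub>v u + \<i> \<cdot>\<^sub>v (Res 0 n ?z *\<^sub>v (?P *\<^sub>v x))"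
    by (subst vr, subst mult_add_distrib_mat_vec[OF R u]) (simp_all add: mult_mat_vec[OF R Px])
  note Pa = mat_adjoint_carrier[OF Ph_carrier[of 0 n]]
  have "x = mat_adjoint ?P *\<^sub>v (Res 0 n ?z *\<^sub>v u + \<i> \<cdot>\<^sub>v (Res 0 n ?z *\<^sub>v (?P *\<^sub>v x)))"
    using arg_cong[OF v_eq, of "\<lambda>y. mat_adjoint ?P *\<^sub>v y"] by (simp only: x_def[symmetric])
  also have "\<dots> = mat_adjoint ?P *\<^sub>v (Res 0 n ?z *\<^sub>v u) + mat_adjoint ?P *\<^sub>v (\<i> \<cdot>\<^sub>v (Res 0 n ?z *\<^sub>v (?P *\<^sub>v x)))"
    by (rule mult_add_distrib_mat_vec[OF Pa Rv]) (use Rv in simp_all)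
  also have "mat_adjoint ?P *\<^sub>v (\<i> \<cdot>\<^sub>v (Res 0 n ?z *\<^sub>v (?P *\<^sub>v x))) = \<i> \<cdot>\<^sub>v (mat_adjoint ?P *\<^sub>v (Res 0 n ?z *\<^sub>v (?P *\<^sub>v x)))"
    by (rule mult_mat_vec[OF Pa Rv]) simp
  also have "mat_adjoint ?P *\<^sub>v (Res 0 n ?z *\<^sub>v (?P *\<^sub>v x)) = delta M 0 n ?z *\<^sub>v x"
    by (rule block_mult_vec(4)[OF _ nonres_0 x, symmetric]) simp
  also have "mat_adjoint ?P *\<^sub>v (Res 0 n ?z *\<^sub>v u) = \<gamma>\<^sub>1"
    unfolding u_def using block_mult_vec(3)[OF _ nonres_0, of "vec (Suc 0) (\<lambda>_. 1)"]
      mult_mat_unit_vec[of ?U] mult_mat_unit_vec[of "gamma M 0 n ?z"] Uh_carrier[of 0 n] block_carriers(3)[of 0 n ?z] by simp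
  finally have "(cvec_norm x)\<^sup>2 = S" unfolding resolvent_density_eq by (rule gn.norm_of_fixed_point[OF x])
  thus ?thesis using ds.Im_F[OF u assms] by (simp add: u_def[symmetric] v_def[symmetric] x_def[symmetric])
qed

end

end

section \<open>Finite-volume approximation of the resolvent\<close>

text \<open>Projections onto increasing subspaces have increasing norms bounded by that of U. The
  squared distance of two of them is the difference of their squared norms, so they form a Cauchy
  sequence; the limit lies in the closure of the union, and the remainder of U is orthogonal to
  it.\<close>

lemma projection_limit:
  fixes Es :: "nat \<Rightarrow> ('a \<Rightarrow> complex) set"
  assumes Es: "\<And>n. Es n \<subseteq> l2" and mono: "\<And>m n. m \<le> n \<Longrightarrow> Es m \<subseteq> Es n"
    and F: "F = (\<Union>n. Es n)" and diff: "\<And>\<chi> \<chi>'. \<chi> \<in> F \<Longrightarrow> \<chi>' \<in> F \<Longrightarrow> (\<lambda>x. \<chi> x - \<chi>' x) \<in> F"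
    and U: "U \<in> l2" and p: "\<And>n. p n \<in> Es n"
    and orth: "\<And>n e. e \<in> Es n \<Longrightarrow> l2_inner e (\<lambda>x. U x - p n x) = 0"
  shows "incseq (\<lambda>n. (l2_norm (p n))\<^sup>2)" "(\<lambda>n. (l2_norm (p n))\<^sup>2) \<longlonglongrightarrow> (l2_norm (l2_proj (l2_closure F) U))\<^sup>2"
    "(l2_norm (p n))\<^sup>2 \<le> (l2_norm (l2_proj (l2_closure F) U))\<^sup>2"
proof -
  have pl2: "p n \<in> l2" for n using p Es by blast
  have pU: "l2_inner e U = l2_inner e (p n)" if "e \<in> Es n" for e n
    using orth[OF that] l2_inner_diff_right[OF U pl2, of e n] that Es by auto
  have pp: "l2_inner (p m) (p n) = complex_of_real ((l2_norm (p m))\<^sup>2)" if "m \<le> n" for m n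
    using pU[of "p m" n] pU[of "p m" m] p[of m] mono[OF that] by (auto simp: l2_inner_self)
  have dist2: "(l2_dist (p n) (p m))\<^sup>2 = (l2_norm (p n))\<^sup>2 - (l2_norm (p m))\<^sup>2" if "m \<le> n" for m n
  proof -
    have "complex_of_real ((l2_dist (p n) (p m))\<^sup>2) = l2_inner (p n) (p n) - l2_inner (p n) (p m) - (l2_inner (p m) (p n) - l2_inner (p m) (p m))"
      unfolding l2_dist_def l2_inner_self[symmetric]
      by (simp add: l2_inner_diff_left l2_inner_diff_right l2_diff pl2)
    also have "l2_inner (p n) (p m) = complex_of_real ((l2_norm (p m))\<^sup>2)"
      by (subst l2_inner_commute) (simp add: pp[OF that])
    finally have "complex_of_real ((l2_dist (p n) (p m))\<^sup>2) = complex_of_real ((l2_norm (p n))\<^sup>2 - (l2_norm (p m))\<^sup>2)"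
      by (simp add: pp[OF that] l2_inner_self)
    thus ?thesis by (simp only: of_real_eq_iff)
  qed
  show inc: "incseq (\<lambda>n. (l2_norm (p n))\<^sup>2)"
  proof (rule incseq_SucI)
    fix n show "(l2_norm (p n))\<^sup>2 \<le> (l2_norm (p (Suc n)))\<^sup>2" using dist2[of n "Suc n"] zero_le_power2[of "l2_dist (p (Suc n)) (p n)"] by simp
  qed
  have bound: "(l2_norm (p n))\<^sup>2 \<le> (l2_norm U)\<^sup>2" for n
  proof -
    have "(l2_norm (p n))\<^sup>2 = cmod (l2_inner (p n) U)" using pU[OF p] by (simp add: l2_inner_self norm_power)
    also have "\<dots> \<le> l2_norm (p n) * l2_norm U" by (rule l2_Cauchy_Schwarz[OF pl2 U])
    finally have "l2_norm (p n) \<le> l2_norm U" using l2_norm_nonneg[of "p n"]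
      by (cases "l2_norm (p n) = 0") (auto simp: power2_eq_square dest: mult_left_le_imp_le)
    thus ?thesis by (intro power_mono) auto
  qed
  obtain L where "(\<lambda>n. (l2_norm (p n))\<^sup>2) \<longlonglongrightarrow> L"
    by (rule incseq_convergent[OF inc, of "(l2_norm U)\<^sup>2"]) (use bound in blast)+
  hence "convergent (\<lambda>n. (l2_norm (p n))\<^sup>2)" by (rule convergentI)
  hence C: "Cauchy (\<lambda>n. (l2_norm (p n))\<^sup>2)" by (rule convergent_Cauchy)
  obtain g where g: "g \<in> l2" "(\<lambda>n. l2_dist (p n) g) \<longlonglongrightarrow> 0"
  proof (rule l2_complete[OF pl2])
    fix e :: real assume e: "e > 0"
    then obtain N where N: "\<forall>m\<ge>N. \<forall>n\<ge>N. \<bar>(l2_norm (p m))\<^sup>2 - (l2_norm (p n))\<^sup>2\<bar> < e\<^sup>2"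
      using CauchyD[OF C, of "e\<^sup>2"] by auto
    have aux: "l2_dist (p n) (p m) < e" if "m \<le> n" "m \<ge> N" for m n
    proof -
      have "(l2_dist (p n) (p m))\<^sup>2 < e\<^sup>2" unfolding dist2[OF that(1)] using N[rule_format, of n m] that by auto
      thus ?thesis using e by (simp add: power_less_imp_less_base)
    qed
    have "l2_dist (p m) (p n) < e" if "m \<ge> N" "n \<ge> N" for m n
      using aux[of m n] aux[of n m] that l2_dist_commute by (metis nat_le_linear)
    thus "\<exists>N. \<forall>m\<ge>N. \<forall>n\<ge>N. l2_dist (p m) (p n) < e" by blast
  qed blast
  have F_l2: "F \<subseteq> l2" using F Es by blast
  have gK: "g \<in> l2_closure F" by (rule l2_closureI[OF g(1) _ g(2)]) (use p F in blast)
  have orth_g: "l2_inner \<chi> (\<lambda>x. U x - g x) = 0" if "\<chi> \<in> F" for \<chi>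
  proof -
    obtain m where m: "\<chi> \<in> Es m" using \<open>\<chi> \<in> F\<close> F by blast
    have \<chi>: "\<chi> \<in> l2" using m Es by blast
    have "(\<lambda>n. l2_inner \<chi> (p n)) \<longlonglongrightarrow> l2_inner \<chi> g"
      using l2_inner_tendsto[OF _ pl2 g(1) \<chi>] g(2) by (simp add: l2_dist_commute[of g])
    moreover have "l2_inner \<chi> (p n) = l2_inner \<chi> U" if "m \<le> n" for n
      using pU[of \<chi> n] mono[OF that] m by auto
    hence "\<forall>\<^sub>F n in sequentially. l2_inner \<chi> (p n) = l2_inner \<chi> U" by (rule eventually_sequentiallyI)
    hence "(\<lambda>n. l2_inner \<chi> (p n)) \<longlonglongrightarrow> l2_inner \<chi> U" by (rule tendsto_eventually)
    ultimately have "l2_inner \<chi> g = l2_inner \<chi> U" by (rule LIMSEQ_unique)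
    thus ?thesis using l2_inner_diff_right[OF U g(1) \<chi>] by simp
  qed
  have proj: "l2_proj (l2_closure F) U = g"
  proof (rule l2_proj_eqI[OF gK _ U])
    show "l2_closure F \<subseteq> l2" by (auto simp: l2_closure_def)
    show "l2_inner \<chi> (\<lambda>x. U x - g x) = 0" if "\<chi> \<in> l2_closure F" for \<chi>
      by (rule orthogonal_l2_closure[OF F_l2 l2_diff[OF U g(1)] orth_g that])
    show "(\<lambda>x. \<chi> x - \<chi>' x) \<in> l2_closure F" if "\<chi> \<in> l2_closure F" "\<chi>' \<in> l2_closure F" for \<chi> \<chi>'
      by (rule l2_closure_diff[OF F_l2 diff that])
  qed
  have "(\<lambda>n. l2_norm (p n) - l2_norm g) \<longlonglongrightarrow> 0"
    by (rule Lim_null_comparison[OF always_eventually g(2)]) (use l2_norm_diff_le[OF pl2 g(1)] in simp)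
  hence "(\<lambda>n. l2_norm (p n)) \<longlonglongrightarrow> l2_norm g" by (simp add: LIM_zero_iff)
  thus lim: "(\<lambda>n. (l2_norm (p n))\<^sup>2) \<longlonglongrightarrow> (l2_norm (l2_proj (l2_closure F) U))\<^sup>2"
    unfolding proj by (intro tendsto_power)
  show "(l2_norm (p n))\<^sup>2 \<le> (l2_norm (l2_proj (l2_closure F) U))\<^sup>2" by (rule incseq_le[OF inc lim])
qed

section \<open>Finitely supported functions, finite-volume vectors and the adjoint operator\<close>

context shells
begin

lemma hop_cnj: "hop M y x = cnj (hop M x y)" and hop_finite: "finite {y. hop M x y \<noteq> 0}"
  using hopping unfolding shell_hopping_def by blast+

lemma distinct_sites: "distinct (sites M 0 n)" and set_sites: "set (sites M 0 n) = (\<Union>j\<le>n. set (shell M j))"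
proof (induction n)
  case 0
  { case 1 show ?case using partition by (simp add: sites_same shell_partition_def)
  next case 2 show ?case by (simp add: sites_same) }
next
  case (Suc n)
  { case 1
    have "set (shell M j) \<inter> set (shell M (Suc n)) = {}" if "j \<le> n" for j
      using partition that by (auto simp: shell_partition_def disjoint_family_on_def)
    thus ?case using Suc partition by (auto simp: sites_Suc shell_partition_def)
  next case 2 show ?case using Suc by (auto simp: sites_Suc le_Suc_eq) }
qed

lemma sites_mono: "m \<le> n \<Longrightarrow> set (sites M 0 m) \<subseteq> set (sites M 0 n)"
  unfolding set_sites by (intro UN_mono) auto

lemma shell_cover: "\<exists>j. x \<in> set (shell M j)"
  using partition unfolding shell_partition_def by (metis UN_E UNIV_I)

lemma finite_subset_sites: "finite X \<Longrightarrow> \<exists>n. X \<subseteq> set (sites M 0 n)"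
proof (induction X rule: finite_induct)
  case (insert x X)
  obtain n where n: "X \<subseteq> set (sites M 0 n)" using insert by blast
  obtain j where "x \<in> set (shell M j)" using shell_cover by blast
  hence "x \<in> set (sites M 0 (max n j))" by (auto simp: set_sites)
  thus ?case using n sites_mono[of n "max n j"] by (intro exI[of _ "max n j"]) auto
qed simp

lemma hop_outside:
  assumes "x \<in> set (sites M 0 n)" "y \<notin> set (sites M 0 (Suc n))"
  shows "hop M y x = 0"
proof -
  obtain j k where jk: "x \<in> set (shell M j)" "j \<le> n" "y \<in> set (shell M k)"
    using assms(1) shell_cover[of y] by (auto simp: set_sites)
  have "Suc n < k" using assms(2) \<open>y \<in> set (shell M k)\<close> by (auto simp: set_sites not_le[symmetric])
  have "\<forall>j k. \<forall>x\<in>set (shell M j). \<forall>y\<in>set (shell M k). j + 2 \<le> k \<or> k + 2 \<le> j \<longrightarrow> hop M x y = 0"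
    using hopping unfolding shell_hopping_def by blast
  moreover have "j + 2 \<le> k" using \<open>Suc n < k\<close> jk(2) by simp
  ultimately show ?thesis using jk(1,3) by blast
qed

definition supported :: "nat \<Rightarrow> ('a \<Rightarrow> complex) \<Rightarrow> bool" where
  "supported n \<phi> \<longleftrightarrow> (\<forall>x. x \<notin> set (sites M 0 n) \<longrightarrow> \<phi> x = 0)"

lemma supported_mono: "m \<le> n \<Longrightarrow> supported m \<phi> \<Longrightarrow> supported n \<phi>"
  using sites_mono unfolding supported_def by blast

lemma supported_finite: "supported n \<phi> \<Longrightarrow> finite {x. \<phi> x \<noteq> 0}"
  unfolding supported_def by (rule finite_subset[of _ "set (sites M 0 n)"]) auto

lemma supported_l2: "supported n \<phi> \<Longrightarrow> \<phi> \<in> l2"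
  by (intro l2_finite_support supported_finite)

lemma finite_supported: "finite {x. \<phi> x \<noteq> 0} \<Longrightarrow> \<exists>n. supported n \<phi>"
  using finite_subset_sites[of "{x. \<phi> x \<noteq> 0}"] unfolding supported_def by auto

definition vecof :: "nat \<Rightarrow> ('a \<Rightarrow> complex) \<Rightarrow> complex vec" where
  "vecof n \<phi> = vec (len 0 n) (\<lambda>i. \<phi> (sites M 0 n ! i))"

text \<open>Extension by zero, inverse to \<open>vecof n\<close> on functions supported in the
  shells up to n. At most one summand is nonzero, since the sites are distinct.\<close>

definition emb :: "nat \<Rightarrow> complex vec \<Rightarrow> 'a \<Rightarrow> complex" where
  "emb n v x = (\<Sum>i<len 0 n. if sites M 0 n ! i = x then v $ i else 0)"

lemma vecof_carrier [simp]: "vecof n \<phi> \<in> carrier_vec (len 0 n)"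
  by (simp add: vecof_def)

lemma emb_nth: "i < len 0 n \<Longrightarrow> emb n v (sites M 0 n ! i) = v $ i"
proof -
  assume i: "i < len 0 n"
  have "emb n v (sites M 0 n ! i) = (\<Sum>j<len 0 n. if j = i then v $ j else 0)"
    unfolding emb_def using i by (intro sum.cong) (auto simp: nth_eq_iff_index_eq[OF distinct_sites])
  thus ?thesis using i by simp
qed

lemma emb_supported: "supported n (emb n v)"
  unfolding supported_def emb_def by (auto intro!: sum.neutral)

lemma vecof_emb: "v \<in> carrier_vec (len 0 n) \<Longrightarrow> vecof n (emb n v) = v"
  unfolding vecof_def by (intro eq_vecI) (auto simp: emb_nth)

lemma vecof_diff: "vecof n (\<lambda>x. \<phi> x - \<psi> x) = vecof n \<phi> - vecof n \<psi>"
  by (intro eq_vecI) (auto simp: vecof_def)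

lemma vecof_scale: "vecof n (\<lambda>x. c * \<phi> x) = c \<cdot>\<^sub>v vecof n \<phi>"
  by (intro eq_vecI) (auto simp: vecof_def)

lemma sum_sites: "(\<Sum>x\<in>set (sites M 0 n). f x) = (\<Sum>i<len 0 n. f (sites M 0 n ! i))"
  by (rule sum.reindex_bij_betw[symmetric]) (rule bij_betw_nth[OF distinct_sites refl refl])

lemma infsum_supported:
  fixes f :: "'a \<Rightarrow> 'b :: {topological_comm_monoid_add, t2_space}"
  assumes "\<And>x. x \<notin> set (sites M 0 n) \<Longrightarrow> f x = 0"
  shows "(\<Sum>\<^sub>\<infinity>x. f x) = (\<Sum>i<len 0 n. f (sites M 0 n ! i))"
proof -
  have "(\<Sum>\<^sub>\<infinity>x. f x) = (\<Sum>\<^sub>\<infinity>x\<in>set (sites M 0 n). f x)"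
    by (rule infsum_cong_neutral) (use assms in auto)
  thus ?thesis by (simp add: sum_sites)
qed

lemma inner_vecof:
  assumes "supported n \<phi> \<or> supported n \<psi>"
  shows "l2_inner \<phi> \<psi> = vecof n \<psi> \<bullet>c vecof n \<phi>"
proof -
  have "l2_inner \<phi> \<psi> = (\<Sum>i<len 0 n. cnj (\<phi> (sites M 0 n ! i)) * \<psi> (sites M 0 n ! i))"
    unfolding l2_inner_def by (rule infsum_supported) (use assms in \<open>auto simp: supported_def\<close>)
  thus ?thesis by (simp add: vecof_def scalar_prod_def atLeast0LessThan mult.commute)
qed

lemma norm_vecof:
  assumes "supported n \<phi>"
  shows "cvec_norm (vecof n \<phi>) = l2_norm \<phi>"
proof -
  have "complex_of_real ((cvec_norm (vecof n \<phi>))\<^sup>2) = complex_of_real ((l2_norm \<phi>)\<^sup>2)"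
    unfolding inner_self[symmetric] l2_inner_self[symmetric] using inner_vecof[of n \<phi> \<phi>] assms by simp
  hence "(cvec_norm (vecof n \<phi>))\<^sup>2 = (l2_norm \<phi>)\<^sup>2" by (simp only: of_real_eq_iff)
  thus ?thesis by simp
qed

lemma ham_eq_sum:
  assumes "finite X" "\<And>y. hop M x y * \<psi> y \<noteq> 0 \<Longrightarrow> y \<in> X"
  shows "ham M \<psi> x = (\<Sum>y\<in>X. hop M x y * \<psi> y)"
proof -
  have "ham M \<psi> x = (\<Sum>y\<in>X \<inter> {y. hop M x y \<noteq> 0}. hop M x y * \<psi> y)"
    unfolding ham_def by (rule sum.mono_neutral_right[OF hop_finite]) (use assms in auto)
  also have "\<dots> = (\<Sum>y\<in>X. hop M x y * \<psi> y)" by (rule sum.mono_neutral_left[OF assms(1)]) auto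
  finally show ?thesis .
qed

lemma ham_lin: "ham M (\<lambda>x. \<phi> x + c * \<psi> x) = (\<lambda>x. ham M \<phi> x + c * ham M \<psi> x)"
  by (auto simp: ham_def sum.distrib sum_distrib_left algebra_simps)

lemma ham_diff: "ham M (\<lambda>x. \<phi> x - \<psi> x) = (\<lambda>x. ham M \<phi> x - ham M \<psi> x)"
  using ham_lin[of \<phi> "-1" \<psi>] by simp

lemma ham_supported: "supported n \<phi> \<Longrightarrow> supported (Suc n) (ham M \<phi>)"
  unfolding supported_def ham_def by (auto intro!: sum.neutral) (metis hop_outside)

lemma ham_vecof: "supported n \<phi> \<Longrightarrow> Hm 0 n *\<^sub>v vecof n \<phi> = vecof n (ham M \<phi>)"
proof (rule eq_vecI)
  assume s: "supported n \<phi>"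
  fix i assume "i < dim_vec (vecof n (ham M \<phi>))"
  hence i: "i < len 0 n" by (simp add: vecof_def)
  have "ham M \<phi> (sites M 0 n ! i) = (\<Sum>y\<in>set (sites M 0 n). hop M (sites M 0 n ! i) y * \<phi> y)"
    by (rule ham_eq_sum) (use s in \<open>auto simp: supported_def\<close>)
  thus "(Hm 0 n *\<^sub>v vecof n \<phi>) $ i = vecof n (ham M \<phi>) $ i"
    using i by (simp add: vecof_def ham_mat_def scalar_prod_def atLeast0LessThan sum_sites)
qed (simp add: vecof_def ham_mat_def)

text \<open>Here \<psi> is an arbitrary function: finite support of \<phi> and finite range of the
  hopping make both sides finite sums, so no summability is involved.\<close>

lemma ham_pairing:
  assumes s: "supported n \<phi>"
  shows "l2_inner \<phi> (ham M \<psi>) = l2_inner (ham M \<phi>) \<psi>"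
proof -
  let ?L = "set (sites M 0 n)" and ?K = "set (sites M 0 (Suc n))"
  have "l2_inner \<phi> (ham M \<psi>) = (\<Sum>x\<in>?L. cnj (\<phi> x) * ham M \<psi> x)"
    unfolding l2_inner_def sum_sites by (rule infsum_supported) (use s in \<open>auto simp: supported_def\<close>)
  also have "\<dots> = (\<Sum>x\<in>?L. \<Sum>y\<in>?K. cnj (\<phi> x) * (hop M x y * \<psi> y))"
  proof (rule sum.cong[OF refl])
    fix x assume x: "x \<in> ?L"
    have "hop M x y = 0" if "y \<notin> ?K" for y using hop_outside[OF x that] hop_cnj[of x y] by simp
    hence "ham M \<psi> x = (\<Sum>y\<in>?K. hop M x y * \<psi> y)" by (intro ham_eq_sum) auto
    thus "cnj (\<phi> x) * ham M \<psi> x = (\<Sum>y\<in>?K. cnj (\<phi> x) * (hop M x y * \<psi> y))" by (simp add: sum_distrib_left)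
  qed
  also have "\<dots> = (\<Sum>y\<in>?K. \<Sum>x\<in>?L. cnj (\<phi> x) * (hop M x y * \<psi> y))" by (rule sum.swap)
  also have "\<dots> = (\<Sum>y\<in>?K. cnj (ham M \<phi> y) * \<psi> y)"
  proof (rule sum.cong[OF refl])
    fix y
    have "ham M \<phi> y = (\<Sum>x\<in>?L. hop M y x * \<phi> x)" by (rule ham_eq_sum) (use s in \<open>auto simp: supported_def\<close>)
    hence e: "cnj (ham M \<phi> y) * \<psi> y = (\<Sum>x\<in>?L. cnj (hop M y x) * cnj (\<phi> x) * \<psi> y)" by (simp add: sum_distrib_right)
    have h: "cnj (hop M y x) = hop M x y" for x by (subst hop_cnj) simp
    show "(\<Sum>x\<in>?L. cnj (\<phi> x) * (hop M x y * \<psi> y)) = cnj (ham M \<phi> y) * \<psi> y"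
      unfolding e by (intro sum.cong refl) (simp only: h mult_ac)
  qed
  also have "\<dots> = l2_inner (ham M \<phi>) \<psi>"
    unfolding l2_inner_def sum_sites by (rule infsum_supported[symmetric]) (use ham_supported[OF s] in \<open>auto simp: supported_def\<close>)
  finally show ?thesis .
qed

text \<open>Testing with the unit function at x shows that the second component of any pair in the
  adjoint is the formal action of H. The adjoint is thus the operator on its maximal domain, as
  \<open>spectral_op\<close> demands.\<close>

lemma adjoint_ham_min: "op_adjoint (ham_min M) = {(\<phi>, ham M \<phi>) | \<phi>. \<phi> \<in> l2 \<and> ham M \<phi> \<in> l2}"
proof (intro Set.set_eqI iffI; clarify)
  fix \<phi> \<chi> assume a: "(\<phi>, \<chi>) \<in> op_adjoint (ham_min M)"
  have l: "\<phi> \<in> l2" "\<chi> \<in> l2" and eq: "\<And>\<psi>. finite {x. \<psi> x \<noteq> 0} \<Longrightarrow> l2_inner \<phi> (ham M \<psi>) = l2_inner \<chi> \<psi>"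
    using a by (auto simp: op_adjoint_def ham_min_def)
  have "\<chi> x = ham M \<phi> x" for x
  proof -
    let ?d = "\<lambda>y. if y = x then 1 else 0 :: complex"
    have f: "finite {y. ?d y \<noteq> 0}" by simp
    from finite_supported[OF f] obtain n where n: "supported n ?d" ..
    have unit: "l2_inner ?d \<psi> = \<psi> x" for \<psi>
    proof -
      have "l2_inner ?d \<psi> = (\<Sum>\<^sub>\<infinity>y\<in>{x}. cnj (?d y) * \<psi> y)"
        unfolding l2_inner_def by (rule infsum_cong_neutral) auto
      thus ?thesis by simp
    qed
    have "cnj (l2_inner \<phi> (ham M ?d)) = l2_inner ?d (ham M \<phi>)"
      unfolding ham_pairing[OF n] by (rule l2_inner_commute[symmetric])
    moreover have "cnj (l2_inner \<chi> ?d) = l2_inner ?d \<chi>" by (rule l2_inner_commute[symmetric])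
    ultimately show ?thesis using eq[OF f] unfolding unit by simp
  qed
  hence "\<chi> = ham M \<phi>" by blast
  thus "\<exists>\<phi>'. (\<phi>, \<chi>) = (\<phi>', ham M \<phi>') \<and> \<phi>' \<in> l2 \<and> ham M \<phi>' \<in> l2" using l by blast
next
  fix \<phi> assume l: "\<phi> \<in> l2" "ham M \<phi> \<in> l2"
  have "l2_inner \<phi> (ham M \<psi>) = l2_inner (ham M \<phi>) \<psi>" if "finite {x. \<psi> x \<noteq> 0}" for \<psi>
  proof -
    from finite_supported[OF \<open>finite {x. \<psi> x \<noteq> 0}\<close>] obtain n where "supported n \<psi>" ..
    from ham_pairing[OF this, of \<phi>] show ?thesis
      by (subst (1 2) l2_inner_commute) simp
  qed
  thus "(\<phi>, ham M \<phi>) \<in> op_adjoint (ham_min M)" using l by (auto simp: op_adjoint_def ham_min_def)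
qed

end

section \<open>Consequences of essential self-adjointness\<close>

locale sa_shells = shells +
  assumes sa: "essentially_self_adjoint (ham_min M)"
begin

lemma ham_min_l2: "(\<psi>, \<eta>) \<in> ham_min M \<Longrightarrow> \<psi> \<in> l2 \<and> \<eta> \<in> l2 \<and> \<eta> = ham M \<psi> \<and> (\<exists>n. supported n \<psi>)"
proof -
  assume "(\<psi>, \<eta>) \<in> ham_min M"
  hence e: "\<eta> = ham M \<psi>" and f: "finite {x. \<psi> x \<noteq> 0}" by (auto simp: ham_min_def)
  from finite_supported[OF f] obtain n where n: "supported n \<psi>" ..
  show ?thesis using e n supported_l2[OF n] supported_l2[OF ham_supported[OF n]] by blast
qed

lemma adjoint_subset_closure:
  "op_adjoint (ham_min M) \<subseteq> op_adjoint (op_closure (ham_min M))"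
proof clarify
  fix \<phi> \<chi> assume a: "(\<phi>, \<chi>) \<in> op_adjoint (ham_min M)"
  have l: "\<phi> \<in> l2" "\<chi> \<in> l2" and eq: "\<And>\<psi> \<eta>. (\<psi>, \<eta>) \<in> ham_min M \<Longrightarrow> l2_inner \<phi> \<eta> = l2_inner \<chi> \<psi>"
    using a unfolding op_adjoint_def by auto
  have "l2_inner \<phi> \<eta> = l2_inner \<chi> \<psi>" if c: "(\<psi>, \<eta>) \<in> op_closure (ham_min M)" for \<psi> \<eta>
  proof -
    have l': "\<psi> \<in> l2" "\<eta> \<in> l2" using c unfolding op_closure_def by auto
    have "cmod (l2_inner \<phi> \<eta> - l2_inner \<chi> \<psi>) \<le> 0 + e" if e: "e > 0" for e
    proof -
      define d where "d = e / (l2_norm \<phi> + l2_norm \<chi> + 1)"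
      have pos: "l2_norm \<phi> + l2_norm \<chi> + 1 > 0" by (simp add: add_nonneg_pos)
      have d: "d > 0" using e pos by (simp add: d_def)
      obtain \<psi>' \<eta>' where m: "(\<psi>', \<eta>') \<in> ham_min M" "l2_dist \<psi> \<psi>' < d" "l2_dist \<eta> \<eta>' < d"
        using c d unfolding op_closure_def by blast
      have l2': "\<psi>' \<in> l2" "\<eta>' \<in> l2" using ham_min_l2[OF m(1)] by auto
      have "cmod (l2_inner \<phi> \<eta> - l2_inner \<chi> \<psi>) = cmod ((l2_inner \<phi> \<eta> - l2_inner \<phi> \<eta>') - (l2_inner \<chi> \<psi> - l2_inner \<chi> \<psi>'))"
        using eq[OF m(1)] by simp
      also have "\<dots> \<le> cmod (l2_inner \<phi> \<eta> - l2_inner \<phi> \<eta>') + cmod (l2_inner \<chi> \<psi> - l2_inner \<chi> \<psi>')" by (rule norm_triangle_ineq4)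
      also have "\<dots> \<le> l2_norm \<phi> * l2_dist \<eta> \<eta>' + l2_norm \<chi> * l2_dist \<psi> \<psi>'"
        by (intro add_mono l2_inner_dist_le l l' l2')
      also have "\<dots> \<le> l2_norm \<phi> * d + l2_norm \<chi> * d" using m by (intro add_mono mult_left_mono) auto
      also have "\<dots> \<le> e" using e pos unfolding d_def by (simp add: divide_simps) (simp add: algebra_simps)
      finally show ?thesis by simp
    qed
    hence "cmod (l2_inner \<phi> \<eta> - l2_inner \<chi> \<psi>) \<le> 0" by (rule field_le_epsilon)
    thus ?thesis by simp
  qed
  thus "(\<phi>, \<chi>) \<in> op_adjoint (op_closure (ham_min M))" using l unfolding op_adjoint_def by blast
qed

text \<open>An element of the adjoint is also in the adjoint of the closure, by continuity of the
  inner product, and the latter is the closure itself. Hence every function in the maximal domain is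
  a limit of finitely supported ones in the graph norm.\<close>

lemma adjoint_eq_closure: "op_adjoint (ham_min M) \<subseteq> op_closure (ham_min M)"
  using adjoint_subset_closure sa unfolding essentially_self_adjoint_def self_adjoint_def by simp

lemma ham_sym:
  assumes "\<phi> \<in> l2" "ham M \<phi> \<in> l2" "\<psi> \<in> l2" "ham M \<psi> \<in> l2"
  shows "l2_inner \<phi> (ham M \<psi>) = l2_inner (ham M \<phi>) \<psi>"
proof -
  have "(\<phi>, ham M \<phi>) \<in> op_adjoint (op_closure (ham_min M))" "(\<psi>, ham M \<psi>) \<in> op_closure (ham_min M)"
    using adjoint_subset_closure adjoint_eq_closure assms unfolding adjoint_ham_min by auto
  thus ?thesis unfolding op_adjoint_def by blast
qed

lemma graph_approx:
  assumes "\<phi> \<in> l2" "ham M \<phi> \<in> l2" "e > 0"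
  obtains \<phi>' n where "supported n \<phi>'" "l2_dist \<phi> \<phi>' < e" "l2_dist (ham M \<phi>) (ham M \<phi>') < e"
proof -
  have "(\<phi>, ham M \<phi>) \<in> op_closure (ham_min M)"
    using adjoint_eq_closure assms unfolding adjoint_ham_min by auto
  then obtain \<psi>' \<eta>' where "(\<psi>', \<eta>') \<in> ham_min M" "l2_dist \<phi> \<psi>' < e" "l2_dist (ham M \<phi>) \<eta>' < e"
    using assms(3) unfolding op_closure_def by blast
  thus thesis using that ham_min_l2 by blast
qed

end

section \<open>Finite-volume resolvents and compactly supported eigenfunctions\<close>

context shells
begin

lemma diss: "dissipative (Hm 0 n) (Ph 0 n) (len 0 n) (rk (Suc n))"
  by unfold_locales (use Ph_carrier[of 0 n] Hm_herm in auto)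

abbreviation "Am n \<equiv> dissipative.A (Hm 0 n) (Ph 0 n)"
abbreviation "Uv n \<equiv> col (Uh 0 n) 0"
abbreviation "Fn n \<equiv> dissipative.F (Hm 0 n) (Ph 0 n) (Uv n)"
abbreviation "eigs n t \<equiv> dissipative.eig (Hm 0 n) (Ph 0 n) (len 0 n) (rk (Suc n)) (complex_of_real t)"
abbreviation "rootv \<equiv> root_vector M"

lemma Uv_carrier [simp]: "Uv n \<in> carrier_vec (len 0 n)"
  using Uh_carrier[of 0 n] by (auto intro!: carrier_vecI)

lemma vecof_Suc: "vecof (Suc n) \<phi> = vecof n \<phi> @\<^sub>v vec (sz (Suc n)) (\<lambda>i. \<phi> (shell M (Suc n) ! i))"
  by (intro eq_vecI) (auto simp: vecof_def len_Suc sites_Suc nth_append shell_size_def)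

lemma vecof_Suc_supported:
  assumes "supported n \<phi>"
  shows "vecof (Suc n) \<phi> = vecof n \<phi> @\<^sub>v 0\<^sub>v (sz (Suc n))"
proof -
  have "\<phi> (shell M (Suc n) ! i) = 0" if "i < sz (Suc n)" for i
  proof -
    let ?x = "shell M (Suc n) ! i"
    have x: "?x \<in> set (shell M (Suc n))" using that by (simp add: shell_size_def)
    have "?x \<notin> set (shell M j)" if "j \<le> n" for j
    proof
      assume y: "?x \<in> set (shell M j)"
      have "set (shell M j) \<inter> set (shell M (Suc n)) = {}"
        using partition that unfolding shell_partition_def disjoint_family_on_def by auto
      thus False using x y by blast
    qed
    thus ?thesis using assms unfolding supported_def set_sites by blast
  qed
  thus ?thesis unfolding vecof_Suc by (auto intro!: eq_vecI simp: vec_eq_iff)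
qed

lemma root_supported_0: "supported 0 rootv"
  unfolding supported_def root_vector_def embed0_def set_sites
  by (auto intro!: sum.neutral simp: shell_size_def)

lemma root_supported: "supported n rootv"
  using supported_mono[OF _ root_supported_0] by simp

lemma root_l2: "rootv \<in> l2"
  by (rule supported_l2[OF root_supported_0])

lemma vecof_root: "vecof n rootv = Uv n"
proof (induction n)
  case 0
  have d: "distinct (shell M 0)" using partition by (simp add: shell_partition_def)
  have "rootv (shell M 0 ! i) = Ups M 0 $$ (i, 0)" if i: "i < sz 0" for i
  proof -
    have "rootv (shell M 0 ! i) = (\<Sum>j<sz 0. if j = i then col (Ups M 0) 0 $ j else 0)"
      unfolding root_vector_def embed0_def using i
      by (intro sum.cong) (auto simp: shell_size_def nth_eq_iff_index_eq[OF d])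
    thus ?thesis using i Ups_carrier[of 0] by simp
  qed
  thus ?case unfolding Uh_same vecof_def sites_same using Ups_carrier[of 0]
    by (intro eq_vecI) (auto simp: shell_size_def)
next
  case (Suc n)
  note I = append_rows_index[OF Uh_carrier[of 0 n] zero_carrier_mat[of "sz (Suc n)" "rk 0"], unfolded rk_0]
  note D = append_rows_dim[OF Uh_carrier[of 0 n] zero_carrier_mat[of "sz (Suc n)" "rk 0"]]
  have "Uv (Suc n) = Uv n @\<^sub>v 0\<^sub>v (sz (Suc n))"
    unfolding Uh_Suc using D Uh_carrier[of 0 n] by (intro eq_vecI) (auto simp: I)
  thus ?case using Suc vecof_Suc_supported[OF root_supported] by simp
qed

lemma norm_Uv: "cvec_norm (Uv n) = l2_norm rootv"
  unfolding vecof_root[symmetric] by (rule norm_vecof[OF root_supported])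

lemma Ph_vecof:
  assumes "supported m \<phi>" "m < n"
  shows "mat_adjoint (Ph 0 n) *\<^sub>v vecof n \<phi> = 0\<^sub>v (rk (Suc n))"
proof -
  obtain k where k: "n = Suc k" "m \<le> k" using assms(2) by (metis Suc_le_mono Suc_le_eq less_imp_Suc_add not0_implies_Suc not_less0)
  have s: "supported k \<phi>" by (rule supported_mono[OF k(2) assms(1)])
  show ?thesis unfolding k(1) vecof_Suc_supported[OF s] Ph_Suc_mult[OF vecof_carrier zero_carrier_vec]
    using Phi_carrier[of "Suc k"] by (intro eq_vecI) (auto simp: scalar_prod_def)
qed

lemma Am_vecof:
  assumes "supported m \<phi>" "m < n"
  shows "Am n *\<^sub>v vecof n \<phi> = vecof n (ham M \<phi>)"
proof -
  interpret ds: dissipative "Hm 0 n" "Ph 0 n" "len 0 n" "rk (Suc n)" by (rule diss)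
  have s: "supported n \<phi>" using supported_mono[OF _ assms(1)] assms(2) by simp
  have "Ph 0 n *\<^sub>v 0\<^sub>v (rk (Suc n)) = 0\<^sub>v (len 0 n)" using Ph_carrier[of 0 n] by (intro eq_vecI) (auto simp: scalar_prod_def)
  thus ?thesis unfolding ds.A_mult_vec[OF vecof_carrier] Ph_vecof[OF assms] ham_vecof[OF s]
    by (intro eq_vecI) (auto simp: vecof_def)
qed

text \<open>On a function supported before shell n the dissipative matrix acts like H, so \<phi> is
  an approximate solution in every such volume with one and the same residual. The bound 1 / Im z
  for the resolvent does not depend on n either.\<close>

lemma Fn_near_pairing:
  assumes z: "Im z > 0" and s: "supported m \<phi>" "m < n"
  shows "cmod (Fn n z - l2_inner rootv \<phi>) \<le> l2_norm (\<lambda>x. ham M \<phi> x - z * \<phi> x - rootv x) / Im z * l2_norm rootv"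
proof -
  interpret ds: dissipative "Hm 0 n" "Ph 0 n" "len 0 n" "rk (Suc n)" by (rule diss)
  have sn: "supported n \<phi>" "supported n (ham M \<phi>)"
    using supported_mono[OF _ s(1), of n] supported_mono[OF _ ham_supported[OF s(1)], of n] s(2) by auto
  define v where "v = vecof n \<phi>"
  have v: "v \<in> carrier_vec (len 0 n)" by (simp add: v_def)
  define r where "r = resolvent (Am n) z *\<^sub>v Uv n"
  have r: "r \<in> carrier_vec (len 0 n)" unfolding r_def by (rule ds.resolvent_vec_carrier[OF Uv_carrier])
  let ?d = "\<lambda>x. ham M \<phi> x - z * \<phi> x - rootv x"
  have sh: "shifted (Am n) z *\<^sub>v v - Uv n = vecof n ?d"
    using shifted_mult_vec[OF ds.A_carrier v, of z] Am_vecof[OF s]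
    by (simp add: v_def vecof_diff vecof_scale vecof_root)
  have "shifted (Am n) z *\<^sub>v (v - r) = shifted (Am n) z *\<^sub>v v - Uv n"
    using mult_minus_distrib_mat_vec[OF shifted_carrier[OF ds.A_carrier] v r, of z]
      resolvent_solves[OF ds.A_carrier ds.det_shifted_nonzero[OF z] Uv_carrier] by (simp add: r_def)
  hence "Im z * cvec_norm (v - r) \<le> cvec_norm (vecof n ?d)"
    using ds.shifted_lower_bound[of "v - r" z] v r by (simp add: sh)
  also have "cvec_norm (vecof n ?d) = l2_norm ?d"
    by (rule norm_vecof) (use sn root_supported[of n] in \<open>auto simp: supported_def\<close>)
  finally have le: "cvec_norm (v - r) \<le> l2_norm ?d / Im z" using z by (simp add: field_simps)
  have "l2_inner rootv \<phi> - Fn n z = (v - r) \<bullet>c Uv n"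
    using inner_vecof[of n rootv \<phi>] root_supported[of n] inner_diff_left[OF v r Uv_carrier]
    by (simp add: ds.F_def[OF Uv_carrier] r_def[symmetric] v_def[symmetric] vecof_root)
  hence "cmod (Fn n z - l2_inner rootv \<phi>) \<le> cvec_norm (v - r) * cvec_norm (Uv n)"
    using inner_Cauchy_Schwarz[of "v - r" "len 0 n" "Uv n"] v r by (simp add: norm_minus_commute)
  also have "\<dots> \<le> l2_norm ?d / Im z * l2_norm rootv" unfolding norm_Uv by (intro mult_right_mono le) simp
  finally show ?thesis .
qed

text \<open>Extension by zero could violate the eigenvalue equation only on shell n + 1, where H
  produces, up to sign, \<Upsilon> applied to the boundary value of v under the adjoint of \<Phi>.
  That value is 0 by the definition of \<open>eigs\<close>.\<close>

lemma eigenvector_embeds: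
  assumes v: "v \<in> eigs n t"
  shows "emb n v \<in> compact_eigenspace M t"
proof -
  interpret ds: dissipative "Hm 0 n" "Ph 0 n" "len 0 n" "rk (Suc n)" by (rule diss)
  let ?z = "complex_of_real t" and ?\<phi> = "emb n v"
  have vc: "v \<in> carrier_vec (len 0 n)" and Hv: "Hm 0 n *\<^sub>v v = ?z \<cdot>\<^sub>v v" and Pv: "mat_adjoint (Ph 0 n) *\<^sub>v v = 0\<^sub>v (rk (Suc n))"
    using v by (auto simp: ds.eig_def)
  have vz: "Y *\<^sub>v 0\<^sub>v b = 0\<^sub>v a" if "Y \<in> carrier_mat a b" for Y :: "complex mat" and a b
    using that by (intro eq_vecI) (auto simp: scalar_prod_def)
  have z1: "mat_adjoint (Ups M (Suc n)) *\<^sub>v 0\<^sub>v (sz (Suc n)) = 0\<^sub>v (rk (Suc n))" by (rule vz[OF mat_adjoint_carrier[OF Ups_carrier]])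
  have z2: "Ph 0 n *\<^sub>v 0\<^sub>v (rk (Suc n)) = 0\<^sub>v (len 0 n)" by (rule vz[OF Ph_carrier]) simp
  have z3: "Ups M (Suc n) *\<^sub>v 0\<^sub>v (rk (Suc n)) = 0\<^sub>v (sz (Suc n))" by (rule vz[OF Ups_carrier])
  have z4: "shifted (Hm (Suc n) (Suc n)) ?z *\<^sub>v 0\<^sub>v (sz (Suc n)) = 0\<^sub>v (sz (Suc n))"
    by (rule vz) (use shifted_carrier[OF Hm_carrier, of "Suc n" "Suc n" ?z] in \<open>simp add: len_same\<close>)
  have "shifted (Hm 0 n) ?z *\<^sub>v v = 0\<^sub>v (len 0 n)" unfolding shifted_mult_vec[OF Hm_carrier vc] Hv using vc by simp
  hence "shifted (Hm 0 (Suc n)) ?z *\<^sub>v (v @\<^sub>v 0\<^sub>v (sz (Suc n))) = 0\<^sub>v (len 0 (Suc n))"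
    unfolding shifted_append[OF vc zero_carrier_vec] z1 z2 Pv z3 z4 by (intro eq_vecI) (auto simp: len_Suc)
  moreover have "vecof (Suc n) ?\<phi> = v @\<^sub>v 0\<^sub>v (sz (Suc n))"
    using vecof_Suc_supported[OF emb_supported] vecof_emb[OF vc] by simp
  ultimately have eq0: "vecof (Suc n) (ham M ?\<phi>) - ?z \<cdot>\<^sub>v vecof (Suc n) ?\<phi> = 0\<^sub>v (len 0 (Suc n))"
    using shifted_mult_vec[OF Hm_carrier[of 0 "Suc n"] vecof_carrier[of "Suc n" ?\<phi>], of ?z]
      ham_vecof[OF supported_mono[OF _ emb_supported[of n v], of "Suc n"]] by simp
  have eq: "ham M ?\<phi> (sites M 0 (Suc n) ! i) = ?z * ?\<phi> (sites M 0 (Suc n) ! i)" if "i < len 0 (Suc n)" for i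
  proof -
    have "(vecof (Suc n) (ham M ?\<phi>) - ?z \<cdot>\<^sub>v vecof (Suc n) ?\<phi>) $ i = 0" unfolding eq0 using that by simp
    thus ?thesis using that by (simp add: vecof_def)
  qed
  have "ham M ?\<phi> x = ?z * ?\<phi> x" for x
  proof (cases "x \<in> set (sites M 0 (Suc n))")
    case True
    thus ?thesis using eq by (auto simp: in_set_conv_nth)
  next
    case False
    thus ?thesis using ham_supported[OF emb_supported[of n v]] supported_mono[OF _ emb_supported[of n v], of "Suc n"]
      by (simp add: supported_def)
  qed
  thus ?thesis using supported_finite[OF emb_supported] by (auto simp: compact_eigenspace_def)
qed

text \<open>The strict inequality matters: a function supported in the shells up to m has no part on
  shell n, so the boundary condition in \<open>eigs n t\<close> holds automatically.\<close>

lemma eigenfunction_restricts: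
  assumes "\<psi> \<in> compact_eigenspace M t" "supported m \<psi>" "m < n"
  shows "vecof n \<psi> \<in> eigs n t" "\<psi> = emb n (vecof n \<psi>)"
proof -
  interpret ds: dissipative "Hm 0 n" "Ph 0 n" "len 0 n" "rk (Suc n)" by (rule diss)
  have s: "supported n \<psi>" using supported_mono[OF _ assms(2)] assms(3) by simp
  have "Hm 0 n *\<^sub>v vecof n \<psi> = complex_of_real t \<cdot>\<^sub>v vecof n \<psi>"
    unfolding ham_vecof[OF s] vecof_scale[symmetric] using assms(1) by (simp add: compact_eigenspace_def)
  thus "vecof n \<psi> \<in> eigs n t" using Ph_vecof[OF assms(2,3)] by (simp add: ds.eig_def)
  show "\<psi> = emb n (vecof n \<psi>)"
  proof
    fix x show "\<psi> x = emb n (vecof n \<psi>) x"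
    proof (cases "x \<in> set (sites M 0 n)")
      case True
      then obtain i where "i < len 0 n" "x = sites M 0 n ! i" by (auto simp: in_set_conv_nth)
      thus ?thesis by (simp add: emb_nth) (simp add: vecof_def)
    next
      case False
      thus ?thesis using s emb_supported[of n "vecof n \<psi>"] by (simp add: supported_def)
    qed
  qed
qed

lemma eigenspaces:
  defines "Es \<equiv> \<lambda>n t. emb n ` eigs n t"
  shows "m \<le> n \<Longrightarrow> Es m t \<subseteq> Es n t" "compact_eigenspace M t = (\<Union>n. Es n t)" "Es n t \<subseteq> l2"
proof -
  show "Es m t \<subseteq> Es n t" if "m \<le> n"
  proof (cases "m = n")
    case False
    hence mn: "m < n" using that by simp
    show ?thesis unfolding Es_def
    proof clarify
      fix v assume "v \<in> eigs m t"
      from eigenfunction_restricts[OF eigenvector_embeds[OF this] emb_supported mn]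
      show "emb m v \<in> emb n ` eigs n t" by blast
    qed
  qed simp
  show "compact_eigenspace M t = (\<Union>n. Es n t)"
  proof (intro equalityI subsetI)
    fix \<psi> assume a: "\<psi> \<in> compact_eigenspace M t"
    hence "finite {x. \<psi> x \<noteq> 0}" by (simp add: compact_eigenspace_def)
    then obtain k where k: "supported k \<psi>" using finite_supported by blast
    have "\<psi> \<in> Es (Suc k) t" unfolding Es_def using eigenfunction_restricts[OF a k lessI] by blast
    thus "\<psi> \<in> (\<Union>n. Es n t)" by blast
  qed (auto simp: Es_def eigenvector_embeds)
  show "Es n t \<subseteq> l2" unfolding Es_def using supported_l2[OF emb_supported] by blast
qed

lemma compact_eigenspace_diff:
  assumes "\<chi> \<in> compact_eigenspace M t" "\<chi>' \<in> compact_eigenspace M t"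
  shows "(\<lambda>x. \<chi> x - \<chi>' x) \<in> compact_eigenspace M t"
proof -
  have "finite {x. \<chi> x - \<chi>' x \<noteq> 0}"
    by (rule finite_subset[of _ "{x. \<chi> x \<noteq> 0} \<union> {x. \<chi>' x \<noteq> 0}"]) (use assms in \<open>auto simp: compact_eigenspace_def\<close>)
  thus ?thesis using assms by (auto simp: compact_eigenspace_def ham_diff algebra_simps)
qed

text \<open>The mass that \<nu> has to carry at t.\<close>

definition weight :: "real \<Rightarrow> real" where
  "weight t = (l2_norm (l2_proj (l2_closure (compact_eigenspace M t)) rootv))\<^sup>2"

lemma weight_limit:
  assumes pr: "\<And>n. pr n \<in> eigs n t" and orth: "\<And>n e. e \<in> eigs n t \<Longrightarrow> (Uv n - pr n) \<bullet>c e = 0"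
  shows "incseq (\<lambda>n. (cvec_norm (pr n))\<^sup>2)" "(\<lambda>n. (cvec_norm (pr n))\<^sup>2) \<longlonglongrightarrow> weight t"
    "(cvec_norm (pr n))\<^sup>2 \<le> weight t"
proof -
  have prc: "pr n \<in> carrier_vec (len 0 n)" for n
    using pr[of n] unfolding dissipative.eig_def[OF diss] by blast
  have nrm: "l2_norm (emb n (pr n)) = cvec_norm (pr n)" for n
    using norm_vecof[OF emb_supported[of n "pr n"]] vecof_emb[OF prc] by simp
  have A7: "l2_inner e (\<lambda>x. rootv x - emb n (pr n) x) = 0" if "e \<in> emb n ` eigs n t" for n e
  proof -
    obtain v where v: "e = emb n v" "v \<in> eigs n t" using \<open>e \<in> emb n ` eigs n t\<close> by blast
    have vc: "v \<in> carrier_vec (len 0 n)" using v(2) unfolding dissipative.eig_def[OF diss] by blast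
    show ?thesis using inner_vecof[of n e] emb_supported[of n v] orth[OF v(2)]
      by (simp add: v(1) vecof_diff vecof_root vecof_emb[OF prc] vecof_emb[OF vc])
  qed
  have A6: "emb n (pr n) \<in> emb n ` eigs n t" for n using pr by blast
  note As = eigenspaces(3,1,2) compact_eigenspace_diff root_l2 A6 A7
  note PL = projection_limit[where Es = "\<lambda>n. emb n ` eigs n t" and F = "compact_eigenspace M t" and U = rootv and p = "\<lambda>n. emb n (pr n)", unfolded nrm]
  show "incseq (\<lambda>n. (cvec_norm (pr n))\<^sup>2)" by (rule PL(1)) (fact As)+
  show "(\<lambda>n. (cvec_norm (pr n))\<^sup>2) \<longlonglongrightarrow> weight t" unfolding weight_def by (rule PL(2)) (fact As)+
  show "(cvec_norm (pr n))\<^sup>2 \<le> weight t" unfolding weight_def by (rule PL(3)) (fact As)+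
qed

text \<open>With \<open>P = 0\<close> the dissipative operator is \<open>H\<^sub>0\<^sub>,\<^sub>n\<close> itself; an eigenvector overlapping with the
  rootv vector makes the upper left boundary resolvent entry blow up along the vertical line.\<close>
lemma overlap_singular:
  assumes v: "v \<in> eigs n t" and ov: "Uv n \<bullet>c v \<noteq> 0"
  shows "complex_of_real t \<in> singular_set1 M 0 n"
proof (rule ccontr)
  assume ns: "complex_of_real t \<notin> singular_set1 M 0 n"
  let ?P = "0\<^sub>m (len 0 n) 0 :: complex mat" and ?z = "\<lambda>e. complex_of_real t + \<i> * complex_of_real e"
  interpret ds: dissipative "Hm 0 n" ?P "len 0 n" 0 by unfold_locales (use Hm_herm in auto)
  have A: "ds.A = Hm 0 n" unfolding ds.A_def using carrier_matD[OF Hm_carrier[of 0 n]] by (intro eq_matI) (auto simp: scalar_prod_def)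
  have v': "v \<in> ds.eig (complex_of_real t)" and vc: "v \<in> carrier_vec (len 0 n)"
    using v unfolding dissipative.eig_def[OF diss] ds.eig_def by (auto intro!: eq_vecI)
  \<comment> \<open>The squared norm of the projection of the root vector onto the line spanned by
    v.\<close>
  define c where "c = (cmod (Uv n \<bullet>c v))\<^sup>2 / (cvec_norm v)\<^sup>2"
  have v0: "cvec_norm v \<noteq> 0" using ov cvec_norm_eq_0[OF vc] by (auto simp: scalar_prod_def)
  have c: "c > 0" using ov v0 by (simp add: c_def)
  obtain g where g: "g analytic_on {complex_of_real t}"
    "\<forall>\<^sub>F w in at (complex_of_real t). g w = bdry_resolvent_raw M 0 n w $$ (0, 0)"
    using ns unfolding singular_set1_def extends_analytically_def by auto
  have path: "filterlim ?z (at (complex_of_real t)) (at_right 0)"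
    unfolding filterlim_at using vertical_path eventually_at_right_less[of 0] by (auto elim: eventually_mono)
  have "isCont g (complex_of_real t)" by (rule analytic_at_imp_isCont[OF g(1)])
  hence "((\<lambda>e. g (?z e)) \<longlongrightarrow> g (complex_of_real t)) (at_right 0)"
    using filterlim_compose[OF _ path] by (simp add: isCont_def)
  \<comment> \<open>An analytic extension would keep the entry bounded near t, so e times its
    imaginary part tends to 0. This contradicts the lower bound c established next.\<close>
  hence bounded: "((\<lambda>e. e * Im (g (?z e))) \<longlongrightarrow> 0 * Im (g (complex_of_real t))) (at_right 0)"
    by (intro tendsto_intros) (auto intro: tendsto_ident_at)
  have lower: "c \<le> e * Im (g (?z e))" if e: "e > 0" and ge: "g (?z e) = bdry_resolvent_raw M 0 n (?z e) $$ (0, 0)" for e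
  proof -
    have I: "Im (?z e) > 0" using e by simp
    have det: "det (shifted (Hm 0 n) (?z e)) \<noteq> 0" using ds.det_shifted_nonzero[OF I] by (simp add: A)
    define r where "r = Res 0 n (?z e) *\<^sub>v Uv n"
    have r: "r \<in> carrier_vec (len 0 n)" unfolding r_def using ds.resolvent_vec_carrier[OF Uv_carrier] by (simp add: A)
    have "Uv n \<bullet>c v = (complex_of_real t - ?z e) * (r \<bullet>c v)"
      using ds.inner_shifted_eig[OF r v', of "?z e"] resolvent_solves[OF Hm_carrier det Uv_carrier] by (simp add: A r_def)
    hence "cmod (Uv n \<bullet>c v) = e * cmod (r \<bullet>c v)" using e by (simp add: norm_mult)
    also have "\<dots> \<le> e * (cvec_norm r * cvec_norm v)" by (intro mult_left_mono inner_Cauchy_Schwarz[OF r vc]) (use e in simp)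
    finally have "(cmod (Uv n \<bullet>c v))\<^sup>2 \<le> (e * (cvec_norm r * cvec_norm v))\<^sup>2" by (intro power_mono) auto
    hence "c \<le> (e * cvec_norm r)\<^sup>2"
      using v0 unfolding c_def by (simp add: divide_simps power_mult_distrib mult_ac)
    moreover have "g (?z e) = (Res 0 n (?z e) *\<^sub>v Uv n) \<bullet>c Uv n"
      unfolding ge using raw_index[of 0 n "?z e" 0 0] det by (simp add: nonres_def bcol_def)
    hence "g (?z e) = ds.F (Uv n) (?z e)" by (simp add: ds.F_def[OF Uv_carrier] A)
    moreover have "Im (ds.F (Uv n) (?z e)) \<ge> e * (cvec_norm r)\<^sup>2"
      using ds.Im_F[OF Uv_carrier, of "?z e"] det by (simp add: A r_def)
    ultimately have "c \<le> e * (e * (cvec_norm r)\<^sup>2)" "e * (cvec_norm r)\<^sup>2 \<le> Im (g (?z e))"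
      by (simp_all add: power2_eq_square mult_ac)
    thus ?thesis using mult_left_mono[of "e * (cvec_norm r)\<^sup>2" "Im (g (?z e))" e] e by linarith
  qed
  have "\<forall>\<^sub>F e in at_right 0. g (?z e) = bdry_resolvent_raw M 0 n (?z e) $$ (0, 0)"
    using path g(2) unfolding filterlim_iff by blast
  hence "\<forall>\<^sub>F e in at_right 0. c \<le> e * Im (g (?z e))"
    using eventually_at_right_less[of "0::real"] by eventually_elim (rule lower)
  hence "c \<le> 0 * Im (g (complex_of_real t))" by (intro tendsto_lowerbound[OF bounded]) auto
  thus False using c by simp
qed

text \<open>The projections increase with n. A positive limit therefore means a nonzero overlap from
  some volume on, and each of these volumes is singular at t; this is why the limit inferior of the
  singular sets appears.\<close>

lemma weight_pos_singular:
  assumes pr: "\<And>n. pr n \<in> eigs n t" and orth: "\<And>n e. e \<in> eigs n t \<Longrightarrow> (Uv n - pr n) \<bullet>c e = 0"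
    and w: "weight t > 0"
  shows "\<exists>m. \<forall>n\<ge>m. complex_of_real t \<in> singular_set1 M 0 n"
proof -
  have prc: "pr n \<in> carrier_vec (len 0 n)" for n
    using pr[of n] unfolding dissipative.eig_def[OF diss] by blast
  note W = weight_limit[of pr t, OF pr orth]
  obtain m where m: "(cvec_norm (pr m))\<^sup>2 > 0"
    using order_tendstoD(1)[OF W(2) w] by (auto simp: eventually_sequentially)
  have "complex_of_real t \<in> singular_set1 M 0 n" if "n \<ge> m" for n
  proof -
    have "(cvec_norm (pr n))\<^sup>2 > 0" using m incseqD[OF W(1) that] by linarith
    hence "pr n \<bullet>c pr n \<noteq> 0" by (simp add: inner_self)
    moreover have "Uv n \<bullet>c pr n = pr n \<bullet>c pr n"
      using orth[OF pr, of n] inner_diff_left[OF Uv_carrier prc prc, of n] by simp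
    ultimately show ?thesis using overlap_singular[OF pr] by simp
  qed
  thus ?thesis by blast
qed

end

context sa_shells
begin

text \<open>An approximate solution of (H - z) \<psi> = u is replaced by a finitely supported one
  close to it in the graph norm, which is then an approximate solution in all large volumes. The
  index k of the approximation is fixed before n grows, so no uniformity in k is required.\<close>

lemma Fn_tendsto:
  assumes sp: "spectral_resolution (op_adjoint (ham_min M)) E" and z: "Im z > 0"
  shows "(\<lambda>n. Fn n z) \<longlonglongrightarrow> (\<integral>t. 1 / (complex_of_real t - z) \<partial>diag_measure E rootv)"
proof -
  interpret so: spectral_op E "ham M" "op_adjoint (ham_min M)"
  proof unfold_locales
    show "proj_valued_measure E" using sp by (simp add: spectral_resolution_def)
    show "spectral_resolution (op_adjoint (ham_min M)) E" by (rule sp)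
  qed (use adjoint_ham_min ham_lin ham_sym in auto)
  let ?I = "\<integral>t. 1 / (complex_of_real t - z) \<partial>diag_measure E rootv"
  obtain \<psi> where \<psi>: "\<And>k. \<psi> k \<in> l2" "\<And>k. ham M (\<psi> k) \<in> l2"
    "(\<lambda>k. l2_norm (\<lambda>x. ham M (\<psi> k) x - z * \<psi> k x - rootv x)) \<longlonglongrightarrow> 0" "(\<lambda>k. l2_inner rootv (\<psi> k)) \<longlonglongrightarrow> ?I"
    using so.approximate_resolvent[OF z root_l2] by blast
  have "\<exists>\<phi> m. supported m \<phi> \<and> l2_dist (\<psi> k) \<phi> < inverse (real (Suc k)) \<and> l2_dist (ham M (\<psi> k)) (ham M \<phi>) < inverse (real (Suc k))" for k
    using graph_approx[OF \<psi>(1,2), of "inverse (real (Suc k))" k] by (metis inverse_positive_iff_positive of_nat_0_less_iff zero_less_Suc)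
  then obtain \<phi> m where \<phi>: "\<And>k. supported (m k) (\<phi> k)" "\<And>k. l2_dist (\<psi> k) (\<phi> k) < inverse (real (Suc k))"
    "\<And>k. l2_dist (ham M (\<psi> k)) (ham M (\<phi> k)) < inverse (real (Suc k))" by metis
  have \<phi>2: "\<phi> k \<in> l2" "ham M (\<phi> k) \<in> l2" for k using supported_l2[OF \<phi>(1)] supported_l2[OF ham_supported[OF \<phi>(1)]] by auto
  let ?r = "\<lambda>k. l2_norm (\<lambda>x. ham M (\<phi> k) x - z * \<phi> k x - rootv x)"
  let ?q = "\<lambda>k. l2_norm (\<lambda>x. ham M (\<psi> k) x - z * \<psi> k x - rootv x)"
  have r_le: "?r k \<le> ?q k + (inverse (real (Suc k)) + cmod z * inverse (real (Suc k)))" for k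
  proof -
    let ?a = "\<lambda>x. ham M (\<psi> k) x - z * \<psi> k x - rootv x"
    let ?b = "\<lambda>x. ham M (\<phi> k) x - ham M (\<psi> k) x" and ?c = "\<lambda>x. (- z) * (\<phi> k x - \<psi> k x)"
    have la: "?a \<in> l2" by (intro l2_diff l2_scale \<psi> root_l2)
    have lb: "?b \<in> l2" by (intro l2_diff \<psi> \<phi>2)
    have lc: "?c \<in> l2" by (intro l2_scale l2_diff \<psi> \<phi>2)
    have "?r k = l2_norm (\<lambda>x. ?a x + (?b x + ?c x))" by (simp add: algebra_simps)
    also have "\<dots> \<le> ?q k + l2_norm (\<lambda>x. ?b x + ?c x)" by (rule l2_norm_triangle[OF la l2_add[OF lb lc]])
    also have "l2_norm (\<lambda>x. ?b x + ?c x) \<le> l2_norm ?b + l2_norm ?c" by (rule l2_norm_triangle[OF lb lc])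
    also have "l2_norm ?b = l2_dist (ham M (\<psi> k)) (ham M (\<phi> k))" by (subst l2_dist_commute) (simp add: l2_dist_def)
    also have "l2_norm ?c = cmod z * l2_dist (\<psi> k) (\<phi> k)" by (subst l2_norm_scale, subst l2_dist_commute) (simp add: l2_dist_def)
    finally show ?thesis using \<phi>(2,3)[of k] mult_left_mono[of "l2_dist (\<psi> k) (\<phi> k)" "inverse (real (Suc k))" "cmod z"] by auto
  qed
  have "(\<lambda>k. ?q k + (inverse (real (Suc k)) + cmod z * inverse (real (Suc k)))) \<longlonglongrightarrow> 0 + (0 + cmod z * 0)"
    by (intro tendsto_intros \<psi>(3) LIMSEQ_inverse_real_of_nat)
  hence "(\<lambda>k. ?q k + (inverse (real (Suc k)) + cmod z * inverse (real (Suc k)))) \<longlonglongrightarrow> 0" by simp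
  hence r0: "?r \<longlonglongrightarrow> 0" by (rule Lim_null_comparison[rotated]) (use r_le in simp)
  have "(\<lambda>k. l2_inner rootv (\<psi> k) - l2_inner rootv (\<phi> k)) \<longlonglongrightarrow> 0"
  proof (rule Lim_null_comparison[OF always_eventually])
    show "\<forall>k. cmod (l2_inner rootv (\<psi> k) - l2_inner rootv (\<phi> k)) \<le> l2_norm rootv * inverse (real (Suc k))"
    proof
      fix k
      have "cmod (l2_inner rootv (\<psi> k) - l2_inner rootv (\<phi> k)) \<le> l2_norm rootv * l2_dist (\<psi> k) (\<phi> k)"
        by (rule l2_inner_dist_le[OF \<psi>(1) \<phi>2(1) root_l2])
      also have "\<dots> \<le> l2_norm rootv * inverse (real (Suc k))" using \<phi>(2)[of k] by (intro mult_left_mono) auto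
      finally show "cmod (l2_inner rootv (\<psi> k) - l2_inner rootv (\<phi> k)) \<le> l2_norm rootv * inverse (real (Suc k))" .
    qed
    show "(\<lambda>k. l2_norm rootv * inverse (real (Suc k))) \<longlonglongrightarrow> 0"
      using tendsto_mult_right_zero[OF LIMSEQ_inverse_real_of_nat] by simp
  qed
  from tendsto_diff[OF \<psi>(4) this] have lim: "(\<lambda>k. l2_inner rootv (\<phi> k)) \<longlonglongrightarrow> ?I" by simp
  have bnd: "(\<lambda>k. ?r k / Im z * l2_norm rootv + cmod (l2_inner rootv (\<phi> k) - ?I)) \<longlonglongrightarrow> 0"
  proof -
    have "(\<lambda>k. ?r k / Im z * l2_norm rootv + cmod (l2_inner rootv (\<phi> k) - ?I)) \<longlonglongrightarrow> 0 / Im z * l2_norm rootv + cmod (?I - ?I)"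
      by (intro tendsto_intros r0 lim) (use z in simp)
    thus ?thesis by simp
  qed
  show ?thesis
  proof (rule metric_LIMSEQ_I)
    fix e :: real assume "e > 0"
    then obtain k where k: "?r k / Im z * l2_norm rootv + cmod (l2_inner rootv (\<phi> k) - ?I) < e"
      using order_tendstoD(2)[OF bnd] by (auto simp: eventually_sequentially)
    have "dist (Fn n z) ?I < e" if "n \<ge> Suc (m k)" for n
    proof -
      have "cmod (Fn n z - ?I) \<le> cmod (Fn n z - l2_inner rootv (\<phi> k)) + cmod (l2_inner rootv (\<phi> k) - ?I)"
        using norm_triangle_ineq[of "Fn n z - l2_inner rootv (\<phi> k)" "l2_inner rootv (\<phi> k) - ?I"] by simp
      also have "\<dots> < e" using Fn_near_pairing[OF z \<phi>(1)[of k], of n] that k by simp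
      finally show ?thesis by (simp add: dist_norm)
    qed
    thus "\<exists>no. \<forall>n\<ge>no. dist (Fn n z) ?I < e" by blast
  qed
qed

end

section \<open>Decomposition of the spectral measure\<close>

lemma density_finite_borel:
  fixes g :: "real \<Rightarrow> real"
  assumes "sets \<kappa> = sets borel" "integrable \<kappa> g" "\<And>t. 0 \<le> g t"
  shows "finite_borel_measure (density \<kappa> (\<lambda>t. ennreal (g t)))"
    "measure (density \<kappa> (\<lambda>t. ennreal (g t))) UNIV = (\<integral>t. g t \<partial>\<kappa>)"
    "\<And>f :: real \<Rightarrow> real. f \<in> borel_measurable borel \<Longrightarrow> (\<integral>t. f t \<partial>density \<kappa> (\<lambda>t. ennreal (g t))) = (\<integral>t. g t * f t \<partial>\<kappa>)"
proof -
  have sp: "space \<kappa> = UNIV" using sets_eq_imp_space_eq[OF assms(1)] by simp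
  have g [measurable]: "g \<in> borel_measurable \<kappa>" using assms(2) by simp
  have "emeasure (density \<kappa> (\<lambda>t. ennreal (g t))) UNIV = (\<integral>\<^sup>+t. ennreal (g t) \<partial>\<kappa>)"
    by (subst emeasure_density) (use assms(1) in auto)
  also have "\<dots> = ennreal (\<integral>t. g t \<partial>\<kappa>)" by (rule nn_integral_eq_integral[OF assms(2)]) (use assms(3) in auto)
  finally have e: "emeasure (density \<kappa> (\<lambda>t. ennreal (g t))) UNIV = ennreal (\<integral>t. g t \<partial>\<kappa>)" .
  show "finite_borel_measure (density \<kappa> (\<lambda>t. ennreal (g t)))"
    unfolding finite_borel_measure_def using assms(1) sp e by (auto intro!: finite_measureI)
  show "measure (density \<kappa> (\<lambda>t. ennreal (g t))) UNIV = (\<integral>t. g t \<partial>\<kappa>)"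
    unfolding measure_def e using assms(3) by (simp add: integral_nonneg_AE)
  show "(\<integral>t. f t \<partial>density \<kappa> (\<lambda>t. ennreal (g t))) = (\<integral>t. g t * f t \<partial>\<kappa>)" if "f \<in> borel_measurable borel" for f :: "real \<Rightarrow> real"
    using integral_real_density[of g \<kappa> f] that g assms(3) measurable_cong_sets[OF assms(1) refl] by auto
qed

text \<open>The densities are defined by descriptions, minima and maxima, whose measurability is not
  apparent. It is inherited from a continuous function with which they agree outside a finite
  set.\<close>

lemma borel_measurable_off_countable:
  fixes f f' :: "real \<Rightarrow> real"
  assumes "f \<in> borel_measurable borel" "countable X" "\<And>t. t \<notin> X \<Longrightarrow> f' t = f t"
  shows "f' \<in> borel_measurable borel"
  by (rule measurable_discrete_difference[OF assms(1,2)]) (use assms(3) in auto)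

lemma AE_lborel_off_finite: "finite X \<Longrightarrow> (\<And>t. t \<notin> X \<Longrightarrow> Q t) \<Longrightarrow> AE t::real in lborel. Q t"
  by (rule AE_mp[OF AE_not_in[OF finite_imp_null_set_lborel]]) auto

lemma scaled_poisson: "y > 0 \<Longrightarrow> y * poisson x y t = 1 / (((t - x) / y)\<^sup>2 + 1)"
proof -
  assume y: "y > 0"
  have "(t - x)\<^sup>2 + y\<^sup>2 > 0" using y by (simp add: add_nonneg_pos)
  thus ?thesis using y by (simp add: poisson_def power_divide divide_simps) (simp add: power2_eq_square algebra_simps)
qed

lemma scaled_poisson_bounds: "y > 0 \<Longrightarrow> 0 \<le> y * poisson x y t" "y > 0 \<Longrightarrow> y * poisson x y t \<le> 1"
  unfolding scaled_poisson by (auto simp: divide_le_eq_1 add_nonneg_pos)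

lemma scaled_poisson_small: "(\<lambda>k. inverse (real (Suc k)) * poisson x (inverse (real (Suc k))) t) \<longlonglongrightarrow> indicator {x} t"
proof (cases "t = x")
  case True
  have "inverse (real (Suc k)) * poisson x (inverse (real (Suc k))) t = 1" for k
    by (subst scaled_poisson) (use True in auto)
  thus ?thesis using True by simp
next
  case False
  let ?y = "\<lambda>k. inverse (real (Suc k))"
  have "(\<lambda>k. ?y k * (?y k / ((t - x)\<^sup>2 + (?y k)\<^sup>2))) \<longlonglongrightarrow> 0 * (0 / ((t - x)\<^sup>2 + 0\<^sup>2))"
    by (intro tendsto_intros LIMSEQ_inverse_real_of_nat) (use False in auto)
  thus ?thesis using False by (simp add: poisson_def)
qed

lemma scaled_poisson_large: "(\<lambda>k. real (Suc k) * poisson x (real (Suc k)) t) \<longlonglongrightarrow> 1"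
proof -
  have "(\<lambda>k. 1 / (((t - x) * inverse (real (Suc k)))\<^sup>2 + 1)) \<longlonglongrightarrow> 1 / (((t - x) * 0)\<^sup>2 + 1)"
    by (intro tendsto_intros LIMSEQ_inverse_real_of_nat) auto
  moreover have "real (Suc k) * poisson x (real (Suc k)) t = 1 / (((t - x) * inverse (real (Suc k)))\<^sup>2 + 1)" for k
    by (subst scaled_poisson) (auto simp: divide_inverse)
  ultimately show ?thesis by simp
qed

context sa_shells
begin

text \<open>The conclusion of \<open>finite_volume_poisson_formula\<close> as one predicate, so that
  the sets, projections and continuous densities can be chosen for all n simultaneously.\<close>

definition poisson_data :: "nat \<Rightarrow> real set \<Rightarrow> (real \<Rightarrow> complex vec) \<Rightarrow> (real \<Rightarrow> real) \<Rightarrow> bool" where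
  "poisson_data n Z pr g \<longleftrightarrow> finite Z \<and> (\<forall>t. pr t \<in> eigs n t) \<and> (\<forall>t. \<forall>e\<in>eigs n t. (Uv n - pr t) \<bullet>c e = 0) \<and>
     (\<forall>t. t \<notin> Z \<longrightarrow> det (shifted (Am n) (complex_of_real t)) \<noteq> 0 \<and> cvec_norm (pr t) = 0) \<and>
     continuous_on UNIV g \<and> (\<forall>t. t \<notin> Z \<longrightarrow> g t = Im (Fn n (complex_of_real t))) \<and>
     (\<forall>x y. y > 0 \<longrightarrow> integrable lborel (\<lambda>t. g t * poisson x y t)) \<and>
     (\<forall>x y. y > 0 \<longrightarrow> pi * Im (Fn n (Complex x y)) =
       (\<integral>t. g t * poisson x y t \<partial>lborel) + pi * (\<Sum>s\<in>Z. (cvec_norm (pr s))\<^sup>2 * poisson x y s))"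

lemma poisson_data_exists: "\<exists>Z pr g. poisson_data n Z pr g"
proof -
  interpret ds: dissipative "Hm 0 n" "Ph 0 n" "len 0 n" "rk (Suc n)" by (rule diss)
  show ?thesis
  proof (rule ds.finite_volume_poisson_formula[OF Uv_carrier[of n]], goal_cases)
    case (1 Z pr g)
    hence "poisson_data n Z pr g" unfolding poisson_data_def by blast
    thus ?case by blast
  qed
qed

text \<open>The last conjunct quantifies over all D and d that agree with
  \<open>resolvent_density\<close> at good points. A finite exceptional set affects neither the
  measures nor measurability, so a single argument, with the same \<rho>, serves all four families
  of densities.\<close>

lemma decomposition:
  assumes sp: "spectral_resolution (op_adjoint (ham_min M)) E"
    and A2: "\<forall>n. AE t in lborel. vec_space.rank (rk n) (beta M n n (complex_of_real t)) = rk n"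
  shows "\<exists>\<nu> \<rho>.
    point_measure_on \<nu> (\<Union>m. \<Inter>n\<in>{m..}. {t. complex_of_real t \<in> singular_set1 M 0 n}) \<and>
    generated_by_compact_eigenfunctions M \<nu> \<and>
    (\<forall>B\<in>sets borel. emeasure (diag_measure E rootv) B = emeasure \<nu> B + emeasure \<rho> B) \<and>
    (\<forall>D d. (\<forall>n t. good n (complex_of_real t) \<longrightarrow> D n t \<and> d n t = resolvent_density M n t) \<longrightarrow>
      weak_limit_of_densities D d \<rho>)"
proof -
  interpret pv: pvm E using sp by unfold_locales (simp add: spectral_resolution_def)
  define \<mu> where "\<mu> = diag_measure E rootv"
  have sets_\<mu> [measurable_cong, simp]: "sets \<mu> = sets borel" and space_\<mu> [simp]: "space \<mu> = UNIV" by (auto simp: \<mu>_def)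
  interpret fm: finite_measure \<mu> unfolding \<mu>_def by (rule pv.finite_diag[OF root_l2])
  have fb: "finite_borel_measure \<mu>" by (simp add: finite_borel_measure_def fm.finite_measure_axioms)
  have \<mu>_UNIV: "measure \<mu> UNIV = (l2_norm rootv)\<^sup>2"
    unfolding \<mu>_def by (simp add: pv.measure_diag[OF root_l2] pv.E_UNIV[OF root_l2])
  have plim: "(\<lambda>n. Im (Fn n (Complex x y))) \<longlonglongrightarrow> poisson_transform \<mu> x y" if y: "y > 0" for x y
  proof -
    have "cmod (1 / (complex_of_real t - Complex x y)) \<le> 1 / y" for t
    proof -
      have "y \<le> cmod (complex_of_real t - Complex x y)" using abs_Im_le_cmod[of "complex_of_real t - Complex x y"] y by simp
      thus ?thesis using y by (simp add: norm_divide frac_le)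
    qed
    hence "integrable \<mu> (\<lambda>t. 1 / (complex_of_real t - Complex x y))"
      by (intro fm.integrable_const_bound[of _ "1 / y"] AE_I2) auto
    note int = integral_bounded_linear[OF bounded_linear_Im this]
    have ker: "Im (1 / (complex_of_real s - Complex x y)) = poisson x y s" for s
      by (rule dissipative.Im_cauchy_kernel[OF diss Uv_carrier])
    have "Im (\<integral>t. 1 / (complex_of_real t - Complex x y) \<partial>\<mu>) = poisson_transform \<mu> x y"
      unfolding int[symmetric] poisson_transform_def by (simp only: ker)
    thus ?thesis using tendsto_Im[OF Fn_tendsto[OF sp, of "Complex x y"]] y by (simp add: \<mu>_def)
  qed
  have "\<exists>Z pr g. \<forall>n. poisson_data n (Z n) (pr n) (g n)" using poisson_data_exists by metis
  then obtain Z pr g where pd: "\<And>n. poisson_data n (Z n) (pr n) (g n)" by blast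
  note pd' = pd[unfolded poisson_data_def]
  have Z: "\<And>n. finite (Z n)" and pr: "\<And>n t. pr n t \<in> eigs n t" using pd' by blast+
  have orth: "\<And>n t e. e \<in> eigs n t \<Longrightarrow> (Uv n - pr n t) \<bullet>c e = 0" using pd' by blast
  have offZ: "\<And>n t. t \<notin> Z n \<Longrightarrow> det (shifted (Am n) (complex_of_real t)) \<noteq> 0 \<and> cvec_norm (pr n t) = 0" using pd' by blast
  have g_cont: "\<And>n. continuous_on UNIV (g n)" and g_eq: "\<And>n t. t \<notin> Z n \<Longrightarrow> g n t = Im (Fn n (complex_of_real t))" using pd' by blast+
  have g_int: "\<And>n x y. y > 0 \<Longrightarrow> integrable lborel (\<lambda>t. g n t * poisson x y t)" using pd' by blast
  have formula: "\<And>n x y. y > 0 \<Longrightarrow> pi * Im (Fn n (Complex x y)) =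
       (\<integral>t. g n t * poisson x y t \<partial>lborel) + pi * (\<Sum>s\<in>Z n. (cvec_norm (pr n s))\<^sup>2 * poisson x y s)" using pd' by blast
  define w where "w n t = (cvec_norm (pr n t))\<^sup>2" for n t
  have w_nonneg: "0 \<le> w n t" for n t by (simp add: w_def)
  have w_off: "t \<notin> Z n \<Longrightarrow> w n t = 0" for n t using offZ by (simp add: w_def)
  note WL = weight_limit[of "\<lambda>n. pr n t" t for t, OF pr orth, folded w_def]
  have w_lim: "(\<lambda>n. w n t) \<longlonglongrightarrow> weight t" and w_mono: "m \<le> n \<Longrightarrow> w m t \<le> w n t" and w_le: "w n t \<le> weight t" for m n t
    using WL(1,2,3)[of t] by (auto simp: incseq_def)
  define r where "r n t = resolvent_density M n t" for n t
  have r_nonneg: "0 \<le> r n t" for n t by (simp add: r_def resolvent_density_def)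
  define X where "X n = {t. \<not> good n (complex_of_real t)} \<union> Z n" for n
  have X: "finite (X n)" for n using finite_not_good[OF A2] Z by (simp add: X_def)
  have r_eq: "r n t = g n t / pi" if "t \<notin> X n" for n t
    using Im_F_eq_density[of n t] offZ[of t n] g_eq[of t n] that by (simp add: X_def r_def field_simps)
  have r_meas [measurable]: "r n \<in> borel_measurable borel" for n
    by (rule borel_measurable_off_countable[of "\<lambda>t. g n t / pi" "X n"])
       (use borel_measurable_continuous_onI[OF g_cont] countable_finite[OF X] r_eq in auto)
  have r_AE: "AE t in lborel. g n t / pi * poisson x y t = r n t * poisson x y t" for n x y
    by (rule AE_lborel_off_finite[OF X[of n]]) (simp add: r_eq)
  have g_int': "integrable lborel (\<lambda>t. g n t / pi * poisson x y t)" if "y > 0" for n x y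
    using integrable_mult_right[OF g_int[OF that], of "1 / pi"] by (simp add: mult_ac)
  have g_meas [measurable]: "g n \<in> borel_measurable borel" for n by (rule borel_measurable_continuous_onI[OF g_cont])
  have r_int: "integrable lborel (\<lambda>t. r n t * poisson x y t)" if "y > 0" for n x y
    by (rule integrable_cong_AE_imp[OF g_int'[OF that, of n x]]) (use r_AE[of n x y] in auto)
  have Im_Fn: "Im (Fn n (Complex x y)) = (\<integral>t. r n t * poisson x y t \<partial>lborel) + (\<Sum>s\<in>Z n. w n s * poisson x y s)" if y: "y > 0" for n x y
  proof -
    have "(\<integral>t. r n t * poisson x y t \<partial>lborel) = (\<integral>t. g n t / pi * poisson x y t \<partial>lborel)"
      by (rule integral_cong_AE[symmetric]) (use r_AE[of n x y] in auto)
    also have "\<dots> = (\<integral>t. g n t * poisson x y t \<partial>lborel) / pi" by (subst integral_divide_zero[symmetric]) simp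
    finally have "pi * (\<integral>t. r n t * poisson x y t \<partial>lborel) = (\<integral>t. g n t * poisson x y t \<partial>lborel)" by simp
    hence "pi * Im (Fn n (Complex x y)) = pi * ((\<integral>t. r n t * poisson x y t \<partial>lborel) + (\<Sum>s\<in>Z n. w n s * poisson x y s))"
      using formula[OF y, of n x] by (simp only: w_def distrib_left)
    thus ?thesis by simp
  qed
  have rp_nonneg: "0 \<le> (\<integral>t. r n t * poisson x y t \<partial>lborel)" if "y > 0" for n x y
    by (intro integral_nonneg_AE AE_I2 mult_nonneg_nonneg r_nonneg poisson_nonneg that)
  define a where "a t = measure \<mu> {t}" for t
  \<comment> \<open>Scaled by y, the Poisson transform of \<mu> at t tends to the atom at t as y
    tends to 0. For fixed y it is a limit of finite-volume values, each of which contains the weight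
    of t because all other terms are nonnegative.\<close>
  have w_le_a: "w m t \<le> a t" for m t
  proof -
    have bound: "w m t \<le> y * poisson_transform \<mu> t y" if y: "y > 0" for y
    proof (rule tendsto_lowerbound[OF tendsto_mult[OF tendsto_const plim[OF y]]])
      show "\<forall>\<^sub>F n in sequentially. w m t \<le> y * Im (Fn n (Complex t y))"
      proof (rule eventually_sequentiallyI[of m])
        fix n assume "m \<le> n"
        have "w n t * poisson t y t \<le> (\<Sum>s\<in>Z n. w n s * poisson t y s)"
        proof (cases "t \<in> Z n")
          case True thus ?thesis using Z y by (intro member_le_sum) (auto intro!: mult_nonneg_nonneg w_nonneg poisson_nonneg)
        qed (use y in \<open>auto simp: w_off intro!: sum_nonneg mult_nonneg_nonneg w_nonneg poisson_nonneg\<close>)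
        hence "w n t * poisson t y t \<le> Im (Fn n (Complex t y))" unfolding Im_Fn[OF y] using rp_nonneg[OF y, of n t] by linarith
        moreover have "poisson t y t = 1 / y" using y by (simp add: poisson_def power2_eq_square)
        ultimately have "w n t \<le> y * Im (Fn n (Complex t y))" using y by (simp add: divide_simps mult.commute)
        thus "w m t \<le> y * Im (Fn n (Complex t y))" using w_mono[OF \<open>m \<le> n\<close>, of t] by linarith
      qed
    qed simp
    have "(\<lambda>k. \<integral>s. inverse (real (Suc k)) * poisson t (inverse (real (Suc k))) s \<partial>\<mu>) \<longlonglongrightarrow> (\<integral>s. indicator {t} s \<partial>\<mu>)"
    proof (rule integral_dominated_convergence[where w = "\<lambda>_. 1"])
      show "AE s in \<mu>. norm (inverse (real (Suc k)) * poisson t (inverse (real (Suc k))) s) \<le> 1" for k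
      proof (rule AE_I2)
        fix s
        have "0 \<le> inverse (real (Suc k)) * poisson t (inverse (real (Suc k))) s" "inverse (real (Suc k)) * poisson t (inverse (real (Suc k))) s \<le> 1"
          by (rule scaled_poisson_bounds; simp)+
        thus "norm (inverse (real (Suc k)) * poisson t (inverse (real (Suc k))) s) \<le> 1" by (simp only: real_norm_def abs_of_nonneg)
      qed
    qed (use scaled_poisson_small in auto)
    hence "(\<lambda>k. inverse (real (Suc k)) * poisson_transform \<mu> t (inverse (real (Suc k)))) \<longlonglongrightarrow> a t"
      unfolding poisson_transform_def a_def by simp
    thus ?thesis by (rule LIMSEQ_le_const) (use bound in auto)
  qed
  have weight_le_a: "weight t \<le> a t" for t by (rule LIMSEQ_le_const2[OF w_lim]) (use w_le_a in auto)
  have weight_nonneg: "0 \<le> weight t" for t by (simp add: weight_def)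
  define C where "C = (\<Union>n. Z n)"
  have C: "countable C" unfolding C_def by (rule countable_UN, simp, rule countable_finite, rule Z)
  have weight_off: "weight t = 0" if "t \<notin> C" for t
    using LIMSEQ_unique[OF w_lim[of t], of 0] w_off[of t] that by (simp add: C_def)
  \<comment> \<open>The densities with respect to \<mu> of \<nu> and, in the next line, of the
    finite-volume point parts. They lie between 0 and 1; the convention 0 / 0 = 0 is harmless, as
    the weight vanishes wherever the atom does.\<close>
  define h where "h t = weight t / a t" for t
  define hn where "hn n t = w n t / a t" for n t
  have ratio: "0 \<le> b / c \<and> b / c \<le> 1 \<and> b / c * c = b" if "0 \<le> b" "b \<le> c" for b c :: real
    using that by (cases "c = 0") auto
  have h: "0 \<le> h t" "h t \<le> 1" "h t * a t = weight t" for t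
    using ratio[OF weight_nonneg weight_le_a, of t] by (auto simp: h_def)
  have hn: "0 \<le> hn n t" "hn n t \<le> 1" "hn n t * a t = w n t" for n t
    using ratio[OF w_nonneg w_le_a, of n t] by (auto simp: hn_def)
  have h_meas [measurable]: "h \<in> borel_measurable borel"
    by (rule borel_measurable_off_countable[OF borel_measurable_const[of 0] C]) (simp add: h_def weight_off)
  have hn_meas [measurable]: "hn n \<in> borel_measurable borel" for n
    by (rule borel_measurable_off_countable[OF borel_measurable_const[of 0] countable_finite[OF Z[of n]]]) (simp add: hn_def w_off)
  have bint: "integrable \<mu> f" if "f \<in> borel_measurable borel" "\<And>t. \<bar>f t\<bar> \<le> b" for f :: "real \<Rightarrow> real" and b
    by (rule integrable_bounded_borel[OF fb that])
  have h_int: "integrable \<mu> h" by (rule bint[OF h_meas, of 1]) (use h in \<open>simp add: abs_of_nonneg\<close>)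
  have hn_int: "integrable \<mu> (hn n)" for n by (rule bint[OF hn_meas, of n 1]) (use hn in \<open>simp add: abs_of_nonneg\<close>)
  have h1_int: "integrable \<mu> (\<lambda>t. 1 - h t)"
    by (rule Bochner_Integration.integrable_diff[OF fm.integrable_const h_int])
  define \<nu> where "\<nu> = density \<mu> (\<lambda>t. ennreal (h t))"
  define \<nu>n where "\<nu>n n = density \<mu> (\<lambda>t. ennreal (hn n t))" for n
  define \<rho> where "\<rho> = density \<mu> (\<lambda>t. ennreal (1 - h t))"
  define \<rho>n where "\<rho>n n = density lborel (\<lambda>t. ennreal (r n t))" for n
  have h1: "\<And>t. 0 \<le> 1 - h t" using h by simp
  note D\<nu> = density_finite_borel[OF sets_\<mu> h_int h(1), folded \<nu>_def]
  note D\<nu>n = density_finite_borel[OF sets_\<mu> hn_int hn(1), folded \<nu>n_def]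
  note D\<rho> = density_finite_borel[OF sets_\<mu> h1_int h1, folded \<rho>_def]
  \<comment> \<open>\<open>hn n\<close> vanishes outside the finite set Z n, and its value times the
    atom of \<mu> is the weight. Integrals against it are therefore the finite sums of the Poisson
    formula.\<close>
  have hn_sum: "(\<integral>t. hn n t * f t \<partial>\<mu>) = (\<Sum>s\<in>Z n. w n s * f s)" for n and f :: "real \<Rightarrow> real"
  proof -
    have "(\<integral>t. hn n t * f t \<partial>\<mu>) = (\<integral>t. (\<Sum>s\<in>Z n. (hn n s * f s) * indicator {s} t) \<partial>\<mu>)"
    proof (rule Bochner_Integration.integral_cong[OF refl])
      fix t
      have "(\<Sum>s\<in>Z n. (hn n s * f s) * indicator {s} t) = (\<Sum>s\<in>Z n. if s = t then hn n s * f s else 0)"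
        by (intro sum.cong) (auto simp: indicator_def)
      thus "hn n t * f t = (\<Sum>s\<in>Z n. (hn n s * f s) * indicator {s} t)" using Z w_off[of t n] by (simp add: hn_def)
    qed
    also have "\<dots> = (\<Sum>s\<in>Z n. (hn n s * f s) * a s)"
    proof (subst Bochner_Integration.integral_sum)
      fix s
      have "integrable \<mu> (indicator {s} :: real \<Rightarrow> real)" by (rule bint[of _ 1]) (auto simp: indicator_def)
      thus "integrable \<mu> (\<lambda>t. (hn n s * f s) * indicator {s} t)" by (rule integrable_mult_right)
    qed (simp add: a_def)
    also have "\<dots> = (\<Sum>s\<in>Z n. w n s * f s)" by (intro sum.cong refl) (simp add: hn(3)[symmetric] mult_ac)
    finally show ?thesis .
  qed
  \<comment> \<open>y Im F(i y) is at most the squared norm of u, and y times the kernel tends to 1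
    as y grows. Fatou's lemma is used because integrability of the density is part of the
    claim.\<close>
  have mass: "integrable lborel (r n) \<and> (\<integral>t. r n t \<partial>lborel) + (\<Sum>s\<in>Z n. w n s) \<le> (l2_norm rootv)\<^sup>2" for n
  proof -
    interpret ds: dissipative "Hm 0 n" "Ph 0 n" "len 0 n" "rk (Suc n)" by (rule diss)
    let ?y = "\<lambda>k. real (Suc k)"
    let ?f = "\<lambda>k t. r n t * (?y k * poisson 0 (?y k) t)"
    let ?b = "\<lambda>k. (l2_norm rootv)\<^sup>2 - (\<Sum>s\<in>Z n. w n s * (?y k * poisson 0 (?y k) s))"
    let ?L = "(l2_norm rootv)\<^sup>2 - (\<Sum>s\<in>Z n. w n s)"
    have f_int: "integrable lborel (?f k)" for k
      using integrable_mult_right[OF r_int[of "?y k" n 0], of "?y k"] by (simp add: mult_ac)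
    have f_nonneg: "0 \<le> ?f k t" for k t by (intro mult_nonneg_nonneg r_nonneg poisson_nonneg) auto
    have f_le: "(\<integral>t. ?f k t \<partial>lborel) \<le> ?b k" for k
    proof -
      have "?y k * Im (Fn n (Complex 0 (?y k))) \<le> ?y k * ((cvec_norm (Uv n))\<^sup>2 / ?y k)"
        using ds.F_bound[OF Uv_carrier, of "Complex 0 (?y k)"] abs_Im_le_cmod[of "Fn n (Complex 0 (?y k))"]
        by (intro mult_left_mono) auto
      hence le: "?y k * Im (Fn n (Complex 0 (?y k))) \<le> (l2_norm rootv)\<^sup>2" by (simp add: norm_Uv)
      have I: "Im (Fn n (Complex 0 (?y k))) = (\<integral>t. r n t * poisson 0 (?y k) t \<partial>lborel) + (\<Sum>s\<in>Z n. w n s * poisson 0 (?y k) s)"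
        by (rule Im_Fn) simp
      have e1: "?y k * (\<integral>t. r n t * poisson 0 (?y k) t \<partial>lborel) = (\<integral>t. ?f k t \<partial>lborel)"
        by (subst integral_mult_right_zero[symmetric]) (simp add: mult_ac)
      have e2: "?y k * (\<Sum>s\<in>Z n. w n s * poisson 0 (?y k) s) = (\<Sum>s\<in>Z n. w n s * (?y k * poisson 0 (?y k) s))"
        by (simp only: sum_distrib_left mult.left_commute)
      show ?thesis using le unfolding I distrib_left e1 e2 by linarith
    qed
    have b_lim: "?b \<longlonglongrightarrow> ?L"
      using tendsto_diff[OF tendsto_const tendsto_sum[OF tendsto_mult[OF tendsto_const scaled_poisson_large]]] by simp
    have "0 \<le> ?b k" for k
      using order_trans[OF integral_nonneg_AE[OF AE_I2[OF f_nonneg]] f_le] .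
    hence L: "0 \<le> ?L" by (intro LIMSEQ_le_const[OF b_lim]) auto
    have "(\<integral>\<^sup>+t. ennreal (r n t) \<partial>lborel) = (\<integral>\<^sup>+t. liminf (\<lambda>k. ennreal (?f k t)) \<partial>lborel)"
    proof (rule nn_integral_cong)
      fix t
      have "(\<lambda>k. ?f k t) \<longlonglongrightarrow> r n t * 1" by (intro tendsto_mult tendsto_const scaled_poisson_large)
      hence "(\<lambda>k. ennreal (?f k t)) \<longlonglongrightarrow> ennreal (r n t)" by (intro tendsto_ennrealI) simp
      thus "ennreal (r n t) = liminf (\<lambda>k. ennreal (?f k t))" by (intro lim_imp_Liminf[symmetric]) auto
    qed
    also have "\<dots> \<le> liminf (\<lambda>k. \<integral>\<^sup>+t. ennreal (?f k t) \<partial>lborel)" by (rule nn_integral_liminf) measurable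
    also have "\<dots> \<le> liminf (\<lambda>k. ennreal (?b k))"
    proof (rule Liminf_mono, rule always_eventually, rule allI)
      fix k show "(\<integral>\<^sup>+t. ennreal (?f k t) \<partial>lborel) \<le> ennreal (?b k)"
        unfolding nn_integral_eq_integral[OF f_int AE_I2[OF f_nonneg]] by (rule ennreal_leI[OF f_le])
    qed
    also have "\<dots> = ennreal ?L" by (intro lim_imp_Liminf tendsto_ennrealI b_lim) auto
    finally have le: "(\<integral>\<^sup>+t. ennreal (r n t) \<partial>lborel) \<le> ennreal ?L" .
    have int: "integrable lborel (r n)"
      using le by (intro integrableI_nonneg) (auto simp: r_nonneg le_less_trans[OF _ ennreal_less_top])
    have "(\<integral>t. r n t \<partial>lborel) \<le> ?L"
      using le L unfolding nn_integral_eq_integral[OF int AE_I2[OF r_nonneg]] by simp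
    thus ?thesis using int by simp
  qed
  note D\<rho>n = density_finite_borel[OF sets_lborel conjunct1[OF mass] r_nonneg, folded \<rho>n_def]
  \<comment> \<open>Both parts together converge through their Poisson transforms. The point parts
    converge separately by dominated convergence with respect to \<mu>, so the remaining part
    converges by subtraction.\<close>
  have conv: "(\<lambda>n. (\<integral>t. f t \<partial>\<rho>n n)) \<longlonglongrightarrow> (\<integral>t. f t \<partial>\<rho>)" if f: "continuous_on UNIV f" "bounded (range f)" for f :: "real \<Rightarrow> real"
  proof -
    have fm [measurable]: "f \<in> borel_measurable borel" by (rule borel_measurable_continuous_onI[OF f(1)])
    obtain b where b: "\<And>t. \<bar>f t\<bar> \<le> b" using f(2) by (auto simp: bounded_iff)
    have "(\<lambda>n. (\<integral>t. f t \<partial>\<rho>n n) + (\<integral>t. f t \<partial>\<nu>n n)) \<longlonglongrightarrow> (\<integral>t. f t \<partial>\<mu>)"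
    proof (rule weak_convergence_of_poisson_transforms[OF D\<rho>n(1) D\<nu>n(1) fb _ _ f])
      show "measure (\<rho>n n) UNIV + measure (\<nu>n n) UNIV \<le> measure \<mu> UNIV" for n
        using conjunct2[OF mass[of n]] hn_sum[of n "\<lambda>_. 1"] unfolding D\<rho>n(2) D\<nu>n(2) \<mu>_UNIV by simp
      show "(\<lambda>n. poisson_transform (\<rho>n n) x y + poisson_transform (\<nu>n n) x y) \<longlonglongrightarrow> poisson_transform \<mu> x y" if "y > 0" for x y
        using plim[OF that, of x] unfolding Im_Fn[OF that] poisson_transform_def[of "\<rho>n _"] poisson_transform_def[of "\<nu>n _"]
          D\<rho>n(3)[OF poisson_measurable] D\<nu>n(3)[OF poisson_measurable] hn_sum .
    qed
    moreover have "(\<lambda>n. \<integral>t. f t \<partial>\<nu>n n) \<longlonglongrightarrow> (\<integral>t. f t \<partial>\<nu>)"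
      unfolding D\<nu>n(3)[OF fm] D\<nu>(3)[OF fm]
    proof (rule integral_dominated_convergence[where w = "\<lambda>_. b"])
      show "AE t in \<mu>. (\<lambda>n. hn n t * f t) \<longlonglongrightarrow> h t * f t"
        unfolding hn_def h_def divide_inverse by (intro AE_I2 tendsto_mult tendsto_const w_lim)
      show "AE t in \<mu>. norm (hn n t * f t) \<le> b" for n
      proof (rule AE_I2)
        fix t
        have "\<bar>hn n t\<bar> * \<bar>f t\<bar> \<le> 1 * b" using hn(1,2)[of n t] b[of t] by (intro mult_mono) auto
        thus "norm (hn n t * f t) \<le> b" by (simp add: abs_mult)
      qed
    qed auto
    ultimately have "(\<lambda>n. \<integral>t. f t \<partial>\<rho>n n) \<longlonglongrightarrow> (\<integral>t. f t \<partial>\<mu>) - (\<integral>t. f t \<partial>\<nu>)"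
      using tendsto_diff by fastforce
    moreover have "(\<integral>t. f t \<partial>\<rho>) = (\<integral>t. f t \<partial>\<mu>) - (\<integral>t. f t \<partial>\<nu>)"
    proof -
      have hf: "integrable \<mu> (\<lambda>t. h t * f t)"
      proof (rule bint)
        fix t
        have "\<bar>h t\<bar> * \<bar>f t\<bar> \<le> 1 * b" using h(1,2)[of t] b[of t] by (intro mult_mono) auto
        thus "\<bar>h t * f t\<bar> \<le> b" by (simp add: abs_mult)
      qed measurable
      have "(\<integral>t. f t \<partial>\<rho>) = (\<integral>t. f t - h t * f t \<partial>\<mu>)" unfolding D\<rho>(3)[OF fm] by (simp add: left_diff_distrib)
      also have "\<dots> = (\<integral>t. f t \<partial>\<mu>) - (\<integral>t. h t * f t \<partial>\<mu>)"
        by (rule Bochner_Integration.integral_diff[OF bint[OF fm b] hf])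
      finally show ?thesis unfolding D\<nu>(3)[OF fm] .
    qed
    ultimately show ?thesis by simp
  qed
  have wl: "weak_limit_of_densities D d \<rho>"
    if Dd: "\<forall>n t. good n (complex_of_real t) \<longrightarrow> D n t \<and> d n t = resolvent_density M n t" for D d
  proof -
    have d: "d n t = r n t" if "t \<notin> {t. \<not> good n (complex_of_real t)}" for n t using Dd that by (simp add: r_def)
    have dm [measurable]: "d n \<in> borel_measurable borel" for n
      by (rule borel_measurable_off_countable[OF r_meas countable_finite[OF finite_not_good[OF A2]] d])
    have "density lborel (\<lambda>t. ennreal (d n t)) = \<rho>n n" for n
      unfolding \<rho>n_def
    proof (rule density_cong)
      show "AE t in lborel. ennreal (d n t) = ennreal (r n t)"
        by (rule AE_lborel_off_finite[OF finite_not_good[OF A2, of n]]) (use d in auto)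
    qed measurable
    moreover have "finite {t. \<not> D n t}" for n
      by (rule finite_subset[OF _ finite_not_good[OF A2, of n]]) (use Dd in auto)
    ultimately show ?thesis
      unfolding weak_limit_of_densities_def weak_limit_def using dm D\<rho>n(1) D\<rho>(1) conv by auto
  qed
  have atom: "measure \<nu> {t} = weight t" for t
  proof -
    have "emeasure \<nu> {t} = (\<integral>\<^sup>+s. ennreal (h s) * indicator {t} s \<partial>\<mu>)" unfolding \<nu>_def by (subst emeasure_density) auto
    also have "\<dots> = ennreal (h t) * emeasure \<mu> {t}" by (rule nn_integral_indicator_singleton) auto
    also have "\<dots> = ennreal (weight t)"
      unfolding fm.emeasure_eq_measure h(3)[symmetric] a_def by (rule ennreal_mult[symmetric]) (use h in auto)
    finally show ?thesis by (simp add: measure_def weight_nonneg)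
  qed
  \<comment> \<open>\<nu> is concentrated on the points of positive weight; this gives both a
    countable carrier and membership in the limit inferior.\<close>
  have pos: "AE t in \<nu>. weight t > 0"
  proof -
    have "weight t > 0" if "h t > 0" for t using weight_nonneg[of t] that by (cases "weight t = 0") (auto simp: h_def)
    thus ?thesis unfolding \<nu>_def by (subst AE_density) (auto simp: ennreal_less_zero_iff)
  qed
  have "point_measure_on \<nu> (\<Union>m. \<Inter>n\<in>{m..}. {t. complex_of_real t \<in> singular_set1 M 0 n})"
    unfolding point_measure_on_def
  proof (intro conjI exI[of _ C] C D\<nu>(1))
    show "AE t in \<nu>. t \<in> C" using pos by eventually_elim (use weight_off in force)
    show "AE t in \<nu>. t \<in> (\<Union>m. \<Inter>n\<in>{m..}. {t. complex_of_real t \<in> singular_set1 M 0 n})"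
      using pos
    proof eventually_elim
      case (elim t)
      show ?case using weight_pos_singular[of "\<lambda>n. pr n t" t, OF pr orth elim] by auto
    qed
  qed
  moreover have "generated_by_compact_eigenfunctions M \<nu>"
    unfolding generated_by_compact_eigenfunctions_def atom weight_def by simp
  moreover have "\<forall>B\<in>sets borel. emeasure \<mu> B = emeasure \<nu> B + emeasure \<rho> B"
  proof
    fix B :: "real set" assume B [measurable]: "B \<in> sets borel"
    have "emeasure \<nu> B + emeasure \<rho> B = (\<integral>\<^sup>+t. ennreal (h t) * indicator B t + ennreal (1 - h t) * indicator B t \<partial>\<mu>)"
      unfolding \<nu>_def \<rho>_def by (simp add: emeasure_density nn_integral_add)
    also have "\<dots> = (\<integral>\<^sup>+t. indicator B t \<partial>\<mu>)"
    proof (rule nn_integral_cong)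
      fix t
      have "ennreal (h t) + ennreal (1 - h t) = 1" using h(1)[of t] h1[of t] by (simp flip: ennreal_plus)
      thus "ennreal (h t) * indicator B t + ennreal (1 - h t) * indicator B t = indicator B t"
        by (simp flip: distrib_right)
    qed
    finally show "emeasure \<mu> B = emeasure \<nu> B + emeasure \<rho> B" by simp
  qed
  ultimately show ?thesis unfolding \<mu>_def using wl by blast
qed

end

theorem theorem1:
  fixes M :: "'a shell_model" and \<mu> :: "real measure"
  assumes partition: "shell_partition M"
    and hopping: "shell_hopping M"
    and factorization: "hop_factorization M"
    and selfadjoint: "essentially_self_adjoint (ham_min M)"
    and A1: "\<forall>n. hop_rank M n \<le> hop_rank M (Suc n)"
    and A2: "\<forall>n. AE t in lborel.
               vec_space.rank (hop_rank M n) (beta M n n (complex_of_real t)) = hop_rank M n"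
    and spectral: "is_spectral_measure (op_adjoint (ham_min M)) (root_vector M) \<mu>"
  shows "\<exists>\<nu> \<rho>.
    point_measure_on \<nu>
      (\<Union>m. \<Inter>n\<in>{m..}. {t. complex_of_real t \<in> singular_set1 M 0 n}) \<and>
    generated_by_compact_eigenfunctions M \<nu> \<and>
    (\<forall>B\<in>sets borel. emeasure \<mu> B = emeasure \<nu> B + emeasure \<rho> B) \<and>
    weak_limit_of_densities (resolvent_density_defined M) (resolvent_density M) \<rho> \<and>
    weak_limit_of_densities (direct_density_defined M) (direct_density M) \<rho> \<and>
    weak_limit_of_densities (chain_density_defined M (transfer_set M))
      (chain_density (transfer_set M)) \<rho> \<and>
    weak_limit_of_densities (chain_density_defined M (restricted_transfer_set M))
      (chain_density (restricted_transfer_set M)) \<rho>"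
proof -
  interpret sa_shells M using partition hopping factorization selfadjoint by unfold_locales
  obtain E where E: "spectral_resolution (op_adjoint (ham_min M)) E" and \<mu>: "\<mu> = diag_measure E (root_vector M)"
    using spectral by (auto simp: is_spectral_measure_def)
  obtain \<nu> \<rho> where nr:
    "point_measure_on \<nu> (\<Union>m. \<Inter>n\<in>{m..}. {t. complex_of_real t \<in> singular_set1 M 0 n})"
    "generated_by_compact_eigenfunctions M \<nu>"
    "\<forall>B\<in>sets borel. emeasure \<mu> B = emeasure \<nu> B + emeasure \<rho> B"
    and wl: "\<forall>D d. (\<forall>n t. good n (complex_of_real t) \<longrightarrow> D n t \<and> d n t = resolvent_density M n t) \<longrightarrow> weak_limit_of_densities D d \<rho>"
    using decomposition[OF E A2] unfolding \<mu> by blast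
  show ?thesis
  proof (rule exI[of _ \<nu>], rule exI[of _ \<rho>], intro conjI nr)
    show "weak_limit_of_densities (resolvent_density_defined M) (resolvent_density M) \<rho>"
      using wl resolvent_density_ok by blast
    show "weak_limit_of_densities (direct_density_defined M) (direct_density M) \<rho>"
      using wl direct_density_ok by blast
    show "weak_limit_of_densities (chain_density_defined M (transfer_set M)) (chain_density (transfer_set M)) \<rho>"
      using wl chain_density_ok by blast
    show "weak_limit_of_densities (chain_density_defined M (restricted_transfer_set M)) (chain_density (restricted_transfer_set M)) \<rho>"
      using wl chain_density_ok by blast
  qed
qed

end
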